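(* Let $R$ be the ring of integers in a nonarchimedean local field $K$. Let $\Lambda$ be an $R$-order in a finite-dimensional semisimple $K$-algebra $A$. Let $L$ be a left $\Lambda$-lattice. Let $\Lambda'$ be a maximal $R$-order in $A$ containing $\Lambda$. Put $L'=\Lambda'L$ and $I=\{x\in A: \Lambda'x\Lambda'\subseteq\Lambda\}$. Let $\kappa=\mathbb{F}_q$, and let $\kappa_1,\kappa_2$ be copies of $\kappa$. Suppose that $I=J(\Lambda')=J(\Lambda)$, and that the embedding $\Lambda/I\hookrightarrow\Lambda'/I$ is isomorphic to the diagonal embedding $\kappa\hookrightarrow\kappa_1\times\kappa_2$. Let $M=L'/IL'$, $M_1=\kappa_1M$, $M_2=\kappa_2M$, $N=L/IL$. Noting that $IL'=IL$, so that $L/IL$ is a $\Lambda/I$-submodule of $L'/IL'$, let $m_1=\dim_{\kappa_1}(M_1)$, $m_2=\dim_{\kappa_2}(M_2)$, $c=\dim_\kappa(M/N)$. Then $$\zeta_{\Lambda'}(L';s)=\prod_{h=0}^{m_1-1}(1-q^{h-s})^{-1}\cdot\prod_{i=0}^{m_2-1}(1-q^{i-s})^{-1}$$ and $$\frac{\zeta_\Lambda(L;s)}{\zeta_{\Lambda'}(L';s)}=\sum_{j=0}^c \binom{c}{j}_q q^{-(c-j)s}P^{m_1,m_2}_j(q,s)\prod_{k=0}^{j-1}(1-q^{k-s})^2,$$ where $$P^{m_1,m_2}_j(q,s)=\sum_{\ell=0}^{\min(m_1-j,m_2-j)}\binom{m_1-j}{\ell}_q\binom{m_2-j}{\ell}_q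 |\mathrm{GL}_\ell(\mathbb{F}_q)|\,q^{\ell(j-s)}.$$ Moreover, $c\le\min(m_1,m_2)$.
   Context: An $R$-order in $A$ is an $R$-subalgebra of $A$ that is finitely generated as an $R$-module and spans $A$ over $K$. A left $\Lambda$-lattice is a left $\Lambda$-module finitely generated and free over $R$; $L$ is viewed inside the $A$-module $K\otimes_R L$, and $\Lambda'L$ is the $\Lambda'$-submodule it generates there. $J(\cdot)$ is the Jacobson radical. The embedding hypothesis means there are ring isomorphisms $\Lambda/I\simeq\kappa$ and $\Lambda'/I\simeq\kappa_1\times\kappa_2$ identifying the map induced by $\Lambda\subseteq\Lambda'$ with the diagonal $x\mapsto(x,x)$; thus $M$ is a $\kappa_1\times\kappa_2$-module, $M=M_1\oplus M_2$ with $\kappa_iM$ the image of the $i$-th factor, and $\kappa$ acts via the diagonal. For $\Gamma\in\{\Lambda,\Lambda'\}$ and a left $\Gamma$-lattice $N_0$, the Solomon zeta function is $\zeta_\Gamma(N_0;s)=\sum_{X}|N_0/X|^{-s}$, summed over all finite-index $\Gamma$-submodules $X$ of $N_0$, as a formal power series in $q^{-s}$ (all the indices occurring are powers of $q$), where $q^{-s}$ is a formal variable, $(q^n)^{-s}=(q^{-s})^n$ and $q^{m-s}=q^m\cdot q^{-s}$. $\binom{\alpha}{\beta}_q$ is the Gaussian binomial coefficient, the number of $\beta$-dimensional subspaces of $\mathbb{F}_q^{\oplus\alpha}$. $|\mathrm{GL}_0(\mathbb{F}_q)|=1$ and empty products equal $1$. *)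

theory Defs
  imports
    "Jordan_Normal_Form.VS_Connect"
    "HOL-Algebra.Chinese_Remainder"
    "HOL-Computational_Algebra.Formal_Power_Series"
    "HOL-Library.Cardinality"
begin

hide_const (open) Multiset.mult

text \<open>
  Conventions. The ambient objects (the local field \<open>K\<close>, the algebra \<open>A\<close>, the \<open>A\<close>-module
  \<open>K \<otimes>\<^sub>R L\<close>, the finite field \<open>\<kappa>\<close>) are types; orders, ideals and lattices are subsets of these
  types. Quotients and isomorphisms are those of HOL-Algebra, \<open>class_ring\<close> being the HOL-Algebra
  ring on a type.
\<close>

section \<open>Local fields and semisimple algebras\<close>

locale nonarch_local_field =
  fixes v :: "'k::field \<Rightarrow> real"
  assumes v_eq_0: "v x = 0 \<longleftrightarrow> x = 0"
    and v_mult: "v (x * y) = v x * v y"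
    and v_add: "v (x + y) \<le> max (v x) (v y)"
    and v_discrete: "\<exists>\<pi>. 0 < v \<pi> \<and> v \<pi> < 1 \<and> (\<forall>x. x \<noteq> 0 \<longrightarrow> (\<exists>n::int. v x = v \<pi> powi n))"
    and v_complete: "\<forall>X :: nat \<Rightarrow> 'k. (\<forall>e>0. \<exists>N. \<forall>m\<ge>N. \<forall>n\<ge>N. v (X m - X n) < e) \<longrightarrow>
      (\<exists>x. (\<lambda>n. v (X n - x)) \<longlonglongrightarrow> 0)"
    and v_residue: "finite (carrier (class_ring\<lparr>carrier := {x. v x \<le> 1}\<rparr> Quot {x. v x < 1}))"

definition integers :: "('k::field \<Rightarrow> real) \<Rightarrow> 'k set" where
  "integers v = {x. v x \<le> 1}"

definition is_add_subgroup :: "'m::ab_group_add set \<Rightarrow> bool" where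
  "is_add_subgroup X \<longleftrightarrow> 0 \<in> X \<and> (\<forall>x\<in>X. \<forall>y\<in>X. x - y \<in> X)"

definition is_submodule :: "'r set \<Rightarrow> ('r \<Rightarrow> 'm::ab_group_add \<Rightarrow> 'm) \<Rightarrow> 'm set \<Rightarrow> bool" where
  "is_submodule S act X \<longleftrightarrow> is_add_subgroup X \<and> (\<forall>s\<in>S. \<forall>x\<in>X. act s x \<in> X)"

definition is_left_ideal :: "'a::ring_1 set \<Rightarrow> 'a set \<Rightarrow> bool" where
  "is_left_ideal S X \<longleftrightarrow> X \<subseteq> S \<and> is_submodule S (*) X"

locale fin_dim_algebra = Vector_Spaces.vector_space scale
  for scale :: "'k::field \<Rightarrow> 'a::ring_1 \<Rightarrow> 'a" +
  assumes scale_mult_left: "scale c x * y = scale c (x * y)"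
    and scale_mult_right: "x * scale c y = scale c (x * y)"
    and fin_dim: "\<exists>B. finite B \<and> is_submodule UNIV scale hull B = UNIV"

text \<open>The ring is the sum of its minimal left ideals, i.e. it is semisimple as a left module
  over itself.\<close>
definition semisimple_ring :: "'a::ring_1 itself \<Rightarrow> bool" where
  "semisimple_ring _ \<longleftrightarrow>
     is_left_ideal UNIV hull
       \<Union>{U :: 'a set. is_left_ideal UNIV U \<and> U \<noteq> {0} \<and>
           (\<forall>W. is_left_ideal UNIV W \<and> W \<subseteq> U \<longrightarrow> W = {0} \<or> W = U)} = UNIV"

locale left_module =
  fixes act :: "'a::ring_1 \<Rightarrow> 'v::ab_group_add \<Rightarrow> 'v"
  assumes act_add_left: "act (a + b) x = act a x + act b x"
    and act_add_right: "act a (x + y) = act a x + act a y"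
    and act_mult: "act (a * b) x = act a (act b x)"
    and act_one: "act 1 x = x"

section \<open>Orders and lattices\<close>

definition is_order :: "'k::field set \<Rightarrow> ('k \<Rightarrow> 'a::ring_1 \<Rightarrow> 'a) \<Rightarrow> 'a set \<Rightarrow> bool" where
  "is_order R scale \<Lambda> \<longleftrightarrow>
     1 \<in> \<Lambda> \<and> (\<forall>x\<in>\<Lambda>. \<forall>y\<in>\<Lambda>. x * y \<in> \<Lambda>) \<and> is_submodule R scale \<Lambda> \<and>
     (\<exists>B. finite B \<and> is_submodule R scale hull B = \<Lambda>) \<and>
     is_submodule UNIV scale hull \<Lambda> = UNIV"

definition is_maximal_order :: "'k::field set \<Rightarrow> ('k \<Rightarrow> 'a::ring_1 \<Rightarrow> 'a) \<Rightarrow> 'a set \<Rightarrow> bool" where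
  "is_maximal_order R scale \<Lambda> \<longleftrightarrow>
     is_order R scale \<Lambda> \<and> (\<forall>\<Gamma>. is_order R scale \<Gamma> \<and> \<Lambda> \<subseteq> \<Gamma> \<longrightarrow> \<Gamma> = \<Lambda>)"

definition is_free_fg :: "'k::field set \<Rightarrow> ('k \<Rightarrow> 'v::ab_group_add \<Rightarrow> 'v) \<Rightarrow> 'v set \<Rightarrow> bool" where
  "is_free_fg R sc X \<longleftrightarrow>
     (\<exists>B. finite B \<and> is_submodule R sc hull B = X \<and>
        (\<forall>c. (\<forall>b\<in>B. c b \<in> R) \<and> (\<Sum>b\<in>B. sc (c b) b) = 0 \<longrightarrow> (\<forall>b\<in>B. c b = 0)))"

text \<open>A lattice \<open>L\<close> together with its ambient \<open>A\<close>-module \<open>K \<otimes>\<^sub>R L\<close>, which is the whole type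
  \<open>'v\<close>: as \<open>L\<close> is \<open>R\<close>-free, an \<open>A\<close>-module containing \<open>L\<close> and spanned by it over \<open>K\<close> is \<open>K \<otimes>\<^sub>R L\<close>
  (an \<open>R\<close>-basis of \<open>L\<close> stays linearly independent over \<open>K = Frac R\<close>).
  The field acts on \<open>'v\<close> through \<open>K \<rightarrow> A\<close>.\<close>
definition is_full_lattice :: "'k::field set \<Rightarrow> ('k \<Rightarrow> 'a::ring_1 \<Rightarrow> 'a) \<Rightarrow> 'a set \<Rightarrow>
    ('a \<Rightarrow> 'v::ab_group_add \<Rightarrow> 'v) \<Rightarrow> 'v set \<Rightarrow> bool" where
  "is_full_lattice R scale \<Lambda> act L \<longleftrightarrow>
     is_submodule \<Lambda> act L \<and>
     is_free_fg R (\<lambda>r. act (scale r 1)) L \<and>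
     is_submodule UNIV (\<lambda>r. act (scale r 1)) hull L = UNIV"

definition two_sided_conductor :: "'a::ring_1 set \<Rightarrow> 'a set \<Rightarrow> 'a set" where
  "two_sided_conductor \<Lambda>' \<Lambda> = {x. \<forall>a\<in>\<Lambda>'. \<forall>b\<in>\<Lambda>'. a * x * b \<in> \<Lambda>}"

definition jacobson_radical :: "'a::ring_1 set \<Rightarrow> 'a set" where
  "jacobson_radical S =
     {x\<in>S. \<forall>U. is_left_ideal S U \<and> U \<noteq> S \<and>
               (\<forall>W. is_left_ideal S W \<and> U \<subseteq> W \<longrightarrow> W = U \<or> W = S) \<longrightarrow> x \<in> U}"

definition ideal_times :: "('a \<Rightarrow> 'v::ab_group_add \<Rightarrow> 'v) \<Rightarrow> 'a set \<Rightarrow> 'v set \<Rightarrow> 'v set" where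
  "ideal_times act I X = is_add_subgroup hull {act a x |a x. a \<in> I \<and> x \<in> X}"

section \<open>Quotients and change of scalars\<close>

definition ring_on :: "'a::ring_1 set \<Rightarrow> 'a ring" where
  "ring_on S = class_ring\<lparr>carrier := S\<rparr>"

text \<open>The multiplicative fields of module records are irrelevant.\<close>

definition module_on :: "('a \<Rightarrow> 'v::ab_group_add \<Rightarrow> 'v) \<Rightarrow> 'v set \<Rightarrow> ('a, 'v) module" where
  "module_on act X =
     \<lparr>carrier = X, mult = undefined, one = undefined, zero = 0, add = (+), smult = act\<rparr>"

definition quot_module :: "('r, 'm) module \<Rightarrow> 'm set \<Rightarrow> ('r, 'm set) module" where
  "quot_module M N =
     \<lparr>carrier = a_rcosets\<^bsub>M\<^esub> N, mult = undefined, one = undefined, zero = N, add = set_add M,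
      smult = (\<lambda>r X. \<Union>x\<in>X. N +>\<^bsub>M\<^esub> (r \<odot>\<^bsub>M\<^esub> x))\<rparr>"

definition restrict_scalars :: "('r \<Rightarrow> 's) \<Rightarrow> ('s, 'm) module \<Rightarrow> ('r, 'm) module" where
  "restrict_scalars f M =
     \<lparr>carrier = carrier M, mult = mult M, one = one M, zero = zero M, add = add M,
      smult = (\<lambda>r x. f r \<odot>\<^bsub>M\<^esub> x)\<rparr>"

text \<open>An \<open>S\<close>-module annihilated by \<open>I\<close>, regarded as a module over the target of
  \<open>\<psi> : S/I \<simeq> T\<close>: an element of \<open>T\<close> acts through any of its lifts to \<open>S\<close>.\<close>
definition residue_module ::
    "'a::ring_1 set \<Rightarrow> 'a set \<Rightarrow> ('a set \<Rightarrow> 't) \<Rightarrow> ('a, 'm) module \<Rightarrow> ('t, 'm) module" where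
  "residue_module S I \<psi> M =
     restrict_scalars (\<lambda>t. SOME a. a \<in> S \<and> \<psi> (I +>\<^bsub>ring_on S\<^esub> a) = t) M"

text \<open>For a module over \<open>\<kappa>\<^sub>1 \<times> \<kappa>\<^sub>2\<close>: the images of the two factors, as \<open>\<kappa>\<close>-vector spaces.\<close>

definition component1 :: "('f::field \<times> 'f, 'm) module \<Rightarrow> ('f, 'm) module" where
  "component1 M = restrict_scalars (\<lambda>a. (a, 0))
     (M\<lparr>carrier := {(a, 0) \<odot>\<^bsub>M\<^esub> x |a x. x \<in> carrier M}\<rparr>)"

definition component2 :: "('f::field \<times> 'f, 'm) module \<Rightarrow> ('f, 'm) module" where
  "component2 M = restrict_scalars (\<lambda>a. (0, a))
     (M\<lparr>carrier := {(0, a) \<odot>\<^bsub>M\<^esub> x |a x. x \<in> carrier M}\<rparr>)"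

section \<open>Solomon zeta functions\<close>

definition finite_index_submodules ::
    "'a set \<Rightarrow> ('a \<Rightarrow> 'v::ab_group_add \<Rightarrow> 'v) \<Rightarrow> 'v set \<Rightarrow> 'v set set" where
  "finite_index_submodules \<Gamma> act N =
     {X. X \<subseteq> N \<and> is_submodule \<Gamma> act X \<and> finite (carrier (quot_module (module_on act N) X))}"

definition submodule_index :: "('a \<Rightarrow> 'v::ab_group_add \<Rightarrow> 'v) \<Rightarrow> 'v set \<Rightarrow> 'v set \<Rightarrow> nat" where
  "submodule_index act N X = card (carrier (quot_module (module_on act N) X))"

text \<open>The zeta function is a power series in the formal variable \<open>q\<^sup>-\<^sup>s\<close>, which is \<open>fps_X\<close>;
  a submodule of index \<open>q ^ n\<close> contributes \<open>fps_X ^ n\<close>. This represents the sum over all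
  submodules of finite index under the two conditions of \<open>zeta_well_defined\<close>.\<close>

definition solomon_zeta ::
    "nat \<Rightarrow> 'a set \<Rightarrow> ('a \<Rightarrow> 'v::ab_group_add \<Rightarrow> 'v) \<Rightarrow> 'v set \<Rightarrow> rat fps" where
  "solomon_zeta q \<Gamma> act N =
     Abs_fps (\<lambda>n. of_nat (card {X \<in> finite_index_submodules \<Gamma> act N. submodule_index act N X = q ^ n}))"

definition zeta_well_defined ::
    "nat \<Rightarrow> 'a set \<Rightarrow> ('a \<Rightarrow> 'v::ab_group_add \<Rightarrow> 'v) \<Rightarrow> 'v set \<Rightarrow> bool" where
  "zeta_well_defined q \<Gamma> act N \<longleftrightarrow>
     (\<forall>X \<in> finite_index_submodules \<Gamma> act N. \<exists>n. submodule_index act N X = q ^ n) \<and>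
     (\<forall>n. finite {X \<in> finite_index_submodules \<Gamma> act N. submodule_index act N X = q ^ n})"

text \<open>\<open>q_pow_minus_s q m\<close> is \<open>q\<^bsup>m - s\<^esup> = q\<^sup>m \<cdot> q\<^sup>-\<^sup>s\<close>.\<close>
definition q_pow_minus_s :: "nat \<Rightarrow> nat \<Rightarrow> rat fps" where
  "q_pow_minus_s q m = fps_const (of_nat (q ^ m)) * fps_X"

section \<open>The explicit formula, with \<open>\<F>\<^sub>q\<close> given as a finite field type\<close>

definition gauss_binomial :: "'f::{field,finite} itself \<Rightarrow> nat \<Rightarrow> nat \<Rightarrow> nat" where
  "gauss_binomial F \<alpha> \<beta> =
     card {W. VectorSpace.subspace class_ring W (module_vec F \<alpha>) \<and>
              vectorspace.dim class_ring ((module_vec F \<alpha>)\<lparr>carrier := W\<rparr>) = \<beta>}"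

definition card_GL :: "'f::{field,finite} itself \<Rightarrow> nat \<Rightarrow> nat" where
  "card_GL _ l = card {g :: 'f mat. g \<in> carrier_mat l l \<and> invertible_mat g}"

text \<open>Used only for \<open>j \<le> min m1 m2\<close>, so that the subtractions do not truncate.\<close>
definition P_poly :: "'f::{field,finite} itself \<Rightarrow> nat \<Rightarrow> nat \<Rightarrow> nat \<Rightarrow> rat fps" where
  "P_poly F m1 m2 j =
     (\<Sum>l = 0..min (m1 - j) (m2 - j).
        of_nat (gauss_binomial F (m1 - j) l) * of_nat (gauss_binomial F (m2 - j) l) *
        of_nat (card_GL F l) * q_pow_minus_s CARD('f) j ^ l)"

end

theory Submission
  imports Defs "HOL-Library.Function_Algebras"
begin

text \<open>
  As \<open>\<Lambda>'\<close> is maximal, the two maximal ideals \<open>P\<close> of \<open>\<Lambda>'\<close> above \<open>J(\<Lambda>') = I\<close> are invertible. Multiplication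
  by an invertible ideal preserves lengths, so \<open>dim Y/PY\<close> is the same for all \<open>\<Lambda>'\<close>-lattices \<open>Y\<close> of finite
  index in \<open>L'\<close>; in particular \<open>Y\<close> and \<open>L'\<close> have the same zeta function. The sublattices of \<open>L'\<close>
  whose image in \<open>L'/IL' = M\<^sub>1 \<oplus> M\<^sub>2\<close> is contained in \<open>D\<^sub>1 \<oplus> D\<^sub>2\<close> are the sublattices of its preimage. This
  determines, by Moebius inversion over subspaces and the \<open>q\<close>-binomial theorem, both \<open>\<zeta>(L')\<close> and the
  generating function of the sublattices with image exactly \<open>D\<^sub>1 \<oplus> D\<^sub>2\<close>.

  A \<open>\<Lambda>\<close>-sublattice \<open>X\<close> of \<open>L\<close> is counted according to \<open>Y = \<Lambda>'X\<close>. For given \<open>Y\<close>, the possible \<open>X\<close> are the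
  submodules with \<open>IY \<subseteq> X \<subseteq> Y \<inter> L\<close> that surject onto both components of \<open>Y/IY\<close>. By duality their number
  reduces to counting common complements of two subspaces, and depends only on the dimension of the image
  of \<open>Y\<close> in \<open>L'/L\<close>, which is read off from the images of \<open>Y\<close> in \<open>M\<^sub>1\<close> and \<open>M\<^sub>2\<close>.
\<close>

section \<open>Counting subspaces over a finite field\<close>

text \<open>Maximality enters through multiplier rings: the left and the right multipliers of a
  product of the ideals \<open>P\<close> form an order, hence lie in the maximal order, and the
  inverse of \<open>P\<close> is built from this. The zeta function over \<Lambda>' is found by
  induction on the degree of the coefficient, for all lattices at once: a smaller image
  \<open>D1\<close>, \<open>D2\<close> leads to a preimage of positive colength and so to lower
  coefficients, while the full image forces the sublattice to be everything, by Nakayama's lemma.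
  The shape of the formula comes from two maps L' -> L'/L, the classes of e y and of (1 - e) y,
  where e lifts (1, 0). Their sum is the projection, which vanishes on L, so on a sublattice X of L
  they have the same image D, and the same holds on Y = \<Lambda>'X. Hence there is a single sum
  over subspaces D of a c-dimensional space, and the square appears because D is prescribed in both
  components. With j = dim D, the lattices Y contribute q^(-2(c-j)s), the quotient of Y by its
  intersection with L has length j, and passing from L' to L removes q^(-cs); q^(-(c-j)s)
  remains.\<close>

definition frames :: "nat \<Rightarrow> nat \<Rightarrow> nat \<Rightarrow> nat" where
  "frames q n l = (\<Prod>k<l. q ^ n - q ^ k)"

text \<open>The Gaussian binomial coefficient as a quotient: \<open>frames q n l\<close> is the
  number of ordered independent \<open>l\<close>-tuples in an \<open>n\<close>-dimensional space,
  and each \<open>l\<close>-dimensional subspace has \<open>frames q l l\<close> ordered bases. For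
  \<open>l > n\<close> the factor with \<open>k = n\<close> makes it vanish.\<close>

definition qbinom :: "nat \<Rightarrow> nat \<Rightarrow> nat \<Rightarrow> rat" where
  "qbinom q n l = of_nat (frames q n l) / of_nat (frames q l l)"

locale finite_field_space = Vector_Spaces.vector_space scale
  for scale :: "'f::{field,finite} \<Rightarrow> 'b::ab_group_add \<Rightarrow> 'b" (infixr "*s" 75)
begin

lemma q_gt_1: "CARD('f) > 1"
proof -
  have "card {0, 1 :: 'f} \<le> CARD('f)"
    by (rule card_mono) auto
  thus ?thesis by simp
qed

lemma card_span:
  assumes "finite B" "independent B"
  shows "finite (span B) \<and> card (span B) = CARD('f) ^ card B"
  using assms
proof (induction B rule: finite_induct)
  case (insert b B)
  have ind: "independent B" and b: "b \<notin> span B"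
    using insert by (auto simp: independent_insert)
  have IH: "finite (span B)" "card (span B) = CARD('f) ^ card B" using insert.IH ind by auto
  let ?h = "\<lambda>(c, x). c *s b + x"
  have inj: "inj_on ?h (UNIV \<times> span B)"
  proof (rule inj_onI, clarsimp)
    fix c c' x x' assume x: "x \<in> span B" "x' \<in> span B" and eq: "c *s b + x = c' *s b + x'"
    have "(c - c') *s b = x' - x" using eq by (simp add: scale_left_diff_distrib algebra_simps)
    hence "(c - c') *s b \<in> span B" using x span_diff by metis
    hence "inverse (c - c') *s (c - c') *s b \<in> span B" by (rule span_scale)
    hence "c = c'" using b by (cases "c = c'") auto
    thus "c = c' \<and> x = x'" using eq by auto
  qed
  have im: "?h ` (UNIV \<times> span B) = span (insert b B)"
  proof (intro equalityI subsetI)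
    fix y assume "y \<in> ?h ` (UNIV \<times> span B)"
    then obtain c x where "y = c *s b + x" "x \<in> span B" by auto
    thus "y \<in> span (insert b B)"
      by (metis insertI1 span_add span_base span_mono span_scale subset_insertI subsetD)
  next
    fix y assume "y \<in> span (insert b B)"
    then obtain c where "y - c *s b \<in> span B" using span_breakdown_eq by blast
    thus "y \<in> ?h ` (UNIV \<times> span B)"
      by (intro image_eqI[of _ _ "(c, y - c *s b)"]) auto
  qed
  have "finite ((UNIV :: 'f set) \<times> span B)" using IH by auto
  moreover have "card (span (insert b B)) = card ((UNIV :: 'f set) \<times> span B)"
    unfolding im[symmetric] by (rule card_image[OF inj])
  ultimately show ?case
    using IH insert.hyps im by (metis card_cartesian_product card_insert_disjoint finite_imageI power_Suc)
qed simp

lemma subspace_basis: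
  assumes "subspace S" "finite S"
  obtains B where "finite B" "independent B" "span B = S" "card S = CARD('f) ^ card B"
proof -
  obtain B where B: "B \<subseteq> S" "independent B" "S \<subseteq> span B"
    by (rule maximal_independent_subset)
  hence "span B = S" using assms span_subspace by blast
  moreover have "finite B" using B assms finite_subset by blast
  ultimately show ?thesis using that B card_span by metis
qed

lemma card_power_inject: "CARD('f) ^ a = CARD('f) ^ b \<longleftrightarrow> a = b"
  using q_gt_1 by auto

lemma span_eqI_card:
  assumes "finite B" "independent B" "subspace S" "finite S" "B \<subseteq> S" "card S = CARD('f) ^ card B"
  shows "span B = S"
proof (rule card_subset_eq)
  show "span B \<subseteq> S" using assms by (simp add: span_minimal)
  show "card (span B) = card S" using card_span[OF assms(1,2)] assms by simp
qed (use assms in simp)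

definition ind_lists :: "'b set \<Rightarrow> nat \<Rightarrow> 'b list set" where
  "ind_lists S l = {ys. length ys = l \<and> set ys \<subseteq> S \<and> distinct ys \<and> independent (set ys)}"

lemma finite_ind_lists: "finite S \<Longrightarrow> finite (ind_lists S l)"
  by (rule finite_subset[OF _ finite_lists_length_eq[of S l]]) (auto simp: ind_lists_def)

text \<open>An independent list of length \<open>Suc l\<close> is a shorter one with a new head
  outside its span, which leaves q^d - q^l choices for the head.\<close>

lemma card_ind_lists:
  assumes "subspace S" "finite S" "card S = CARD('f) ^ d"
  shows "card (ind_lists S l) = frames CARD('f) d l"
proof (induction l)
  case 0
  have "ind_lists S 0 = {[]}" by (auto simp: ind_lists_def independent_empty)
  thus ?case by (simp add: frames_def)
next
  case (Suc l)
  let ?A = "SIGMA zs : ind_lists S l. S - span (set zs)"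
  have "bij_betw (\<lambda>(zs, y). y # zs) ?A (ind_lists S (Suc l))"
  proof (rule bij_betwI[where g = "\<lambda>ys. (tl ys, hd ys)"], goal_cases)
    case 1
    show ?case by (auto simp: ind_lists_def dest: dependent_insertD span_base)
  next
    case 2
    show ?case
    proof
      fix ys assume "ys \<in> ind_lists S (Suc l)"
      then obtain y zs where "ys = y # zs" "length zs = l" "y # zs \<in> ind_lists S (Suc l)"
        by (cases ys) (auto simp: ind_lists_def)
      thus "(tl ys, hd ys) \<in> ?A" by (auto simp: ind_lists_def independent_insert)
    qed
  next
    case 3 thus ?case by auto
  next
    case (4 ys) thus ?case by (cases ys) (auto simp: ind_lists_def)
  qed
  hence "card (ind_lists S (Suc l)) = card ?A" by (metis bij_betw_same_card)
  also have "\<dots> = (\<Sum>zs\<in>ind_lists S l. card (S - span (set zs)))"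
    using finite_ind_lists[OF assms(2)] assms(2) by (intro card_SigmaI) auto
  also have "\<dots> = (\<Sum>zs\<in>ind_lists S l. CARD('f) ^ d - CARD('f) ^ l)"
  proof (rule sum.cong[OF refl])
    fix zs assume "zs \<in> ind_lists S l"
    hence zs: "length zs = l" "set zs \<subseteq> S" "distinct zs" "independent (set zs)"
      by (auto simp: ind_lists_def)
    have "card (span (set zs)) = CARD('f) ^ l" "finite (span (set zs))"
      using card_span[of "set zs"] zs distinct_card[of zs] by auto
    moreover have "span (set zs) \<subseteq> S" using zs assms by (simp add: span_minimal)
    ultimately show "card (S - span (set zs)) = CARD('f) ^ d - CARD('f) ^ l"
      using assms by (simp add: card_Diff_subset)
  qed
  also have "\<dots> = frames CARD('f) d (Suc l)" using Suc by (simp add: frames_def)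
  finally show ?case .
qed

lemma frames_pos: "frames CARD('f) l l > 0"
proof -
  have "CARD('f) ^ k < CARD('f) ^ l" if "k < l" for k using that q_gt_1 by (simp add: power_strict_increasing)
  thus ?thesis unfolding frames_def by (auto intro!: prod_pos)
qed

text \<open>Double counting: membership of a list in \<open>Ys\<close> depends only on its span, and
  every subspace in \<open>Ws\<close> has \<open>frames q l l\<close> ordered bases.\<close>

lemma card_eq_by_frames:
  assumes fin: "finite Ys" "finite Ws"
    and Ws: "\<And>W. W \<in> Ws \<Longrightarrow> subspace W \<and> finite W \<and> card W = CARD('f) ^ l"
    and sub: "\<And>ys. ys \<in> Ys \<Longrightarrow> length ys = l \<and> distinct ys \<and> independent (set ys)"
    and iff: "\<And>ys. length ys = l \<Longrightarrow> distinct ys \<Longrightarrow> independent (set ys) \<Longrightarrow>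
                ys \<in> Ys \<longleftrightarrow> span (set ys) \<in> Ws"
  shows "card Ys = card Ws * frames CARD('f) l l"
proof -
  have "card Ys = (\<Sum>W\<in>Ws. card {ys\<in>Ys. span (set ys) = W})"
    using sum_card_image
  proof -
    have "Ys = (\<Union>W\<in>Ws. {ys\<in>Ys. span (set ys) = W})" using iff sub by blast
    moreover have "card (\<Union>W\<in>Ws. {ys\<in>Ys. span (set ys) = W}) =
                   (\<Sum>W\<in>Ws. card {ys\<in>Ys. span (set ys) = W})"
      using fin by (intro card_UN_disjoint) auto
    ultimately show ?thesis by simp
  qed
  also have "\<dots> = (\<Sum>W\<in>Ws. frames CARD('f) l l)"
  proof (rule sum.cong[OF refl])
    fix W assume W: "W \<in> Ws"
    have "{ys\<in>Ys. span (set ys) = W} = ind_lists W l"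
    proof (intro equalityI subsetI)
      fix ys assume "ys \<in> {ys\<in>Ys. span (set ys) = W}"
      thus "ys \<in> ind_lists W l" using sub by (auto simp: ind_lists_def intro: span_base)
    next
      fix ys assume ys: "ys \<in> ind_lists W l"
      hence "span (set ys) = W"
        using Ws[OF W] by (intro span_eqI_card) (auto simp: ind_lists_def distinct_card)
      thus "ys \<in> {ys\<in>Ys. span (set ys) = W}" using ys iff W by (auto simp: ind_lists_def)
    qed
    thus "card {ys\<in>Ys. span (set ys) = W} = frames CARD('f) l l" using card_ind_lists Ws[OF W] by metis
  qed
  finally show ?thesis by simp
qed

lemma finite_subspaces: "finite S \<Longrightarrow> finite {W. subspace W \<and> W \<subseteq> S \<and> P W}"
  by (rule finite_subset[of _ "Pow S"]) auto

lemma card_subspaces: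
  assumes "subspace S" "finite S" "card S = CARD('f) ^ d"
  shows "card {W. subspace W \<and> W \<subseteq> S \<and> card W = CARD('f) ^ l} * frames CARD('f) l l = frames CARD('f) d l"
proof -
  have "card (ind_lists S l) = card {W. subspace W \<and> W \<subseteq> S \<and> card W = CARD('f) ^ l} * frames CARD('f) l l"
  proof (rule card_eq_by_frames)
    fix ys :: "'b list" assume ys: "length ys = l" "distinct ys" "independent (set ys)"
    have "card (span (set ys)) = CARD('f) ^ l" using card_span[of "set ys"] ys distinct_card[of ys] by auto
    moreover have "set ys \<subseteq> S \<longleftrightarrow> span (set ys) \<subseteq> S"
      using assms(1) by (metis span_minimal span_superset subset_trans)
    ultimately show "ys \<in> ind_lists S l \<longleftrightarrow> span (set ys) \<in> {W. subspace W \<and> W \<subseteq> S \<and> card W = CARD('f) ^ l}"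
      using ys by (auto simp: ind_lists_def)
  qed (use assms in \<open>auto simp: ind_lists_def finite_ind_lists[unfolded ind_lists_def] intro: finite_subset finite_subspaces\<close>)
  thus ?thesis using card_ind_lists[OF assms] by simp
qed

lemma card_subspaces_qbinom:
  assumes "subspace S" "finite S" "card S = CARD('f) ^ d"
  shows "of_nat (card {W. subspace W \<and> W \<subseteq> S \<and> card W = CARD('f) ^ l}) = qbinom CARD('f) d l"
  using card_subspaces[OF assms, of l] frames_pos[of l] unfolding qbinom_def
  by (simp add: field_simps flip: of_nat_mult)

text \<open>The bilinear form for which the basis \<open>B\<close> is orthonormal turns subspaces of small
  codimension into subspaces of small dimension.\<close>

definition ip :: "'b set \<Rightarrow> 'b \<Rightarrow> 'b \<Rightarrow> 'f" where
  "ip B x y = (\<Sum>b\<in>B. representation B x b * representation B y b)"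

definition perp :: "'b set \<Rightarrow> 'b set \<Rightarrow> 'b set" where
  "perp B X = {y \<in> span B. \<forall>x\<in>X. ip B x y = 0}"

context
  fixes B assumes fB: "finite B" and iB: "independent B"
begin

lemma ip_commute: "ip B x y = ip B y x"
  by (simp add: ip_def mult.commute)

lemma ip_add: "y \<in> span B \<Longrightarrow> z \<in> span B \<Longrightarrow> ip B x (y + z) = ip B x y + ip B x z"
  using iB by (simp add: ip_def representation_add sum.distrib algebra_simps)

lemma ip_scale: "y \<in> span B \<Longrightarrow> ip B x (c *s y) = c * ip B x y"
  using iB by (simp add: ip_def representation_scale sum_distrib_left algebra_simps)

lemma ip_diff: "y \<in> span B \<Longrightarrow> z \<in> span B \<Longrightarrow> ip B x (y - z) = ip B x y - ip B x z"
  using iB by (simp add: ip_def representation_diff sum_subtractf algebra_simps)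

lemma ip_zero: "ip B x 0 = 0"
  by (simp add: ip_def representation_zero)

lemma ip_basis: "b \<in> B \<Longrightarrow> ip B b y = representation B y b"
proof -
  assume b: "b \<in> B"
  have "ip B b y = (\<Sum>c\<in>B. if c = b then representation B y c else 0)"
    unfolding ip_def by (rule sum.cong) (use iB b in \<open>auto simp: representation_basis\<close>)
  thus ?thesis using fB b by simp
qed

lemma subspace_perp: "subspace (perp B X)"
  unfolding subspace_def perp_def
  by (auto simp: ip_zero ip_add ip_scale span_zero span_add span_scale)

lemma perp_span:
  assumes "X \<subseteq> span B" shows "perp B (span X) = perp B X"
proof
  show "perp B (span X) \<subseteq> perp B X" unfolding perp_def using span_superset by blast
  show "perp B X \<subseteq> perp B (span X)"
  proof
    fix y assume y: "y \<in> perp B X"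
    have "x \<in> span B \<and> ip B x y = 0" if "x \<in> span X" for x
      using that
    proof (induction x rule: span_induct_alt)
      case base thus ?case using ip_zero ip_commute span_zero by metis
    next
      case (step c x z)
      have "x \<in> span B" "ip B x y = 0" using step assms y by (auto simp: perp_def)
      thus ?case using step ip_add[of "c *s x" z y] ip_scale[of x y c]
        by (simp add: ip_commute[of _ y] span_add span_scale)
    qed
    thus "y \<in> perp B (span X)" using y by (auto simp: perp_def)
  qed
qed

lemma finite_span_B: "finite (span B)" using card_span[OF fB iB] by simp

lemma finite_perp: "finite (perp B X)"
  by (rule finite_subset[OF _ finite_span_B]) (auto simp: perp_def)

lemma perp_span_B: "perp B (span B) = {0}"
proof -
  have "y = 0" if "y \<in> perp B B" for y
  proof -
    have "representation B y b = 0" if "b \<in> B" for b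
      using that \<open>y \<in> perp B B\<close> ip_basis by (auto simp: perp_def)
    moreover have "y = (\<Sum>b\<in>B. representation B y b *s b)"
      using sum_representation_eq[OF iB _ fB, of y] \<open>y \<in> perp B B\<close> by (auto simp: perp_def)
    ultimately show ?thesis by simp
  qed
  moreover have "0 \<in> perp B B" using subspace_perp subspace_0 by blast
  ultimately show ?thesis using perp_span[of B] span_superset by blast
qed

text \<open>Every nonempty fibre of the functional \<open>ip B x\<close> on \<open>perp B X\<close>
  is a translate of a subset of its kernel, and there are q fibres.\<close>

lemma card_perp_insert:
  assumes "x \<in> span B"
  shows "card (perp B X) \<le> CARD('f) * card (perp B (insert x X))"
proof -
  let ?F = "\<lambda>c. {y \<in> perp B X. ip B x y = c}"
  have le: "card (?F c) \<le> card (perp B (insert x X))" for c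
  proof (cases "?F c = {}")
    case False
    then obtain y0 where y0: "y0 \<in> perp B X" "ip B x y0 = c" by auto
    have "(\<lambda>y. y - y0) ` ?F c \<subseteq> perp B (insert x X)"
      using y0 assms by (auto simp: perp_def ip_diff span_diff)
    moreover have "inj_on (\<lambda>y. y - y0) (?F c)" by (auto simp: inj_on_def)
    ultimately show ?thesis using card_inj_on_le[OF _ _ finite_perp] by blast
  next
    case True
    show ?thesis unfolding True by simp
  qed
  have "perp B X = (\<Union>c\<in>UNIV. ?F c)" by auto
  hence "card (perp B X) \<le> (\<Sum>c\<in>UNIV. card (?F c))" using card_UN_le[of UNIV ?F] by simp
  also have "\<dots> \<le> (\<Sum>c\<in>(UNIV :: 'f set). card (perp B (insert x X)))" by (intro sum_mono le)
  finally show ?thesis by simp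
qed

lemma card_perp_Un:
  assumes "finite Y" "Y \<subseteq> span B"
  shows "card (perp B X) \<le> CARD('f) ^ card Y * card (perp B (Y \<union> X))"
  using assms
proof (induction Y rule: finite_induct)
  case (insert y Y)
  have "card (perp B X) \<le> CARD('f) ^ card Y * card (perp B (Y \<union> X))" using insert by auto
  also have "\<dots> \<le> CARD('f) ^ card Y * (CARD('f) * card (perp B (insert y (Y \<union> X))))"
    using card_perp_insert[of y "Y \<union> X"] insert by (intro mult_left_mono) auto
  finally show ?case using insert by (simp add: mult_ac)
qed simp

text \<open>Over a finite field \<open>W\<close> may meet its orthogonal, so dimensions cannot be
  compared by a direct sum. Both inequalities come instead from the bound on how far new conditions
  shrink an orthogonal: from \<open>perp B W\<close> down to the orthogonal of the whole space,
  which is 0, and from the whole space down to \<open>perp B W\<close>.\<close>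

lemma card_perp:
  assumes "subspace W" "W \<subseteq> span B"
  shows "card W * card (perp B W) = card (span B)"
proof -
  obtain C where C: "C \<subseteq> W" "independent C" "W \<subseteq> span C" by (rule maximal_independent_subset)
  have CW: "span C = W" using C assms span_subspace by blast
  have "C \<subseteq> span B" using C assms by auto
  then obtain D where D: "C \<subseteq> D" "D \<subseteq> span B" "independent D" "span B \<subseteq> span D"
    using C(2) by (rule maximal_independent_subset_extend)
  have DB: "span D = span B" using D span_subspace subspace_span by blast
  have fD: "finite D" using D finite_span_B finite_subset by blast
  hence fC: "finite C" using D finite_subset by blast
  have cW: "card W = CARD('f) ^ card C" using card_span[OF fC C(2)] CW by simp
  have cB: "card (span B) = CARD('f) ^ card D" using card_span[OF fD D(3)] DB by simp
  have pW: "perp B W = perp B C" using perp_span[OF \<open>C \<subseteq> span B\<close>] CW by simp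
  have "card (perp B C) \<le> CARD('f) ^ card (D - C) * card (perp B ((D - C) \<union> C))"
    using fD D by (intro card_perp_Un) auto
  also have "perp B ((D - C) \<union> C) = {0}"
    using D perp_span[OF D(2)] DB perp_span_B by (simp add: Un_absorb2)
  finally have 1: "card (perp B C) \<le> CARD('f) ^ (card D - card C)" using D fC by (simp add: card_Diff_subset)
  have 2: "card (perp B {}) \<le> CARD('f) ^ card C * card (perp B (C \<union> {}))"
    using fC \<open>C \<subseteq> span B\<close> by (rule card_perp_Un)
  have "perp B {} = span B" by (auto simp: perp_def)
  hence 2: "CARD('f) ^ card D \<le> CARD('f) ^ card C * card (perp B C)" using 2 cB by simp
  have "card C \<le> card D" using D fD card_mono by blast
  hence "CARD('f) ^ card C * CARD('f) ^ (card D - card C) = CARD('f) ^ card D" by (simp flip: power_add)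
  hence "CARD('f) ^ card C * card (perp B C) \<le> CARD('f) ^ card D" using 1 by (metis mult_le_mono2)
  thus ?thesis using 2 cW cB pW by simp
qed

text \<open>One inclusion is clear, and applying \<open>card_perp\<close> to \<open>W\<close> and to
  its orthogonal shows that both sides have the same cardinality.\<close>

lemma perp_perp:
  assumes "subspace W" "W \<subseteq> span B"
  shows "perp B (perp B W) = W"
proof -
  have sub: "W \<subseteq> perp B (perp B W)" using assms by (auto simp: perp_def ip_commute)
  have P: "subspace (perp B W)" "perp B W \<subseteq> span B" using subspace_perp by (auto simp: perp_def)
  have "card W * card (perp B W) = card (perp B (perp B W)) * card (perp B W)"
    using card_perp[OF assms] card_perp[OF P] by (simp add: mult.commute)
  moreover have "card (perp B W) > 0" 
    using finite_perp subspace_0[OF P(1)] by (metis card_gt_0_iff empty_iff)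
  ultimately show ?thesis using card_subset_eq[OF finite_perp sub] by simp
qed

text \<open>The intersection of the orthogonals is the orthogonal of the sum; double orthogonals
  recover the sum from it.\<close>

lemma perp_sum_trivial:
  assumes "subspace W" "W \<subseteq> span B" "subspace K" "K \<subseteq> span B"
  shows "span (W \<union> K) = span B \<longleftrightarrow> perp B W \<inter> perp B K = {0}"
proof -
  have sub: "W \<union> K \<subseteq> span B" using assms by auto
  have "perp B W \<inter> perp B K = perp B (W \<union> K)" by (auto simp: perp_def)
  also have "\<dots> = perp B (span (W \<union> K))" using perp_span[OF sub] by simp
  finally have eq: "perp B W \<inter> perp B K = perp B (span (W \<union> K))" .
  have "perp B (perp B (span (W \<union> K))) = span (W \<union> K)"
    using sub by (intro perp_perp) (auto simp: span_minimal)
  moreover have "perp B {0} = span B" using ip_zero ip_commute by (auto simp: perp_def)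
  ultimately show ?thesis using eq perp_span_B by metis
qed

end

end

section \<open>Subspaces that span the whole space together with each of two given subspaces\<close>

context finite_field_space
begin

text \<open>Trivial intersection makes addition injective on pairs, so the span of the union has
  q^(|B| + |C|) elements. A basis of that span chosen inside the union must therefore be the whole
  union.\<close>

lemma independent_Un:
  assumes "finite B" "finite C" "independent B" "independent C" "span B \<inter> span C = {0}"
  shows "B \<inter> C = {}" "independent (B \<union> C)"
proof -
  have "x = 0" if "x \<in> B" "x \<in> C" for x using that assms(5) span_base by blast
  moreover have "0 \<notin> B" using assms(3) dependent_zero by blast
  ultimately show dis: "B \<inter> C = {}" by blast
  obtain D where D: "D \<subseteq> B \<union> C" "independent D" "B \<union> C \<subseteq> span D"
    by (rule maximal_independent_subset)
  have fD: "finite D" using D assms finite_subset by blast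
  have sD: "span D = span (B \<union> C)" using D by (metis span_eq subset_trans)
  have "inj_on (\<lambda>(x, y). x + y) (span B \<times> span C)"
  proof (rule inj_onI, clarsimp)
    fix x y x' y' assume *: "x \<in> span B" "y \<in> span C" "x' \<in> span B" "y' \<in> span C" "x + y = x' + y'"
    have "x - x' = y' - y" using *(5) by (simp add: algebra_simps)
    moreover have "x - x' \<in> span B" "y' - y \<in> span C" using * span_diff by auto
    ultimately have "x - x' \<in> span B \<inter> span C" "y' - y \<in> span B \<inter> span C" by auto
    hence "x - x' = 0" "y' - y = 0" using assms(5) by blast+
    thus "x = x' \<and> y = y'" by simp
  qed
  moreover have "(\<lambda>(x, y). x + y) ` (span B \<times> span C) = span (B \<union> C)"
    unfolding span_Un by auto
  ultimately have "card (span (B \<union> C)) = card (span B) * card (span C)"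
    using card_image by (fastforce simp: card_cartesian_product)
  hence "CARD('f) ^ card D = CARD('f) ^ (card B + card C)"
    using card_span[OF fD D(2)] card_span[OF assms(1,3)] card_span[OF assms(2,4)] sD
    by (simp add: power_add)
  hence "card D = card (B \<union> C)"
    using card_power_inject assms dis by (simp add: card_Un_disjoint)
  hence "D = B \<union> C" using D(1) assms card_subset_eq[of "B \<union> C" D] by simp
  thus "independent (B \<union> C)" using D by simp
qed

interpretation vp: vector_space_pair scale scale ..

lemma independent_image_iff:
  assumes lin: "Vector_Spaces.linear scale scale p" and ys: "distinct ys" "independent (set ys)"
  shows "distinct (map p ys) \<and> independent (set (map p ys)) \<longleftrightarrow>
           (\<forall>y\<in>span (set ys). p y = 0 \<longrightarrow> y = 0)"
proof
  assume *: "distinct (map p ys) \<and> independent (set (map p ys))"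
  hence "inj_on p (set ys)" by (simp add: distinct_map)
  hence "inj_on p (span (set ys))"
    using * vp.linear_inj_on_span_independent_image[OF lin, of "set ys"] by simp
  thus "\<forall>y\<in>span (set ys). p y = 0 \<longrightarrow> y = 0"
    using vp.linear_inj_on_iff_eq_0[OF lin subspace_span] by blast
next
  assume "\<forall>y\<in>span (set ys). p y = 0 \<longrightarrow> y = 0"
  hence inj: "inj_on p (span (set ys))"
    using vp.linear_inj_on_iff_eq_0[OF lin subspace_span] by blast
  hence "inj_on p (set ys)" using inj_on_subset span_superset by blast
  thus "distinct (map p ys) \<and> independent (set (map p ys))"
    using vp.linear_independent_injective_image[OF lin ys(2) inj] ys by (simp add: distinct_map)
qed

text \<open>Because \<open>B\<close> is orthonormal for the form, the kernel of the coordinate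
  projection onto \<open>span A\<close> is exactly the orthogonal of \<open>span A\<close>. This
  turns a condition on orthogonals into injectivity of a projection.\<close>

lemma obtain_projection:
  assumes "finite B" "independent B" "A \<subseteq> B"
  obtains p where "Vector_Spaces.linear scale scale p"
    "\<And>x. x \<in> span A \<Longrightarrow> p x = x" "\<And>x. x \<in> span (B - A) \<Longrightarrow> p x = 0"
    "\<And>x. x \<in> span B \<Longrightarrow> p x \<in> span A"
    "\<And>x. x \<in> span B \<Longrightarrow> p x = 0 \<longleftrightarrow> x \<in> perp B (span A)"
proof -
  obtain p where p: "Vector_Spaces.linear scale scale p"
    "\<And>x. x \<in> B \<Longrightarrow> p x = (if x \<in> A then x else 0)"
    using vp.linear_independent_extend[OF assms(2), of "\<lambda>x. if x \<in> A then x else 0"] by auto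
  have id: "Vector_Spaces.linear scale scale (\<lambda>x. x)" and zero: "Vector_Spaces.linear scale scale (\<lambda>x. 0)"
    using linear_ident vp.linear_zero by auto
  have 1: "p x = x" if "x \<in> span A" for x
    by (rule vp.linear_eq_on_span[OF p(1) id _ that]) (use p(2) assms(3) in auto)
  have 2: "p x = 0" if "x \<in> span (B - A)" for x
    by (rule vp.linear_eq_on_span[OF p(1) zero _ that]) (use p(2) assms(3) in auto)
  have px: "p x = (\<Sum>b\<in>A. representation B x b *s b)" if "x \<in> span B" for x
  proof -
    have "p x = p (\<Sum>b\<in>B. representation B x b *s b)"
      using sum_representation_eq[OF assms(2) that assms(1)] by simp
    also have "\<dots> = (\<Sum>b\<in>B. p (representation B x b *s b))"
      by (rule vp.linear_sum[OF p(1)])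
    also have "\<dots> = (\<Sum>b\<in>B. if b \<in> A then representation B x b *s b else 0)"
      using vp.linear_scale[OF p(1)] p(2) by (intro sum.cong) auto
    also have "\<dots> = (\<Sum>b\<in>B \<inter> A. representation B x b *s b)"
      using assms(1) by (simp add: sum.inter_restrict)
    finally show ?thesis using assms(3) by (simp add: Int_absorb1)
  qed
  have 3: "p x \<in> span A" if "x \<in> span B" for x
    unfolding px[OF that] by (intro span_sum span_scale span_base)
  have 4: "p x = 0 \<longleftrightarrow> x \<in> perp B (span A)" if "x \<in> span B" for x
  proof -
    have iA: "independent A" and fA: "finite A" using assms independent_mono finite_subset by auto
    have "p x = 0 \<longleftrightarrow> (\<forall>b\<in>A. representation B x b = 0)"
    proof
      assume "p x = 0"
      thus "\<forall>b\<in>A. representation B x b = 0"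
        using independentD[OF iA fA order_refl] px[OF that] by metis
    qed (simp add: px[OF that])
    also have "\<dots> \<longleftrightarrow> x \<in> perp B A"
      using that ip_basis[OF assms(1,2)] assms(3) by (auto simp: perp_def subset_iff)
    also have "perp B A = perp B (span A)"
      using perp_span[OF assms(1,2), of A] assms(3) span_superset by blast
    finally show ?thesis .
  qed
  show ?thesis by (rule that[OF p(1) 1 2 3 4])
qed

text \<open>Orthogonals replace \<open>W\<close> by an \<open>l\<close>-dimensional \<open>Y\<close>
  that meets the orthogonals of \<open>K1\<close> and \<open>K2\<close> trivially, which means that
  \<open>Y\<close> projects injectively to \<open>K1\<close> and to \<open>K2\<close>. An ordered
  basis of such a \<open>Y\<close> amounts to an independent \<open>l\<close>-list in
  \<open>K1\<close>, another one in \<open>K2\<close> and an arbitrary \<open>l\<close>-list in a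
  \<open>j\<close>-dimensional complement of \<open>K1 + K2\<close>. Division by the number of
  ordered bases of \<open>Y\<close> gives the formula; the remaining \<open>frames q l l\<close> is
  the order of GL_l, and the free list gives q^(jl).\<close>

lemma card_common_complements:
  assumes U: "subspace U" "finite U" "card U = CARD('f) ^ (a + b + j)"
    and K1: "subspace K1" "K1 \<subseteq> U" "card K1 = CARD('f) ^ a"
    and K2: "subspace K2" "K2 \<subseteq> U" "card K2 = CARD('f) ^ b"
    and disj: "K1 \<inter> K2 = {0}"
  shows "of_nat (card {W. subspace W \<and> W \<subseteq> U \<and> card W * CARD('f) ^ l = card U \<and>
                          span (W \<union> K1) = U \<and> span (W \<union> K2) = U}) =
         qbinom CARD('f) a l * qbinom CARD('f) b l * of_nat (frames CARD('f) l l) * of_nat (CARD('f) ^ (j * l))"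
proof -
  have fin: "finite K1" "finite K2" using U K1 K2 finite_subset by blast+
  obtain B1 where B1: "finite B1" "independent B1" "span B1 = K1" "card K1 = CARD('f) ^ card B1"
    by (rule subspace_basis[OF K1(1) fin(1)])
  obtain B2 where B2: "finite B2" "independent B2" "span B2 = K2" "card K2 = CARD('f) ^ card B2"
    by (rule subspace_basis[OF K2(1) fin(2)])
  have B12: "B1 \<inter> B2 = {}" "independent (B1 \<union> B2)"
    using independent_Un[of B1 B2] B1 B2 disj by auto
  have "B1 \<union> B2 \<subseteq> U" using B1 B2 K1 K2 span_superset by blast
  then obtain B where B: "B1 \<union> B2 \<subseteq> B" "B \<subseteq> U" "independent B" "U \<subseteq> span B"
    using B12(2) by (rule maximal_independent_subset_extend)
  have sB: "span B = U" using B U span_subspace by blast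
  have fB: "finite B" using B U finite_subset by blast
  \<comment> \<open>\<open>B3\<close> spans the complement of \<open>K1 + K2\<close>. Its dimension
    is \<open>j\<close>, and no condition is imposed on the coordinates there.\<close>
  define B3 where "B3 = B - (B1 \<union> B2)"
  define K3 where "K3 = span B3"
  have B3: "finite B3" "independent B3" "B3 \<subseteq> B"
    using fB B(3) independent_mono[OF B(3)] by (auto simp: B3_def)
  have cards: "card B1 = a" "card B2 = b" "card B = a + b + j"
    using B1(4) B2(4) K1(3) K2(3) U(3) card_span[OF fB B(3)] sB by (simp_all add: card_power_inject)
  have "card B = card (B1 \<union> B2) + card B3"
    using B(1) fB B1(1) B2(1) card_mono[OF fB B(1)] unfolding B3_def by (simp add: card_Diff_subset)
  hence cB3: "card B3 = j" using cards B1 B2 B12 by (simp add: card_Un_disjoint)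
  have cK3: "card K3 = CARD('f) ^ j" "finite K3" using card_span[OF B3(1,2)] cB3 K3_def by auto
  have BB: "B1 \<subseteq> B" "B2 \<subseteq> B" using B(1) by auto
  obtain p1 where p1: "Vector_Spaces.linear scale scale p1"
    "\<And>x. x \<in> span B1 \<Longrightarrow> p1 x = x" "\<And>x. x \<in> span (B - B1) \<Longrightarrow> p1 x = 0"
    "\<And>x. x \<in> span B \<Longrightarrow> p1 x \<in> span B1"
    "\<And>x. x \<in> span B \<Longrightarrow> p1 x = 0 \<longleftrightarrow> x \<in> perp B (span B1)"
    by (rule obtain_projection[OF fB B(3) BB(1)], rule that; blast)
  obtain p2 where p2: "Vector_Spaces.linear scale scale p2"
    "\<And>x. x \<in> span B2 \<Longrightarrow> p2 x = x" "\<And>x. x \<in> span (B - B2) \<Longrightarrow> p2 x = 0"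
    "\<And>x. x \<in> span B \<Longrightarrow> p2 x \<in> span B2"
    "\<And>x. x \<in> span B \<Longrightarrow> p2 x = 0 \<longleftrightarrow> x \<in> perp B (span B2)"
    by (rule obtain_projection[OF fB B(3) BB(2)], rule that; blast)
  obtain p3 where p3: "Vector_Spaces.linear scale scale p3"
    "\<And>x. x \<in> span B3 \<Longrightarrow> p3 x = x" "\<And>x. x \<in> span (B - B3) \<Longrightarrow> p3 x = 0"
    "\<And>x. x \<in> span B \<Longrightarrow> p3 x \<in> span B3"
    by (rule obtain_projection[OF fB B(3) B3(3)], rule that; blast)
  note add = vp.linear_add[OF p1(1)] vp.linear_add[OF p2(1)] vp.linear_add[OF p3(1)]
  have inB: "K1 \<subseteq> U" "K2 \<subseteq> U" "K3 \<subseteq> U"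
    using K1 K2 span_mono[OF B3(3)] sB by (auto simp: K3_def)
  have sub: "B1 \<subseteq> B - B2" "B1 \<subseteq> B - B3" "B2 \<subseteq> B - B1" "B2 \<subseteq> B - B3" "B3 \<subseteq> B - B1" "B3 \<subseteq> B - B2"
    using B(1) B12(1) by (auto simp: B3_def)
  have p1K: "p1 x = x" if "x \<in> K1" for x using p1(2) B1 that by simp
  have p2K: "p2 x = x" if "x \<in> K2" for x using p2(2) B2 that by simp
  have p3K: "p3 x = x" if "x \<in> K3" for x using p3(2) that by (simp add: K3_def)
  have p1K0: "p1 x = 0" if "x \<in> K2 \<or> x \<in> K3" for x
    using that p1(3) span_mono[OF sub(3)] span_mono[OF sub(5)] B2 by (auto simp: K3_def)
  have p2K0: "p2 x = 0" if "x \<in> K1 \<or> x \<in> K3" for x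
    using that p2(3) span_mono[OF sub(1)] span_mono[OF sub(6)] B1 by (auto simp: K3_def)
  have p3K0: "p3 x = 0" if "x \<in> K1 \<or> x \<in> K2" for x
    using that p3(3) span_mono[OF sub(2)] span_mono[OF sub(4)] B1 B2 by (auto)
  have pin: "p1 x \<in> K1" "p2 x \<in> K2" "p3 x \<in> K3" if "x \<in> U" for x
    using that p1(4) p2(4) p3(4) sB B1 B2 by (auto simp: K3_def)
  have psum: "p1 x + (p2 x + p3 x) = x" if "x \<in> U" for x
  proof -
    let ?s = "\<lambda>x. p1 x + (p2 x + p3 x)"
    have s: "Vector_Spaces.linear scale scale ?s" by (intro vp.linear_compose_add p1(1) p2(1) p3(1))
    have "?s y = y" if "y \<in> B" for y
    proof -
      have "y \<in> B1 \<or> y \<in> B2 \<or> y \<in> B3" using that by (auto simp: B3_def)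
      hence "y \<in> K1 \<or> y \<in> K2 \<or> y \<in> K3" using B1(3) B2(3) span_base by (auto simp: K3_def)
      thus ?thesis using p1K p2K p3K p1K0 p2K0 p3K0 by auto
    qed
    thus ?thesis using vp.linear_eq_on_span[OF s linear_ident, of B x] that sB by simp
  qed
  define Ys where "Ys = {ys. set ys \<subseteq> U \<and> map p1 ys \<in> ind_lists K1 l \<and> map p2 ys \<in> ind_lists K2 l}"
  define L3 where "L3 = {ws. set ws \<subseteq> K3 \<and> length ws = l}"
  have "bij_betw (\<lambda>ys. (map p1 ys, map p2 ys, map p3 ys)) Ys (ind_lists K1 l \<times> ind_lists K2 l \<times> L3)"
  proof (rule bij_betwI[where g = "\<lambda>(us, vs, ws). map (\<lambda>i. us ! i + (vs ! i + ws ! i)) [0..<l]"], goal_cases)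
    case 1
    show ?case using pin(3) by (auto simp: Ys_def L3_def ind_lists_def subset_iff)
  next
    case 2
    show ?case
    proof (rule, clarify)
      fix us vs ws assume *: "us \<in> ind_lists K1 l" "vs \<in> ind_lists K2 l" "ws \<in> L3"
      have len: "length us = l" "length vs = l" "length ws = l"
        and nth: "\<And>i. i < l \<Longrightarrow> us ! i \<in> K1 \<and> vs ! i \<in> K2 \<and> ws ! i \<in> K3"
        using * by (auto simp: ind_lists_def L3_def)
      let ?ys = "map (\<lambda>i. us ! i + (vs ! i + ws ! i)) [0..<l]"
      have "map p1 ?ys = us" "map p2 ?ys = vs"
        using len nth by (auto intro!: nth_equalityI simp: add p1K p1K0 p2K p2K0)
      moreover have "set ?ys \<subseteq> U"
      proof -
        have "us ! i + (vs ! i + ws ! i) \<in> U" if "i < l" for i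
          using nth[OF that] inB by (intro subspace_add[OF U(1)]) auto
        thus ?thesis by auto
      qed
      ultimately show "?ys \<in> Ys" using * by (simp add: Ys_def)
    qed
  next
    case (3 ys)
    hence "length ys = l" "set ys \<subseteq> U" by (auto simp: Ys_def ind_lists_def)
    thus ?case by (auto intro!: nth_equalityI simp: psum subset_iff)
  next
    case (4 y)
    then obtain us vs ws where y: "y = (us, vs, ws)" 
      and *: "us \<in> ind_lists K1 l" "vs \<in> ind_lists K2 l" "ws \<in> L3" by auto
    have len: "length us = l" "length vs = l" "length ws = l"
      and nth: "\<And>i. i < l \<Longrightarrow> us ! i \<in> K1 \<and> vs ! i \<in> K2 \<and> ws ! i \<in> K3"
      using * by (auto simp: ind_lists_def L3_def)
    show ?case unfolding y 
      using len nth by (auto intro!: nth_equalityI simp: add p1K p1K0 p2K p2K0 p3K p3K0)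
  qed
  from bij_betw_same_card[OF this]
  have "card Ys = card (ind_lists K1 l) * (card (ind_lists K2 l) * card L3)"
    by (simp add: card_cartesian_product)
  also have "card L3 = (CARD('f) ^ j) ^ l" 
    using card_lists_length_eq[OF cK3(2), of l] cK3(1) by (simp add: L3_def)
  finally have cYs: "card Ys = frames CARD('f) a l * (frames CARD('f) b l * CARD('f) ^ (j * l))"
    using card_ind_lists[OF K1(1) fin(1) K1(3)] card_ind_lists[OF K2(1) fin(2) K2(3)]
    by (simp add: power_mult)
  have dep: "distinct ys \<and> independent (set ys)" if "ys \<in> Ys" for ys
  proof -
    have ys: "set ys \<subseteq> span B" "distinct (map p1 ys)" "independent (set (map p1 ys))"
      using that sB by (auto simp: Ys_def ind_lists_def)
    have inj: "inj_on p1 (set ys)" using ys by (simp add: distinct_map)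
    hence "inj_on p1 (span (set ys))"
      using ys vp.linear_inj_on_span_independent_image[OF p1(1), of "set ys"] by simp
    moreover have "set (map p1 ys) = p1 ` set ys" by simp
    ultimately have "independent (set ys)" 
    proof -
      \<comment> \<open>An entry outside a maximal independent subset \<open>C\<close> would have
        its image under \<open>p1\<close> in the span of the other images, which are
        independent.\<close>
      obtain C where C: "C \<subseteq> set ys" "independent C" "set ys \<subseteq> span C"
        by (rule maximal_independent_subset)
      have "y \<in> C" if y: "y \<in> set ys" for y
      proof (rule ccontr)
        assume "y \<notin> C"
        hence "p1 ` C \<subseteq> p1 ` set ys - {p1 y}" using inj C y by (auto simp: inj_on_def)
        moreover have "p1 y \<in> span (p1 ` C)" using C y vp.linear_span_image[OF p1(1)] by auto
        ultimately have "p1 y \<in> span (p1 ` set ys - {p1 y})" using span_mono by blast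
        thus False using ys(3) y dependent_def by auto
      qed
      hence "C = set ys" using C(1) by blast
      thus ?thesis using C(2) by simp
    qed
    thus ?thesis using ys by (simp add: distinct_map)
  qed
  define Zs where "Zs = {Y. subspace Y \<and> Y \<subseteq> U \<and> card Y = CARD('f) ^ l \<and>
                     Y \<inter> perp B K1 = {0} \<and> Y \<inter> perp B K2 = {0}}"
  have "card Ys = card Zs * frames CARD('f) l l"
  proof (rule card_eq_by_frames)
    show "finite Ys"
      by (intro finite_subset[OF _ finite_lists_length_eq[OF U(2), of l]]) (auto simp: Ys_def ind_lists_def)
    show "finite Zs" unfolding Zs_def using U(2) finite_subset[of _ "Pow U"] by (auto intro: finite_subset[of _ "Pow U"])
    show "subspace W \<and> finite W \<and> card W = CARD('f) ^ l" if "W \<in> Zs" for W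
      using that U(2) finite_subset by (auto simp: Zs_def)
    show "length ys = l \<and> distinct ys \<and> independent (set ys)" if "ys \<in> Ys" for ys
      using dep[OF that] that by (auto simp: Ys_def ind_lists_def)
    fix ys :: "'b list" assume ys: "length ys = l" "distinct ys" "independent (set ys)"
    have cs: "card (span (set ys)) = CARD('f) ^ l" using card_span[of "set ys"] ys distinct_card[of ys] by auto
    have su: "set ys \<subseteq> U \<longleftrightarrow> span (set ys) \<subseteq> U"
      using U(1) by (metis span_minimal span_superset subset_trans)
    show "ys \<in> Ys \<longleftrightarrow> span (set ys) \<in> Zs"
    proof (cases "set ys \<subseteq> U")
      case True
      hence spU: "span (set ys) \<subseteq> span B" using su sB by simp
      have "map p1 ys \<in> ind_lists K1 l \<longleftrightarrow> distinct (map p1 ys) \<and> independent (set (map p1 ys))"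
        using True pin ys by (auto simp: ind_lists_def subset_iff)
      also have "\<dots> \<longleftrightarrow> (\<forall>y\<in>span (set ys). p1 y = 0 \<longrightarrow> y = 0)" 
        by (rule independent_image_iff[OF p1(1) ys(2,3)])
      also have "\<dots> \<longleftrightarrow> (\<forall>y\<in>span (set ys). y \<in> perp B K1 \<longrightarrow> y = 0)" using p1(5) spU B1(3) by blast
      also have "\<dots> \<longleftrightarrow> span (set ys) \<inter> perp B K1 = {0}"
        using span_zero subspace_0[OF subspace_perp[OF fB B(3)]] by blast
      finally have 1: "map p1 ys \<in> ind_lists K1 l \<longleftrightarrow> span (set ys) \<inter> perp B K1 = {0}" .
      have "map p2 ys \<in> ind_lists K2 l \<longleftrightarrow> distinct (map p2 ys) \<and> independent (set (map p2 ys))"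
        using True pin ys by (auto simp: ind_lists_def subset_iff)
      also have "\<dots> \<longleftrightarrow> (\<forall>y\<in>span (set ys). p2 y = 0 \<longrightarrow> y = 0)" 
        by (rule independent_image_iff[OF p2(1) ys(2,3)])
      also have "\<dots> \<longleftrightarrow> (\<forall>y\<in>span (set ys). y \<in> perp B K2 \<longrightarrow> y = 0)" using p2(5) spU B2(3) by blast
      also have "\<dots> \<longleftrightarrow> span (set ys) \<inter> perp B K2 = {0}"
        using span_zero subspace_0[OF subspace_perp[OF fB B(3)]] by blast
      finally have 2: "map p2 ys \<in> ind_lists K2 l \<longleftrightarrow> span (set ys) \<inter> perp B K2 = {0}" .
      show ?thesis unfolding Ys_def Zs_def mem_Collect_eq 1 2 using True su cs by simp
    next
      case False
      thus ?thesis using su by (auto simp: Ys_def Zs_def)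
    qed
  qed
  define Ws where "Ws = {W. subspace W \<and> W \<subseteq> U \<and> card W * CARD('f) ^ l = card U \<and>
                          span (W \<union> K1) = U \<and> span (W \<union> K2) = U}"
  have q0: "CARD('f) ^ n > 0" for n by simp
  have U0: "card U > 0" using U by simp
  have pc: "card W * card (perp B W) = card U" if "subspace W" "W \<subseteq> U" for W
    using card_perp[OF fB B(3) that(1)] that sB by simp
  have pU: "perp B X \<subseteq> U" "subspace (perp B X)" for X
    using subspace_perp[OF fB B(3)] sB by (auto simp: perp_def)
  have pp: "perp B (perp B W) = W" if "subspace W" "W \<subseteq> U" for W
    using perp_perp[OF fB B(3)] that sB by simp
  have cnd: "span (W \<union> K) = U \<longleftrightarrow> perp B W \<inter> perp B K = {0}"
    if "subspace W" "W \<subseteq> U" "subspace K" "K \<subseteq> U" for W K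
    using perp_sum_trivial[OF fB B(3)] that sB by simp
  \<comment> \<open>Taking orthogonals is an involution that exchanges codimension \<open>l\<close>
    with dimension \<open>l\<close>.\<close>
  have "bij_betw (perp B) Ws Zs"
  proof (rule bij_betwI[where g = "perp B"], goal_cases)
    case 1
    show ?case
    proof
      fix W assume "W \<in> Ws"
      hence W: "subspace W" "W \<subseteq> U" "card W * CARD('f) ^ l = card U" "span (W \<union> K1) = U" "span (W \<union> K2) = U"
        by (auto simp: Ws_def)
      have "card W * card (perp B W) = card W * CARD('f) ^ l" using pc W by simp
      moreover have "card W \<noteq> 0" using W(3) U0 by (intro notI) simp
      ultimately have "card (perp B W) = CARD('f) ^ l" by simp
      thus "perp B W \<in> Zs" using pU W cnd K1 K2 by (simp add: Zs_def)
    qed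
  next
    case 2
    show ?case
    proof
      fix Y assume "Y \<in> Zs"
      hence Y: "subspace Y" "Y \<subseteq> U" "card Y = CARD('f) ^ l" 
        "Y \<inter> perp B K1 = {0}" "Y \<inter> perp B K2 = {0}" by (auto simp: Zs_def)
      have "card (perp B Y) * CARD('f) ^ l = card U" using pc[OF Y(1,2)] Y by (simp add: mult.commute)
      thus "perp B Y \<in> Ws" using pU Y cnd K1 K2 pp[OF Y(1,2)] by (simp add: Ws_def)
    qed
  next
    case (3 W) thus ?case using pp by (simp add: Ws_def)
  next
    case (4 Y) thus ?case using pp by (simp add: Zs_def)
  qed
  hence "card Ws = card Zs" by (rule bij_betw_same_card)
  hence "card Ws * frames CARD('f) l l = frames CARD('f) a l * (frames CARD('f) b l * CARD('f) ^ (j * l))"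
    using \<open>card Ys = card Zs * frames CARD('f) l l\<close> cYs by simp
  hence "(of_nat (card Ws) :: rat) * of_nat (frames CARD('f) l l) = 
     of_nat (frames CARD('f) a l) * (of_nat (frames CARD('f) b l) * of_nat (CARD('f) ^ (j * l)))"
    unfolding of_nat_mult[symmetric] of_nat_eq_iff by simp
  thus ?thesis unfolding Ws_def[symmetric] qbinom_def using frames_pos[of l] by (simp add: field_simps)
qed

end

section \<open>The $q$-binomial identity\<close>

text \<open>The q-Pochhammer symbol (X; q)_j at X = q^(-s), the inverse of the zeta factor expected
  from a component of rank \<open>j\<close>.\<close>

definition qpoch :: "nat \<Rightarrow> nat \<Rightarrow> rat fps" where
  "qpoch q j = (\<Prod>k<j. 1 - q_pow_minus_s q k)"

text \<open>Natural subtraction truncates only at indices \<open>k > n\<close>; the product then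
  also contains \<open>k = n\<close>, and both sides are 0.\<close>

lemma of_nat_frames:
  assumes "q \<ge> 1"
  shows "(of_nat (frames q n l) :: rat) = (\<Prod>k<l. of_nat q ^ n - of_nat q ^ k)"
proof (cases "l \<le> n")
  case True
  have "q ^ k \<le> q ^ n" if "k < l" for k using that True assms by (intro power_increasing) auto
  thus ?thesis unfolding frames_def of_nat_prod by (intro prod.cong) (auto simp: of_nat_diff)
next
  case False
  hence "frames q n l = 0" "(\<Prod>k<l. of_nat q ^ n - of_nat q ^ k :: rat) = 0"
    unfolding frames_def by (auto intro!: bexI[of _ n])
  thus ?thesis by simp
qed

lemma frames_gt: "n < l \<Longrightarrow> frames q n l = 0"
  unfolding frames_def by (auto intro!: bexI[of _ n])

lemma qbinom_0 [simp]: "qbinom q n 0 = 1"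
  by (simp add: qbinom_def frames_def)

lemma qbinom_gt: "n < l \<Longrightarrow> qbinom q n l = 0"
  by (simp add: qbinom_def frames_gt)

lemma frames_Suc_right:
  assumes "q \<ge> 1"
  shows "(of_nat (frames q n (Suc l)) :: rat) = (of_nat q ^ n - of_nat q ^ l) * of_nat (frames q n l)"
  using assms by (simp add: of_nat_frames mult.commute)

lemma frames_Suc_Suc:
  assumes "q \<ge> 1"
  shows "(of_nat (frames q (Suc n) (Suc l)) :: rat) =
           (of_nat q ^ Suc n - 1) * of_nat q ^ l * of_nat (frames q n l)"
proof -
  have "(\<Prod>k<l. of_nat q ^ Suc n - of_nat q ^ Suc k :: rat) =
        (\<Prod>k<l. of_nat q * (of_nat q ^ n - of_nat q ^ k))"
    by (intro prod.cong) (auto simp: algebra_simps)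
  also have "\<dots> = of_nat q ^ l * (\<Prod>k<l. of_nat q ^ n - of_nat q ^ k)"
    by (simp add: prod.distrib)
  finally show ?thesis
    unfolding of_nat_frames[OF assms] prod.lessThan_Suc_shift by simp
qed

text \<open>Of the two q-Pascal rules this is the one whose power of q matches the factor 1 - q^j X
  by which \<open>qpoch\<close> grows.\<close>

lemma qbinom_Suc_Suc:
  assumes "q \<ge> 2"
  shows "qbinom q (Suc n) (Suc l) = qbinom q n l + of_nat q ^ Suc l * qbinom q n (Suc l)"
proof -
  let ?q = "of_nat q :: rat"
  have q1: "q \<ge> 1" and qq: "?q > 1" using assms by auto
  define A where "A = (of_nat (frames q n l) :: rat)"
  define B where "B = (of_nat (frames q l l) :: rat)"
  have "q ^ k < q ^ l" if "k < l" for k using that assms by (simp add: power_strict_increasing)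
  hence "frames q l l > 0" unfolding frames_def by (auto intro!: prod_pos)
  hence B: "B > 0" by (simp add: B_def)
  have p: "?q ^ Suc l - 1 > 0" using one_less_power[OF qq, of "Suc l"] by simp
  have ql: "?q ^ l > 0" using qq by simp
  have 1: "qbinom q (Suc n) (Suc l) = ((?q ^ Suc n - 1) * ?q ^ l * A) / ((?q ^ Suc l - 1) * ?q ^ l * B)"
    unfolding qbinom_def frames_Suc_Suc[OF q1] A_def B_def ..
  have 2: "qbinom q n (Suc l) = ((?q ^ n - ?q ^ l) * A) / ((?q ^ Suc l - 1) * ?q ^ l * B)"
    unfolding qbinom_def frames_Suc_Suc[OF q1] frames_Suc_right[OF q1, of n] A_def B_def ..
  have 3: "qbinom q n l = A / B" unfolding qbinom_def A_def B_def ..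
  define x where "x = ?q ^ Suc l - 1"
  define y where "y = ?q ^ l"
  define z where "z = ?q ^ n"
  have x: "x > 0" "y > 0" "x = ?q * y - 1" using p ql by (simp_all add: x_def y_def)
  have "((?q * z - 1) * y * A) / (x * y * B) = A / B + (?q * y) * (((z - y) * A) / (x * y * B))"
    using x(1,2) B by (simp add: field_simps) (simp add: x(3) algebra_simps)
  thus ?thesis unfolding 1 2 3 x_def y_def z_def by simp
qed

text \<open>By the q-Pascal rule, the last factor 1 - q^j X of each new \<open>qpoch\<close> splits
  off a correction q^j X from the terms for \<open>d\<close>, and the second half of the rule
  restores exactly these corrections. Read over subspaces, the identity solves the Moebius inversion
  that is needed for the zeta functions.\<close>

lemma qbinom_theorem:
  assumes "q \<ge> 2"
  shows "(\<Sum>j\<le>d. fps_const (qbinom q d j) * fps_X ^ (d - j) * qpoch q j) = 1"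
proof (induction d)
  case (Suc d)
  let ?a = "\<lambda>d j. fps_const (qbinom q d j) * fps_X ^ (d - j) * qpoch q j"
  let ?c = "\<lambda>j. fps_const (of_nat q ^ j :: rat)"
  have "(\<Sum>j\<le>Suc d. ?a (Suc d) j) = ?a (Suc d) 0 + (\<Sum>j\<le>d. ?a (Suc d) (Suc j))"
    by (rule sum.atMost_Suc_shift)
  also have "(\<Sum>j\<le>d. ?a (Suc d) (Suc j)) =
      (\<Sum>j\<le>d. ?a d j * (1 - ?c j * fps_X)) +
      (\<Sum>j\<le>d. ?c (Suc j) * (fps_const (qbinom q d (Suc j)) * fps_X ^ (d - j) * qpoch q (Suc j)))"
    unfolding sum.distrib[symmetric]
  proof (rule sum.cong[OF refl])
    fix j
    have "fps_const (qbinom q (Suc d) (Suc j)) =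
            fps_const (qbinom q d j) + ?c (Suc j) * fps_const (qbinom q d (Suc j))"
      unfolding qbinom_Suc_Suc[OF assms] by simp
    moreover have "qpoch q (Suc j) = qpoch q j * (1 - ?c j * fps_X)"
      by (simp add: qpoch_def q_pow_minus_s_def)
    ultimately show "?a (Suc d) (Suc j) = ?a d j * (1 - ?c j * fps_X) +
        ?c (Suc j) * (fps_const (qbinom q d (Suc j)) * fps_X ^ (d - j) * qpoch q (Suc j))"
      by (simp only: diff_Suc_Suc distrib_right) (simp only: mult.assoc)
  qed
  also have "?a (Suc d) 0 + ((\<Sum>j\<le>d. ?a d j * (1 - ?c j * fps_X)) +
      (\<Sum>j\<le>d. ?c (Suc j) * (fps_const (qbinom q d (Suc j)) * fps_X ^ (d - j) * qpoch q (Suc j)))) =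
    (\<Sum>j\<le>d. ?a d j * (1 - ?c j * fps_X)) +
    (?c 0 * (fps_const (qbinom q d 0) * fps_X ^ (Suc d - 0) * qpoch q 0) +
      (\<Sum>j\<le>d. ?c (Suc j) * (fps_const (qbinom q d (Suc j)) * fps_X ^ (Suc d - Suc j) * qpoch q (Suc j))))"
    by simp
  also have "(?c 0 * (fps_const (qbinom q d 0) * fps_X ^ (Suc d - 0) * qpoch q 0) +
      (\<Sum>j\<le>d. ?c (Suc j) * (fps_const (qbinom q d (Suc j)) * fps_X ^ (Suc d - Suc j) * qpoch q (Suc j)))) =
     (\<Sum>j\<le>Suc d. ?c j * (fps_const (qbinom q d j) * fps_X ^ (Suc d - j) * qpoch q j))"
    by (rule sum.atMost_Suc_shift[symmetric])
  \<comment> \<open>The term with index \<open>Suc d\<close> vanishes, and one factor X is split off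
    from the others, so that they become the corrections that were subtracted.\<close>
  also have "\<dots> = (\<Sum>j\<le>d. ?c j * (fps_const (qbinom q d j) * fps_X ^ (Suc d - j) * qpoch q j))"
    by (simp add: qbinom_gt)
  also have "\<dots> = (\<Sum>j\<le>d. ?a d j * (?c j * fps_X))"
    by (intro sum.cong) (auto simp: Suc_diff_le mult_ac)
  also have "(\<Sum>j\<le>d. ?a d j * (1 - ?c j * fps_X)) + (\<Sum>j\<le>d. ?a d j * (?c j * fps_X)) = (\<Sum>j\<le>d. ?a d j)"
    unfolding sum.distrib[symmetric] by (intro sum.cong refl) (simp add: right_diff_distrib)
  finally show ?case using Suc by simp
qed (simp add: qpoch_def)

text \<open>Uniqueness of Moebius inversion.\<close>

lemma zero_if_lower_sums_zero:
  fixes d :: "'x \<Rightarrow> 'r::ab_group_add" and below :: "'x \<Rightarrow> 'x \<Rightarrow> bool" and m :: "'x \<Rightarrow> nat"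
  assumes "\<And>x. x \<in> S \<Longrightarrow> finite {y\<in>S. below y x}" "\<And>x. x \<in> S \<Longrightarrow> below x x"
    and "\<And>x y. x \<in> S \<Longrightarrow> y \<in> S \<Longrightarrow> below y x \<Longrightarrow> y \<noteq> x \<Longrightarrow> m y < m x"
    and "\<And>x y z. below x y \<Longrightarrow> below y z \<Longrightarrow> below x z"
    and "x \<in> S" "\<And>y. y \<in> S \<Longrightarrow> below y x \<Longrightarrow> (\<Sum>z\<in>{z\<in>S. below z y}. d z) = 0"
  shows "d x = 0"
  using assms(5,6)
proof (induction "m x" arbitrary: x rule: less_induct)
  case less
  have "0 = (\<Sum>z\<in>{z\<in>S. below z x}. d z)" using less.prems assms(2) by auto
  also have "\<dots> = d x + (\<Sum>z\<in>{z\<in>S. below z x} - {x}. d z)"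
    using less.prems(1) assms(1,2) by (intro sum.remove) auto
  also have "(\<Sum>z\<in>{z\<in>S. below z x} - {x}. d z) = 0"
  proof (intro sum.neutral ballI)
    fix z assume z: "z \<in> {z\<in>S. below z x} - {x}"
    show "d z = 0"
    proof (rule less.hyps)
      show "m z < m x" using z less.prems(1) assms(3) by auto
      show "z \<in> S" using z by simp
      show "(\<Sum>w\<in>{w\<in>S. below w y}. d w) = 0" if "y \<in> S" "below y z" for y
        using less.prems(2)[OF that(1)] assms(4)[OF that(2)] z by auto
    qed
  qed
  finally show ?case by simp
qed

context finite_field_space
begin

lemma card_dim:
  assumes "subspace S" "finite S" shows "card S = CARD('f) ^ dim S"
  by (rule subspace_basis[OF assms]) (metis dim_span_eq_card_independent)

lemma dim_mono_finite:
  assumes "subspace E" "finite D" "subspace D" "E \<subseteq> D" shows "dim E \<le> dim D"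
proof -
  have "CARD('f) ^ dim E \<le> CARD('f) ^ dim D"
    using card_dim[OF assms(1) finite_subset[OF assms(4,2)]] card_dim[OF assms(3,2)]
      card_mono[OF assms(2,4)] by simp
  thus ?thesis using q_gt_1 by (metis power_le_imp_le_exp)
qed

lemma dim_strict_mono_finite:
  assumes "subspace E" "finite D" "subspace D" "E \<subseteq> D" "E \<noteq> D" shows "dim E < dim D"
proof -
  have "card E < card D" using assms by (intro psubset_card_mono) auto
  hence "CARD('f) ^ dim E < CARD('f) ^ dim D"
    using card_dim[OF assms(1) finite_subset[OF assms(4,2)]] card_dim[OF assms(3,2)] by simp
  thus ?thesis using q_gt_1 by (metis power_less_imp_less_exp)
qed

lemma sum_subspaces_by_dim:
  fixes g :: "nat \<Rightarrow> rat fps"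
  assumes "subspace D" "finite D"
  shows "(\<Sum>E\<in>{E. subspace E \<and> E \<subseteq> D}. g (dim E)) =
           (\<Sum>j\<le>dim D. fps_const (qbinom CARD('f) (dim D) j) * g j)"
proof -
  let ?S = "{E. subspace E \<and> E \<subseteq> D}"
  have fin: "finite ?S" using finite_subset[of ?S "Pow D"] assms by auto
  have "(\<Sum>E\<in>?S. g (dim E)) = (\<Sum>j\<le>dim D. \<Sum>E\<in>{E\<in>?S. dim E = j}. g (dim E))"
    using fin dim_mono_finite[OF _ assms(2,1)] by (intro sum.group[symmetric]) auto
  also have "\<dots> = (\<Sum>j\<le>dim D. fps_const (qbinom CARD('f) (dim D) j) * g j)"
  proof (rule sum.cong[OF refl])
    fix j
    have "{E\<in>?S. dim E = j} = {W. subspace W \<and> W \<subseteq> D \<and> card W = CARD('f) ^ j}"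
      using card_dim finite_subset[OF _ assms(2)] card_power_inject by auto
    hence "of_nat (card {E\<in>?S. dim E = j}) = qbinom CARD('f) (dim D) j"
      using card_subspaces_qbinom[OF assms card_dim[OF assms]] by simp
    hence "fps_const (of_nat (card {E\<in>?S. dim E = j})) = fps_const (qbinom CARD('f) (dim D) j)"
      by (rule arg_cong)
    hence eq: "of_nat (card {E\<in>?S. dim E = j}) = fps_const (qbinom CARD('f) (dim D) j)"
      by (simp only: fps_of_nat)
    have "(\<Sum>E\<in>{E\<in>?S. dim E = j}. g (dim E)) = of_nat (card {E\<in>?S. dim E = j}) * g j"
      by simp
    thus "(\<Sum>E\<in>{E\<in>?S. dim E = j}. g (dim E)) = fps_const (qbinom CARD('f) (dim D) j) * g j"
      by (simp only: eq)
  qed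
  finally show ?thesis .
qed

lemma sum_subspaces_qpoch:
  assumes "subspace D" "finite D"
  shows "(\<Sum>E\<in>{E. subspace E \<and> E \<subseteq> D}. fps_X ^ (dim D - dim E) * qpoch CARD('f) (dim E)) = 1"
proof -
  have "CARD('f) \<ge> 2" using q_gt_1 by simp
  thus ?thesis using sum_subspaces_by_dim[OF assms, of "\<lambda>j. fps_X ^ (dim D - j) * qpoch CARD('f) j"]
      qbinom_theorem[of "CARD('f)" "dim D"] by (simp add: mult.assoc)
qed

end

section \<open>Indices of additive subgroups\<close>

lemma add_subgroup_0: "is_add_subgroup A \<Longrightarrow> 0 \<in> A"
  by (simp add: is_add_subgroup_def)

lemma add_subgroup_diff: "is_add_subgroup A \<Longrightarrow> x \<in> A \<Longrightarrow> y \<in> A \<Longrightarrow> x - y \<in> A"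
  by (simp add: is_add_subgroup_def)

lemma add_subgroup_minus: "is_add_subgroup A \<Longrightarrow> x \<in> A \<Longrightarrow> - x \<in> A"
  using add_subgroup_diff[of A 0 x] add_subgroup_0 by auto

lemma add_subgroup_add: "is_add_subgroup A \<Longrightarrow> x \<in> A \<Longrightarrow> y \<in> A \<Longrightarrow> x + y \<in> A"
  using add_subgroup_diff[of A x "- y"] add_subgroup_minus by auto

lemma add_subgroup_diff_swap: "is_add_subgroup A \<Longrightarrow> x - y \<in> A \<longleftrightarrow> y - x \<in> A"
  using add_subgroup_minus[of A "x - y"] add_subgroup_minus[of A "y - x"] by auto

lemma add_subgroup_sum:
  "is_add_subgroup A \<Longrightarrow> (\<And>i. i \<in> F \<Longrightarrow> f i \<in> A) \<Longrightarrow> sum f F \<in> A"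
  by (induction F rule: infinite_finite_induct) (auto intro: add_subgroup_0 add_subgroup_add)

definition coset :: "'v::ab_group_add set \<Rightarrow> 'v \<Rightarrow> 'v set" where
  "coset A x = (\<lambda>a. a + x) ` A"

definition quo :: "'v::ab_group_add set \<Rightarrow> 'v set \<Rightarrow> 'v set set" where
  "quo B A = coset A ` B"

text \<open>For an infinite quotient this is 0, like \<open>card\<close>. Under this convention the
  tower formula holds with no finiteness hypothesis, but finiteness has to be carried along
  separately.\<close>

definition idx :: "'v::ab_group_add set \<Rightarrow> 'v set \<Rightarrow> nat" where
  "idx B A = card (quo B A)"

lemma coset_eq_iff:
  assumes "is_add_subgroup A" shows "coset A x = coset A y \<longleftrightarrow> x - y \<in> A"
proof
  assume "coset A x = coset A y"
  moreover have "x \<in> coset A x" using add_subgroup_0[OF assms] by (force simp: coset_def)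
  ultimately obtain a where "a \<in> A" "x = a + y" by (auto simp: coset_def)
  thus "x - y \<in> A" by simp
next
  have *: "coset A x \<subseteq> coset A y" if "x - y \<in> A" for x y
  proof
    fix z assume "z \<in> coset A x"
    then obtain a where "a \<in> A" "z = a + x" by (auto simp: coset_def)
    hence "z = (a + (x - y)) + y" "a + (x - y) \<in> A" using that assms by (auto intro: add_subgroup_add)
    thus "z \<in> coset A y" unfolding coset_def by (rule image_eqI)
  qed
  assume "x - y \<in> A"
  thus "coset A x = coset A y"
    using *[of x y] *[of y x] add_subgroup_diff_swap[OF assms] by auto
qed

lemma mem_coset: "is_add_subgroup A \<Longrightarrow> z \<in> coset A x \<longleftrightarrow> z - x \<in> A"
proof
  assume "z - x \<in> A" thus "z \<in> coset A x"
    unfolding coset_def by (intro image_eqI[of _ _ "z - x"]) auto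
qed (auto simp: coset_def)

lemma images_same_kernel:
  assumes "\<And>x y. x \<in> B \<Longrightarrow> y \<in> B \<Longrightarrow> f x = f y \<longleftrightarrow> g x = g y"
  shows "card (f ` B) = card (g ` B) \<and> (finite (f ` B) \<longleftrightarrow> finite (g ` B))"
proof -
  define h where "h y = g (SOME x. x \<in> B \<and> f x = y)" for y
  have h: "h (f x) = g x" if "x \<in> B" for x
    using someI[of "\<lambda>z. z \<in> B \<and> f z = f x" x] that assms unfolding h_def by blast
  have "inj_on h (f ` B)" using h assms by (auto simp: inj_on_def)
  moreover have "h ` f ` B = g ` B" using h by (force simp: image_iff)
  ultimately have "bij_betw h (f ` B) (g ` B)" by (simp add: bij_betw_def)
  thus ?thesis using bij_betw_same_card bij_betw_finite by blast
qed

text \<open>The first isomorphism theorem for a mere map: \<open>f\<close> has to separate the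
  cosets of \<open>A\<close> but need not be additive. This admits maps built from chosen
  representatives and pairs of coordinates.\<close>

lemma idx_kernel:
  assumes "is_add_subgroup A" "\<And>x y. x \<in> B \<Longrightarrow> y \<in> B \<Longrightarrow> f x = f y \<longleftrightarrow> x - y \<in> A"
  shows "idx B A = card (f ` B)" "finite (quo B A) \<longleftrightarrow> finite (f ` B)"
proof -
  have "coset A x = coset A y \<longleftrightarrow> f x = f y" if "x \<in> B" "y \<in> B" for x y
    using assms(2)[OF that] coset_eq_iff[OF assms(1)] by simp
  from images_same_kernel[of B "coset A" f, OF this]
  show "idx B A = card (f ` B)" "finite (quo B A) \<longleftrightarrow> finite (f ` B)"
    by (simp_all add: idx_def quo_def)
qed

text \<open>With a representative \<open>r\<close> for each coset of \<open>B\<close>, an element x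
  of \<open>C\<close> is sent to its coset modulo \<open>B\<close> and to the coset of x - r modulo
  \<open>A\<close>. This identifies C/A with the product of C/B and B/A as sets.\<close>

lemma quo_tower:
  assumes A: "is_add_subgroup A" and B: "is_add_subgroup B" and C: "is_add_subgroup C"
    and sub: "A \<subseteq> B" "B \<subseteq> C"
  shows "idx C A = idx C B * idx B A"
    and "finite (quo C A) \<longleftrightarrow> finite (quo C B) \<and> finite (quo B A)"
proof -
  define r where "r K = (SOME x. x \<in> C \<and> coset B x = K)" for K
  have r: "r (coset B x) \<in> C \<and> coset B (r (coset B x)) = coset B x" if "x \<in> C" for x
    unfolding r_def by (rule someI[of _ x]) (use that in simp)
  define f where "f x = (coset B x, coset A (x - r (coset B x)))" for x
  have "f x = f y \<longleftrightarrow> x - y \<in> A" for x y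
    using sub by (auto simp: f_def coset_eq_iff[OF A] coset_eq_iff[OF B])
      (metis coset_eq_iff[OF B] diff_diff_eq2 diff_add_cancel subsetD)+
  moreover have "f ` C = quo C B \<times> quo B A"
  proof (intro equalityI subsetI)
    fix p assume "p \<in> f ` C"
    then obtain x where x: "x \<in> C" "p = f x" by auto
    have "x - r (coset B x) \<in> B" using r[OF x(1)] coset_eq_iff[OF B] by metis
    thus "p \<in> quo C B \<times> quo B A" using x by (auto simp: f_def quo_def)
  next
    fix p assume "p \<in> quo C B \<times> quo B A"
    then obtain z w where p: "p = (coset B z, coset A w)" "z \<in> C" "w \<in> B" by (auto simp: quo_def)
    define x where "x = r (coset B z) + w"
    have xC: "x \<in> C" using r[OF p(2)] p(3) sub C by (auto simp: x_def intro: add_subgroup_add)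
    have "coset B x = coset B (r (coset B z))" using p(3) by (simp add: coset_eq_iff[OF B] x_def)
    hence "coset B x = coset B z" using r[OF p(2)] by simp
    hence "f x = p" by (simp add: f_def p x_def)
    thus "p \<in> f ` C" using xC by blast
  qed
  moreover have "quo C B \<noteq> {}" "quo B A \<noteq> {}" using add_subgroup_0[OF B] add_subgroup_0[OF C]
    by (auto simp: quo_def)
  ultimately show "idx C A = idx C B * idx B A" "finite (quo C A) \<longleftrightarrow> finite (quo C B) \<and> finite (quo B A)"
    using idx_kernel[OF A, of C f] by (auto simp: idx_def card_cartesian_product finite_cartesian_product_iff)
qed

definition ssum :: "'v::ab_group_add set \<Rightarrow> 'v set \<Rightarrow> 'v set" where
  "ssum A B = {a + b |a b. a \<in> A \<and> b \<in> B}"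

lemma add_subgroup_ssum:
  assumes "is_add_subgroup A" "is_add_subgroup B" shows "is_add_subgroup (ssum A B)"
  unfolding is_add_subgroup_def
proof (intro conjI ballI)
  show "0 \<in> ssum A B" using assms by (force simp: ssum_def is_add_subgroup_def)
  fix x y assume "x \<in> ssum A B" "y \<in> ssum A B"
  then obtain a b c d where *: "x = a + b" "y = c + d" "a \<in> A" "b \<in> B" "c \<in> A" "d \<in> B"
    by (auto simp: ssum_def)
  hence "x - y = (a - c) + (b - d)" "a - c \<in> A" "b - d \<in> B"
    using assms by (auto simp: add_subgroup_diff)
  thus "x - y \<in> ssum A B" unfolding ssum_def by blast
qed

lemma add_subgroup_Int: "is_add_subgroup A \<Longrightarrow> is_add_subgroup B \<Longrightarrow> is_add_subgroup (A \<inter> B)"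
  by (auto simp: is_add_subgroup_def)

lemma ssum_upper: "is_add_subgroup B \<Longrightarrow> A \<subseteq> ssum A B" "is_add_subgroup A \<Longrightarrow> B \<subseteq> ssum A B"
  by (force simp: ssum_def is_add_subgroup_def)+

lemma ssum_least: "is_add_subgroup C \<Longrightarrow> A \<subseteq> C \<Longrightarrow> B \<subseteq> C \<Longrightarrow> ssum A B \<subseteq> C"
  by (auto simp: ssum_def add_subgroup_add subset_iff)

text \<open>The second isomorphism theorem: every coset of \<open>B\<close> in the sum is
  represented in \<open>A\<close>.\<close>

lemma idx_ssum:
  assumes "is_add_subgroup A" "is_add_subgroup B"
  shows "idx (ssum A B) B = idx A (A \<inter> B)" "finite (quo (ssum A B) B) \<longleftrightarrow> finite (quo A (A \<inter> B))"
proof -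
  have "quo (ssum A B) B = coset B ` A"
  proof (intro equalityI subsetI)
    fix K assume "K \<in> quo (ssum A B) B"
    then obtain a b where *: "K = coset B (a + b)" "a \<in> A" "b \<in> B" by (auto simp: quo_def ssum_def)
    hence "K = coset B a" using coset_eq_iff[OF assms(2)] by simp
    thus "K \<in> coset B ` A" using * by blast
  qed (use ssum_upper[OF assms(2)] in \<open>auto simp: quo_def\<close>)
  moreover have "coset B x = coset B y \<longleftrightarrow> x - y \<in> A \<inter> B" if "x \<in> A" "y \<in> A" for x y
    using that assms by (auto simp: coset_eq_iff add_subgroup_diff)
  ultimately show "idx (ssum A B) B = idx A (A \<inter> B)" "finite (quo (ssum A B) B) \<longleftrightarrow> finite (quo A (A \<inter> B))"
    using idx_kernel[OF add_subgroup_Int[OF assms], of A "coset B"] by (auto simp: idx_def)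
qed

lemma idx_self:
  assumes "is_add_subgroup A" shows "idx A A = 1" "finite (quo A A)"
proof -
  have "idx A A = card ((\<lambda>x. x - x) ` A)" "finite (quo A A) \<longleftrightarrow> finite ((\<lambda>x. x - x) ` A)"
    using assms by (intro idx_kernel; simp add: add_subgroup_diff)+
  moreover have "(\<lambda>x. x - x) ` A = {0}" using add_subgroup_0[OF assms] by auto
  ultimately show "idx A A = 1" "finite (quo A A)" by simp_all
qed

lemma idx_pos:
  assumes "is_add_subgroup B" "finite (quo B A)" shows "idx B A > 0"
  using assms add_subgroup_0[OF assms(1)] by (auto simp: idx_def quo_def card_gt_0_iff)

lemma idx_eq_1:
  assumes "is_add_subgroup A" "is_add_subgroup B" "A \<subseteq> B" "idx B A = 1" shows "A = B"
proof -
  obtain K where K: "quo B A = {K}" using assms(4) by (auto simp: idx_def card_1_singleton_iff)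
  have "x \<in> A" if "x \<in> B" for x
  proof -
    have "coset A x \<in> quo B A" "coset A 0 \<in> quo B A"
      using that add_subgroup_0[OF assms(2)] unfolding quo_def by blast+
    hence "coset A x = coset A 0" using K by simp
    thus ?thesis using coset_eq_iff[OF assms(1)] by auto
  qed
  thus ?thesis using assms(3) by auto
qed

text \<open>A group between \<open>A\<close> and \<open>B\<close> is the union of its cosets of
  \<open>A\<close>, hence is determined by a subset of the finite quotient.\<close>

lemma finite_between:
  assumes "is_add_subgroup A" "finite (quo B A)"
  shows "finite {X. is_add_subgroup X \<and> A \<subseteq> X \<and> X \<subseteq> B}"
proof (rule finite_subset[of _ "(\<lambda>S. \<Union>S) ` Pow (quo B A)"])
  show "finite ((\<lambda>S. \<Union>S) ` Pow (quo B A))" using assms by simp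
  show "{X. is_add_subgroup X \<and> A \<subseteq> X \<and> X \<subseteq> B} \<subseteq> (\<lambda>S. \<Union>S) ` Pow (quo B A)"
  proof
    fix X assume X: "X \<in> {X. is_add_subgroup X \<and> A \<subseteq> X \<and> X \<subseteq> B}"
    have "X = \<Union>(coset A ` X)"
    proof
      show "X \<subseteq> \<Union>(coset A ` X)" using mem_coset[OF assms(1)] add_subgroup_0[OF assms(1)] by fastforce
      show "\<Union>(coset A ` X) \<subseteq> X" using X by (auto simp: coset_def intro: add_subgroup_add)
    qed
    moreover have "coset A ` X \<in> Pow (quo B A)" using X by (auto simp: quo_def)
    ultimately show "X \<in> (\<lambda>S. \<Union>S) ` Pow (quo B A)" by blast
  qed
qed

section \<open>Lattices over a ring with known residue field\<close>

lemma submodule_subgroup: "is_submodule S act X \<Longrightarrow> is_add_subgroup X"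
  by (simp add: is_submodule_def)

lemma submodule_act: "is_submodule S act X \<Longrightarrow> s \<in> S \<Longrightarrow> x \<in> X \<Longrightarrow> act s x \<in> X"
  by (simp add: is_submodule_def)

lemma submodule_mono: "is_submodule S act X \<Longrightarrow> T \<subseteq> S \<Longrightarrow> is_submodule T act X"
  by (auto simp: is_submodule_def)

lemma submodule_Int: "is_submodule S act X \<Longrightarrow> is_submodule S act Y \<Longrightarrow> is_submodule S act (X \<inter> Y)"
  by (auto simp: is_submodule_def is_add_subgroup_def)

lemma add_subgroup_hull: "is_add_subgroup (is_add_subgroup hull S)"
  by (rule hull_in) (auto simp: is_add_subgroup_def)

lemma submodule_hull: "is_submodule S act (is_submodule S act hull X)"
  by (rule hull_in) (auto simp: is_add_subgroup_def is_submodule_def)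

lemma ideal_times_subgroup: "is_add_subgroup (ideal_times act P X)"
  unfolding ideal_times_def by (rule add_subgroup_hull)

lemma ideal_times_mem: "a \<in> P \<Longrightarrow> x \<in> X \<Longrightarrow> act a x \<in> ideal_times act P X"
  unfolding ideal_times_def by (rule hull_inc) blast

lemma ideal_times_least:
  assumes "is_add_subgroup C" "\<And>a x. a \<in> P \<Longrightarrow> x \<in> X \<Longrightarrow> act a x \<in> C"
  shows "ideal_times act P X \<subseteq> C"
  unfolding ideal_times_def using assms by (intro hull_minimal) auto

lemma ideal_times_mono:
  assumes "P \<subseteq> Q" "X \<subseteq> Y" shows "ideal_times act P X \<subseteq> ideal_times act Q Y"
  by (rule ideal_times_least[OF ideal_times_subgroup]) (use assms in \<open>auto intro!: ideal_times_mem\<close>)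

context left_module
begin

lemma act_0_right [simp]: "act a 0 = 0"
  using act_add_right[of a 0 0] by simp

lemma act_0_left [simp]: "act 0 x = 0"
  using act_add_left[of 0 0 x] by simp

lemma act_minus_right: "act a (- x) = - act a x"
  using act_add_right[of a x "- x"] by (simp add: eq_neg_iff_add_eq_0 add.commute)

lemma act_minus_left: "act (- a) x = - act a x"
  using act_add_left[of a "- a" x] by (simp add: eq_neg_iff_add_eq_0 add.commute)

lemma act_diff_right: "act a (x - y) = act a x - act a y"
  using act_add_right[of a x "- y"] by (simp add: act_minus_right)

lemma act_diff_left: "act (a - b) x = act a x - act b x"
  using act_add_left[of a "- b" x] by (simp add: act_minus_left)

lemma vimage_subgroup:
  assumes "is_add_subgroup C" shows "is_add_subgroup {x. act a x \<in> C}" "is_add_subgroup {a. act a x \<in> C}"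
  using assms by (auto simp: is_add_subgroup_def act_diff_right act_diff_left)

lemma ideal_times_assoc:
  "ideal_times act (ideal_times (*) P Q) X = ideal_times act P (ideal_times act Q X)"
proof
  show "ideal_times act (ideal_times (*) P Q) X \<subseteq> ideal_times act P (ideal_times act Q X)" (is "_ \<subseteq> ?R")
  proof (rule ideal_times_least[OF ideal_times_subgroup])
    fix c x assume c: "c \<in> ideal_times (*) P Q" and x: "x \<in> X"
    have "ideal_times (*) P Q \<subseteq> {c. act c x \<in> ?R}"
      by (rule ideal_times_least[OF vimage_subgroup(2)[OF ideal_times_subgroup]])
        (use x in \<open>auto simp: act_mult intro!: ideal_times_mem\<close>)
    thus "act c x \<in> ?R" using c by blast
  qed
  show "ideal_times act P (ideal_times act Q X) \<subseteq> ideal_times act (ideal_times (*) P Q) X" (is "_ \<subseteq> ?L")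
  proof (rule ideal_times_least[OF ideal_times_subgroup])
    fix a y assume a: "a \<in> P" and y: "y \<in> ideal_times act Q X"
    have "ideal_times act Q X \<subseteq> {y. act a y \<in> ?L}"
      by (rule ideal_times_least[OF vimage_subgroup(1)[OF ideal_times_subgroup]])
        (use a in \<open>auto simp: act_mult[symmetric] intro!: ideal_times_mem\<close>)
    thus "act a y \<in> ?L" using y by blast
  qed
qed

lemma ideal_times_submodule:
  assumes "\<And>s a. s \<in> S \<Longrightarrow> a \<in> P \<Longrightarrow> s * a \<in> P"
  shows "is_submodule S act (ideal_times act P X)"
  unfolding is_submodule_def
proof (intro conjI ballI)
  fix s y assume s: "s \<in> S" and y: "y \<in> ideal_times act P X"
  have "ideal_times act P X \<subseteq> {y. act s y \<in> ideal_times act P X}"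
    by (rule ideal_times_least[OF vimage_subgroup(1)[OF ideal_times_subgroup]])
      (use s assms in \<open>auto simp: act_mult[symmetric] intro!: ideal_times_mem\<close>)
  thus "act s y \<in> ideal_times act P X" using y by blast
qed (rule ideal_times_subgroup)

lemma ideal_times_subset:
  assumes "is_submodule S act X" "P \<subseteq> S" shows "ideal_times act P X \<subseteq> X"
  by (rule ideal_times_least) (use assms in \<open>auto simp: is_submodule_def\<close>)

lemma ideal_times_unit:
  assumes "is_submodule S act X" "1 \<in> S" shows "ideal_times act S X = X"
proof
  show "X \<subseteq> ideal_times act S X" using ideal_times_mem[OF assms(2), of _ X act] act_one by auto
qed (rule ideal_times_subset[OF assms(1) order_refl])

lemma submodule_ssum:
  assumes "is_submodule S act X" "is_submodule S act Y" shows "is_submodule S act (ssum X Y)"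
  unfolding is_submodule_def
proof (intro conjI ballI)
  show "is_add_subgroup (ssum X Y)" using assms by (simp add: add_subgroup_ssum is_submodule_def)
  fix s x assume "s \<in> S" "x \<in> ssum X Y"
  thus "act s x \<in> ssum X Y" using assms by (force simp: ssum_def act_add_right is_submodule_def)
qed

end

lemma left_module_mult: "left_module ((*) :: 'a::ring_1 \<Rightarrow> 'a \<Rightarrow> 'a)"
  by unfold_locales (auto simp: algebra_simps)

definition maximal_submodule :: "'a set \<Rightarrow> ('a \<Rightarrow> 'v::ab_group_add \<Rightarrow> 'v) \<Rightarrow> 'v set \<Rightarrow> 'v set \<Rightarrow> bool" where
  "maximal_submodule S act X Z \<longleftrightarrow> is_submodule S act X \<and> is_submodule S act Z \<and> Z \<subseteq> X \<and> Z \<noteq> X \<and>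
     (\<forall>W. is_submodule S act W \<and> Z \<subseteq> W \<and> W \<subseteq> X \<longrightarrow> W = Z \<or> W = X)"

text \<open>The acting ring is a subset of the ring type, so that both orders can act on the same
  modules through the same \<open>act\<close>.\<close>

locale ring_acting = left_module act
  for act :: "'a::ring_1 \<Rightarrow> 'v::ab_group_add \<Rightarrow> 'v" and S :: "'a set" +
  assumes one_mem: "1 \<in> S" and diff_mem: "a \<in> S \<Longrightarrow> b \<in> S \<Longrightarrow> a - b \<in> S"
    and mult_mem: "a \<in> S \<Longrightarrow> b \<in> S \<Longrightarrow> a * b \<in> S"
begin

lemma subgroup_S: "is_add_subgroup S"
  using one_mem diff_mem[of 1 1] by (auto simp: is_add_subgroup_def diff_mem)

lemma orbit_submodule:
  assumes "is_add_subgroup U" "\<And>s u. s \<in> S \<Longrightarrow> u \<in> U \<Longrightarrow> s * u \<in> U"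
  shows "is_submodule S act ((\<lambda>a. act a x) ` U)"
  unfolding is_submodule_def is_add_subgroup_def
proof (intro conjI ballI)
  show "0 \<in> (\<lambda>a. act a x) ` U" using assms(1) add_subgroup_0 act_0_left by (metis imageI)
  show "u - w \<in> (\<lambda>a. act a x) ` U" if "u \<in> (\<lambda>a. act a x) ` U" "w \<in> (\<lambda>a. act a x) ` U" for u w
    using that add_subgroup_diff[OF assms(1)] by (auto simp: act_diff_left[symmetric])
  show "act s u \<in> (\<lambda>a. act a x) ` U" if "s \<in> S" "u \<in> (\<lambda>a. act a x) ` U" for s u
    using that assms(2) by (auto simp: act_mult[symmetric])
qed

text \<open>The submodule Z + Ux strictly contains \<open>Z\<close> because of \<open>w\<close>,
  hence equals \<open>X\<close> by maximality.\<close>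

lemma cyclic_cover:
  assumes max: "maximal_submodule S act X Z" and x: "x \<in> X" and U: "is_add_subgroup U" "U \<subseteq> S"
    "\<And>s u. s \<in> S \<Longrightarrow> u \<in> U \<Longrightarrow> s * u \<in> U" and w: "w \<in> U" "act w x \<notin> Z" and y: "y \<in> X"
  obtains z u where "z \<in> Z" "u \<in> U" "y = z + act u x"
proof -
  let ?W = "ssum Z ((\<lambda>a. act a x) ` U)"
  have sub: "is_submodule S act X" "is_submodule S act Z" "Z \<subseteq> X" using max by (auto simp: maximal_submodule_def)
  have W: "is_submodule S act ?W" by (intro submodule_ssum sub orbit_submodule U)
  have orb: "is_submodule S act ((\<lambda>a. act a x) ` U)" by (intro orbit_submodule U)
  have "(\<lambda>a. act a x) ` U \<subseteq> X" using sub(1) x U(2) by (auto simp: is_submodule_def)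
  hence "?W \<subseteq> X" by (rule ssum_least[OF submodule_subgroup[OF sub(1)] sub(3)])
  moreover have "Z \<subseteq> ?W" by (rule ssum_upper[OF submodule_subgroup[OF orb]])
  moreover have "(\<lambda>a. act a x) ` U \<subseteq> ?W" by (rule ssum_upper(2)[OF submodule_subgroup[OF sub(2)]])
  moreover from this have "act w x \<in> ?W" using w(1) by blast
  hence "?W \<noteq> Z" using w(2) by metis
  ultimately have "?W = X" using max W unfolding maximal_submodule_def by metis
  hence "y \<in> ?W" using y by simp
  thus ?thesis using that by (auto simp: ssum_def)
qed

text \<open>The annihilator of \<open>x\<close> modulo \<open>Z\<close> is a maximal left ideal.\<close>

lemma jacobson_radical_kills:
  assumes max: "maximal_submodule S act X Z" and a: "a \<in> jacobson_radical S" and x: "x \<in> X"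
  shows "act a x \<in> Z"
proof (cases "x \<in> Z")
  case True
  thus ?thesis using max a by (auto simp: maximal_submodule_def is_submodule_def jacobson_radical_def)
next
  case False
  have sub: "is_submodule S act X" "is_submodule S act Z" "Z \<subseteq> X" using max by (auto simp: maximal_submodule_def)
  have gZ: "is_add_subgroup Z" using sub submodule_subgroup by blast
  define U where "U = {a\<in>S. act a x \<in> Z}"
  have U: "is_left_ideal S U"
    using gZ sub subgroup_S
    by (auto simp: is_left_ideal_def is_submodule_def is_add_subgroup_def U_def act_diff_left act_mult mult_mem)
  have "1 \<notin> U" using False act_one by (simp add: U_def)
  hence "U \<noteq> S" using one_mem by blast
  moreover have "W = U \<or> W = S" if W: "is_left_ideal S W" "U \<subseteq> W" for W
  proof (cases "W = U")
    case neq: False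
    then obtain w where w: "w \<in> W" "w \<notin> U" using W by blast
    have W': "is_add_subgroup W" "W \<subseteq> S" "\<And>s u. s \<in> S \<Longrightarrow> u \<in> W \<Longrightarrow> s * u \<in> W"
      using W by (auto simp: is_left_ideal_def is_submodule_def)
    have nw: "act w x \<notin> Z" using w W' by (auto simp: U_def)
    obtain z u where zu: "z \<in> Z" "u \<in> W" "x = z + act u x"
      by (rule cyclic_cover[OF max x W' w(1) nw x])
    have "act (1 - u) x = z" using zu by (simp add: act_diff_left act_one algebra_simps)
    hence "1 - u \<in> U" using zu W' one_mem diff_mem by (auto simp: U_def)
    hence "1 \<in> W" using zu W(2) W'(1) add_subgroup_add[of W "1 - u" u] by auto
    hence "W = S" using W'(2,3) by force
    thus ?thesis ..
  qed simp
  ultimately have "a \<in> U" using a U by (auto simp: jacobson_radical_def)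
  thus ?thesis by (simp add: U_def)
qed

text \<open>\<open>S\<close> acts on the simple quotient X/Z through the field onto which
  \<open>p\<close> maps, so the quotient is one-dimensional: for \<open>x\<close> outside
  \<open>Z\<close>, the map sending a to the class of ax is onto and identifies the same elements as
  \<open>p\<close>.\<close>

lemma idx_maximal_submodule:
  fixes p :: "'a \<Rightarrow> 'f::{field,finite}"
  assumes max: "maximal_submodule S act X Z"
    and p: "\<And>a b. a \<in> S \<Longrightarrow> b \<in> S \<Longrightarrow> p (a - b) = p a - p b" 
      "\<And>a b. a \<in> S \<Longrightarrow> b \<in> S \<Longrightarrow> p (a * b) = p a * p b" "p 1 = 1" "p ` S = UNIV"
    and kill: "\<And>a x. a \<in> S \<Longrightarrow> p a = 0 \<Longrightarrow> x \<in> X \<Longrightarrow> act a x \<in> Z"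
  shows "idx X Z = CARD('f)" "finite (quo X Z)"
proof -
  have sub: "is_submodule S act X" "is_submodule S act Z" "Z \<subseteq> X" using max by (auto simp: maximal_submodule_def)
  have gZ: "is_add_subgroup Z" using sub submodule_subgroup by blast
  obtain x where x: "x \<in> X" "x \<notin> Z" using max by (auto simp: maximal_submodule_def)
  have "p a = p b \<longleftrightarrow> coset Z (act a x) = coset Z (act b x)" if ab: "a \<in> S" "b \<in> S" for a b
  proof -
    have dS: "a - b \<in> S" using ab diff_mem by simp
    have "act (a - b) x \<in> Z \<longleftrightarrow> p (a - b) = 0"
    proof
      assume *: "act (a - b) x \<in> Z"
      show "p (a - b) = 0"
      proof (rule ccontr)
        assume nz: "p (a - b) \<noteq> 0"
        have "inverse (p (a - b)) \<in> p ` S" using p(4) by simp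
        then obtain c where c: "c \<in> S" "p c = inverse (p (a - b))" by auto
        \<comment> \<open>\<open>c\<close> inverts \<open>a - b\<close> modulo the kernel of
          \<open>p\<close>. Hence \<open>x\<close> is the sum of (1 - c (a - b)) x and c (a - b) x,
          both of which would lie in \<open>Z\<close>.\<close>
        have "p (1 - c * (a - b)) = 0" using nz c dS by (simp add: p one_mem mult_mem)
        hence "act (1 - c * (a - b)) x \<in> Z"
          using kill[OF diff_mem[OF one_mem mult_mem[OF c(1) dS]]] x by simp
        moreover have "act (c * (a - b)) x \<in> Z" using * c sub by (simp add: act_mult is_submodule_def)
        ultimately have "act (1 - c * (a - b)) x + act (c * (a - b)) x \<in> Z" using gZ add_subgroup_add by blast
        thus False using x by (simp add: act_add_left[symmetric] act_one)
      qed
    qed (use kill[OF dS] x in simp)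
    thus ?thesis using ab by (simp add: coset_eq_iff[OF gZ] act_diff_left p)
  qed
  from images_same_kernel[of S p "\<lambda>a. coset Z (act a x)", OF this]
  have "card ((\<lambda>a. coset Z (act a x)) ` S) = CARD('f)" "finite ((\<lambda>a. coset Z (act a x)) ` S)"
    using p(4) by simp_all
  moreover have "(\<lambda>a. coset Z (act a x)) ` S = quo X Z"
  proof (intro equalityI subsetI)
    fix K assume "K \<in> quo X Z"
    then obtain y where y: "K = coset Z y" "y \<in> X" by (auto simp: quo_def)
    have nx: "act 1 x \<notin> Z" using x by (simp add: act_one)
    obtain z u where zu: "z \<in> Z" "u \<in> S" "y = z + act u x"
      by (rule cyclic_cover[OF max x(1) subgroup_S order_refl mult_mem one_mem nx y(2)])
    hence "K = coset Z (act u x)" using y by (simp add: coset_eq_iff[OF gZ])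
    thus "K \<in> (\<lambda>a. coset Z (act a x)) ` S" using zu by blast
  next
    fix K assume "K \<in> (\<lambda>a. coset Z (act a x)) ` S"
    thus "K \<in> quo X Z" using sub(1) x by (auto simp: quo_def is_submodule_def)
  qed
  ultimately show "idx X Z = CARD('f)" "finite (quo X Z)" by (simp_all add: idx_def)
qed

lemma maximal_submodule_exists:
  assumes "is_submodule S act X" "is_submodule S act Y" "Y \<subseteq> X" "Y \<noteq> X" "finite (quo X Y)"
  obtains Z where "maximal_submodule S act X Z" "Y \<subseteq> Z"
proof -
  define F where "F = {Z. is_submodule S act Z \<and> Y \<subseteq> Z \<and> Z \<subseteq> X \<and> Z \<noteq> X}"
  have "finite F" unfolding F_def
    by (rule finite_subset[OF _ finite_between[OF submodule_subgroup[OF assms(2)] assms(5)]])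
      (auto simp: is_submodule_def)
  moreover have "Y \<in> F" using assms by (simp add: F_def)
  ultimately have "\<exists>m\<in>F. Y \<subseteq> m \<and> (\<forall>b\<in>F. m \<subseteq> b \<longrightarrow> m = b)"
    by (rule finite_has_maximal2)
  then obtain Z where Z: "Z \<in> F" "Y \<subseteq> Z" "\<forall>b\<in>F. Z \<subseteq> b \<longrightarrow> Z = b" by (elim bexE conjE)
  have "W = Z \<or> W = X" if "is_submodule S act W" "Z \<subseteq> W" "W \<subseteq> X" for W
  proof (cases "W = X")
    case False
    hence "W \<in> F" using that Z(2) by (simp add: F_def subset_trans[OF Z(2)])
    thus ?thesis using Z(3) that(2) by auto
  qed simp
  hence "maximal_submodule S act X Z"
    using Z(1) assms(1) by (simp add: F_def maximal_submodule_def)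
  thus ?thesis by (rule that[OF _ Z(2)])
qed

text \<open>Induction along a composition series from \<open>Y\<close> to \<open>X\<close>: the
  index of \<open>Y\<close> drops on passing to a maximal \<open>Z\<close>, since
  \<open>idx X Z\<close> exceeds 1.\<close>

lemma chain_induct [consumes 4, case_names base step]:
  assumes "is_submodule S act X" "is_submodule S act Y" "Y \<subseteq> X" "finite (quo X Y)"
    and base: "P Y"
    and step: "\<And>X Z. maximal_submodule S act X Z \<Longrightarrow> Y \<subseteq> Z \<Longrightarrow> finite (quo X Y) \<Longrightarrow> finite (quo Z Y) \<Longrightarrow>
                 P Z \<Longrightarrow> P X"
  shows "P X"
  using assms(1,3,4)
proof (induction "idx X Y" arbitrary: X rule: less_induct)
  case less
  show ?case
  proof (cases "Y = X")
    case False
    obtain Z where Z: "maximal_submodule S act X Z" "Y \<subseteq> Z"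
      by (rule maximal_submodule_exists[OF less.prems(1) assms(2) less.prems(2) False less.prems(3)])
    have sub: "is_submodule S act X" "is_submodule S act Z" "Z \<subseteq> X" "Z \<noteq> X"
      using Z by (auto simp: maximal_submodule_def)
    note g = submodule_subgroup[OF sub(1)] submodule_subgroup[OF sub(2)] submodule_subgroup[OF assms(2)]
    have fin: "finite (quo X Z)" "finite (quo Z Y)" and idx: "idx X Y = idx X Z * idx Z Y"
      using quo_tower[OF g(3,2,1) Z(2) sub(3)] less.prems by auto
    have "idx X Z \<noteq> 1" using idx_eq_1[OF g(2,1) sub(3)] sub(4) by blast
    moreover have "idx X Z > 0" "idx Z Y > 0" using idx_pos g fin by auto
    ultimately have "idx Z Y < idx X Y" using idx by (cases "idx X Z") auto
    hence "P Z" by (rule less.hyps[OF _ sub(2) Z(2) fin(2)])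
    thus ?thesis by (rule step[OF Z less.prems(3) fin(2)])
  qed (use base in simp)
qed

end

text \<open>The common framework of the two orders: all their simple quotients have the same number
  \<open>q\<close> of elements, so that index and composition length determine each other.\<close>

locale residue_ring = ring_acting act S
  for act :: "'a::ring_1 \<Rightarrow> 'v::ab_group_add \<Rightarrow> 'v" and S :: "'a set" +
  fixes J :: "'a set" and q :: nat
  assumes q_gt_1: "q > 1"
    and J_subset: "J \<subseteq> jacobson_radical S"
    and idx_maximal: "maximal_submodule S act X Z \<Longrightarrow> idx X Z = q \<and> finite (quo X Z)"
begin

lemma idx_power:
  assumes "is_submodule S act X" "is_submodule S act Y" "Y \<subseteq> X" "finite (quo X Y)"
  shows "\<exists>n. idx X Y = q ^ n"
  using assms
proof (induction rule: chain_induct)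
  case base thus ?case using idx_self[OF submodule_subgroup[OF assms(2)]] by (intro exI[of _ 0]) simp
next
  case (step X Z)
  have sub: "is_submodule S act X" "is_submodule S act Z" "Z \<subseteq> X"
    using step by (auto simp: maximal_submodule_def)
  have "idx X Y = idx X Z * idx Z Y"
    by (rule quo_tower(1)[OF submodule_subgroup[OF assms(2)] submodule_subgroup[OF sub(2)]
          submodule_subgroup[OF sub(1)] step(2) sub(3)])
  moreover obtain n where "idx Z Y = q ^ n" using step(5) by (elim exE)
  ultimately have "idx X Y = q ^ Suc n" using idx_maximal[OF step(1)] by simp
  thus ?case by (rule exI)
qed

text \<open>Each factor of a composition series is killed by \<open>r\<close>, and the number of
  factors is the exponent of the index. Submodules of a given index therefore contain a fixed
  multiple of \<open>X\<close>, which is what makes their number finite.\<close>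

lemma J_power_kills:
  assumes "is_submodule S act X" "is_submodule S act Y" "Y \<subseteq> X" "finite (quo X Y)" "r \<in> J"
  shows "\<exists>n. idx X Y = q ^ n \<and> (\<forall>x\<in>X. act (r ^ n) x \<in> Y)"
  using assms(1-4)
proof (induction rule: chain_induct)
  case base thus ?case
    using idx_self[OF submodule_subgroup[OF assms(2)]] by (intro exI[of _ 0]) (auto simp: act_one)
next
  case (step X Z)
  have sub: "is_submodule S act X" "is_submodule S act Z" "Z \<subseteq> X"
    using step by (auto simp: maximal_submodule_def)
  have "idx X Y = idx X Z * idx Z Y"
    by (rule quo_tower(1)[OF submodule_subgroup[OF assms(2)] submodule_subgroup[OF sub(2)]
          submodule_subgroup[OF sub(1)] step(2) sub(3)])
  moreover obtain n where n: "idx Z Y = q ^ n" "\<forall>x\<in>Z. act (r ^ n) x \<in> Y" using step(5) by (elim exE conjE)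
  ultimately have "idx X Y = q ^ Suc n" using idx_maximal[OF step(1)] by simp
  moreover have "act (r ^ Suc n) x \<in> Y" if "x \<in> X" for x
  proof -
    have "act r x \<in> Z" using jacobson_radical_kills[OF step(1)] assms(5) J_subset that by blast
    thus ?thesis using n by (simp add: power_Suc2 act_mult del: power_Suc)
  qed
  ultimately show ?case by blast
qed

text \<open>The composition length of X/Y, read off as the logarithm of the index.\<close>

definition len :: "'v set \<Rightarrow> 'v set \<Rightarrow> nat" where
  "len X Y = (THE n. idx X Y = q ^ n)"

lemma len_eqI: "idx X Y = q ^ n \<Longrightarrow> len X Y = n"
  unfolding len_def using q_gt_1 by auto

lemma idx_len:
  assumes "is_submodule S act X" "is_submodule S act Y" "Y \<subseteq> X" "finite (quo X Y)"
  shows "idx X Y = q ^ len X Y"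
proof -
  obtain n where "idx X Y = q ^ n" using idx_power[OF assms] by (elim exE)
  thus ?thesis using len_eqI by simp
qed

text \<open>A proper \<open>Y\<close> lies in a maximal submodule. This also contains JX, because
  the radical kills the simple quotient, and so it would contain the sum.\<close>

lemma nakayama:
  assumes "is_submodule S act X" "is_submodule S act Y" "Y \<subseteq> X" "finite (quo X Y)"
    "ssum Y (ideal_times act J X) = X"
  shows "Y = X"
proof (rule ccontr)
  assume "Y \<noteq> X"
  obtain Z where Z: "maximal_submodule S act X Z" "Y \<subseteq> Z"
    by (rule maximal_submodule_exists[OF assms(1-3) \<open>Y \<noteq> X\<close> assms(4)])
  have gZ: "is_add_subgroup Z" using Z by (auto simp: maximal_submodule_def is_submodule_def)
  have "ideal_times act J X \<subseteq> Z"
    using jacobson_radical_kills[OF Z(1)] J_subset by (intro ideal_times_least gZ) auto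
  hence "X \<subseteq> Z" using assms(5) ssum_least[OF gZ Z(2)] by blast
  thus False using Z by (auto simp: maximal_submodule_def)
qed

text \<open>Multiplication by an invertible ideal is an automorphism of the lattice of submodules, hence
  preserves composition length.\<close>

context
  fixes P T :: "'a set"
  assumes PT: "ideal_times (*) P T = S" "ideal_times (*) T P = S"
    and stable: "\<And>s a. s \<in> S \<Longrightarrow> a \<in> P \<Longrightarrow> s * a \<in> P" "\<And>s a. s \<in> S \<Longrightarrow> a \<in> T \<Longrightarrow> s * a \<in> T"
begin

lemma invertible_cancel:
  assumes "is_submodule S act X"
  shows "ideal_times act T (ideal_times act P X) = X" "ideal_times act P (ideal_times act T X) = X"
  using ideal_times_unit[OF assms one_mem] by (simp_all add: ideal_times_assoc[symmetric] PT)

lemma invertible_maximal: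
  assumes "maximal_submodule S act X Z"
  shows "maximal_submodule S act (ideal_times act P X) (ideal_times act P Z)"
proof -
  have sub: "is_submodule S act X" "is_submodule S act Z" "Z \<subseteq> X" "Z \<noteq> X"
    using assms by (auto simp: maximal_submodule_def)
  have "ideal_times act P Z \<noteq> ideal_times act P X"
    using invertible_cancel(1)[OF sub(1)] invertible_cancel(1)[OF sub(2)] sub(4) by auto
  moreover have "W = ideal_times act P Z \<or> W = ideal_times act P X"
    if W: "is_submodule S act W" "ideal_times act P Z \<subseteq> W" "W \<subseteq> ideal_times act P X" for W
  proof -
    have "Z \<subseteq> ideal_times act T W" 
      using ideal_times_mono[OF order_refl W(2), of act T] invertible_cancel(1)[OF sub(2)] by simp
    moreover have "ideal_times act T W \<subseteq> X"
      using ideal_times_mono[OF order_refl W(3), of act T] invertible_cancel(1)[OF sub(1)] by simp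
    ultimately have "ideal_times act T W = Z \<or> ideal_times act T W = X"
      using assms ideal_times_submodule[of S T W] stable by (auto simp: maximal_submodule_def)
    thus ?thesis using invertible_cancel(2)[OF W(1)] by auto
  qed
  moreover have "is_submodule S act (ideal_times act P Y)" for Y
    by (rule ideal_times_submodule) (rule stable(1))
  ultimately show ?thesis unfolding maximal_submodule_def
    using ideal_times_mono[OF order_refl sub(3), of act P] by simp
qed

lemma invertible_idx:
  assumes "is_submodule S act X" "is_submodule S act Y" "Y \<subseteq> X" "finite (quo X Y)"
  shows "idx (ideal_times act P X) (ideal_times act P Y) = idx X Y \<and>
         finite (quo (ideal_times act P X) (ideal_times act P Y))"
  using assms
proof (induction rule: chain_induct)
  case base thus ?case using idx_self[OF submodule_subgroup[OF assms(2)]] idx_self[OF ideal_times_subgroup[of act P Y]] by simp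
next
  case (step X Z)
  have sub: "is_submodule S act X" "is_submodule S act Z" "Z \<subseteq> X"
    using step by (auto simp: maximal_submodule_def)
  have "idx X Y = idx X Z * idx Z Y"
    by (rule quo_tower(1)[OF submodule_subgroup[OF assms(2)] submodule_subgroup[OF sub(2)]
          submodule_subgroup[OF sub(1)] step(2) sub(3)])
  moreover note quo_tower[OF ideal_times_subgroup ideal_times_subgroup ideal_times_subgroup
      ideal_times_mono[OF order_refl step(2), of act P] ideal_times_mono[OF order_refl sub(3), of act P]]
  ultimately show ?case using step(5) idx_maximal[OF step(1)] idx_maximal[OF invertible_maximal[OF step(1)]]
    by simp
qed

text \<open>The index of PY in X is computed through PX and through Y. Since PX/PY and X/Y have
  equal index, that factor cancels.\<close>

lemma idx_mod_invertible:
  assumes X: "is_submodule S act X" and Y: "is_submodule S act Y" and sub: "Y \<subseteq> X" and fin: "finite (quo X Y)"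
    and P: "P \<subseteq> S" and finP: "finite (quo X (ideal_times act P X))"
  shows "idx Y (ideal_times act P Y) = idx X (ideal_times act P X)" "finite (quo Y (ideal_times act P Y))"
proof -
  note gX = submodule_subgroup[OF X] and gY = submodule_subgroup[OF Y] and gP = ideal_times_subgroup[of act P]
  have PX: "ideal_times act P X \<subseteq> X" and PY: "ideal_times act P Y \<subseteq> Y"
    using ideal_times_subset X Y P by auto
  have PYX: "ideal_times act P Y \<subseteq> ideal_times act P X" by (rule ideal_times_mono[OF order_refl sub])
  note t1 = quo_tower[OF gP gP gX PYX PX] and t2 = quo_tower[OF gP gY gX PY sub]
  note inv = invertible_idx[OF X Y sub fin]
  show "finite (quo Y (ideal_times act P Y))" using t1 t2 inv finP by auto
  have "idx X Y * idx Y (ideal_times act P Y) = idx X Y * idx X (ideal_times act P X)"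
    using t1 t2 inv by (simp add: mult.commute)
  thus "idx Y (ideal_times act P Y) = idx X (ideal_times act P X)" using idx_pos[OF gX fin] by simp
qed

end

end

section \<open>Maximal orders with residue ring $\kappa\times\kappa$\<close>

text \<open>\<open>p True\<close> and \<open>p False\<close> are the two projections of \<open>S\<close> onto the factors of
  \<open>S / J(S) \<simeq> \<kappa> \<times> \<kappa>\<close>.\<close>

locale split_ring =
  fixes S :: "'a::ring_1 set" and p :: "bool \<Rightarrow> 'a \<Rightarrow> 'f::{field,finite}"
  assumes S_one: "1 \<in> S" and S_diff: "a \<in> S \<Longrightarrow> b \<in> S \<Longrightarrow> a - b \<in> S"
    and S_mult: "a \<in> S \<Longrightarrow> b \<in> S \<Longrightarrow> a * b \<in> S"
    and p_diff: "a \<in> S \<Longrightarrow> b \<in> S \<Longrightarrow> p w (a - b) = p w a - p w b"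
    and p_mult: "a \<in> S \<Longrightarrow> b \<in> S \<Longrightarrow> p w (a * b) = p w a * p w b"
    and p_one: "p w 1 = 1"
    and p_surj: "\<exists>x\<in>S. p True x = c \<and> p False x = d"
    and ker_jacobson: "a \<in> S \<Longrightarrow> p True a = 0 \<Longrightarrow> p False a = 0 \<Longrightarrow> a \<in> jacobson_radical S"
begin

definition P :: "bool \<Rightarrow> 'a set" where "P w = {x\<in>S. p w x = 0}"

definition J :: "'a set" where "J = {x\<in>S. \<forall>w. p w x = 0}"

lemma P_S: "P w \<subseteq> S" by (auto simp: P_def)

lemma S_subgroup: "is_add_subgroup S"
  using S_one S_diff[of 1 1] by (auto simp: is_add_subgroup_def S_diff)

lemma S_0: "0 \<in> S" and S_add: "a \<in> S \<Longrightarrow> b \<in> S \<Longrightarrow> a + b \<in> S"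
  using S_subgroup add_subgroup_0 add_subgroup_add by auto

lemma p_0: "p w 0 = 0"
  using p_diff[OF S_one S_one] by simp

lemma S_power: "a \<in> S \<Longrightarrow> a ^ n \<in> S"
  by (induction n) (auto simp: S_one S_mult)

lemma p_power: "a \<in> S \<Longrightarrow> p w (a ^ n) = p w a ^ n"
  by (induction n) (auto simp: p_one p_mult S_power)

lemma P_subgroup: "is_add_subgroup (P w)"
  by (auto simp: is_add_subgroup_def P_def S_0 p_0 S_diff p_diff)

lemma P_left: "s \<in> S \<Longrightarrow> a \<in> P w \<Longrightarrow> s * a \<in> P w"
  by (auto simp: P_def S_mult p_mult)

lemma P_right: "s \<in> S \<Longrightarrow> a \<in> P w \<Longrightarrow> a * s \<in> P w"
  by (auto simp: P_def S_mult p_mult)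

lemma p_surj1: "\<exists>x\<in>S. p w x = c \<and> p (\<not> w) x = d"
  using p_surj[of c d] p_surj[of d c] by (cases w) auto

lemma ring_acting: "left_module act \<Longrightarrow> ring_acting act S"
  by (simp add: ring_acting_def ring_acting_axioms_def S_one S_diff S_mult)

text \<open>A simple quotient is a module over one of the two factors of the residue ring: which one
  is decided by whether a lift \<open>e\<close> of (1, 0) acts on it as zero.\<close>

lemma maximal_killed:
  assumes act: "left_module act" and max: "maximal_submodule S act X Z"
  shows "\<exists>w. \<forall>a\<in>P w. \<forall>x\<in>X. act a x \<in> Z"
proof -
  interpret ring_acting act S by (rule ring_acting[OF act])
  have sub: "is_submodule S act X" "is_submodule S act Z" "Z \<subseteq> X" using max by (auto simp: maximal_submodule_def)
  have gZ: "is_add_subgroup Z" using sub(2) by (rule submodule_subgroup)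
  have Jkill: "act a x \<in> Z" if "a \<in> S" "p True a = 0" "p False a = 0" "x \<in> X" for a x
    using jacobson_radical_kills[OF max ker_jacobson] that by simp
  obtain e where e: "e \<in> S" "p True e = 1" "p False e = 0"
    using p_surj[of 1 0] by (elim bexE conjE)
  show ?thesis
  proof (cases "\<forall>x\<in>X. act e x \<in> Z")
    case True
    have "act a x \<in> Z" if a: "a \<in> P False" and x: "x \<in> X" for a x
    proof -
      have aS: "a \<in> S" "p False a = 0" using a by (auto simp: P_def)
      \<comment> \<open>Modulo the radical \<open>a\<close> equals \<open>a * e\<close>, and
        \<open>e\<close> kills the quotient.\<close>
      have "act (a - a * e) x \<in> Z"
        using aS e x by (intro Jkill) (auto simp: p_diff p_mult S_diff S_mult)
      moreover have "act (a * e) x \<in> Z" using True x aS sub(2) by (simp add: act_mult is_submodule_def)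
      ultimately have "act (a - a * e) x + act (a * e) x \<in> Z" by (rule add_subgroup_add[OF gZ])
      thus ?thesis by (simp add: act_add_left[symmetric])
    qed
    thus ?thesis by blast
  next
    case False
    then obtain x0 where x0: "x0 \<in> X" "act e x0 \<notin> Z" by auto
    have x1: "act e x0 \<in> X" using sub(1) x0 e by (simp add: is_submodule_def)
    have n1: "act 1 (act e x0) \<notin> Z" using x0 by (simp add: act_one)
    have "act a x \<in> Z" if a: "a \<in> P True" and x: "x \<in> X" for a x
    proof -
      have aS: "a \<in> S" "p True a = 0" using a by (auto simp: P_def)
      obtain z u where zu: "z \<in> Z" "u \<in> S" "x = z + act u (act e x0)"
        by (rule cyclic_cover[OF max x1 subgroup_S order_refl mult_mem one_mem n1 x])
      \<comment> \<open>Now X = Z + S e x0, and for \<open>a\<close> in \<open>P True\<close> every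
        \<open>a * u * e\<close> vanishes in both factors, hence is radical.\<close>
      have "act (a * u * e) x0 \<in> Z"
        using aS e x0 zu by (intro Jkill) (auto simp: p_mult S_mult)
      moreover have "act a z \<in> Z" using zu aS sub(2) by (simp add: is_submodule_def)
      ultimately have "act a z + act (a * u * e) x0 \<in> Z" using add_subgroup_add[OF gZ] by simp
      thus ?thesis using zu(3) by (simp add: act_add_right act_mult)
    qed
    thus ?thesis by blast
  qed
qed

lemma p_image: "p w ` S = UNIV"
proof -
  have "c \<in> p w ` S" for c using p_surj1[of w c 0] by (elim bexE conjE) (rule image_eqI, auto)
  thus ?thesis by auto
qed

lemma residue_ring:
  assumes "left_module act" shows "residue_ring act S J (CARD('f))"
proof -
  interpret ring_acting act S by (rule ring_acting[OF assms])
  show ?thesis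
  proof
    have "card {0, 1 :: 'f} \<le> CARD('f)" by (rule card_mono) auto
    thus "CARD('f) > 1" by simp
    show "J \<subseteq> jacobson_radical S" using ker_jacobson by (auto simp: J_def)
    fix X Z assume max: "maximal_submodule S act X Z"
    obtain w where w: "\<forall>a\<in>P w. \<forall>x\<in>X. act a x \<in> Z" using maximal_killed[OF assms max] by (elim exE)
    have "idx X Z = CARD('f)" "finite (quo X Z)"
      by (rule idx_maximal_submodule[OF max, of "p w"]; use w in \<open>simp add: p_diff p_mult p_one p_image P_def\<close>)+
    thus "idx X Z = CARD('f) \<and> finite (quo X Z)" by simp
  qed
qed

text \<open>Products of the ideals \<open>P True\<close> and \<open>P False\<close> in a prescribed
  order. They are indexed by words since it has not been established that these ideals
  commute.\<close>

fun word_ideal :: "bool list \<Rightarrow> 'a set" where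
  "word_ideal [] = S"
| "word_ideal (w # ws) = ideal_times (*) (P w) (word_ideal ws)"

interpretation mult: ring_acting "(*)" S
  by (rule ring_acting[OF left_module_mult])

lemma ideal_times_right:
  assumes "\<And>x s. x \<in> X \<Longrightarrow> s \<in> S \<Longrightarrow> x * s \<in> X" "y \<in> ideal_times (*) Q X" "s \<in> S"
  shows "y * s \<in> ideal_times (*) Q X"
proof -
  have "ideal_times (*) Q X \<subseteq> {y. y * s \<in> ideal_times (*) Q X}"
  proof (rule ideal_times_least)
    show "is_add_subgroup {y. y * s \<in> ideal_times (*) Q X}"
      using ideal_times_subgroup[of "(*)" Q X] by (auto simp: is_add_subgroup_def left_diff_distrib)
    show "a * x \<in> {y. y * s \<in> ideal_times (*) Q X}" if "a \<in> Q" "x \<in> X" for a x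
      using ideal_times_mem[OF that(1) assms(1)[OF that(2) assms(3)], of "(*)"] by (simp add: mult.assoc)
  qed
  thus ?thesis using assms(2) by auto
qed

lemma S_submodule: "is_submodule S (*) S"
  by (simp add: is_submodule_def S_subgroup S_mult)

lemma word_ideal_props:
  "is_add_subgroup (word_ideal ws)" "word_ideal ws \<subseteq> S"
  "s \<in> S \<Longrightarrow> x \<in> word_ideal ws \<Longrightarrow> s * x \<in> word_ideal ws"
  "s \<in> S \<Longrightarrow> x \<in> word_ideal ws \<Longrightarrow> x * s \<in> word_ideal ws"
proof -
  show 1: "is_add_subgroup (word_ideal ws)" by (cases ws) (auto simp: S_subgroup ideal_times_subgroup)
  show 2: "s * x \<in> word_ideal ws" if "s \<in> S" "x \<in> word_ideal ws" for s x
    using that submodule_act[OF mult.ideal_times_submodule[OF P_left]]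
    by (cases ws) (auto simp: S_mult)
  show "word_ideal ws \<subseteq> S"
  proof (induction ws)
    case (Cons w ws)
    have "ideal_times (*) (P w) (word_ideal ws) \<subseteq> ideal_times (*) S S"
      by (rule ideal_times_mono[OF P_S Cons])
    thus ?case using mult.ideal_times_unit[OF S_submodule S_one] by simp
  qed simp
  show "x * s \<in> word_ideal ws" if "s \<in> S" "x \<in> word_ideal ws" for s x
    using that
  proof (induction ws arbitrary: x s)
    case (Cons w ws)
    have "y * t \<in> word_ideal ws" if "y \<in> word_ideal ws" "t \<in> S" for y t
      by (rule Cons.IH[OF that(2,1)])
    from ideal_times_right[of "word_ideal ws", OF this] show ?case using Cons.prems by simp
  qed (simp add: S_mult)
qed

lemma word_ideal_submodule: "is_submodule S (*) (word_ideal ws)"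
  by (simp add: is_submodule_def word_ideal_props)

lemma word_ideal_append: "word_ideal (us @ ws) = ideal_times (*) (word_ideal us) (word_ideal ws)"
proof (induction us)
  case Nil
  show ?case using mult.ideal_times_unit[OF word_ideal_submodule S_one] by simp
next
  case (Cons u us)
  thus ?case by (simp add: mult.ideal_times_assoc)
qed

lemma power_in_word_ideal:
  assumes "\<And>w. w \<in> set ws \<Longrightarrow> e \<in> P w" shows "e ^ length ws \<in> word_ideal ws"
  using assms
proof (induction ws)
  case (Cons w ws)
  have "e \<in> P w" "e ^ length ws \<in> word_ideal ws" using Cons by auto
  thus ?case using ideal_times_mem[of e "P w" "e ^ length ws" "word_ideal ws" "(*)"] by simp
qed (simp add: S_one)

text \<open>The word records, along a composition series, which of the two ideals kills each
  factor.\<close>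

lemma word_kills:
  assumes act: "left_module act"
    and "is_submodule S act X" "is_submodule S act Y" "Y \<subseteq> X" "finite (quo X Y)"
  shows "\<exists>ws. ideal_times act (word_ideal ws) X \<subseteq> Y"
proof -
  interpret V: ring_acting act S by (rule ring_acting[OF act])
  show ?thesis using assms(2-5)
  proof (induction rule: V.chain_induct)
    case base
    show ?case using V.ideal_times_unit[OF assms(3) S_one] by (intro exI[of _ "[]"]) simp
  next
    case (step X Z)
    obtain ws where ws: "ideal_times act (word_ideal ws) Z \<subseteq> Y" using step(5) by (elim exE)
    obtain w where w: "\<forall>a\<in>P w. \<forall>x\<in>X. act a x \<in> Z" using maximal_killed[OF act step(1)] by (elim exE)
    have gZ: "is_add_subgroup Z" and subX: "is_submodule S act X"
      using step(1) by (auto simp: maximal_submodule_def is_submodule_def)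
    \<comment> \<open>The new letter goes to the right end because it acts first, carrying
      \<open>X\<close> into \<open>Z\<close>.\<close>
    have "ideal_times act (word_ideal (ws @ [w])) X =
        ideal_times act (word_ideal ws) (ideal_times act (P w) (ideal_times act S X))"
      by (simp add: word_ideal_append V.ideal_times_assoc)
    also have "ideal_times act S X = X" by (rule V.ideal_times_unit[OF subX S_one])
    also have "ideal_times act (word_ideal ws) (ideal_times act (P w) X) \<subseteq> ideal_times act (word_ideal ws) Z"
      by (rule ideal_times_mono[OF order_refl ideal_times_least[OF gZ]]) (use w in simp)
    also have "\<dots> \<subseteq> Y" by (rule ws)
    finally show ?case by (rule exI)
  qed
qed

text \<open>S / P w is a field, so a left ideal that contains \<open>P w\<close> and an element
  outside it contains 1.\<close>

lemma P_comaximal: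
  assumes "P w \<subseteq> Q" "is_add_subgroup Q" "\<And>s x. s \<in> S \<Longrightarrow> x \<in> Q \<Longrightarrow> s * x \<in> Q" "Q \<subseteq> S" "\<not> Q \<subseteq> P w"
  shows "Q = S"
proof -
  obtain x where x: "x \<in> Q" "p w x \<noteq> 0" using assms(4,5) by (auto simp: P_def)
  obtain s where s: "s \<in> S" "p w s = inverse (p w x)"
    using p_surj1[of w "inverse (p w x)" 0] by (elim bexE conjE)
  have xS: "x \<in> S" using x assms(4) by auto
  have "p w (1 - s * x) = 0" using x s xS by (simp add: p_diff p_mult p_one S_one S_mult)
  hence "1 - s * x \<in> P w" using s xS by (simp add: P_def S_one S_diff S_mult)
  hence "(1 - s * x) + s * x \<in> Q" using assms(1,2,3) s x by (intro add_subgroup_add) auto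
  hence one: "1 \<in> Q" by simp
  have "s \<in> Q" if "s \<in> S" for s using assms(3)[OF that one] by simp
  thus ?thesis using assms(4) by auto
qed

end

section \<open>Finitely generated modules over the integers of a local field\<close>

context nonarch_local_field
begin

text \<open>Positivity comes from discreteness: nonzero values are integer powers of a positive
  number.\<close>

lemma v_pos: "x \<noteq> 0 \<Longrightarrow> v x > 0"
proof -
  assume x: "x \<noteq> 0"
  obtain \<pi> where "0 < v \<pi>" "\<forall>x. x \<noteq> 0 \<longrightarrow> (\<exists>n::int. v x = v \<pi> powi n)" using v_discrete by (elim exE conjE)
  thus ?thesis using x by (metis zero_less_power_int)
qed

lemma v_one: "v 1 = 1"
  using v_mult[of 1 1] v_pos[of 1] by simp

lemma v_minus: "v (- x) = v x"
proof -
  have "v (- 1) * v (- 1) = 1" using v_mult[of "- 1" "- 1"] v_one by simp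
  moreover have "v (- 1) > 0" by (rule v_pos) simp
  moreover have "(v (- 1) - 1) * (v (- 1) + 1) = v (- 1) * v (- 1) - 1" by (simp add: algebra_simps)
  ultimately have "v (- 1) = 1" by auto
  thus ?thesis using v_mult[of "- 1" x] by simp
qed

lemma v_diff: "v (x - y) \<le> max (v x) (v y)"
  using v_add[of x "- y"] by (simp add: v_minus)

lemma v_inverse: "x \<noteq> 0 \<Longrightarrow> v (inverse x) = inverse (v x)"
  using v_mult[of x "inverse x"] v_one v_pos[of x] by (simp add: field_simps)

lemma v_power: "v (x ^ n) = v x ^ n"
  by (induction n) (auto simp: v_one v_mult)

lemma integers_ring:
  "0 \<in> integers v" "1 \<in> integers v"
  "x \<in> integers v \<Longrightarrow> y \<in> integers v \<Longrightarrow> x - y \<in> integers v"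
  "x \<in> integers v \<Longrightarrow> y \<in> integers v \<Longrightarrow> x * y \<in> integers v"
proof -
  have nn: "v x \<ge> 0" for x using v_pos[of x] v_eq_0[of x] by (cases "x = 0") auto
  show "0 \<in> integers v" "1 \<in> integers v" using v_eq_0[of 0] v_one by (auto simp: integers_def)
  show "x - y \<in> integers v" if "x \<in> integers v" "y \<in> integers v"
    using that v_diff[of x y] by (auto simp: integers_def)
  show "x * y \<in> integers v" if "x \<in> integers v" "y \<in> integers v"
    using that nn by (auto simp: integers_def v_mult mult_le_one)
qed

definition unif :: 'k where
  "unif = (SOME \<pi>. 0 < v \<pi> \<and> v \<pi> < 1 \<and> (\<forall>x. x \<noteq> 0 \<longrightarrow> (\<exists>n::int. v x = v \<pi> powi n)))"

lemma unif: "0 < v unif" "v unif < 1" "x \<noteq> 0 \<Longrightarrow> \<exists>n::int. v x = v unif powi n"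
proof -
  have U: "0 < v unif \<and> v unif < 1 \<and> (\<forall>x. x \<noteq> 0 \<longrightarrow> (\<exists>n::int. v x = v unif powi n))"
    unfolding unif_def by (rule someI_ex[OF v_discrete])
  show "0 < v unif" by (rule conjunct1[OF U])
  show "v unif < 1" by (rule conjunct1[OF conjunct2[OF U]])
  show "\<exists>n::int. v x = v unif powi n" if "x \<noteq> 0"
    by (rule conjunct2[OF conjunct2[OF U], rule_format, OF that])
qed

lemma unif_nonzero: "unif \<noteq> 0"
  proof
  assume "unif = 0"
  thus False using unif(1) v_eq_0[of 0] by simp
qed

lemma unif_integer: "unif \<in> integers v"
  using unif(2) by (simp add: integers_def)

text \<open>The maximal ideal is principal: a value below 1 is a positive power of
  \<open>v unif\<close>, hence at most \<open>v unif\<close>.\<close>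

lemma unif_multiples:
  assumes "v x < 1" obtains y where "y \<in> integers v" "x = unif * y"
proof (cases "x = 0")
  case True thus ?thesis using that[of 0] integers_ring by simp
next
  case False
  obtain n :: int where n: "v x = v unif powi n" using unif(3)[OF False] by (elim exE)
  have "n > 0"
  proof (rule ccontr)
    assume "\<not> n > 0"
    hence "v unif powi n = inverse (v unif) ^ nat (- n)" by (simp add: power_int_def)
    moreover have "inverse (v unif) \<ge> 1" using unif(1,2) by (simp add: one_le_inverse)
    ultimately show False using n assms one_le_power[of "inverse (v unif)" "nat (- n)"] by linarith
  qed
  hence "v x = v unif ^ nat n" using n by (simp add: power_int_def)
  also have "\<dots> \<le> v unif ^ 1" using \<open>n > 0\<close> unif(1,2) by (intro power_decreasing) auto
  finally have "v x \<le> v unif" by simp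
  hence "inverse (v unif) * v x \<le> 1" using unif(1) by (simp add: field_simps)
  hence "v (inverse unif * x) \<le> 1" by (simp only: v_mult v_inverse[OF unif_nonzero])
  hence "inverse unif * x \<in> integers v" by (simp add: integers_def)
  moreover have "x = unif * (inverse unif * x)" using unif_nonzero by simp
  ultimately show ?thesis by (rule that)
qed

text \<open>The ultrametric inequality, applied to 1 - unif^k and to 1 = (1 - unif^k) + unif^k,
  bounds the value of 1 - unif^k by 1 from both sides.\<close>

lemma one_minus_power_unit:
  assumes "k > 0" shows "1 - unif ^ k \<in> integers v" "inverse (1 - unif ^ k) \<in> integers v" "1 - unif ^ k \<noteq> 0"
proof -
  have "v (unif ^ k) < 1" using unif(1,2) assms by (simp add: v_power power_less_one_iff)
  moreover have "1 \<le> max (v (1 - unif ^ k)) (v (unif ^ k))" using v_add[of "1 - unif ^ k" "unif ^ k"] v_one by simp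
  moreover have "v (1 - unif ^ k) \<le> max 1 (v (unif ^ k))" using v_diff[of 1 "unif ^ k"] v_one by simp
  ultimately have "v (1 - unif ^ k) = 1" by simp
  moreover from this show "1 - unif ^ k \<noteq> 0" using v_eq_0[of "1 - unif ^ k"] by auto
  ultimately show "1 - unif ^ k \<in> integers v" "inverse (1 - unif ^ k) \<in> integers v"
    by (auto simp: integers_def v_inverse)
qed

lemma residue_representatives:
  obtains C where "finite C" "C \<subseteq> integers v" "\<And>x. x \<in> integers v \<Longrightarrow> \<exists>c\<in>C. \<exists>y\<in>integers v. x = c + unif * y"
proof -
  let ?I = "{x. v x < 1}"
  have sub: "is_add_subgroup ?I"
    using v_eq_0[of 0] by (auto simp: is_add_subgroup_def intro!: le_less_trans[OF v_diff])
  have "carrier (class_ring\<lparr>carrier := {x. v x \<le> 1}\<rparr> Quot ?I) = coset ?I ` integers v"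
    by (auto simp: FactRing_def A_RCOSETS_def RCOSETS_def r_coset_def coset_def integers_def)
  hence "finite (coset ?I ` integers v)" using v_residue by simp
  from finite_subset_image[OF this order_refl]
  obtain C where C: "C \<subseteq> integers v" "finite C" "coset ?I ` integers v = coset ?I ` C"
    by (elim exE conjE)
  have cover: "\<exists>c\<in>C. \<exists>y\<in>integers v. x = c + unif * y" if x: "x \<in> integers v" for x
  proof -
    have "coset ?I x \<in> coset ?I ` C" using C(3) x by blast
    then obtain c where c: "c \<in> C" "coset ?I x = coset ?I c" by auto
    hence "v (x - c) < 1" using coset_eq_iff[OF sub] by simp
    then obtain y where "y \<in> integers v" "x - c = unif * y" by (rule unif_multiples)
    thus ?thesis using c by (intro bexI[of _ c] bexI[of _ y]) (auto simp: algebra_simps)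
  qed
  show ?thesis by (rule that[OF C(2,1) cover])
qed

lemma finite_quo_cover:
  assumes "is_add_subgroup A" "finite F" "\<And>m. m \<in> M \<Longrightarrow> \<exists>f\<in>F. m - f \<in> A"
  shows "finite (quo M A)"
proof (rule finite_subset[of _ "coset A ` F"])
  show "quo M A \<subseteq> coset A ` F"
  proof
    fix K assume "K \<in> quo M A"
    then obtain m where m: "m \<in> M" "K = coset A m" by (auto simp: quo_def)
    obtain f where "f \<in> F" "m - f \<in> A" using assms(3)[OF m(1)] by (elim bexE)
    thus "K \<in> coset A ` F" using m coset_eq_iff[OF assms(1)] by auto
  qed
qed (use assms in simp)

lemma hull_span:
  assumes sc: "left_module sc" and B: "finite B"
  shows "is_submodule (integers v) sc hull B \<subseteq> {\<Sum>b\<in>B. sc (r b) b |r. \<forall>b\<in>B. r b \<in> integers v}"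
proof (rule hull_minimal)
  interpret left_module sc by (rule sc)
  let ?M = "{\<Sum>b\<in>B. sc (r b) b |r. \<forall>b\<in>B. r b \<in> integers v}"
  show "B \<subseteq> ?M"
  proof
    fix b assume b: "b \<in> B"
    have "(\<Sum>c\<in>B. sc (if c = b then 1 else 0) c) = (\<Sum>c\<in>B. if c = b then c else 0)"
      by (intro sum.cong) (auto simp: act_one)
    hence "b = (\<Sum>c\<in>B. sc (if c = b then 1 else 0) c)" using B b by simp
    thus "b \<in> ?M" using integers_ring by (intro CollectI exI[of _ "\<lambda>c. if c = b then 1 else 0"]) auto
  qed
  show "is_submodule (integers v) sc ?M"
    unfolding is_submodule_def is_add_subgroup_def
  proof (intro conjI ballI)
    show "0 \<in> ?M" using integers_ring by (intro CollectI exI[of _ "\<lambda>c. 0"]) auto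
    show "x - y \<in> ?M" if "x \<in> ?M" "y \<in> ?M" for x y
    proof -
      obtain r s where "x = (\<Sum>b\<in>B. sc (r b) b)" "y = (\<Sum>b\<in>B. sc (s b) b)"
        "\<forall>b\<in>B. r b \<in> integers v" "\<forall>b\<in>B. s b \<in> integers v" using \<open>x \<in> ?M\<close> \<open>y \<in> ?M\<close> by auto
      thus ?thesis using integers_ring
        by (intro CollectI exI[of _ "\<lambda>b. r b - s b"]) (auto simp: act_diff_left sum_subtractf)
    qed
    show "sc c x \<in> ?M" if "c \<in> integers v" "x \<in> ?M" for c x
    proof -
      obtain r where r: "x = (\<Sum>b\<in>B. sc (r b) b)" "\<forall>b\<in>B. r b \<in> integers v" using \<open>x \<in> ?M\<close> by auto
      have "sc c (\<Sum>b\<in>F. sc (r b) b) = (\<Sum>b\<in>F. sc (c * r b) b)" if "finite F" for F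
        using that by induction (auto simp: act_add_right act_mult)
      thus ?thesis using r B that integers_ring
        by (intro CollectI exI[of _ "\<lambda>b. c * r b"]) auto
    qed
  qed
qed

text \<open>Modulo \<open>unif\<close>, every element agrees with one of the finitely many
  combinations of the generators whose coefficients are residue representatives. Higher powers are
  reached through the submodule \<open>unif M\<close>: multiplication by \<open>unif\<close> is
  injective, so its quotient by the next power is a copy of the quotient of \<open>M\<close> by the
  previous one.\<close>

lemma finite_quo_unif:
  assumes sc: "left_module sc" and B: "finite B" and M: "is_submodule (integers v) sc hull B = M"
  shows "finite (quo M (sc (unif ^ n) ` M))"
proof -
  interpret left_module sc by (rule sc)
  have subM: "is_submodule (integers v) sc M" unfolding M[symmetric] by (rule submodule_hull)
  note gM = submodule_subgroup[OF subM]
  have gim: "is_add_subgroup (sc c ` M)" for c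
    unfolding is_add_subgroup_def
  proof (intro conjI ballI)
    show "0 \<in> sc c ` M" using add_subgroup_0[OF gM] by (intro image_eqI[of _ _ 0]) auto
    show "x - y \<in> sc c ` M" if "x \<in> sc c ` M" "y \<in> sc c ` M" for x y
      using that add_subgroup_diff[OF gM] by (auto simp: act_diff_right[symmetric])
  qed
  have im: "sc c ` M \<subseteq> M" if "c \<in> integers v" for c
    using subM that by (auto simp: is_submodule_def)
  obtain C where C: "finite C" "C \<subseteq> integers v" 
    "\<And>x. x \<in> integers v \<Longrightarrow> \<exists>c\<in>C. \<exists>y\<in>integers v. x = c + unif * y" by (rule residue_representatives, rule that; blast)
  have 1: "finite (quo M (sc unif ` M))"
  proof (rule finite_quo_cover[OF gim, of "(\<lambda>c. \<Sum>b\<in>B. sc (c b) b) ` (B \<rightarrow>\<^sub>E C)"])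
    show "finite ((\<lambda>c. \<Sum>b\<in>B. sc (c b) b) ` (B \<rightarrow>\<^sub>E C))" using B C by (intro finite_imageI finite_PiE) auto
    fix m assume "m \<in> M"
    then obtain r where r: "m = (\<Sum>b\<in>B. sc (r b) b)" "\<forall>b\<in>B. r b \<in> integers v"
      using hull_span[OF sc B] M by auto
    have "\<forall>b\<in>B. \<exists>c y. c \<in> C \<and> y \<in> integers v \<and> r b = c + unif * y" using C(3) r(2) by blast
    then obtain c y where cy: "\<forall>b\<in>B. c b \<in> C \<and> y b \<in> integers v \<and> r b = c b + unif * y b"
      by metis
    have "sc unif (\<Sum>b\<in>F. sc (y b) b) = (\<Sum>b\<in>F. sc (unif * y b) b)" if "finite F" for F
      using that by induction (auto simp: act_add_right act_mult)
    moreover have "(\<Sum>b\<in>B. sc (r b) b) = (\<Sum>b\<in>B. sc (c b) b) + (\<Sum>b\<in>B. sc (unif * y b) b)"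
      unfolding sum.distrib[symmetric] using cy by (intro sum.cong) (auto simp: act_add_left)
    ultimately have eq: "m - (\<Sum>b\<in>B. sc (c b) b) = sc unif (\<Sum>b\<in>B. sc (y b) b)" using r B by simp
    have "B \<subseteq> M" unfolding M[symmetric] by (rule hull_subset)
    hence "(\<Sum>b\<in>B. sc (y b) b) \<in> M"
      using cy by (intro add_subgroup_sum[OF gM] submodule_act[OF subM]) auto
    hence "m - (\<Sum>b\<in>B. sc (c b) b) \<in> sc unif ` M" unfolding eq by (rule imageI)
    moreover have "restrict c B \<in> B \<rightarrow>\<^sub>E C" using cy by simp
    hence "(\<Sum>b\<in>B. sc (restrict c B b) b) \<in> (\<lambda>c. \<Sum>b\<in>B. sc (c b) b) ` (B \<rightarrow>\<^sub>E C)" by (rule imageI)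
    moreover have "(\<Sum>b\<in>B. sc (restrict c B b) b) = (\<Sum>b\<in>B. sc (c b) b)" by (rule sum.cong) simp_all
    ultimately show "\<exists>f\<in>(\<lambda>c. \<Sum>b\<in>B. sc (c b) b) ` (B \<rightarrow>\<^sub>E C). m - f \<in> sc unif ` M"
      by (simp only:) (rule bexI)
  qed
  show ?thesis
  proof (induction n)
    case 0
    have "sc (unif ^ 0) ` M = M" by (auto simp: act_one)
    thus ?case using idx_self[OF gM] by simp
  next
    case (Suc n)
    let ?A = "sc (unif ^ n) ` M"
    have eq: "sc (unif ^ Suc n) ` M = sc unif ` ?A" by (auto simp: act_mult image_image)
    have "x - y \<in> ?A \<longleftrightarrow> sc unif x - sc unif y \<in> sc unif ` ?A" for x y
    proof
      assume "sc unif x - sc unif y \<in> sc unif ` ?A"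
      then obtain z where "z \<in> ?A" "sc unif (x - y) = sc unif z" by (auto simp: act_diff_right)
      hence "sc (inverse unif) (sc unif (x - y)) = sc (inverse unif) (sc unif z)" by simp
      hence "x - y = z" using unif_nonzero by (simp add: act_mult[symmetric] act_one)
      thus "x - y \<in> ?A" using \<open>z \<in> ?A\<close> by simp
    qed (auto simp: act_diff_right[symmetric])
    hence "(coset (sc unif ` ?A) \<circ> sc unif) x = (coset (sc unif ` ?A) \<circ> sc unif) y \<longleftrightarrow> x - y \<in> ?A" for x y
      using coset_eq_iff[OF gim, of "unif ^ Suc n"] eq by simp
    from idx_kernel(2)[OF gim, of M "coset (sc unif ` ?A) \<circ> sc unif" "unif ^ n", OF this]
    have "finite (quo (sc unif ` M) (sc unif ` ?A))"
      using Suc by (simp add: quo_def image_comp)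
    moreover have un: "unif ^ n \<in> integers v"
      by (induction n) (auto simp: integers_ring unif_integer)
    have "sc unif ` ?A \<subseteq> sc unif ` M" by (rule image_mono[OF im[OF un]])
    ultimately show ?case
      using quo_tower(2)[OF gim[of "unif ^ Suc n"] gim[of unif] gM] 1 im[OF unif_integer] eq by simp
  qed
qed

end

section \<open>Invertibility of the maximal ideals\<close>

locale split_maximal_order = nonarch_local_field v + fin_dim_algebra scale + split_ring S p
  for v :: "'k::field \<Rightarrow> real" and scale :: "'k \<Rightarrow> 'a::ring_1 \<Rightarrow> 'a"
    and S :: "'a set" and p :: "bool \<Rightarrow> 'a \<Rightarrow> 'f::{field,finite}" +
  assumes maximal: "is_maximal_order (integers v) scale S"
begin

lemma scale_eq: "scale c x = scale c 1 * x" "scale c x = x * scale c 1"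
  by (simp_all add: scale_mult_left scale_mult_right)

lemma left_module_scale: "left_module scale"
  by unfold_locales (simp_all add: scale_left_distrib scale_right_distrib)

lemma order: "is_order (integers v) scale S"
  using maximal by (simp add: is_maximal_order_def)

lemma scale_mem: "c \<in> integers v \<Longrightarrow> x \<in> S \<Longrightarrow> scale c x \<in> S"
  using order by (simp add: is_order_def is_submodule_def)

lemma unif_power_integer: "unif ^ n \<in> integers v"
  by (induction n) (auto simp: integers_ring unif_integer)

definition rho :: "nat \<Rightarrow> 'a" where "rho n = scale (unif ^ n) 1"

lemma rho_S: "rho n \<in> S"
  unfolding rho_def by (intro scale_mem unif_power_integer S_one)

lemma rho_power: "rho 1 ^ n = rho n"
proof (induction n)
  case (Suc n)
  have "rho 1 ^ Suc n = scale unif 1 * scale (unif ^ n) 1" using Suc by (simp add: rho_def)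
  also have "\<dots> = scale unif (scale (unif ^ n) 1)" by (rule scale_eq(1)[symmetric])
  finally show ?case by (simp add: rho_def)
qed (simp add: rho_def)

lemma generators: obtains B where "finite B" "is_submodule (integers v) scale hull B = S"
  using order unfolding is_order_def by (elim conjE exE)

lemma finite_quo_scaled: "finite (quo S (scale (unif ^ n) ` S))"
proof -
  obtain B where B: "finite B" "is_submodule (integers v) scale hull B = S" by (rule generators)
  show ?thesis by (rule finite_quo_unif[OF left_module_scale B])
qed

text \<open>The bound embeds Om/S into the finite quotient of \<open>S\<close> by
  \<open>unif ^ n\<close>. Hence \<open>Om\<close> is generated by generators of \<open>S\<close>
  and finitely many coset representatives, so it is an order and maximality applies.\<close>

lemma order_eqI:
  assumes "S \<subseteq> Om" "\<And>x y. x \<in> Om \<Longrightarrow> y \<in> Om \<Longrightarrow> x * y \<in> Om" "is_submodule (integers v) scale Om"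
    and bound: "\<And>x. x \<in> Om \<Longrightarrow> scale (unif ^ n) x \<in> S"
  shows "Om = S"
proof -
  let ?A = "scale (unif ^ n)"
  have gA: "is_add_subgroup (?A ` S)"
    unfolding is_add_subgroup_def
  proof (intro conjI ballI)
    show "0 \<in> ?A ` S" using S_0 by (intro image_eqI[of _ _ 0]) auto
    show "x - y \<in> ?A ` S" if "x \<in> ?A ` S" "y \<in> ?A ` S" for x y
      using that S_diff by (auto simp: scale_right_diff_distrib[symmetric])
  qed
  have "?A x - ?A y \<in> ?A ` S \<longleftrightarrow> x - y \<in> S" for x y
    by (auto simp: scale_right_diff_distrib[symmetric] unif_nonzero)
  hence "(coset (?A ` S) \<circ> ?A) x = (coset (?A ` S) \<circ> ?A) y \<longleftrightarrow> x - y \<in> S" for x y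
    using coset_eq_iff[OF gA] by simp
  from idx_kernel(2)[OF S_subgroup, of Om "coset (?A ` S) \<circ> ?A", OF this]
  have "finite (quo Om S) \<longleftrightarrow> finite ((coset (?A ` S) \<circ> ?A) ` Om)" .
  moreover have "(coset (?A ` S) \<circ> ?A) ` Om \<subseteq> quo S (?A ` S)" using bound by (auto simp: quo_def)
  ultimately have "finite (coset S ` Om)" using finite_quo_scaled[of n] finite_subset by (auto simp: quo_def)
  from finite_subset_image[OF this order_refl]
  obtain F where F: "F \<subseteq> Om" "finite F" "coset S ` Om = coset S ` F" by (elim exE conjE)
  obtain B where B: "finite B" "is_submodule (integers v) scale hull B = S" by (rule generators)
  have "is_submodule (integers v) scale hull (B \<union> F) = Om"
  proof
    have "B \<subseteq> S" unfolding B(2)[symmetric] by (rule hull_subset)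
    thus "is_submodule (integers v) scale hull (B \<union> F) \<subseteq> Om"
      using assms(1,3) F by (intro hull_minimal) auto
    show "Om \<subseteq> is_submodule (integers v) scale hull (B \<union> F)" (is "_ \<subseteq> ?H")
    proof
      fix x assume "x \<in> Om"
      hence "coset S x \<in> coset S ` F" using F(3) by (metis imageI)
      then obtain f where f: "f \<in> F" "x - f \<in> S" by (auto simp: coset_eq_iff[OF S_subgroup])
      have "S \<subseteq> ?H" unfolding B(2)[symmetric] by (rule hull_mono) simp
      moreover have "f \<in> ?H" using f by (intro hull_inc) simp
      ultimately have "(x - f) + f \<in> ?H"
        using f submodule_subgroup[OF submodule_hull] by (intro add_subgroup_add) auto
      thus "x \<in> ?H" by simp
    qed
  qed
  moreover have "finite (B \<union> F)" using B F by simp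
  ultimately have fg: "\<exists>B. finite B \<and> is_submodule (integers v) scale hull B = Om" by (intro exI conjI)
  have "UNIV = is_submodule UNIV scale hull S" using order by (simp add: is_order_def)
  also have "\<dots> \<subseteq> is_submodule UNIV scale hull Om" by (rule hull_mono[OF assms(1)])
  finally have "is_submodule UNIV scale hull Om = UNIV" by (rule UNIV_eq_I[OF subsetD, symmetric]) simp
  hence "is_order (integers v) scale Om"
    unfolding is_order_def using fg assms S_one by blast
  thus ?thesis using maximal assms(1) unfolding is_maximal_order_def by simp
qed

text \<open>The left multipliers of \<open>B\<close> form a ring containing \<open>S\<close>. As
  \<open>B\<close> contains the central element \<open>rho n\<close>, each multiplier is carried
  into \<open>S\<close> by \<open>unif ^ n\<close>, so \<open>order_eqI\<close> applies.\<close>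

lemma left_multiplier:
  assumes B: "is_add_subgroup B" "B \<subseteq> S" "\<And>s b. s \<in> S \<Longrightarrow> b \<in> B \<Longrightarrow> s * b \<in> B" "rho n \<in> B"
    and x: "\<And>b. b \<in> B \<Longrightarrow> x * b \<in> B"
  shows "x \<in> S"
proof -
  let ?Om = "{x. \<forall>b\<in>B. x * b \<in> B}"
  have "?Om = S"
  proof (rule order_eqI[of _ n])
    show "is_submodule (integers v) scale ?Om"
      unfolding is_submodule_def is_add_subgroup_def
    proof (intro conjI ballI)
      show "0 \<in> ?Om" using add_subgroup_0[OF B(1)] by simp
      show "x - y \<in> ?Om" if "x \<in> ?Om" "y \<in> ?Om" for x y
        using that add_subgroup_diff[OF B(1)] by (simp add: left_diff_distrib)
      show "scale c x \<in> ?Om" if "c \<in> integers v" "x \<in> ?Om" for c x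
      proof -
        have "scale c x * b \<in> B" if b: "b \<in> B" for b
        proof -
          have "scale c x * b = scale c 1 * (x * b)" by (simp add: scale_mult_left)
          thus ?thesis using \<open>x \<in> ?Om\<close> b B(3)[OF scale_mem[OF \<open>c \<in> integers v\<close> S_one]] by simp
        qed
        thus ?thesis by simp
      qed
    qed
    show "scale (unif ^ n) x \<in> S" if "x \<in> ?Om" for x
    proof -
      have "x * rho n \<in> S" using that B by auto
      thus ?thesis by (simp add: rho_def scale_mult_right)
    qed
  qed (use B(3) in \<open>auto simp: mult.assoc\<close>)
  thus ?thesis using x by auto
qed

lemma right_multiplier:
  assumes B: "is_add_subgroup B" "B \<subseteq> S" "\<And>s b. s \<in> S \<Longrightarrow> b \<in> B \<Longrightarrow> b * s \<in> B" "rho n \<in> B"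
    and x: "\<And>b. b \<in> B \<Longrightarrow> b * x \<in> B"
  shows "x \<in> S"
proof -
  let ?Om = "{x. \<forall>b\<in>B. b * x \<in> B}"
  have "?Om = S"
  proof (rule order_eqI[of _ n])
    show "is_submodule (integers v) scale ?Om"
      unfolding is_submodule_def is_add_subgroup_def
    proof (intro conjI ballI)
      show "0 \<in> ?Om" using add_subgroup_0[OF B(1)] by simp
      show "x - y \<in> ?Om" if "x \<in> ?Om" "y \<in> ?Om" for x y
        using that add_subgroup_diff[OF B(1)] by (simp add: right_diff_distrib)
      show "scale c x \<in> ?Om" if "c \<in> integers v" "x \<in> ?Om" for c x
      proof -
        have "b * scale c x \<in> B" if b: "b \<in> B" for b
        proof -
          have "b * scale c x = (b * x) * scale c 1" by (simp add: scale_mult_right)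
          thus ?thesis using \<open>x \<in> ?Om\<close> b B(3)[OF scale_mem[OF \<open>c \<in> integers v\<close> S_one]] by simp
        qed
        thus ?thesis by simp
      qed
    qed
    show "scale (unif ^ n) x \<in> S" if "x \<in> ?Om" for x
    proof -
      have "rho n * x \<in> S" using that B by auto
      thus ?thesis by (simp add: rho_def scale_mult_left)
    qed
  qed (use B(3) in \<open>auto simp: mult.assoc[symmetric]\<close>)
  thus ?thesis using x by auto
qed

text \<open>The image of a uniformizer in a finite field has a power equal to \<open>1\<close> unless it vanishes,
  while \<open>1 - unif ^ k\<close> is a unit.\<close>

lemma p_rho: "p w (rho 1) = 0"
proof (rule ccontr)
  assume nz: "p w (rho 1) \<noteq> 0"
  let ?x = "p w (rho 1)"
  have "\<not> inj (\<lambda>n::nat. ?x ^ n)"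
    using finite_imageD[of "\<lambda>n::nat. ?x ^ n" UNIV] by (metis finite infinite_UNIV_nat)
  then obtain m n :: nat where mn: "m < n" "?x ^ m = ?x ^ n"
    unfolding inj_def by (metis linorder_neqE_nat)
  define k where "k = n - m"
  have k: "k > 0" "n = m + k" using mn(1) by (simp_all add: k_def)
  hence "?x ^ k = 1" using mn(2) nz by (simp add: power_add)
  hence "p w (1 - rho 1 ^ k) = 0"
    by (simp add: p_diff S_one S_power rho_S p_one p_power)
  moreover have "1 - rho 1 ^ k = scale (1 - unif ^ k) 1"
    by (simp add: rho_power[unfolded One_nat_def]) (simp add: rho_def scale_left_diff_distrib)
  ultimately have z: "p w (scale (1 - unif ^ k) 1) = 0" by simp
  note u = one_minus_power_unit[OF k(1)]
  have "scale (inverse (1 - unif ^ k)) 1 * scale (1 - unif ^ k) 1 = 1"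
    using u(3) by (simp add: scale_mult_left)
  hence "p w (scale (inverse (1 - unif ^ k)) 1) * p w (scale (1 - unif ^ k) 1) = p w 1"
    using p_mult[OF scale_mem[OF u(2) S_one] scale_mem[OF u(1) S_one]] by metis
  thus False using z p_one by simp
qed

lemma rho_P: "rho 1 \<in> P w"
  by (simp add: P_def rho_S p_rho del: One_nat_def)

lemma rho_J: "rho 1 \<in> J"
  by (simp add: J_def rho_S p_rho del: One_nat_def)

lemma rho_word: "rho (length ws) \<in> word_ideal ws"
  using power_in_word_ideal[of ws "rho 1"] rho_P rho_power by metis

text \<open>Take a shortest product of the ideals \<open>P True\<close> and \<open>P False\<close>
  that lies in Y = unif S. The ideal P = P w occurs in it, say as B P C. The shorter product D = C B
  is not contained in Y, so T = D/unif + S is strictly larger than S. But D P C = C (B P C) lies in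
  unif C, hence D P / unif consists of left multipliers of C and lies in S; P D is treated in the
  same way with right multipliers of B. So T P and P T lie in S and contain P. They are not equal to
  P, since then T would multiply P into itself and lie in S, and hence both are S.\<close>

lemma P_invertible:
  "\<exists>T. (\<forall>s\<in>S. \<forall>a\<in>T. s * a \<in> T) \<and> ideal_times (*) (P w) T = S \<and> ideal_times (*) T (P w) = S"
proof -
  interpret mult: ring_acting "(*)" S by (rule ring_acting[OF left_module_mult])
  let ?u = "scale unif" and ?i = "scale (inverse unif)"
  have ui: "?u (?i x) = x" "?i (?u x) = x" for x using unif_nonzero by simp_all
  define Y where "Y = ?u ` S"
  have Y: "is_submodule S (*) Y" 
    unfolding is_submodule_def is_add_subgroup_def Y_def
  proof (intro conjI ballI)
    show "0 \<in> ?u ` S" using S_0 by (intro image_eqI[of _ _ 0]) auto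
    show "x - y \<in> ?u ` S" if "x \<in> ?u ` S" "y \<in> ?u ` S" for x y
      using that S_diff by (auto simp: scale_right_diff_distrib[symmetric])
    show "s * x \<in> ?u ` S" if "s \<in> S" "x \<in> ?u ` S" for s x
      using that S_mult by (auto simp: scale_mult_right)
  qed
  have YS: "Y \<subseteq> S" using scale_mem[OF unif_integer] by (auto simp: Y_def)
  have "finite (quo S Y)" using finite_quo_scaled[of 1] by (simp add: Y_def)
  from word_kills[OF left_module_mult S_submodule Y YS this]
  obtain ws where "ideal_times (*) (word_ideal ws) S \<subseteq> Y" by (elim exE)
  hence "x * 1 \<in> Y" if "x \<in> word_ideal ws" for x
    using ideal_times_mem[OF that S_one, of "(*)"] by (rule subsetD)
  hence "word_ideal ws \<subseteq> Y" by auto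
  \<comment> \<open>Minimal length is used only for the word obtained by deleting one letter and
    exchanging the two remaining pieces.\<close>
  from ex_has_least_nat[of "\<lambda>ws. word_ideal ws \<subseteq> Y" ws length, OF this]
  obtain ws where ws: "word_ideal ws \<subseteq> Y" 
    and least: "\<And>us. word_ideal us \<subseteq> Y \<Longrightarrow> length ws \<le> length us" by auto
  have YP: "Y \<subseteq> P w"
  proof
    fix y assume "y \<in> Y"
    then obtain s where "s \<in> S" "y = rho 1 * s" by (auto simp: Y_def rho_def scale_mult_left)
    thus "y \<in> P w" using P_right[OF _ rho_P] by simp
  qed
  \<comment> \<open>Otherwise all letters denote the other ideal. It contains an element with
    residue 1 at \<open>w\<close>, and a power of that element would lie in Y, which is contained in
    \<open>P w\<close>.\<close>
  have "w \<in> set ws"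
  proof (rule ccontr)
    assume "w \<notin> set ws"
    hence sub: "w' = (\<not> w)" if "w' \<in> set ws" for w' using that by (cases w; cases w') auto
    obtain e where e: "e \<in> S" "p w e = 1" "p (\<not> w) e = 0" using p_surj1[of w 1 0] by (elim bexE conjE)
    have "e \<in> P w'" if "w' \<in> set ws" for w' using sub[OF that] e by (simp add: P_def)
    from power_in_word_ideal[of ws e, OF this] have "e ^ length ws \<in> P w" using ws YP by auto
    thus False using e by (simp add: P_def p_power)
  qed
  then obtain us vs where split: "ws = us @ w # vs" by (meson split_list)
  let ?B = "word_ideal us" and ?C = "word_ideal vs"
  have BPC: "b * (a * c) \<in> Y" if "b \<in> ?B" "a \<in> P w" "c \<in> ?C" for a b c
  proof -
    have "b * (a * c) \<in> ideal_times (*) ?B (ideal_times (*) (P w) ?C)"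
      by (intro ideal_times_mem that)
    thus ?thesis using ws by (auto simp: split word_ideal_append)
  qed
  define D where "D = word_ideal (vs @ us)"
  have D: "D = ideal_times (*) ?C ?B" by (simp add: D_def word_ideal_append)
  note Dp = word_ideal_props[where ws = "vs @ us", folded D_def]
  have nD: "\<not> D \<subseteq> Y" using least[of "vs @ us"] by (auto simp: D_def split)
  have gC: "is_add_subgroup ?C" and gB: "is_add_subgroup ?B" by (rule word_ideal_props)+
  \<comment> \<open>For d = cb, associativity moves the product b a c' together. It equals
    \<open>unif\<close> times some s in \<open>S\<close>, and c s stays in the right ideal
    \<open>?C\<close>.\<close>
  have "D \<subseteq> {d. \<forall>a\<in>P w. \<forall>c'\<in>?C. ?i (d * a * c') \<in> ?C}" unfolding D
  proof (rule ideal_times_least)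
    show "is_add_subgroup {d. \<forall>a\<in>P w. \<forall>c'\<in>?C. ?i (d * a * c') \<in> ?C}"
      using gC by (auto simp: is_add_subgroup_def left_diff_distrib scale_right_diff_distrib)
    show "c * b \<in> {d. \<forall>a\<in>P w. \<forall>c'\<in>?C. ?i (d * a * c') \<in> ?C}" if cb: "c \<in> ?C" "b \<in> ?B" for c b
    proof (clarify)
      fix a c' assume ac: "a \<in> P w" "c' \<in> ?C"
      obtain s where s: "s \<in> S" "b * (a * c') = ?u s" using BPC[OF cb(2) ac] by (auto simp: Y_def)
      have "?i (c * b * a * c') = ?i (c * (b * (a * c')))" by (simp add: mult.assoc)
      also have "\<dots> = c * s" using s(2) ui(2) by (simp add: scale_mult_right)
      finally show "?i (c * b * a * c') \<in> ?C" using word_ideal_props(4)[OF s(1) cb(1)] by simp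
    qed
  qed
  hence left: "?i (d * a * c') \<in> ?C" if "d \<in> D" "a \<in> P w" "c' \<in> ?C" for d a c' using that by auto
  \<comment> \<open>The mirror image: here b' a c is moved together, and \<open>?B\<close> is used
    as a left ideal.\<close>
  have "D \<subseteq> {d. \<forall>a\<in>P w. \<forall>b'\<in>?B. ?i (b' * a * d) \<in> ?B}" unfolding D
  proof (rule ideal_times_least)
    show "is_add_subgroup {d. \<forall>a\<in>P w. \<forall>b'\<in>?B. ?i (b' * a * d) \<in> ?B}"
      using gB by (auto simp: is_add_subgroup_def right_diff_distrib scale_right_diff_distrib)
    show "c * b \<in> {d. \<forall>a\<in>P w. \<forall>b'\<in>?B. ?i (b' * a * d) \<in> ?B}" if cb: "c \<in> ?C" "b \<in> ?B" for c b
    proof (clarify)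
      fix a b' assume ab: "a \<in> P w" "b' \<in> ?B"
      obtain s where s: "s \<in> S" "b' * (a * c) = ?u s" using BPC[OF ab(2,1) cb(1)] by (auto simp: Y_def)
      have "?i (b' * a * (c * b)) = ?i ((b' * (a * c)) * b)" by (simp add: mult.assoc)
      also have "\<dots> = s * b" using s(2) ui(2) by (simp add: scale_mult_left)
      finally show "?i (b' * a * (c * b)) \<in> ?B" using word_ideal_props(3)[OF s(1) cb(2)] by simp
    qed
  qed
  hence right: "?i (b' * a * d) \<in> ?B" if "d \<in> D" "a \<in> P w" "b' \<in> ?B" for d a b' using that by auto
  have TP: "?i d * a \<in> S" if "d \<in> D" "a \<in> P w" for d a
  proof (rule left_multiplier[OF word_ideal_props(1)[of vs] word_ideal_props(2)[of vs] word_ideal_props(3) rho_word])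
    show "?i d * a * c' \<in> ?C" if "c' \<in> ?C" for c'
      using left[OF \<open>d \<in> D\<close> \<open>a \<in> P w\<close> that] by (simp add: scale_mult_left)
  qed
  have PT: "a * ?i d \<in> S" if "d \<in> D" "a \<in> P w" for d a
  proof (rule right_multiplier[OF word_ideal_props(1)[of us] word_ideal_props(2)[of us] word_ideal_props(4) rho_word])
    show "b' * (a * ?i d) \<in> ?B" if "b' \<in> ?B" for b'
      using right[OF \<open>d \<in> D\<close> \<open>a \<in> P w\<close> that] by (simp add: scale_mult_right mult.assoc)
  qed
  \<comment> \<open>The summand \<open>S\<close> puts 1 into \<open>T\<close>, so that the products
    of \<open>T\<close> with \<open>P w\<close> contain \<open>P w\<close>.\<close>
  define T where "T = ssum (?i ` D) S"
  have gD: "is_submodule S (*) (?i ` D)"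
    unfolding is_submodule_def is_add_subgroup_def
  proof (intro conjI ballI)
    show "0 \<in> ?i ` D" using add_subgroup_0[OF Dp(1)] by (intro image_eqI[of _ _ 0]) auto
    show "x - y \<in> ?i ` D" if "x \<in> ?i ` D" "y \<in> ?i ` D" for x y
      using that add_subgroup_diff[OF Dp(1)] by (auto simp: scale_right_diff_distrib[symmetric])
    show "s * x \<in> ?i ` D" if "s \<in> S" "x \<in> ?i ` D" for s x
      using that Dp(3) by (auto simp: scale_mult_right)
  qed
  have T: "is_submodule S (*) T" unfolding T_def by (rule mult.submodule_ssum[OF gD S_submodule])
  have ST: "S \<subseteq> T" unfolding T_def by (rule ssum_upper(2)[OF submodule_subgroup[OF gD]])
  have DT: "?i ` D \<subseteq> T" unfolding T_def by (rule ssum_upper(1)[OF S_subgroup])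
  have nT: "\<not> T \<subseteq> S"
  proof
    assume "T \<subseteq> S"
    have "d \<in> Y" if "d \<in> D" for d
    proof -
      have "?i d \<in> S" using DT \<open>T \<subseteq> S\<close> that by auto
      hence "?u (?i d) \<in> Y" unfolding Y_def by (rule imageI)
      thus ?thesis by (simp only: ui(1))
    qed
    hence "D \<subseteq> Y" by (rule subsetI)
    thus False using nD by simp
  qed
  have rho1: "rho 1 \<in> P w" by (rule rho_P)
  have "ideal_times (*) T (P w) = S"
  proof (rule P_comaximal)
    show "P w \<subseteq> ideal_times (*) T (P w)" (is "_ \<subseteq> ?Q")
      using ideal_times_mem[of 1 T _ "P w" "(*)"] ST S_one by auto
    show "?Q \<subseteq> S"
    proof (rule ideal_times_least[OF S_subgroup])
      show "t * a \<in> S" if t: "t \<in> T" and a: "a \<in> P w" for t a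
      proof -
        obtain d s where "t = ?i d + s" "d \<in> D" "s \<in> S" using t by (auto simp: T_def ssum_def)
        moreover have "a \<in> S" using a by (simp add: P_def)
        ultimately show ?thesis using TP[OF _ a] S_mult[of s a] S_add by (simp add: distrib_right)
      qed
    qed
    show "is_add_subgroup ?Q" by (rule ideal_times_subgroup)
    show "s * x \<in> ?Q" if "s \<in> S" "x \<in> ?Q" for s x
      using submodule_act[OF mult.ideal_times_submodule[of S T "P w"]] submodule_act[OF T] that by simp
    show "\<not> ?Q \<subseteq> P w"
    proof
      \<comment> \<open>In this case every element of \<open>T\<close> is a left multiplier of
        \<open>P w\<close>, hence lies in \<open>S\<close>.\<close>
      assume Q: "?Q \<subseteq> P w"
      have "t \<in> S" if t: "t \<in> T" for t
        by (rule left_multiplier[OF P_subgroup P_S P_left rho1]) (use ideal_times_mem[OF t, of _ "P w" "(*)"] Q in auto)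
      thus False using nT by auto
    qed
  qed
  moreover have "ideal_times (*) (P w) T = S"
  proof (rule P_comaximal)
    show "P w \<subseteq> ideal_times (*) (P w) T" (is "_ \<subseteq> ?Q")
      using ideal_times_mem[of _ "P w" 1 T "(*)"] ST S_one by auto
    show "?Q \<subseteq> S"
    proof (rule ideal_times_least[OF S_subgroup])
      show "a * t \<in> S" if a: "a \<in> P w" and t: "t \<in> T" for t a
      proof -
        obtain d s where "t = ?i d + s" "d \<in> D" "s \<in> S" using t by (auto simp: T_def ssum_def)
        moreover have "a \<in> S" using a by (simp add: P_def)
        ultimately show ?thesis using PT[OF _ a] S_mult[of a s] S_add by (simp add: distrib_left)
      qed
    qed
    show "is_add_subgroup ?Q" by (rule ideal_times_subgroup)
    show "s * x \<in> ?Q" if "s \<in> S" "x \<in> ?Q" for s x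
      using submodule_act[OF mult.ideal_times_submodule[of S "P w" T, OF P_left]] that by simp
    show "\<not> ?Q \<subseteq> P w"
    proof
      assume Q: "?Q \<subseteq> P w"
      have "t \<in> S" if t: "t \<in> T" for t
        by (rule right_multiplier[OF P_subgroup P_S P_right rho1]) (use ideal_times_mem[OF _ t, of _ "P w" "(*)"] Q in auto)
      thus False using nT by auto
    qed
  qed
  ultimately show ?thesis using submodule_act[OF T] by (intro exI[of _ T]) auto
qed

text \<open>Scalars commute with the action, so the \<open>S\<close>-module generated by
  \<open>L\<close> is generated over the integers by the finitely many products of generators of
  \<open>S\<close> with generators of \<open>L\<close>.\<close>

lemma finite_quo_lattice:
  assumes act: "left_module act" and B: "finite B" "is_submodule (integers v) (\<lambda>r. act (scale r 1)) hull B = L"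
  shows "finite (quo L (act (rho n) ` L))"
    and "finite (quo (is_submodule S act hull L) (act (rho n) ` (is_submodule S act hull L)))"
proof -
  interpret left_module act by (rule act)
  let ?sc = "\<lambda>r. act (scale r 1)"
  have sc: "left_module ?sc"
    by unfold_locales (simp_all add: scale_left_distrib act_add_left act_add_right act_one act_mult[symmetric] scale_mult_left)
  show "finite (quo L (act (rho n) ` L))"
    unfolding rho_def by (rule finite_quo_unif[OF sc B])
  obtain C where C: "finite C" "is_submodule (integers v) scale hull C = S" by (rule generators)
  define G where "G = (\<lambda>(s, b). act s b) ` (C \<times> B)"
  define H where "H = is_submodule (integers v) ?sc hull G"
  have subH: "is_submodule (integers v) ?sc H" unfolding H_def by (rule submodule_hull)
  note gH = submodule_subgroup[OF subH]
  have comm: "act s (?sc r x) = ?sc r (act s x)" for s r x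
    by (simp add: act_mult[symmetric] scale_mult_left scale_mult_right)
  have SB: "act s b \<in> H" if "s \<in> S" "b \<in> B" for s b
  proof -
    have "is_submodule (integers v) scale hull C \<subseteq> {s. act s b \<in> H}"
    proof (rule hull_minimal)
      show "C \<subseteq> {s. act s b \<in> H}" using \<open>b \<in> B\<close> unfolding H_def G_def by (auto intro!: hull_inc)
      show "is_submodule (integers v) scale {s. act s b \<in> H}"
        unfolding is_submodule_def
      proof (intro conjI ballI)
        show "is_add_subgroup {s. act s b \<in> H}" by (rule vimage_subgroup[OF gH])
        show "scale r s \<in> {s. act s b \<in> H}" if "r \<in> integers v" "s \<in> {s. act s b \<in> H}" for r s
          using submodule_act[OF subH that(1), of "act s b"] that(2)
          by (simp add: act_mult[symmetric] scale_mult_left)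
      qed
    qed
    thus ?thesis using C(2) that by auto
  qed
  have SH: "is_submodule S act H"
    unfolding is_submodule_def
  proof (intro conjI ballI gH)
    fix s x assume s: "s \<in> S" and x: "x \<in> H"
    have "is_submodule (integers v) ?sc hull G \<subseteq> {x. act s x \<in> H}"
    proof (rule hull_minimal)
      show "G \<subseteq> {x. act s x \<in> H}"
      proof
        fix g assume "g \<in> G"
        then obtain c b where cb: "c \<in> C" "b \<in> B" "g = act c b" by (auto simp: G_def)
        have "C \<subseteq> S" unfolding C(2)[symmetric] by (rule hull_subset)
        hence "act (s * c) b \<in> H" using cb s by (intro SB S_mult) auto
        thus "g \<in> {x. act s x \<in> H}" using cb by (simp add: act_mult)
      qed
      show "is_submodule (integers v) ?sc {x. act s x \<in> H}"
        unfolding is_submodule_def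
      proof (intro conjI ballI)
        show "is_add_subgroup {x. act s x \<in> H}" by (rule vimage_subgroup[OF gH])
        show "?sc r x \<in> {x. act s x \<in> H}" if "r \<in> integers v" "x \<in> {x. act s x \<in> H}" for r x
          using submodule_act[OF subH that(1), of "act s x"] that(2) comm by simp
      qed
    qed
    thus "act s x \<in> H" using x unfolding H_def[symmetric] by auto
  qed
  have "L \<subseteq> H" unfolding B(2)[symmetric]
    using SB[OF S_one] act_one by (intro hull_minimal subH) auto
  hence "is_submodule S act hull L \<subseteq> H" by (intro hull_minimal SH)
  moreover have "H \<subseteq> is_submodule S act hull L" unfolding H_def
  proof (rule hull_minimal)
    have subL: "is_submodule S act (is_submodule S act hull L)" by (rule submodule_hull)
    have "B \<subseteq> L" unfolding B(2)[symmetric] by (rule hull_subset)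
    moreover have "L \<subseteq> is_submodule S act hull L" by (rule hull_subset)
    moreover have "C \<subseteq> S" unfolding C(2)[symmetric] by (rule hull_subset)
    ultimately show "G \<subseteq> is_submodule S act hull L"
      unfolding G_def using submodule_act[OF subL] by (auto simp: subset_iff)
    show "is_submodule (integers v) ?sc (is_submodule S act hull L)"
      using subL scale_mem[OF _ S_one] by (auto simp: is_submodule_def)
  qed
  ultimately have eq: "is_submodule S act hull L = H" by (rule subset_antisym)
  have "finite G" unfolding G_def using B C by simp
  thus "finite (quo (is_submodule S act hull L) (act (rho n) ` (is_submodule S act hull L)))"
    unfolding eq unfolding rho_def by (rule finite_quo_unif[OF sc _ H_def[symmetric]])
qed

end

section \<open>Coordinates on finite quotients\<close>

text \<open>Sequences over the field form one type that contains spaces of every finite dimension,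
  so quotients of varying dimension can share a coordinate type.\<close>

definition fscale :: "'f::{field,finite} \<Rightarrow> (nat \<Rightarrow> 'f) \<Rightarrow> nat \<Rightarrow> 'f" where
  "fscale c g = (\<lambda>i. c * g i)"

interpretation fs: finite_field_space fscale
  by unfold_locales (auto simp: fscale_def fun_eq_iff algebra_simps)

lemma finite_bounded_functions:
  assumes "\<And>g i. g \<in> G \<Longrightarrow> i \<ge> N \<Longrightarrow> g i = (0 :: 'f::{field,finite})"
  shows "finite (G :: (nat \<Rightarrow> 'f) set)"
proof (rule finite_imageD)
  show "finite ((\<lambda>g. restrict g {..<N}) ` G)"
    by (rule finite_subset[of _ "{..<N} \<rightarrow>\<^sub>E UNIV"]) (auto intro: finite_PiE split: if_splits)
  show "inj_on (\<lambda>g. restrict g {..<N}) G"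
  proof (rule inj_onI, rule ext)
    fix g h i assume *: "g \<in> G" "h \<in> G" "restrict g {..<N} = restrict h {..<N}"
    show "g i = h i"
    proof (cases "i < N")
      case True thus ?thesis using fun_cong[OF *(3), of i] by simp
    next
      case False thus ?thesis using assms[OF *(1), of i] assms[OF *(2), of i] by simp
    qed
  qed
qed

context ring_acting
begin

text \<open>Finite quotients \<open>X / Y\<close> killed by the radical are handled through coordinates: additive maps
  from \<open>X\<close> with kernel \<open>Y\<close> into sequences over \<open>\<kappa>\<close>, semilinear along a ring homomorphism
  \<open>p : S \<rightarrow> \<kappa>\<close>.\<close>

definition semilinear :: "('a \<Rightarrow> 'f::{field,finite}) \<Rightarrow> 'v set \<Rightarrow> ('v \<Rightarrow> nat \<Rightarrow> 'f) \<Rightarrow> bool" where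
  "semilinear p X f \<longleftrightarrow> (\<forall>x\<in>X. \<forall>y\<in>X. f (x - y) = f x - f y) \<and>
     (\<forall>a\<in>S. \<forall>x\<in>X. f (act a x) = fscale (p a) (f x)) \<and> finite (f ` X)"

lemma semilinear_diff: "semilinear p X f \<Longrightarrow> x \<in> X \<Longrightarrow> y \<in> X \<Longrightarrow> f (x - y) = f x - f y"
  and semilinear_act: "semilinear p X f \<Longrightarrow> a \<in> S \<Longrightarrow> x \<in> X \<Longrightarrow> f (act a x) = fscale (p a) (f x)"
  and semilinear_finite: "semilinear p X f \<Longrightarrow> finite (f ` X)"
  by (simp_all add: semilinear_def)

lemma semilinear_0:
  assumes "semilinear p X f" "is_add_subgroup X" shows "f 0 = 0"
  using semilinear_diff[OF assms(1), of 0 0] add_subgroup_0[OF assms(2)] by simp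

lemma semilinear_add:
  assumes "semilinear p X f" "is_add_subgroup X" "x \<in> X" "y \<in> X" shows "f (x + y) = f x + f y"
proof -
  have "x + y \<in> X" using assms by (simp add: add_subgroup_add)
  from semilinear_diff[OF assms(1) this assms(4)] show ?thesis by simp
qed

lemma semilinear_mono: "semilinear p X f \<Longrightarrow> Y \<subseteq> X \<Longrightarrow> semilinear p Y f"
  unfolding semilinear_def using finite_subset[OF image_mono[of Y X f]] by (auto simp: subset_iff)

lemma semilinear_image_subspace:
  assumes f: "semilinear p X f" and X: "is_submodule S act X" and surj: "p ` S = UNIV"
  shows "fs.subspace (f ` X)"
proof (rule fs.subspaceI)
  note gX = submodule_subgroup[OF X]
  show "0 \<in> f ` X" using semilinear_0[OF f gX] add_subgroup_0[OF gX] by (metis imageI)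
  show "u + w \<in> f ` X" if "u \<in> f ` X" "w \<in> f ` X" for u w
    using that semilinear_add[OF f gX] add_subgroup_add[OF gX] by (auto simp: image_iff) metis
  show "fscale c u \<in> f ` X" if "u \<in> f ` X" for c u
  proof -
    obtain x where x: "x \<in> X" "u = f x" using \<open>u \<in> f ` X\<close> by auto
    have "c \<in> p ` S" using surj by simp
    then obtain a where "a \<in> S" "c = p a" by auto
    thus ?thesis using semilinear_act[OF f _ x(1), of a] submodule_act[OF X _ x(1), of a] x(2) by (metis imageI)
  qed
qed

lemma semilinear_idx:
  assumes "semilinear p X f" "is_add_subgroup X" "is_add_subgroup A" "\<And>x. x \<in> X \<Longrightarrow> f x = 0 \<longleftrightarrow> x \<in> A"
  shows "idx X A = card (f ` X)" "finite (quo X A)"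
proof -
  have "f x = f y \<longleftrightarrow> x - y \<in> A" if "x \<in> X" "y \<in> X" for x y
    using semilinear_diff[OF assms(1) that] assms(4)[OF add_subgroup_diff[OF assms(2) that]] by auto
  from idx_kernel[OF assms(3), of X f, OF this] show "idx X A = card (f ` X)" "finite (quo X A)"
    using semilinear_finite[OF assms(1)] by simp_all
qed

text \<open>The quotient X/A is a finite module over the field onto which \<open>p\<close> maps. Its
  coordinates are built along a composition series, each factor of which is one-dimensional and adds
  one entry.\<close>

lemma coordinates:
  fixes p :: "'a \<Rightarrow> 'f::{field,finite}"
  assumes p: "\<And>a b. a \<in> S \<Longrightarrow> b \<in> S \<Longrightarrow> p (a - b) = p a - p b" 
      "\<And>a b. a \<in> S \<Longrightarrow> b \<in> S \<Longrightarrow> p (a * b) = p a * p b" "p 1 = 1" "p ` S = UNIV"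
    and XA: "is_submodule S act X" "is_submodule S act A" "A \<subseteq> X" "finite (quo X A)"
    and kill: "\<And>a x. a \<in> S \<Longrightarrow> p a = 0 \<Longrightarrow> x \<in> X \<Longrightarrow> act a x \<in> A"
  shows "\<exists>f. semilinear p X f \<and> (\<forall>x\<in>X. f x = 0 \<longleftrightarrow> x \<in> A)"
proof -
  \<comment> \<open>The kernel condition refers to \<open>X\<close>, which varies in the induction,
    so it becomes a premise of the induction claim. The bound \<open>N\<close> marks the next free
    position.\<close>
  have "(\<forall>a\<in>S. p a = 0 \<longrightarrow> (\<forall>x\<in>X. act a x \<in> A)) \<Longrightarrow>
    \<exists>f::'v \<Rightarrow> nat \<Rightarrow> 'f. (\<forall>x\<in>X. \<forall>y\<in>X. f (x - y) = f x - f y) \<and>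
     (\<forall>a\<in>S. \<forall>x\<in>X. f (act a x) = fscale (p a) (f x)) \<and> (\<forall>x\<in>X. f x = 0 \<longleftrightarrow> x \<in> A) \<and>
     (\<exists>N. \<forall>x\<in>X. \<forall>i\<ge>N. f x i = 0)"
    using XA
  proof (induction rule: chain_induct)
    case base
    note gA = submodule_subgroup[OF XA(2)]
    show ?case by (intro exI[of _ "\<lambda>_ _. 0"]) (auto simp: fscale_def fun_eq_iff)
  next
    case (step X Z)
    have sub: "is_submodule S act X" "is_submodule S act Z" "Z \<subseteq> X" "Z \<noteq> X"
      using step(1) by (auto simp: maximal_submodule_def)
    note gX = submodule_subgroup[OF sub(1)] and gZ = submodule_subgroup[OF sub(2)] and gA = submodule_subgroup[OF XA(2)]
    have kill: "act a x \<in> A" if "a \<in> S" "p a = 0" "x \<in> X" for a x using step(6) that by simp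
    hence "\<forall>a\<in>S. p a = 0 \<longrightarrow> (\<forall>x\<in>Z. act a x \<in> A)" using sub(3) by auto
    from step(5)[OF this] obtain f :: "'v \<Rightarrow> nat \<Rightarrow> 'f" and N where
      f: "\<forall>x\<in>Z. \<forall>y\<in>Z. f (x - y) = f x - f y" "\<forall>a\<in>S. \<forall>x\<in>Z. f (act a x) = fscale (p a) (f x)"
        "\<forall>x\<in>Z. f x = 0 \<longleftrightarrow> x \<in> A" "\<forall>x\<in>Z. \<forall>i\<ge>N. f x i = 0" by (elim exE conjE)
    obtain x0 where x0: "x0 \<in> X" "x0 \<notin> Z" using sub by auto
    define \<sigma> where "\<sigma> c = (SOME a. a \<in> S \<and> p a = c)" for c
    have \<sigma>: "\<sigma> c \<in> S" "p (\<sigma> c) = c" for c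
    proof -
      have "c \<in> p ` S" using p(4) by simp
      hence "\<exists>a. a \<in> S \<and> p a = c" by auto
      from someI_ex[OF this] show "\<sigma> c \<in> S" "p (\<sigma> c) = c" unfolding \<sigma>_def by auto
    qed
    have n1: "act 1 x0 \<notin> Z" using x0 by (simp add: act_one)
    have decomp: "\<exists>c. x - act (\<sigma> c) x0 \<in> Z" if x: "x \<in> X" for x
    proof -
      obtain z u where zu: "z \<in> Z" "u \<in> S" "x = z + act u x0"
        by (rule cyclic_cover[OF step(1) x0(1) subgroup_S order_refl mult_mem one_mem n1 x])
      have "p (u - \<sigma> (p u)) = 0" using zu \<sigma> p(1) by simp
      hence "act (u - \<sigma> (p u)) x0 \<in> Z" using kill[OF diff_mem[OF zu(2) \<sigma>(1)] _ x0(1)] step(2) by auto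
      moreover have "x - act (\<sigma> (p u)) x0 = z + act (u - \<sigma> (p u)) x0"
        using zu(3) by (simp add: act_diff_left)
      ultimately have "x - act (\<sigma> (p u)) x0 \<in> Z" using zu(1) add_subgroup_add[OF gZ] by simp
      thus ?thesis ..
    qed
    have unit: "p u = 0" if u: "u \<in> S" "act u x0 \<in> Z" for u
    proof (rule ccontr)
      assume nz: "p u \<noteq> 0"
      let ?c = "\<sigma> (inverse (p u))"
      have cu: "?c * u \<in> S" using \<sigma> u mult_mem by simp
      have "p (1 - ?c * u) = 0" using nz p(1)[OF one_mem cu] p(2)[OF \<sigma>(1) u(1)] p(3) \<sigma>(2) by simp
      hence "act (1 - ?c * u) x0 \<in> Z" using kill[OF diff_mem[OF one_mem cu] _ x0(1)] step(2) by auto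
      moreover have "act (?c * u) x0 \<in> Z" using submodule_act[OF sub(2) \<sigma>(1) u(2)] by (simp add: act_mult)
      ultimately have "act (1 - ?c * u) x0 + act (?c * u) x0 \<in> Z" by (rule add_subgroup_add[OF gZ])
      thus False using x0(2) by (simp add: act_add_left[symmetric] act_one)
    qed
    have unique: "c = p u" if "x - act (\<sigma> c) x0 \<in> Z" "u \<in> S" "x - act u x0 \<in> Z" for c x u
    proof -
      have "(x - act (\<sigma> c) x0) - (x - act u x0) \<in> Z" using that add_subgroup_diff[OF gZ] by blast
      hence "act (u - \<sigma> c) x0 \<in> Z" by (simp add: act_diff_left)
      from unit[OF diff_mem[OF that(2) \<sigma>(1)] this] show ?thesis using p(1)[OF that(2) \<sigma>(1)] \<sigma>(2) by simp
    qed
    define c where "c x = (SOME c. x - act (\<sigma> c) x0 \<in> Z)" for x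
    have c: "x - act (\<sigma> (c x)) x0 \<in> Z" if "x \<in> X" for x
      unfolding c_def by (rule someI_ex[OF decomp[OF that]])
    have cu: "c x = p u" if "x \<in> X" "u \<in> S" "x - act u x0 \<in> Z" for x u
      by (rule unique[OF c[OF that(1)] that(2,3)])
    \<comment> \<open>X is Z plus the multiples of \<open>x0\<close>. The part in \<open>Z\<close>
      keeps its old coordinates, and the residue of the multiplier of \<open>x0\<close> is entered
      at position \<open>N\<close>.\<close>
    define h where "h x = (f (x - act (\<sigma> (c x)) x0))(N := c x)" for x
    have fdiff0: "f z = f z'" if "z \<in> Z" "z' \<in> Z" "z - z' \<in> A" for z z'
    proof -
      have "z - z' \<in> Z" using that add_subgroup_diff[OF gZ] by simp
      hence "f (z - z') = 0" using that f(3) by simp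
      thus ?thesis using f(1) that by simp
    qed
    \<comment> \<open>The section \<open>\<sigma>\<close> is neither additive nor multiplicative.
      The value of \<open>h\<close> may nevertheless be computed with any multiplier
      \<open>u\<close>: two multipliers of equal residue differ by an element of the kernel of
      \<open>p\<close>, which carries \<open>x0\<close> into \<open>A\<close>, where
      \<open>f\<close> vanishes.\<close>
    have hval: "h x = (f (x - act u x0))(N := p u)" if "x \<in> X" "u \<in> S" "x - act u x0 \<in> Z" for x u
    proof -
      have "p (u - \<sigma> (p u)) = 0" using \<sigma> p(1) that by simp
      hence "act (u - \<sigma> (p u)) x0 \<in> A" using kill[OF diff_mem[OF that(2) \<sigma>(1)] _ x0(1)] by simp
      moreover have "(x - act (\<sigma> (c x)) x0) - (x - act u x0) = act (u - \<sigma> (p u)) x0"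
        using cu[OF that] by (simp add: act_diff_left)
      ultimately have "f (x - act (\<sigma> (c x)) x0) = f (x - act u x0)"
        using fdiff0[OF c[OF that(1)] that(3)] by simp
      thus ?thesis using cu[OF that] by (simp add: h_def)
    qed
    have h1: "h (x - y) = h x - h y" if xy: "x \<in> X" "y \<in> X" for x y
    proof -
      let ?a = "\<sigma> (c x)" and ?b = "\<sigma> (c y)"
      have eq: "(x - y) - act (?a - ?b) x0 = (x - act ?a x0) - (y - act ?b x0)"
        by (simp add: act_diff_left)
      have "(x - y) - act (?a - ?b) x0 \<in> Z" unfolding eq using c xy add_subgroup_diff[OF gZ] by simp
      from hval[OF add_subgroup_diff[OF gX xy] diff_mem[OF \<sigma>(1) \<sigma>(1)] this]
      have "h (x - y) = (f (x - act ?a x0) - f (y - act ?b x0))(N := c x - c y)"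
        unfolding eq using f(1) c xy p(1)[OF \<sigma>(1) \<sigma>(1)] \<sigma>(2) by simp
      thus ?thesis by (auto simp: h_def fun_eq_iff)
    qed
    have h2: "h (act a x) = fscale (p a) (h x)" if ax: "a \<in> S" "x \<in> X" for a x
    proof -
      let ?b = "\<sigma> (c x)"
      have eq: "act a x - act (a * ?b) x0 = act a (x - act ?b x0)"
        by (simp add: act_diff_right act_mult)
      have "act a x - act (a * ?b) x0 \<in> Z" unfolding eq using c ax submodule_act[OF sub(2)] by simp
      from hval[OF submodule_act[OF sub(1) ax] mult_mem[OF ax(1) \<sigma>(1)] this]
      have "h (act a x) = (fscale (p a) (f (x - act ?b x0)))(N := p a * c x)"
        unfolding eq using f(2) c ax p(2)[OF ax(1) \<sigma>(1)] \<sigma>(2) by simp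
      thus ?thesis by (auto simp: h_def fun_eq_iff fscale_def)
    qed
    have h3: "h x = 0 \<longleftrightarrow> x \<in> A" if x: "x \<in> X" for x
    proof
      assume "x \<in> A"
      hence "x \<in> Z" using step(2) by auto
      moreover have "0 \<in> S" using subgroup_S add_subgroup_0 by blast
      moreover have "p 0 = 0" using p(1)[OF one_mem one_mem] by simp
      moreover have "f x = 0" using f(3) \<open>x \<in> Z\<close> \<open>x \<in> A\<close> by simp
      ultimately show "h x = 0" using hval[OF x, of 0] by (simp add: fun_eq_iff)
    next
      assume h0: "h x = 0"
      hence "c x = 0" by (auto simp: h_def fun_eq_iff split: if_splits)
      have z: "x - act (\<sigma> (c x)) x0 \<in> Z" by (rule c[OF x])
      have "f (x - act (\<sigma> (c x)) x0) i = 0" for i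
        using fun_cong[OF h0, of i] f(4) z by (cases "i = N") (simp_all add: h_def)
      hence "f (x - act (\<sigma> (c x)) x0) = 0" by (simp add: fun_eq_iff)
      hence "x - act (\<sigma> (c x)) x0 \<in> A" using f(3) z by simp
      moreover have "act (\<sigma> (c x)) x0 \<in> A" using kill[OF \<sigma>(1) _ x0(1)] \<sigma>(2) \<open>c x = 0\<close> by simp
      ultimately have "(x - act (\<sigma> (c x)) x0) + act (\<sigma> (c x)) x0 \<in> A" by (rule add_subgroup_add[OF gA])
      thus "x \<in> A" by simp
    qed
    have h4: "h x i = 0" if "x \<in> X" "i \<ge> Suc N" for x i
      using f(4) c[OF that(1)] that(2) by (simp add: h_def)
    have h4': "\<exists>N. \<forall>x\<in>X. \<forall>i\<ge>N. h x i = 0" using h4 by (intro exI[of _ "Suc N"]) simp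
    have A1: "\<forall>x\<in>X. \<forall>y\<in>X. h (x - y) = h x - h y" by (intro ballI h1)
    have A2: "\<forall>a\<in>S. \<forall>x\<in>X. h (act a x) = fscale (p a) (h x)" by (intro ballI h2)
    have A3: "\<forall>x\<in>X. h x = 0 \<longleftrightarrow> x \<in> A" by (intro ballI h3)
    show ?case by (rule exI[of _ h], intro conjI; fact)
  qed
  hence "\<exists>f::'v \<Rightarrow> nat \<Rightarrow> 'f. (\<forall>x\<in>X. \<forall>y\<in>X. f (x - y) = f x - f y) \<and>
     (\<forall>a\<in>S. \<forall>x\<in>X. f (act a x) = fscale (p a) (f x)) \<and> (\<forall>x\<in>X. f x = 0 \<longleftrightarrow> x \<in> A) \<and>
     (\<exists>N. \<forall>x\<in>X. \<forall>i\<ge>N. f x i = 0)"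
    using kill by simp
  then obtain f :: "'v \<Rightarrow> nat \<Rightarrow> 'f" and N where
      f: "\<forall>x\<in>X. \<forall>y\<in>X. f (x - y) = f x - f y" "\<forall>a\<in>S. \<forall>x\<in>X. f (act a x) = fscale (p a) (f x)"
        "\<forall>x\<in>X. f x = 0 \<longleftrightarrow> x \<in> A" "\<forall>x\<in>X. \<forall>i\<ge>N. f x i = 0" by (elim exE conjE)
  have "finite (f ` X)" by (rule finite_bounded_functions[of _ N]) (use f(4) in auto)
  hence "semilinear p X f" using f by (simp add: semilinear_def)
  thus ?thesis using f(3) by (intro exI conjI)
qed

end

section \<open>Generating functions of sets with a length function\<close>

definition genfun :: "'x set \<Rightarrow> ('x \<Rightarrow> nat) \<Rightarrow> rat fps" where
  "genfun A l = Abs_fps (\<lambda>n. of_nat (card {x\<in>A. l x = n}))"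

lemma genfun_cong: "A = B \<Longrightarrow> (\<And>x. x \<in> B \<Longrightarrow> l x = l' x) \<Longrightarrow> genfun A l = genfun B l'"
  unfolding genfun_def by (intro arg_cong[of _ _ Abs_fps] ext arg_cong[of _ _ of_nat] arg_cong[of _ _ card]) auto

lemma genfun_partition:
  assumes "\<And>n. finite {x\<in>A. l x = n}" "finite I" "\<And>x. x \<in> A \<Longrightarrow> \<pi> x \<in> I"
  shows "genfun A l = (\<Sum>i\<in>I. genfun {x\<in>A. \<pi> x = i} l)"
proof (rule fps_ext)
  fix n
  have "card {x\<in>A. l x = n} = (\<Sum>i\<in>I. card {x\<in>{x\<in>A. l x = n}. \<pi> x = i})"
  proof -
    have "{x\<in>A. l x = n} = (\<Union>i\<in>I. {x\<in>{x\<in>A. l x = n}. \<pi> x = i})" using assms(3) by auto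
    from arg_cong[OF this, of card]
    have "card {x\<in>A. l x = n} = card (\<Union>i\<in>I. {x\<in>{x\<in>A. l x = n}. \<pi> x = i})" .
    also have "\<dots> = (\<Sum>i\<in>I. card {x\<in>{x\<in>A. l x = n}. \<pi> x = i})"
      by (intro card_UN_disjoint ballI assms(2) finite_subset[OF _ assms(1)[of n]]) auto
    finally show ?thesis .
  qed
  moreover have "{x\<in>{x\<in>A. l x = n}. \<pi> x = i} = {x\<in>{x\<in>A. \<pi> x = i}. l x = n}" for i by auto
  ultimately show "fps_nth (genfun A l) n = fps_nth (\<Sum>i\<in>I. genfun {x\<in>A. \<pi> x = i} l) n"
    by (simp add: genfun_def fps_sum_nth)
qed

lemma genfun_shift:
  assumes "\<And>x. x \<in> A \<Longrightarrow> l x = c + l' x"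
  shows "genfun A l = fps_X ^ c * genfun A l'"
proof (rule fps_ext)
  fix n
  have "{x\<in>A. l x = n} = (if n < c then {} else {x\<in>A. l' x = n - c})"
    using assms by auto
  thus "fps_nth (genfun A l) n = fps_nth (fps_X ^ c * genfun A l') n"
    by (simp add: genfun_def fps_X_power_mult_nth)
qed

text \<open>Grouping by the base point, over which the fibre series is always \<open>Q\<close>,
  turns the count into a Cauchy product.\<close>

lemma genfun_fibration:
  assumes finA: "\<And>n. finite {x\<in>A. l x = n}" and finB: "\<And>n. finite {y\<in>B. m y = n}"
    and map: "\<And>x. x \<in> A \<Longrightarrow> \<pi> x \<in> B" and len: "\<And>x. x \<in> A \<Longrightarrow> l x = m (\<pi> x) + r x"
    and fibre: "\<And>y. y \<in> B \<Longrightarrow> genfun {x\<in>A. \<pi> x = y} r = Q"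
  shows "genfun A l = genfun B m * Q"
proof (rule fps_ext)
  fix n
  let ?B = "\<lambda>k. {y\<in>B. m y = k}"
  let ?F = "\<lambda>y. {x\<in>A. l x = n \<and> \<pi> x = y}"
  have cF: "of_nat (card (?F y)) = fps_nth Q (n - k)" if "y \<in> ?B k" "k \<le> n" for y k
  proof -
    have "?F y = {x\<in>{x\<in>A. \<pi> x = y}. r x = n - k}" using that len by auto
    moreover have "fps_nth (genfun {x\<in>A. \<pi> x = y} r) (n - k) = fps_nth Q (n - k)" using fibre that by simp
    ultimately show ?thesis by (simp add: genfun_def)
  qed
  have "{x\<in>A. l x = n} = (\<Union>k\<in>{..n}. \<Union>y\<in>?B k. ?F y)" using map len by auto
  from arg_cong[OF this, of card]
  have "card {x\<in>A. l x = n} = card (\<Union>k\<in>{..n}. \<Union>y\<in>?B k. ?F y)" .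
  also have "\<dots> = (\<Sum>k\<le>n. card (\<Union>y\<in>?B k. ?F y))"
  proof (rule card_UN_disjoint)
    show "\<forall>k\<in>{..n}. finite (\<Union>y\<in>?B k. ?F y)" by (intro ballI finite_UN_I finB finite_subset[OF _ finA[of n]]) auto
  qed auto
  also have "\<dots> = (\<Sum>k\<le>n. \<Sum>y\<in>?B k. card (?F y))"
  proof (rule sum.cong[OF refl])
    fix k
    show "card (\<Union>y\<in>?B k. ?F y) = (\<Sum>y\<in>?B k. card (?F y))"
      by (intro card_UN_disjoint ballI finB finite_subset[OF _ finA[of n]]) auto
  qed
  finally have "of_nat (card {x\<in>A. l x = n}) = (\<Sum>k\<le>n. \<Sum>y\<in>?B k. of_nat (card (?F y)) :: rat)"
    by simp
  also have "\<dots> = (\<Sum>k\<le>n. \<Sum>y\<in>?B k. fps_nth Q (n - k))"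
    by (intro sum.cong refl) (use cF in simp)
  also have "\<dots> = (\<Sum>k\<le>n. of_nat (card (?B k)) * fps_nth Q (n - k))" by simp
  finally show "fps_nth (genfun A l) n = fps_nth (genfun B m * Q) n"
    by (simp add: genfun_def fps_mult_nth atLeast0AtMost)
qed

section \<open>Counting sublattices over the maximal order\<close>

lemma qpoch_nth_0: "fps_nth (qpoch q j) 0 = 1"
  unfolding qpoch_def by (induction j) (auto simp: q_pow_minus_s_def)

text \<open>What the counting takes from the local situation. \<open>r\<close> stands for the
  uniformizer, \<open>finite_r\<close> for finite generation over the integers, and
  \<open>invertible\<close> for maximality; \<open>Lam\<close> is the preimage of the diagonal of
  the residue ring.\<close>

locale lattice_pair = split_ring S p + left_module act
  for S :: "'a::ring_1 set" and p :: "bool \<Rightarrow> 'a \<Rightarrow> 'f::{field,finite}"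
    and act :: "'a \<Rightarrow> 'v::ab_group_add \<Rightarrow> 'v" +
  fixes Lam :: "'a set" and L :: "'v set" and r :: 'a
  assumes Lam_def: "Lam = {x\<in>S. p True x = p False x}"
    and J_Lam: "J \<subseteq> jacobson_radical Lam"
    and L_submodule: "is_submodule Lam act L"
    and r_J: "r \<in> J"
    and finite_r: "finite (quo (is_submodule S act hull L) (act (r ^ n) ` (is_submodule S act hull L)))"
    and invertible: "\<exists>T. (\<forall>s\<in>S. \<forall>a\<in>T. s * a \<in> T) \<and>
                       ideal_times (*) (P w) T = S \<and> ideal_times (*) T (P w) = S"

sublocale lattice_pair \<subseteq> R: residue_ring act S J "CARD('f)"
  by (rule residue_ring[OF left_module_axioms])

context lattice_pair
begin

definition L' :: "'v set" where "L' = is_submodule S act hull L"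

lemma L'_submodule: "is_submodule S act L'"
  unfolding L'_def by (rule submodule_hull)

lemma J_S: "J \<subseteq> S" by (auto simp: J_def)

lemma J_P: "J \<subseteq> P w" by (auto simp: J_def P_def)

lemma J_left: "s \<in> S \<Longrightarrow> a \<in> J \<Longrightarrow> s * a \<in> J"
  and J_right: "s \<in> S \<Longrightarrow> a \<in> J \<Longrightarrow> a * s \<in> J"
  by (auto simp: J_def S_mult p_mult)

lemma r_power_S: "r ^ n \<in> S"
  using S_power r_J J_S by auto

lemma act_image_subgroup: "is_add_subgroup X \<Longrightarrow> is_add_subgroup (act a ` X)"
  unfolding is_add_subgroup_def
proof (intro conjI ballI)
  assume X: "0 \<in> X \<and> (\<forall>x\<in>X. \<forall>y\<in>X. x - y \<in> X)"
  show "0 \<in> act a ` X" using X by (intro image_eqI[of _ _ 0]) auto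
  show "x - y \<in> act a ` X" if "x \<in> act a ` X" "y \<in> act a ` X" for x y
    using that X by (auto simp: act_diff_right[symmetric])
qed

text \<open>The multiple r^(n+k) L' is contained in r^n Y and has finite index in L', so all
  quotients in between are finite.\<close>

lemma finite_quo_r:
  assumes Y: "is_add_subgroup Y" "Y \<subseteq> L'" "act (r ^ k) ` L' \<subseteq> Y" "act (r ^ n) ` Y \<subseteq> Y"
  shows "finite (quo Y (act (r ^ n) ` Y))"
proof -
  note gL = submodule_subgroup[OF L'_submodule]
  have "act (r ^ (n + k)) ` L' = act (r ^ n) ` (act (r ^ k) ` L')"
    by (simp add: power_add act_mult image_image)
  hence sub: "act (r ^ (n + k)) ` L' \<subseteq> act (r ^ n) ` Y" using Y(3) by auto
  have "finite (quo L' (act (r ^ (n + k)) ` L'))" using finite_r by (simp add: L'_def)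
  hence "finite (quo L' (act (r ^ n) ` Y))"
    using quo_tower(2)[OF act_image_subgroup[OF gL] act_image_subgroup[OF Y(1)] gL sub] Y(2,4) by auto
  thus ?thesis using quo_tower(2)[OF act_image_subgroup[OF Y(1)] Y(1) gL Y(4,2)] by simp
qed

definition lattice :: "'v set \<Rightarrow> bool" where
  "lattice X \<longleftrightarrow> is_submodule S act X \<and> X \<subseteq> L' \<and> finite (quo L' X)"

definition sublattices :: "'v set \<Rightarrow> 'v set set" where
  "sublattices Y = {X. is_submodule S act X \<and> X \<subseteq> Y \<and> finite (quo Y X)}"

lemma lattice_L': "lattice L'"
  using L'_submodule idx_self[OF submodule_subgroup[OF L'_submodule]] by (simp add: lattice_def)

lemma lattice_submodule: "lattice X \<Longrightarrow> is_submodule S act X"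
  and lattice_subgroup: "lattice X \<Longrightarrow> is_add_subgroup X"
  by (simp_all add: lattice_def is_submodule_def)

lemma sublattice_lattice: "lattice Y \<Longrightarrow> X \<in> sublattices Y \<Longrightarrow> lattice X"
  using quo_tower(2)[of X Y L'] L'_submodule
  by (auto simp: lattice_def sublattices_def is_submodule_def)

lemma lattice_self: "lattice Y \<Longrightarrow> Y \<in> sublattices Y"
  using idx_self[of Y] by (auto simp: lattice_def sublattices_def is_submodule_def)

lemma lattice_contains_r: "lattice Y \<Longrightarrow> \<exists>k. act (r ^ k) ` L' \<subseteq> Y"
  using R.J_power_kills[of L' Y r] r_J L'_submodule by (auto simp: lattice_def)

text \<open>A sublattice of colength \<open>n\<close> contains r^n Y, and only finitely many groups
  lie between r^n Y and Y.\<close>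

lemma finite_level:
  assumes "lattice Y" shows "finite {X\<in>sublattices Y. R.len Y X = n}"
proof -
  note Y = lattice_submodule[OF assms] and gY = lattice_subgroup[OF assms]
  obtain k where k: "act (r ^ k) ` L' \<subseteq> Y" using lattice_contains_r[OF assms] by (elim exE)
  have sub: "act (r ^ n) ` Y \<subseteq> Y" using submodule_act[OF Y r_power_S] by auto
  have fin: "finite (quo Y (act (r ^ n) ` Y))"
    using assms by (intro finite_quo_r[OF gY _ k sub]) (simp add: lattice_def)
  show ?thesis
  proof (rule finite_subset[OF _ finite_between[OF act_image_subgroup[OF gY] fin]])
    show "{X \<in> sublattices Y. R.len Y X = n} \<subseteq> {X. is_add_subgroup X \<and> act (r ^ n) ` Y \<subseteq> X \<and> X \<subseteq> Y}"
    proof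
      fix X assume "X \<in> {X \<in> sublattices Y. R.len Y X = n}"
      hence X: "is_submodule S act X" "X \<subseteq> Y" "finite (quo Y X)" "R.len Y X = n" by (auto simp: sublattices_def)
      obtain n' where n': "idx Y X = CARD('f) ^ n'" "\<forall>x\<in>Y. act (r ^ n') x \<in> X"
        using R.J_power_kills[OF Y X(1-3) r_J] by (elim exE conjE)
      have "n' = n" using R.len_eqI[OF n'(1)] X(4) by simp
      thus "X \<in> {X. is_add_subgroup X \<and> act (r ^ n) ` Y \<subseteq> X \<and> X \<subseteq> Y}"
        using n'(2) X submodule_subgroup by auto
    qed
  qed
qed

lemma len_tower:
  assumes "lattice Y" "Z \<in> sublattices Y" "X \<in> sublattices Z"
  shows "R.len Y X = R.len Y Z + R.len Z X" "X \<in> sublattices Y"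
proof -
  have sub: "is_submodule S act Y" "is_submodule S act Z" "is_submodule S act X" "X \<subseteq> Z" "Z \<subseteq> Y"
    "finite (quo Y Z)" "finite (quo Z X)"
    using assms by (auto simp: sublattices_def lattice_def)
  note t = quo_tower[OF sub(3)[THEN submodule_subgroup] sub(2)[THEN submodule_subgroup]
      sub(1)[THEN submodule_subgroup] sub(4,5)]
  show "X \<in> sublattices Y" using sub t by (auto simp: sublattices_def)
  have "idx Y X = CARD('f) ^ (R.len Y Z + R.len Z X)"
    using t(1) R.idx_len[OF sub(1,2,5,6)] R.idx_len[OF sub(2,3,4,7)] by (simp add: power_add)
  thus "R.len Y X = R.len Y Z + R.len Z X" by (rule R.len_eqI)
qed

lemma sublattices_restrict:
  assumes "lattice Y" "Z \<in> sublattices Y"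
  shows "{X\<in>sublattices Y. X \<subseteq> Z} = sublattices Z"
proof (intro equalityI subsetI)
  fix X assume X: "X \<in> {X\<in>sublattices Y. X \<subseteq> Z}"
  have "is_add_subgroup X" "is_add_subgroup Y" "is_add_subgroup Z" "Z \<subseteq> Y" "finite (quo Y X)"
    using X assms by (auto simp: sublattices_def lattice_def is_submodule_def)
  thus "X \<in> sublattices Z" using quo_tower(2)[of X Z Y] X by (auto simp: sublattices_def)
next
  fix X assume "X \<in> sublattices Z"
  thus "X \<in> {X\<in>sublattices Y. X \<subseteq> Z}" using len_tower(2)[OF assms] by (auto simp: sublattices_def)
qed

definition e :: 'a where "e = (SOME e. e \<in> S \<and> p True e = 1 \<and> p False e = 0)"

lemma e: "e \<in> S" "p True e = 1" "p False e = 0"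
proof -
  have "\<exists>e. e \<in> S \<and> p True e = 1 \<and> p False e = 0" using p_surj[of 1 0] by auto
  from someI_ex[OF this] show "e \<in> S" "p True e = 1" "p False e = 0" unfolding e_def by auto
qed

text \<open>Lifts of the two idempotents of the residue ring. They are idempotent only modulo
  \<open>J\<close>, but their sum is exactly 1, so every vector is the sum of its two parts.\<close>

definition idem :: "bool \<Rightarrow> 'a" where "idem w = (if w then e else 1 - e)"

lemma idem: "idem w \<in> S" "p w (idem w) = 1" "p (\<not> w) (idem w) = 0" "idem True + idem False = 1"
  by (auto simp: idem_def e S_diff S_one p_diff p_one)

lemma p_idem: "p w (idem w') = (if w = w' then 1 else 0)"
  using idem(2)[of w'] idem(3)[of w'] by (cases w; cases w') auto

lemma idem_P: "idem w \<in> P (\<not> w)"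
  using idem by (simp add: P_def)

lemma idem_P_J: "a \<in> P w \<Longrightarrow> idem w * a \<in> J"
  by (cases w) (auto simp: J_def P_def S_mult p_mult idem(1) p_idem all_bool_eq)

lemma split_one: "x = act (idem True) x + act (idem False) x"
  by (simp add: act_add_left[symmetric] idem(4) act_one)

lemma P_submodule: "is_submodule S act (ideal_times act (P w) X)"
  by (rule ideal_times_submodule) (rule P_left)

lemma J_submodule: "is_submodule S act (ideal_times act J X)"
  by (rule ideal_times_submodule) (rule J_left)

lemma idem_ideal_times:
  assumes "x \<in> ideal_times act (P w) X" shows "act (idem w) x \<in> ideal_times act J X"
proof -
  have "ideal_times act (P w) X \<subseteq> {x. act (idem w) x \<in> ideal_times act J X}"
    by (rule ideal_times_least[OF vimage_subgroup(1)[OF ideal_times_subgroup]])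
      (auto simp: act_mult[symmetric] intro!: ideal_times_mem idem_P_J)
  thus ?thesis using assms by auto
qed

text \<open>The element \<open>idem w\<close> carries P w X into JX; hence both parts of an element
  of the intersection lie in JX.\<close>

lemma P_Int: "ideal_times act (P True) X \<inter> ideal_times act (P False) X = ideal_times act J X"
proof
  show "ideal_times act J X \<subseteq> ideal_times act (P True) X \<inter> ideal_times act (P False) X"
    using ideal_times_mono[OF J_P order_refl] by blast
  show "ideal_times act (P True) X \<inter> ideal_times act (P False) X \<subseteq> ideal_times act J X"
  proof
    fix x assume "x \<in> ideal_times act (P True) X \<inter> ideal_times act (P False) X"
    hence "act (idem True) x + act (idem False) x \<in> ideal_times act J X"
      using idem_ideal_times by (intro add_subgroup_add[OF ideal_times_subgroup]) auto
    thus "x \<in> ideal_times act J X" using split_one by simp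
  qed
qed

text \<open>The ranks of the two components do not depend on the lattice, because \<open>P w\<close> is invertible.\<close>

definition comp_rank :: "bool \<Rightarrow> nat" where "comp_rank w = R.len L' (ideal_times act (P w) L')"

lemma P_quo:
  assumes "lattice Y"
  shows "finite (quo Y (ideal_times act (P w) Y))" "idx Y (ideal_times act (P w) Y) = CARD('f) ^ comp_rank w"
    "ideal_times act (P w) Y \<in> sublattices Y"
proof -
  have PL: "ideal_times act (P w) L' \<subseteq> L'" by (rule ideal_times_subset[OF L'_submodule P_S])
  have gL: "is_add_subgroup L'" using L'_submodule by (rule submodule_subgroup)
  have "act (r ^ 1) ` L' \<subseteq> ideal_times act (P w) L'"
    using r_J J_P by (auto intro!: ideal_times_mem)
  moreover have "finite (quo L' (act (r ^ 1) ` L'))" using finite_r unfolding L'_def .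
  ultimately have fin: "finite (quo L' (ideal_times act (P w) L'))"
    using quo_tower(2)[OF act_image_subgroup[OF gL, of "r ^ 1"] ideal_times_subgroup[of act "P w" L'] gL _ PL] by simp
  obtain T where T: "\<forall>s\<in>S. \<forall>a\<in>T. s * a \<in> T" "ideal_times (*) (P w) T = S" "ideal_times (*) T (P w) = S"
    using invertible[of w] by (elim exE conjE)
  have *: "Y \<subseteq> L'" "finite (quo L' Y)" using assms by (auto simp: lattice_def)
  have Tl: "s * a \<in> T" if "s \<in> S" "a \<in> T" for s a using T(1) that by simp
  note inv = R.idx_mod_invertible[OF T(2,3) P_left Tl L'_submodule lattice_submodule[OF assms] * P_S fin]
  show "finite (quo Y (ideal_times act (P w) Y))" by (rule inv(2))
  thus "ideal_times act (P w) Y \<in> sublattices Y"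
    using P_submodule ideal_times_subset[OF lattice_submodule[OF assms] P_S] by (simp add: sublattices_def)
  show "idx Y (ideal_times act (P w) Y) = CARD('f) ^ comp_rank w"
    using inv(1) R.idx_len[OF L'_submodule P_submodule PL fin] by (simp add: comp_rank_def)
qed

definition components :: "'v set \<Rightarrow> (bool \<Rightarrow> 'v \<Rightarrow> nat \<Rightarrow> 'f) \<Rightarrow> bool" where
  "components Y g \<longleftrightarrow> (\<forall>w. R.semilinear (p w) Y (g w))"

lemma components_P:
  assumes "lattice Y"
  shows "\<exists>g. components Y g \<and> (\<forall>w. \<forall>x\<in>Y. g w x = 0 \<longleftrightarrow> x \<in> ideal_times act (P w) Y)"
proof -
  have "\<exists>f. R.semilinear (p w) Y f \<and> (\<forall>x\<in>Y. f x = 0 \<longleftrightarrow> x \<in> ideal_times act (P w) Y)" for w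
  proof -
    have kill: "act a x \<in> ideal_times act (P w) Y" if "a \<in> S" "p w a = 0" "x \<in> Y" for a x
      using that by (intro ideal_times_mem) (auto simp: P_def)
    show ?thesis
      by (rule R.coordinates[of "p w", OF p_diff p_mult p_one p_image lattice_submodule[OF assms] P_submodule
            ideal_times_subset[OF lattice_submodule[OF assms] P_S] P_quo(1)[OF assms] kill])
  qed
  hence "\<exists>g. \<forall>w. R.semilinear (p w) Y (g w) \<and> (\<forall>x\<in>Y. g w x = 0 \<longleftrightarrow> x \<in> ideal_times act (P w) Y)"
    by (rule choice[OF allI])
  thus ?thesis by (auto simp: components_def)
qed

context
  fixes Y g assumes Y: "is_submodule S act Y" and g: "components Y g"
begin

lemma comp_semilinear: "R.semilinear (p w) Y (g w)"
  using g by (simp add: components_def)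

lemma comp_mix:
  assumes "x \<in> Y" "y \<in> Y"
  shows "g True (act (idem True) x + act (idem False) y) = g True x"
    "g False (act (idem True) x + act (idem False) y) = g False y"
proof -
  have "act (idem w) x \<in> Y" "act (idem w) y \<in> Y" for w using submodule_act[OF Y idem(1)] assms by auto
  note add = R.semilinear_add[OF comp_semilinear submodule_subgroup[OF Y] this(1) this(2)]
  show "g True (act (idem True) x + act (idem False) y) = g True x"
    "g False (act (idem True) x + act (idem False) y) = g False y"
    using R.semilinear_act[OF comp_semilinear idem(1)] assms
    by (simp_all add: add p_idem fscale_def fun_eq_iff)
qed

text \<open>Mixing two elements of an \<open>S\<close>-submodule by the idempotents realizes every
  pair of coordinates, so the image is a full rectangle. This rests on the idempotents, neither of
  which belongs to \<open>Lam\<close>.\<close>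

lemma comp_image:
  assumes "is_submodule S act X" "X \<subseteq> Y"
  shows "(\<lambda>x. (g True x, g False x)) ` X = g True ` X \<times> g False ` X"
proof (intro equalityI subsetI)
  fix u assume "u \<in> g True ` X \<times> g False ` X"
  then obtain x y where xy: "u = (g True x, g False y)" "x \<in> X" "y \<in> X" by auto
  have "act (idem True) x + act (idem False) y \<in> X"
    using submodule_act[OF assms(1) idem(1)] xy by (intro add_subgroup_add[OF submodule_subgroup[OF assms(1)]]) auto
  moreover have "u = (\<lambda>x. (g True x, g False x)) (act (idem True) x + act (idem False) y)"
    using comp_mix[OF subsetD[OF assms(2) xy(2)] subsetD[OF assms(2) xy(3)]] xy(1) by simp
  ultimately show "u \<in> (\<lambda>x. (g True x, g False x)) ` X" by (rule rev_image_eqI)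
qed auto

lemma comp_subspace:
  assumes "is_submodule S act X" "X \<subseteq> Y"
  shows "fs.subspace (g w ` X)" "finite (g w ` X)"
  using R.semilinear_image_subspace[OF R.semilinear_mono[OF comp_semilinear assms(2)] assms(1) p_image]
    R.semilinear_finite[OF R.semilinear_mono[OF comp_semilinear assms(2)]] by auto

lemma comp_idx:
  assumes X: "is_submodule S act X" "X \<subseteq> Y" and K: "is_add_subgroup K"
    "\<And>x. x \<in> X \<Longrightarrow> x \<in> K \<longleftrightarrow> g True x = 0 \<and> g False x = 0"
  shows "idx X K = card (g True ` X) * card (g False ` X)" "finite (quo X K)"
proof -
  have "(g True x, g False x) = (g True y, g False y) \<longleftrightarrow> x - y \<in> K" if "x \<in> X" "y \<in> X" for x y
  proof -
    have "x \<in> Y" "y \<in> Y" "x - y \<in> X" using that X add_subgroup_diff[OF submodule_subgroup[OF X(1)]] by auto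
    thus ?thesis using K(2)[of "x - y"] R.semilinear_diff[OF comp_semilinear] by auto
  qed
  from idx_kernel[OF K(1), of X "\<lambda>x. (g True x, g False x)", OF this]
  show "idx X K = card (g True ` X) * card (g False ` X)" "finite (quo X K)"
    using comp_subspace(2)[OF X] unfolding comp_image[OF X] by (simp_all add: card_cartesian_product)
qed

definition preimage :: "(nat \<Rightarrow> 'f) set \<Rightarrow> (nat \<Rightarrow> 'f) set \<Rightarrow> 'v set" where
  "preimage D1 D2 = {y\<in>Y. g True y \<in> D1 \<and> g False y \<in> D2}"

lemma preimage_submodule:
  assumes "fs.subspace D1" "fs.subspace D2" shows "is_submodule S act (preimage D1 D2)"
  unfolding is_submodule_def is_add_subgroup_def preimage_def
proof (intro conjI ballI)
  note gY = submodule_subgroup[OF Y]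
  show "0 \<in> {y\<in>Y. g True y \<in> D1 \<and> g False y \<in> D2}"
    using add_subgroup_0[OF gY] R.semilinear_0[OF comp_semilinear gY]
      fs.subspace_0[OF assms(1)] fs.subspace_0[OF assms(2)] by simp
  show "x - y \<in> {y\<in>Y. g True y \<in> D1 \<and> g False y \<in> D2}"
    if "x \<in> {y\<in>Y. g True y \<in> D1 \<and> g False y \<in> D2}" "y \<in> {y\<in>Y. g True y \<in> D1 \<and> g False y \<in> D2}" for x y
    using that add_subgroup_diff[OF gY] R.semilinear_diff[OF comp_semilinear]
      fs.subspace_diff[OF assms(1)] fs.subspace_diff[OF assms(2)] by simp
  show "act a x \<in> {y\<in>Y. g True y \<in> D1 \<and> g False y \<in> D2}"
    if "a \<in> S" "x \<in> {y\<in>Y. g True y \<in> D1 \<and> g False y \<in> D2}" for a x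
    using that submodule_act[OF Y] R.semilinear_act[OF comp_semilinear]
      fs.subspace_scale[OF assms(1)] fs.subspace_scale[OF assms(2)] by simp
qed

lemma preimage_image:
  assumes "D1 \<subseteq> g True ` Y" "D2 \<subseteq> g False ` Y" "fs.subspace D1" "fs.subspace D2"
  shows "g True ` preimage D1 D2 = D1" "g False ` preimage D1 D2 = D2"
proof -
  have *: "\<exists>z\<in>preimage D1 D2. g True z = d1 \<and> g False z = d2" if "d1 \<in> D1" "d2 \<in> D2" for d1 d2
  proof -
    have "d1 \<in> g True ` Y" "d2 \<in> g False ` Y" using that assms(1,2) by auto
    then obtain x y where xy: "x \<in> Y" "y \<in> Y" "d1 = g True x" "d2 = g False y" by (elim imageE)
    have "act (idem True) x + act (idem False) y \<in> Y"
      using submodule_act[OF Y idem(1)] xy by (intro add_subgroup_add[OF submodule_subgroup[OF Y]]) auto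
    thus ?thesis using comp_mix[OF xy(1,2)] xy that
      by (intro bexI[of _ "act (idem True) x + act (idem False) y"]) (auto simp: preimage_def)
  qed
  have 0: "0 \<in> D1" "0 \<in> D2" by (rule fs.subspace_0[OF assms(3)], rule fs.subspace_0[OF assms(4)])
  show "g True ` preimage D1 D2 = D1"
  proof (intro equalityI subsetI)
    fix d assume "d \<in> D1"
    from *[OF this 0(2)] show "d \<in> g True ` preimage D1 D2" by auto
  qed (auto simp: preimage_def)
  show "g False ` preimage D1 D2 = D2"
  proof (intro equalityI subsetI)
    fix d assume "d \<in> D2"
    from *[OF 0(1) this] show "d \<in> g False ` preimage D1 D2" by auto
  qed (auto simp: preimage_def)
qed

text \<open>Both indices are compared with the common kernel of the coordinates, over which the
  index of a submodule is the product of the sizes of its two images.\<close>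

lemma preimage_idx:
  assumes D: "D1 \<subseteq> g True ` Y" "D2 \<subseteq> g False ` Y" "fs.subspace D1" "fs.subspace D2"
  shows "preimage D1 D2 \<in> sublattices Y"
    "R.len Y (preimage D1 D2) = (fs.dim (g True ` Y) - fs.dim D1) + (fs.dim (g False ` Y) - fs.dim D2)"
proof -
  let ?P = "preimage D1 D2" and ?K = "preimage {0} {0}"
  have PY: "?P \<subseteq> Y" by (auto simp: preimage_def)
  have P: "is_submodule S act ?P" by (rule preimage_submodule[OF D(3,4)])
  have K: "is_submodule S act ?K" by (rule preimage_submodule) (rule fs.subspace_single_0)+
  have KP: "?K \<subseteq> ?P" using fs.subspace_0[OF D(3)] fs.subspace_0[OF D(4)] by (auto simp: preimage_def)
  note g = submodule_subgroup[OF K] submodule_subgroup[OF P] submodule_subgroup[OF Y]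
  have 1: "idx Y ?K = card (g True ` Y) * card (g False ` Y)" "finite (quo Y ?K)"
    by (rule comp_idx[OF Y order_refl g(1)]; simp add: preimage_def)+
  have "idx ?P ?K = card (g True ` ?P) * card (g False ` ?P)" "finite (quo ?P ?K)"
    using PY by (intro comp_idx[OF P PY g(1)]; auto simp: preimage_def)+
  hence 2: "idx ?P ?K = card D1 * card D2" using preimage_image[OF D] by simp
  note t = quo_tower[OF g(1,2,3) KP PY]
  show PL: "?P \<in> sublattices Y" using P PY t 1 by (simp add: sublattices_def)
  note sp = comp_subspace[OF Y order_refl]
  have fD: "finite D1" "finite D2" using finite_subset[OF D(1) sp(2)] finite_subset[OF D(2) sp(2)] by auto
  let ?a = "fs.dim (g True ` Y)" and ?b = "fs.dim (g False ` Y)"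
  have le: "fs.dim D1 \<le> ?a" "fs.dim D2 \<le> ?b"
    using fs.dim_mono_finite[OF D(3) sp(2)[of True] sp(1) D(1)] fs.dim_mono_finite[OF D(4) sp(2)[of False] sp(1) D(2)] by auto
  have "idx Y ?P * CARD('f) ^ (fs.dim D1 + fs.dim D2) = CARD('f) ^ (?a + ?b)"
    using t(1) 1(1) 2 fs.card_dim[OF D(3) fD(1)] fs.card_dim[OF D(4) fD(2)]
      fs.card_dim[OF sp(1)[of True] sp(2)[of True]] fs.card_dim[OF sp(1)[of False] sp(2)[of False]]
    by (simp add: power_add)
  also have "CARD('f) ^ (?a + ?b) = CARD('f) ^ ((?a - fs.dim D1) + (?b - fs.dim D2)) * CARD('f) ^ (fs.dim D1 + fs.dim D2)"
    using le by (simp flip: power_add)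
  finally have "idx Y ?P = CARD('f) ^ ((?a - fs.dim D1) + (?b - fs.dim D2))" by simp
  thus "R.len Y ?P = (?a - fs.dim D1) + (?b - fs.dim D2)" by (rule R.len_eqI)
qed

end

end

definition subspaces :: "(nat \<Rightarrow> 'f::{field,finite}) set \<Rightarrow> (nat \<Rightarrow> 'f) set set" where
  "subspaces C = {E. fs.subspace E \<and> E \<subseteq> C}"

lemma finite_subspaces_of: "finite C \<Longrightarrow> finite (subspaces C)"
  unfolding subspaces_def by (rule finite_subset[of _ "Pow C"]) auto

lemma subspaces_trans: "D \<in> subspaces E \<Longrightarrow> E \<in> subspaces C \<Longrightarrow> D \<in> subspaces C"
  unfolding subspaces_def by blast

section \<open>Zeta functions over the maximal order by Moebius inversion\<close>

context lattice_pair
begin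

definition zeta :: "'v set \<Rightarrow> rat fps" where
  "zeta Y = genfun (sublattices Y) (R.len Y)"

text \<open>The value that \<open>zeta_eq\<close> will establish for every lattice. It depends only
  on the two ranks, which all lattices share.\<close>

definition zeta_maximal :: "rat fps" where
  "zeta_maximal = inverse (qpoch CARD('f) (comp_rank True) * qpoch CARD('f) (comp_rank False))"

lemma zeta_maximal_mult: "qpoch CARD('f) (comp_rank True) * qpoch CARD('f) (comp_rank False) * zeta_maximal = 1"
proof -
  have "fps_nth (qpoch CARD('f) (comp_rank True) * qpoch CARD('f) (comp_rank False)) 0 \<noteq> 0"
    by (simp add: qpoch_nth_0 fps_mult_nth_0)
  from inverse_mult_eq_1[OF this] show ?thesis by (simp add: zeta_maximal_def mult.commute)
qed

definition image_series :: "'v set \<Rightarrow> (bool \<Rightarrow> 'v \<Rightarrow> nat \<Rightarrow> 'f) \<Rightarrow> (nat \<Rightarrow> 'f) set \<Rightarrow> (nat \<Rightarrow> 'f) set \<Rightarrow> rat fps" where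
  "image_series Y g D1 D2 = genfun {X\<in>sublattices Y. g True ` X = D1 \<and> g False ` X = D2} (R.len Y)"

text \<open>The solution of the Moebius inversion when all lattices have series
  \<open>zeta_maximal\<close>: by the q-binomial theorem its sum over all subspaces of
  \<open>D1\<close> and \<open>D2\<close> collapses to X to the total codimension, times
  \<open>zeta_maximal\<close>.\<close>

definition image_series_value :: "'v set \<Rightarrow> (bool \<Rightarrow> 'v \<Rightarrow> nat \<Rightarrow> 'f) \<Rightarrow> (nat \<Rightarrow> 'f) set \<Rightarrow> (nat \<Rightarrow> 'f) set \<Rightarrow> rat fps" where
  "image_series_value Y g D1 D2 =
     (fps_X ^ (fs.dim (g True ` Y) - fs.dim D1) * qpoch CARD('f) (fs.dim D1)) *
     (fps_X ^ (fs.dim (g False ` Y) - fs.dim D2) * qpoch CARD('f) (fs.dim D2)) * zeta_maximal"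

context
  fixes Y g assumes latY: "lattice Y" and g: "components Y g"
begin

lemmas Ysub = lattice_submodule[OF latY]

lemma C_subspace: "fs.subspace (g w ` Y)" "finite (g w ` Y)"
  using comp_subspace[OF Ysub g Ysub order_refl] by auto

lemma sum_image_series:
  assumes D: "D1 \<in> subspaces (g True ` Y)" "D2 \<in> subspaces (g False ` Y)"
  shows "(\<Sum>F\<in>subspaces D1 \<times> subspaces D2. image_series Y g (fst F) (snd F)) =
    fps_X ^ ((fs.dim (g True ` Y) - fs.dim D1) + (fs.dim (g False ` Y) - fs.dim D2)) * zeta (preimage Y g D1 D2)"
proof -
  let ?P = "preimage Y g D1 D2"
  have D': "D1 \<subseteq> g True ` Y" "D2 \<subseteq> g False ` Y" "fs.subspace D1" "fs.subspace D2"
    using D by (auto simp: subspaces_def)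
  note P = preimage_idx[OF Ysub g D']
  let ?A = "{X\<in>sublattices Y. X \<subseteq> ?P}"
  let ?\<pi> = "\<lambda>X. (g True ` X, g False ` X)"
  have fin: "finite (subspaces D1 \<times> subspaces D2)"
    using finite_subset[OF D'(1) C_subspace(2)] finite_subset[OF D'(2) C_subspace(2)]
    by (intro finite_cartesian_product finite_subspaces_of)
  have lev: "finite {X\<in>?A. R.len Y X = n}" for n
    by (rule finite_subset[OF _ finite_level[OF latY, of n]]) auto
  have map: "?\<pi> X \<in> subspaces D1 \<times> subspaces D2" if "X \<in> ?A" for X
  proof -
    have "is_submodule S act X" "X \<subseteq> Y" using that by (auto simp: sublattices_def)
    from comp_subspace(1)[OF Ysub g this] show ?thesis using that by (auto simp: subspaces_def preimage_def[OF Ysub g])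
  qed
  have "genfun ?A (R.len Y) = (\<Sum>F\<in>subspaces D1 \<times> subspaces D2. genfun {X\<in>?A. ?\<pi> X = F} (R.len Y))"
    by (rule genfun_partition[OF lev fin map])
  also have "\<dots> = (\<Sum>F\<in>subspaces D1 \<times> subspaces D2. image_series Y g (fst F) (snd F))"
  proof (rule sum.cong[OF refl])
    fix F assume F: "F \<in> subspaces D1 \<times> subspaces D2"
    have "{X\<in>?A. ?\<pi> X = F} = {X\<in>sublattices Y. g True ` X = fst F \<and> g False ` X = snd F}"
    proof (intro equalityI subsetI)
      fix X assume X: "X \<in> {X\<in>sublattices Y. g True ` X = fst F \<and> g False ` X = snd F}"
      hence "g True ` X \<subseteq> D1" "g False ` X \<subseteq> D2" "X \<subseteq> Y" using F by (auto simp: subspaces_def sublattices_def)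
      hence "X \<subseteq> ?P" by (auto simp: preimage_def[OF Ysub g])
      thus "X \<in> {X\<in>?A. ?\<pi> X = F}" using X by (simp add: prod_eq_iff)
    qed auto
    thus "genfun {X\<in>?A. ?\<pi> X = F} (R.len Y) = image_series Y g (fst F) (snd F)" by (simp add: image_series_def)
  qed
  also have "?A = sublattices ?P" by (rule sublattices_restrict[OF latY P(1)])
  also have "genfun (sublattices ?P) (R.len Y) = fps_X ^ R.len Y ?P * genfun (sublattices ?P) (R.len ?P)"
    by (rule genfun_shift) (rule len_tower(1)[OF latY P(1)])
  finally show ?thesis by (simp add: P(2) zeta_def)
qed

lemma sum_image_series_value:
  assumes D: "D1 \<in> subspaces (g True ` Y)" "D2 \<in> subspaces (g False ` Y)"
  shows "(\<Sum>F\<in>subspaces D1 \<times> subspaces D2. image_series_value Y g (fst F) (snd F)) =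
    fps_X ^ ((fs.dim (g True ` Y) - fs.dim D1) + (fs.dim (g False ` Y) - fs.dim D2)) * zeta_maximal"
proof -
  have *: "(\<Sum>F\<in>subspaces D. fps_X ^ (fs.dim (g w ` Y) - fs.dim F) * qpoch CARD('f) (fs.dim F)) =
     fps_X ^ (fs.dim (g w ` Y) - fs.dim D)" if D: "D \<in> subspaces (g w ` Y)" for D w
  proof -
    have D': "fs.subspace D" "finite D" "D \<subseteq> g w ` Y"
      using D finite_subset[OF _ C_subspace(2)[of w]] by (auto simp: subspaces_def)
    have "(\<Sum>F\<in>subspaces D. fps_X ^ (fs.dim (g w ` Y) - fs.dim F) * qpoch CARD('f) (fs.dim F)) =
      (\<Sum>F\<in>subspaces D. fps_X ^ (fs.dim (g w ` Y) - fs.dim D) *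
         (fps_X ^ (fs.dim D - fs.dim F) * qpoch CARD('f) (fs.dim F)))"
    proof (rule sum.cong[OF refl])
      fix F assume "F \<in> subspaces D"
      hence "fs.dim F \<le> fs.dim D" using D' by (auto simp: subspaces_def intro: fs.dim_mono_finite)
      moreover have "fs.dim D \<le> fs.dim (g w ` Y)" using D' C_subspace by (intro fs.dim_mono_finite)
      ultimately have "fs.dim (g w ` Y) - fs.dim F = (fs.dim (g w ` Y) - fs.dim D) + (fs.dim D - fs.dim F)" by simp
      thus "fps_X ^ (fs.dim (g w ` Y) - fs.dim F) * qpoch CARD('f) (fs.dim F) =
        fps_X ^ (fs.dim (g w ` Y) - fs.dim D) * (fps_X ^ (fs.dim D - fs.dim F) * qpoch CARD('f) (fs.dim F))"
        by (simp only: power_add mult.assoc)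
    qed
    also have "\<dots> = fps_X ^ (fs.dim (g w ` Y) - fs.dim D) * 1"
      unfolding sum_distrib_left[symmetric] unfolding subspaces_def fs.sum_subspaces_qpoch[OF D'(1,2)] ..
    finally show ?thesis by simp
  qed
  have "(\<Sum>F\<in>subspaces D1 \<times> subspaces D2. image_series_value Y g (fst F) (snd F)) =
    (\<Sum>F1\<in>subspaces D1. fps_X ^ (fs.dim (g True ` Y) - fs.dim F1) * qpoch CARD('f) (fs.dim F1)) *
    (\<Sum>F2\<in>subspaces D2. fps_X ^ (fs.dim (g False ` Y) - fs.dim F2) * qpoch CARD('f) (fs.dim F2)) * zeta_maximal"
    unfolding image_series_value_def sum_distrib_right[symmetric] sum_product sum.cartesian_product
    by (simp add: case_prod_unfold)
  thus ?thesis using *[OF D(1)] *[OF D(2)] by (simp add: power_add)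
qed

text \<open>The inversion is carried out for a single coefficient, because during the induction the
  zeta functions are known only in low degrees. Degree n of the sum below (D1, D2) involves the zeta
  function of the preimage only in degree n minus the codimension. Hence the difference of the two
  sides has vanishing lower sums.\<close>

lemma image_series_coeff:
  assumes E: "E1 \<in> subspaces (g True ` Y)" "E2 \<in> subspaces (g False ` Y)"
    and hyp: "\<And>D1 D2. D1 \<in> subspaces E1 \<Longrightarrow> D2 \<in> subspaces E2 \<Longrightarrow>
      (fs.dim (g True ` Y) - fs.dim D1) + (fs.dim (g False ` Y) - fs.dim D2) \<le> n \<Longrightarrow>
      fps_nth (zeta (preimage Y g D1 D2)) (n - ((fs.dim (g True ` Y) - fs.dim D1) + (fs.dim (g False ` Y) - fs.dim D2))) =
      fps_nth zeta_maximal (n - ((fs.dim (g True ` Y) - fs.dim D1) + (fs.dim (g False ` Y) - fs.dim D2)))"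
  shows "fps_nth (image_series Y g E1 E2) n = fps_nth (image_series_value Y g E1 E2) n"
proof -
  let ?S = "subspaces (g True ` Y) \<times> subspaces (g False ` Y)"
  let ?below = "\<lambda>F E :: (nat \<Rightarrow> 'f) set \<times> (nat \<Rightarrow> 'f) set. fst F \<subseteq> fst E \<and> snd F \<subseteq> snd E"
  let ?m = "\<lambda>F :: (nat \<Rightarrow> 'f) set \<times> (nat \<Rightarrow> 'f) set. fs.dim (fst F) + fs.dim (snd F)"
  let ?d = "\<lambda>F. fps_nth (image_series Y g (fst F) (snd F)) n - fps_nth (image_series_value Y g (fst F) (snd F)) n"
  have low: "{z\<in>?S. ?below z y} = subspaces (fst y) \<times> subspaces (snd y)" if "y \<in> ?S" for y
  proof (intro equalityI subsetI)
    fix z assume z: "z \<in> subspaces (fst y) \<times> subspaces (snd y)"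
    hence z': "fst z \<in> subspaces (fst y)" "snd z \<in> subspaces (snd y)" by auto
    have "fst y \<in> subspaces (g True ` Y)" "snd y \<in> subspaces (g False ` Y)" using that by auto
    hence "fst z \<in> subspaces (g True ` Y)" "snd z \<in> subspaces (g False ` Y)"
      using subspaces_trans[OF z'(1)] subspaces_trans[OF z'(2)] by simp_all
    moreover have "fst z \<subseteq> fst y" "snd z \<subseteq> snd y" using z' by (simp_all add: subspaces_def)
    ultimately show "z \<in> {z\<in>?S. ?below z y}" by (simp add: mem_Times_iff)
  next
    fix z assume "z \<in> {z\<in>?S. ?below z y}"
    thus "z \<in> subspaces (fst y) \<times> subspaces (snd y)" by (cases z) (auto simp: subspaces_def)
  qed
  have "?d (E1, E2) = 0"
  proof (rule zero_if_lower_sums_zero[where S = ?S and below = ?below and m = ?m])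
    show "(E1, E2) \<in> ?S" using E by simp
    show "finite {y \<in> ?S. ?below y x}" for x
      using C_subspace(2) finite_subspaces_of by (intro finite_subset[OF _ finite_cartesian_product[of "subspaces (g True ` Y)" "subspaces (g False ` Y)"]]) auto
    show "?m y < ?m x" if "x \<in> ?S" "y \<in> ?S" "?below y x" "y \<noteq> x" for x y
    proof -
      have *: "fs.subspace (fst x)" "fs.subspace (snd x)" "fs.subspace (fst y)" "fs.subspace (snd y)"
        "finite (fst x)" "finite (snd x)"
        using that finite_subset[OF _ C_subspace(2)[of True]] finite_subset[OF _ C_subspace(2)[of False]]
        by (auto simp: subspaces_def)
      have le: "fs.dim (fst y) \<le> fs.dim (fst x)" "fs.dim (snd y) \<le> fs.dim (snd x)"
        using that * by (auto intro: fs.dim_mono_finite)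
      have "fst y \<noteq> fst x \<or> snd y \<noteq> snd x" using that(4) by (auto simp: prod_eq_iff)
      thus ?thesis
      proof
        assume "fst y \<noteq> fst x"
        hence "fs.dim (fst y) < fs.dim (fst x)" using that * by (auto intro: fs.dim_strict_mono_finite)
        thus ?thesis using le by simp
      next
        assume "snd y \<noteq> snd x"
        hence "fs.dim (snd y) < fs.dim (snd x)" using that * by (auto intro: fs.dim_strict_mono_finite)
        thus ?thesis using le by simp
      qed
    qed
    show "(\<Sum>z\<in>{z\<in>?S. ?below z y}. ?d z) = 0" if y: "y \<in> ?S" "?below y (E1, E2)" for y
    proof -
      let ?k = "(fs.dim (g True ` Y) - fs.dim (fst y)) + (fs.dim (g False ` Y) - fs.dim (snd y))"
      have y': "fst y \<in> subspaces (g True ` Y)" "snd y \<in> subspaces (g False ` Y)"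
        "fst y \<in> subspaces E1" "snd y \<in> subspaces E2" using y by (auto simp: subspaces_def)
      have "(\<Sum>z\<in>{z\<in>?S. ?below z y}. ?d z) =
        fps_nth (\<Sum>F\<in>subspaces (fst y) \<times> subspaces (snd y). image_series Y g (fst F) (snd F)) n -
        fps_nth (\<Sum>F\<in>subspaces (fst y) \<times> subspaces (snd y). image_series_value Y g (fst F) (snd F)) n"
        unfolding low[OF y(1)] by (simp add: sum_subtractf fps_sum_nth)
      also have "\<dots> = 0"
        unfolding sum_image_series[OF y'(1,2)] sum_image_series_value[OF y'(1,2)]
        using hyp[OF y'(3,4)] by (simp add: fps_X_power_mult_nth)
      finally show ?thesis .
    qed
  qed auto
  thus ?thesis by simp
qed

end

text \<open>Summing the series with prescribed images over all images gives the zeta function. Below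
  the full image only coefficients of smaller degree of other lattices occur, to which the induction
  hypothesis applies. The full image is attained by \<open>Y\<close> alone and contributes 1, which
  is also what the predicted value gives. The induction therefore has to range over all
  lattices.\<close>

lemma zeta_coeff: "lattice Y \<Longrightarrow> fps_nth (zeta Y) n = fps_nth zeta_maximal n"
proof (induction n arbitrary: Y rule: less_induct)
  case (less n)
  note latY = less.prems
  note Ysub = lattice_submodule[OF latY]
  obtain g where g: "components Y g" and ker': "\<forall>w. \<forall>x\<in>Y. g w x = 0 \<longleftrightarrow> x \<in> ideal_times act (P w) Y"
    using components_P[OF latY] by (elim exE conjE)
  have ker: "g w x = 0 \<longleftrightarrow> x \<in> ideal_times act (P w) Y" if "x \<in> Y" for w x
    using ker' that by simp
  note C = C_subspace[OF latY g]
  have dimC: "fs.dim (g w ` Y) = comp_rank w" for w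
  proof -
    have "R.semilinear (p w) Y (g w)" using g by (simp add: components_def)
    from R.semilinear_idx(1)[OF this submodule_subgroup[OF Ysub] ideal_times_subgroup ker]
    have "CARD('f) ^ comp_rank w = CARD('f) ^ fs.dim (g w ` Y)"
      using P_quo(2)[OF latY, of w] fs.card_dim[OF C] by simp
    thus ?thesis by (simp add: fs.card_power_inject)
  qed
  let ?C1 = "g True ` Y" and ?C2 = "g False ` Y"
  let ?I = "subspaces ?C1 \<times> subspaces ?C2"
  have Cin: "?C1 \<in> subspaces ?C1" "?C2 \<in> subspaces ?C2" using C by (auto simp: subspaces_def)
  have finI: "finite ?I" using C finite_subspaces_of by auto
  \<comment> \<open>If \<open>X\<close> has full image in both components, then since images are
    rectangles every y in \<open>Y\<close> agrees with some x in \<open>X\<close> in both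
    coordinates. Thus X + JY = Y, and Nakayama's lemma gives X = Y.\<close>
  have "{X\<in>sublattices Y. g True ` X = ?C1 \<and> g False ` X = ?C2} = {Y}"
  proof (intro equalityI subsetI)
    fix X assume "X \<in> {X\<in>sublattices Y. g True ` X = ?C1 \<and> g False ` X = ?C2}"
    hence X: "is_submodule S act X" "X \<subseteq> Y" "finite (quo Y X)" "g True ` X = ?C1" "g False ` X = ?C2"
      by (auto simp: sublattices_def)
    have "y \<in> ssum X (ideal_times act J Y)" if y: "y \<in> Y" for y
    proof -
      have "(g True y, g False y) \<in> (\<lambda>x. (g True x, g False x)) ` X"
        using comp_image[OF Ysub g X(1,2)] X(4,5) y by auto
      then obtain x where x: "x \<in> X" "g True x = g True y" "g False x = g False y" by auto
      have d: "y - x \<in> Y" using x(1) X(2) y add_subgroup_diff[OF submodule_subgroup[OF Ysub]] by auto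
      have "g w (y - x) = 0" for w
        using R.semilinear_diff[OF comp_semilinear[OF Ysub g] y subsetD[OF X(2) x(1)], of w] x
        by (cases w) auto
      hence "y - x \<in> ideal_times act J Y" using ker[OF d] P_Int[of Y] by blast
      moreover have "y = x + (y - x)" by simp
      ultimately show ?thesis using x(1) unfolding ssum_def by blast
    qed
    moreover have "ssum X (ideal_times act J Y) \<subseteq> Y"
      using X(2) ideal_times_subset[OF Ysub J_S] by (intro ssum_least submodule_subgroup[OF Ysub])
    ultimately have "ssum X (ideal_times act J Y) = Y" by auto
    thus "X \<in> {Y}" using R.nakayama[OF Ysub X(1-3)] by simp
  qed (use lattice_self[OF latY] in auto)
  hence "image_series Y g ?C1 ?C2 = genfun {Y} (R.len Y)" by (simp only: image_series_def)
  also have "\<dots> = 1"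
  proof (rule fps_ext)
    fix n
    have "R.len Y Y = 0" using R.len_eqI[of Y Y 0] idx_self(1)[OF submodule_subgroup[OF Ysub]] by simp
    hence "{x\<in>{Y}. R.len Y x = n} = (if n = 0 then {Y} else {})" by auto
    thus "fps_nth (genfun {Y} (R.len Y)) n = fps_nth 1 n"
      unfolding genfun_def fps_nth_Abs_fps by (simp only:) simp
  qed
  finally have top: "image_series Y g ?C1 ?C2 = 1" .
  \<comment> \<open>At the full image both codimensions are 0, and the two \<open>qpoch\<close>
    factors cancel \<open>zeta_maximal\<close>, which is their inverse.\<close>
  have top': "image_series_value Y g ?C1 ?C2 = 1"
    using zeta_maximal_mult by (simp add: image_series_value_def dimC)
  have preY: "preimage Y g ?C1 ?C2 = Y" by (auto simp: preimage_def[OF Ysub g])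
  have rest: "fps_nth (image_series Y g (fst F) (snd F)) n = fps_nth (image_series_value Y g (fst F) (snd F)) n"
    if F: "F \<in> ?I" for F
  proof (cases "F = (?C1, ?C2)")
    case True thus ?thesis using top top' by simp
  next
    case False
    have F': "fst F \<in> subspaces ?C1" "snd F \<in> subspaces ?C2" using F by auto
    show ?thesis
    proof (rule image_series_coeff[OF latY g F'])
      fix D1 D2 assume D: "D1 \<in> subspaces (fst F)" "D2 \<in> subspaces (snd F)"
      let ?k = "(fs.dim ?C1 - fs.dim D1) + (fs.dim ?C2 - fs.dim D2)"
      assume kn: "?k \<le> n"
      have D': "D1 \<subseteq> ?C1" "D2 \<subseteq> ?C2" "fs.subspace D1" "fs.subspace D2"
        using D F' by (auto simp: subspaces_def)
      have "D1 \<noteq> ?C1 \<or> D2 \<noteq> ?C2" using D F' False by (auto simp: subspaces_def prod_eq_iff)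
      hence "fs.dim D1 < fs.dim ?C1 \<or> fs.dim D2 < fs.dim ?C2"
        using fs.dim_strict_mono_finite[OF D'(3) C(2) C(1) D'(1)] fs.dim_strict_mono_finite[OF D'(4) C(2) C(1) D'(2)] by blast
      \<comment> \<open>The strict inequality is what makes the induction on the degree work: the
        full image has already been treated directly.\<close>
      hence "?k > 0" by auto
      hence "n - ?k < n" using kn by linarith
      thus "fps_nth (zeta (preimage Y g D1 D2)) (n - ?k) = fps_nth zeta_maximal (n - ?k)"
        by (rule less.IH[OF _ sublattice_lattice[OF latY preimage_idx(1)[OF Ysub g D']]])
    qed
  qed
  have "zeta Y = (\<Sum>F\<in>?I. image_series Y g (fst F) (snd F))"
    using sum_image_series[OF latY g Cin] preY by simp
  hence "fps_nth (zeta Y) n = (\<Sum>F\<in>?I. fps_nth (image_series Y g (fst F) (snd F)) n)" by (simp add: fps_sum_nth)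
  also have "\<dots> = (\<Sum>F\<in>?I. fps_nth (image_series_value Y g (fst F) (snd F)) n)" by (rule sum.cong[OF refl rest])
  also have "\<dots> = fps_nth (\<Sum>F\<in>?I. image_series_value Y g (fst F) (snd F)) n" by (simp add: fps_sum_nth)
  also have "(\<Sum>F\<in>?I. image_series_value Y g (fst F) (snd F)) = zeta_maximal"
    using sum_image_series_value[OF latY g Cin] by simp
  finally show ?case .
qed

lemma zeta_eq: "lattice Y \<Longrightarrow> zeta Y = zeta_maximal"
  by (rule fps_ext) (rule zeta_coeff)

lemma image_series_eq:
  assumes "lattice Y" "components Y g" "E1 \<in> subspaces (g True ` Y)" "E2 \<in> subspaces (g False ` Y)"
  shows "image_series Y g E1 E2 = image_series_value Y g E1 E2"
proof (rule fps_ext, rule image_series_coeff[OF assms])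
  fix n D1 D2 assume D: "D1 \<in> subspaces E1" "D2 \<in> subspaces E2"
  have "D1 \<subseteq> g True ` Y" "D2 \<subseteq> g False ` Y" "fs.subspace D1" "fs.subspace D2"
    using D assms(3,4) by (auto simp: subspaces_def)
  from preimage_idx(1)[OF lattice_submodule[OF assms(1)] assms(2) this]
  have "lattice (preimage Y g D1 D2)" by (rule sublattice_lattice[OF assms(1)])
  thus "fps_nth (zeta (preimage Y g D1 D2)) k = fps_nth zeta_maximal k" for k by (rule zeta_coeff)
qed

end

section \<open>Lattices over the diagonal suborder\<close>

context lattice_pair
begin

lemma Lam_S: "Lam \<subseteq> S" and J_subset_Lam: "J \<subseteq> Lam"
  by (auto simp: Lam_def J_def)

lemma Lam_p: "a \<in> Lam \<Longrightarrow> p w a = p True a"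
  by (cases w) (auto simp: Lam_def)

lemma Lam_ring: "1 \<in> Lam" "a \<in> Lam \<Longrightarrow> b \<in> Lam \<Longrightarrow> a - b \<in> Lam" "a \<in> Lam \<Longrightarrow> b \<in> Lam \<Longrightarrow> a * b \<in> Lam"
  by (auto simp: Lam_def S_one S_diff S_mult p_one p_diff p_mult)

lemma Lam_hom:
  "a \<in> Lam \<Longrightarrow> b \<in> Lam \<Longrightarrow> p True (a - b) = p True a - p True b"
  "a \<in> Lam \<Longrightarrow> b \<in> Lam \<Longrightarrow> p True (a * b) = p True a * p True b"
  by (auto simp: Lam_def p_diff p_mult)

lemma Lam_surj: "\<exists>a\<in>Lam. p True a = c"
  using p_surj[of c c] by (auto simp: Lam_def)

lemma Lam_image: "p True ` Lam = UNIV"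
proof -
  have "c \<in> p True ` Lam" for c using Lam_surj[of c] by auto
  thus ?thesis by auto
qed

lemma Lam_kernel: "a \<in> Lam \<Longrightarrow> p True a = 0 \<Longrightarrow> a \<in> J"
  by (auto simp: Lam_def J_def all_bool_eq)

lemma residue_ring_Lam: "residue_ring act Lam J (CARD('f))"
proof -
  interpret Lm: ring_acting act Lam by unfold_locales (auto intro: Lam_ring)
  show ?thesis
  proof
    show "CARD('f) > 1" by (rule R.q_gt_1)
    show "J \<subseteq> jacobson_radical Lam" by (rule J_Lam)
    fix X Z assume max: "maximal_submodule Lam act X Z"
    have kill: "act a x \<in> Z" if "a \<in> Lam" "p True a = 0" "x \<in> X" for a x
      using Lm.jacobson_radical_kills[OF max] Lam_kernel[OF that(1,2)] J_Lam that(3) by auto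
    have "idx X Z = CARD('f)" "finite (quo X Z)"
      by (rule Lm.idx_maximal_submodule[OF max Lam_hom p_one Lam_image kill], assumption+)+
    thus "idx X Z = CARD('f) \<and> finite (quo X Z)" by simp
  qed
qed

end

sublocale lattice_pair \<subseteq> Q: residue_ring act Lam J "CARD('f)"
  by (rule residue_ring_Lam)

context lattice_pair
begin

lemma S_act_submodule: "is_submodule S act (ideal_times act S X)"
  by (rule ideal_times_submodule) (rule S_mult)

lemma S_act_superset: "X \<subseteq> ideal_times act S X"
  using ideal_times_mem[OF S_one, of _ X act] act_one by auto

lemma L'_eq: "L' = ideal_times act S L"
proof
  show "L' \<subseteq> ideal_times act S L"
    unfolding L'_def by (intro hull_minimal S_act_superset S_act_submodule)
  have "L \<subseteq> L'" unfolding L'_def by (rule hull_subset)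
  thus "ideal_times act S L \<subseteq> L'"
    using submodule_act[OF L'_submodule] by (intro ideal_times_least submodule_subgroup[OF L'_submodule]) auto
qed

lemma L_L': "L \<subseteq> L'"
  unfolding L'_eq by (rule S_act_superset)

text \<open>\<open>J\<close> is also a right ideal of \<open>S\<close>, so it absorbs the factor
  \<open>S\<close>. Consequently JL' = JL, which is contained in \<open>L\<close>.\<close>

lemma J_S_act: "ideal_times act J (ideal_times act S X) = ideal_times act J X"
proof
  have "ideal_times (*) J S \<subseteq> J"
  proof (rule ideal_times_least)
    show "is_add_subgroup J"
      by (auto simp: J_def is_add_subgroup_def S_0 p_0 S_diff p_diff)
  qed (rule J_right)
  thus "ideal_times act J (ideal_times act S X) \<subseteq> ideal_times act J X"
    unfolding ideal_times_assoc[symmetric] by (rule ideal_times_mono) simp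
  show "ideal_times act J X \<subseteq> ideal_times act J (ideal_times act S X)"
    by (rule ideal_times_mono[OF order_refl S_act_superset])
qed

lemma J_L': "ideal_times act J L' = ideal_times act J L"
  unfolding L'_eq by (rule J_S_act)

lemma J_L'_L: "ideal_times act J L' \<subseteq> L"
  unfolding J_L' by (rule ideal_times_subset[OF L_submodule J_subset_Lam])

lemma L_subgroup: "is_add_subgroup L" and L'_subgroup: "is_add_subgroup L'"
  using L_submodule L'_submodule submodule_subgroup by auto

lemma L'_Lam: "is_submodule Lam act L'"
  by (rule submodule_mono[OF L'_submodule Lam_S])

lemma r_L': "act (r ^ 1) ` L' \<subseteq> L"
  using J_L'_L ideal_times_mem[OF r_J, of _ L' act] by auto

lemma finite_quo_J: "lattice Y \<Longrightarrow> finite (quo Y (ideal_times act J Y))"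
proof -
  assume Y: "lattice Y"
  obtain k where k: "act (r ^ k) ` L' \<subseteq> Y" using lattice_contains_r[OF Y] by (elim exE)
  note gY = lattice_subgroup[OF Y]
  have "act (r ^ 1) ` Y \<subseteq> ideal_times act J Y" using r_J by (auto intro!: ideal_times_mem)
  moreover have JY: "ideal_times act J Y \<subseteq> Y" by (rule ideal_times_subset[OF lattice_submodule[OF Y] J_S])
  moreover have "finite (quo Y (act (r ^ 1) ` Y))"
    using calculation Y by (intro finite_quo_r[OF gY _ k]) (auto simp: lattice_def)
  ultimately show ?thesis
    using quo_tower(2)[OF act_image_subgroup[OF gY, of "r ^ 1"] ideal_times_subgroup[of act J Y] gY] by simp
qed

lemma finite_L'_L: "finite (quo L' L)"
  using quo_tower(2)[OF ideal_times_subgroup[of act J L'] L_subgroup L'_subgroup J_L'_L L_L']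
    finite_quo_J[OF lattice_L'] by simp

definition quot_rank :: nat where "quot_rank = Q.len L' L"

lemma idx_L'_L: "idx L' L = CARD('f) ^ quot_rank"
  unfolding quot_rank_def by (rule Q.idx_len[OF L'_Lam L_submodule L_L' finite_L'_L])

text \<open>Coordinates on L'/L, on which \<open>Lam\<close> acts through its residue field because
  \<open>L\<close> contains JL'.\<close>

definition quot_coord :: "'v \<Rightarrow> nat \<Rightarrow> 'f" where
  "quot_coord = (SOME f. Q.semilinear (p True) L' f \<and> (\<forall>x\<in>L'. f x = 0 \<longleftrightarrow> x \<in> L))"

lemma quot_coord: "Q.semilinear (p True) L' quot_coord" "x \<in> L' \<Longrightarrow> quot_coord x = 0 \<longleftrightarrow> x \<in> L"
proof -
  have kill: "act a x \<in> L" if "a \<in> Lam" "p True a = 0" "x \<in> L'" for a x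
    using J_L'_L ideal_times_mem[OF Lam_kernel[OF that(1,2)] that(3), of act] by auto
  have "\<exists>f. Q.semilinear (p True) L' f \<and> (\<forall>x\<in>L'. f x = 0 \<longleftrightarrow> x \<in> L)"
    by (rule Q.coordinates[OF Lam_hom p_one Lam_image L'_Lam L_submodule L_L' finite_L'_L kill]; assumption)
  from someI_ex[OF this]
  have "Q.semilinear (p True) L' quot_coord \<and> (\<forall>x\<in>L'. quot_coord x = 0 \<longleftrightarrow> x \<in> L)" unfolding quot_coord_def .
  thus "Q.semilinear (p True) L' quot_coord" "x \<in> L' \<Longrightarrow> quot_coord x = 0 \<longleftrightarrow> x \<in> L" by auto
qed

definition quot_space :: "(nat \<Rightarrow> 'f) set" where "quot_space = quot_coord ` L'"

lemma quot_space: "fs.subspace quot_space" "finite quot_space" "fs.dim quot_space = quot_rank"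
proof -
  show 1: "fs.subspace quot_space" unfolding quot_space_def
    by (rule Q.semilinear_image_subspace[OF quot_coord(1) L'_Lam Lam_image])
  show 2: "finite quot_space" unfolding quot_space_def by (rule Q.semilinear_finite[OF quot_coord(1)])
  have "CARD('f) ^ quot_rank = CARD('f) ^ fs.dim quot_space"
    using Q.semilinear_idx(1)[OF quot_coord(1) L'_subgroup L_subgroup quot_coord(2)] idx_L'_L fs.card_dim[OF 1 2]
    by (simp add: quot_space_def)
  thus "fs.dim quot_space = quot_rank" by (simp add: fs.card_power_inject)
qed

text \<open>The class in L'/L of the part of \<open>x\<close> in the component \<open>w\<close>.
  \<open>quot_coord\<close> is only \<open>Lam\<close>-semilinear; restricted to one component it
  becomes \<open>S\<close>-semilinear along \<open>p w\<close>, so that the results on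
  \<open>S\<close>-lattices apply to L'/L.\<close>

definition half_coord :: "bool \<Rightarrow> 'v \<Rightarrow> nat \<Rightarrow> 'f" where "half_coord w x = quot_coord (act (idem w) x)"

lemma idem_L': "x \<in> L' \<Longrightarrow> act (idem w) x \<in> L'"
  by (rule submodule_act[OF L'_submodule idem(1)])

lemma quot_coord_J: "a \<in> J \<Longrightarrow> x \<in> L' \<Longrightarrow> quot_coord (act a x) = 0"
  using quot_coord(2)[of "act a x"] J_L'_L ideal_times_mem[of a J x L' act] J_S submodule_act[OF L'_submodule, of a x] by auto

lemma quot_coord_cong:
  assumes "a \<in> S" "b \<in> S" "a - b \<in> J" "x \<in> L'" shows "quot_coord (act a x) = quot_coord (act b x)"
proof -
  have "quot_coord (act a x - act b x) = 0" using quot_coord_J[OF assms(3,4)] by (simp add: act_diff_left)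
  moreover have "act a x \<in> L'" "act b x \<in> L'" using assms submodule_act[OF L'_submodule] by auto
  ultimately show ?thesis using Q.semilinear_diff[OF quot_coord(1), of "act a x" "act b x"] by simp
qed

lemma half_coord_components: "components L' half_coord"
  unfolding components_def R.semilinear_def
proof (intro allI conjI ballI)
  fix w x y assume xy: "x \<in> L'" "y \<in> L'"
  show "half_coord w (x - y) = half_coord w x - half_coord w y"
    using Q.semilinear_diff[OF quot_coord(1) idem_L'[OF xy(1)] idem_L'[OF xy(2)]] by (simp add: half_coord_def act_diff_right)
next
  fix w a x assume a: "a \<in> S" and x: "x \<in> L'"
  \<comment> \<open>On the component \<open>w\<close> the element \<open>a\<close> acts like an
    element \<open>b\<close> of \<open>Lam\<close>: modulo \<open>J\<close>,
    \<open>idem w * a\<close> equals \<open>b * idem w\<close>.\<close>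
  obtain b where b: "b \<in> Lam" "p True b = p w a" using Lam_surj[of "p w a"] by (elim bexE)
  have bS: "b \<in> S" using b Lam_S by auto
  have "p w' (idem w * a - b * idem w) = 0" for w'
    using a bS b Lam_p[OF b(1), of w'] by (simp add: p_diff p_mult S_mult idem(1) p_idem)
  hence "idem w * a - b * idem w \<in> J" using a bS by (simp add: J_def S_diff S_mult idem(1))
  from quot_coord_cong[OF S_mult[OF idem(1) a] S_mult[OF bS idem(1)] this x]
  have "half_coord w (act a x) = quot_coord (act b (act (idem w) x))" by (simp add: half_coord_def act_mult)
  thus "half_coord w (act a x) = fscale (p w a) (half_coord w x)"
    using Q.semilinear_act[OF quot_coord(1) b(1) idem_L'[OF x]] b(2) by (simp add: half_coord_def)
next
  fix w
  show "finite (half_coord w ` L')"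
    by (rule finite_subset[OF _ quot_space(2)]) (auto simp: half_coord_def quot_space_def intro: idem_L')
qed

lemma quot_coord_half_coord:
  assumes "x \<in> L'" shows "quot_coord x = half_coord True x + half_coord False x"
proof -
  have "quot_coord (act (idem True) x + act (idem False) x) = half_coord True x + half_coord False x"
    unfolding half_coord_def using assms by (intro Q.semilinear_add[OF quot_coord(1) L'_subgroup] idem_L')
  thus ?thesis using split_one[of x] by simp
qed

lemmas half_coord_subspace = comp_subspace[OF L'_submodule half_coord_components]
lemmas half_coord_semilinear = comp_semilinear[OF L'_submodule half_coord_components]

text \<open>Modulo \<open>J\<close>, \<open>S\<close> is generated by \<open>Lam\<close> and either one of the two idempotents.\<close>

lemma half_coord_image: "half_coord w ` L' = quot_space"
proof
  show "half_coord w ` L' \<subseteq> quot_space" by (auto simp: half_coord_def quot_space_def intro: idem_L')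
  have "L' \<subseteq> {x\<in>L'. quot_coord x \<in> half_coord w ` L'}" 
    unfolding L'_eq
  proof (rule ideal_times_least, unfold L'_eq[symmetric])
    note sp = half_coord_subspace(1)[OF L'_submodule order_refl, of w]
    show "is_add_subgroup {x\<in>L'. quot_coord x \<in> half_coord w ` L'}"
      unfolding is_add_subgroup_def
    proof (intro conjI ballI)
      show "0 \<in> {x\<in>L'. quot_coord x \<in> half_coord w ` L'}"
        using add_subgroup_0[OF L'_subgroup] Q.semilinear_0[OF quot_coord(1) L'_subgroup] fs.subspace_0[OF sp] by simp
      show "x - y \<in> {x\<in>L'. quot_coord x \<in> half_coord w ` L'}"
        if "x \<in> {x\<in>L'. quot_coord x \<in> half_coord w ` L'}" "y \<in> {x\<in>L'. quot_coord x \<in> half_coord w ` L'}" for x y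
        using that add_subgroup_diff[OF L'_subgroup] Q.semilinear_diff[OF quot_coord(1)] fs.subspace_diff[OF sp] by simp
    qed
    fix a x assume a: "a \<in> S" and x: "x \<in> L"
    have xL: "x \<in> L'" using x L_L' by auto
    \<comment> \<open>Subtracting a \<open>b\<close> in \<open>Lam\<close> that agrees with
      \<open>a\<close> at the other factor changes a x only by an element of \<open>L\<close>, and a
      - b is supported at \<open>w\<close> modulo \<open>J\<close>. So the class of a x is that of
      the \<open>w\<close>-part of (a - b) x.\<close>
    obtain b where b: "b \<in> Lam" "p True b = p (\<not> w) a" using Lam_surj by blast
    have bS: "b \<in> S" using b Lam_S by auto
    let ?d = "idem w * (a - b)"
    have "p w' ((a - b) - ?d) = 0" for w'
      using a bS b Lam_p[OF b(1), of w'] 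
      by (cases "w' = w") (auto simp: p_diff p_mult S_mult S_diff idem(1) p_idem)
    hence "(a - b) - ?d \<in> J" using a bS by (simp add: J_def S_diff S_mult idem(1))
    from quot_coord_cong[OF S_diff[OF a bS] _ this xL]
    have 1: "quot_coord (act (a - b) x) = half_coord w (act (a - b) x)"
      using a bS by (simp add: S_mult S_diff idem(1) half_coord_def act_mult)
    have in1: "act (a - b) x \<in> L'" by (rule submodule_act[OF L'_submodule S_diff[OF a bS] xL])
    have bL: "act b x \<in> L" by (rule submodule_act[OF L_submodule b(1) x])
    have "quot_coord (act (a - b) x + act b x) = quot_coord (act (a - b) x) + quot_coord (act b x)"
      using bL L_L' by (intro Q.semilinear_add[OF quot_coord(1) L'_subgroup in1]) auto
    also have "quot_coord (act b x) = 0" using bL L_L' quot_coord(2) by auto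
    finally have "quot_coord (act a x) = half_coord w (act (a - b) x)" using 1 by (simp add: act_diff_left)
    thus "act a x \<in> {x\<in>L'. quot_coord x \<in> half_coord w ` L'}" using in1 submodule_act[OF L'_submodule a xL] by simp
  qed
  thus "quot_space \<subseteq> half_coord w ` L'" by (auto simp: quot_space_def)
qed

text \<open>\<open>half_coord w\<close> maps L' onto the coordinate space of L'/L and kills P w L',
  so L'/L is a quotient of the component \<open>w\<close> of L'/JL'.\<close>

lemma quot_rank_le: "quot_rank \<le> comp_rank w"
proof -
  let ?K = "{x\<in>L'. half_coord w x = 0}" and ?PL = "ideal_times act (P w) L'"
  have gK: "is_add_subgroup ?K"
    unfolding is_add_subgroup_def
    using add_subgroup_0[OF L'_subgroup] add_subgroup_diff[OF L'_subgroup]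
      R.semilinear_0[OF half_coord_semilinear L'_subgroup] R.semilinear_diff[OF half_coord_semilinear] by auto
  have "?PL \<subseteq> ?K"
  proof (rule ideal_times_least[OF gK])
    show "act a x \<in> ?K" if "a \<in> P w" "x \<in> L'" for a x
      using that R.semilinear_act[OF half_coord_semilinear _ that(2), of a w] submodule_act[OF L'_submodule _ that(2), of a]
      by (auto simp: P_def fscale_def fun_eq_iff)
  qed
  moreover have "idx L' ?K = CARD('f) ^ quot_rank"
    using R.semilinear_idx(1)[OF half_coord_semilinear L'_subgroup gK] half_coord_image[of w] fs.card_dim[OF quot_space(1,2)] quot_space(3) by simp
  moreover have "?K \<subseteq> L'" by auto
  ultimately have "CARD('f) ^ comp_rank w = CARD('f) ^ quot_rank * idx ?K ?PL" "finite (quo ?K ?PL)"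
    using quo_tower[OF ideal_times_subgroup gK L'_subgroup, of act "P w" L'] P_quo[OF lattice_L', of w] by auto
  moreover have "idx ?K ?PL > 0" by (rule idx_pos[OF gK calculation(2)])
  ultimately have "CARD('f) ^ quot_rank \<le> CARD('f) ^ comp_rank w" by simp
  thus ?thesis using R.q_gt_1 by simp
qed

definition sublattices_Lam :: "'v set set" where
  "sublattices_Lam = {X. is_submodule Lam act X \<and> X \<subseteq> L \<and> finite (quo L X)}"

definition lift :: "'v set \<Rightarrow> 'v set" where "lift X = ideal_times act S X"

lemma sublattices_Lam_L':
  assumes "X \<in> sublattices_Lam" shows "is_submodule Lam act X" "X \<subseteq> L'" "finite (quo L' X)" "is_add_subgroup X"
proof -
  show X: "is_submodule Lam act X" "X \<subseteq> L'" using assms L_L' by (auto simp: sublattices_Lam_def)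
  thus gX: "is_add_subgroup X" using submodule_subgroup by auto
  show "finite (quo L' X)"
    using quo_tower(2)[OF gX L_subgroup L'_subgroup _ L_L'] finite_L'_L assms by (auto simp: sublattices_Lam_def)
qed

lemma lift_sublattice:
  assumes "X \<in> sublattices_Lam" shows "lift X \<in> sublattices L'" "X \<subseteq> lift X" "finite (quo (lift X) X)"
proof -
  note X = sublattices_Lam_L'[OF assms]
  show 1: "X \<subseteq> lift X" unfolding lift_def by (rule S_act_superset)
  have S: "is_submodule S act (lift X)" unfolding lift_def by (rule S_act_submodule)
  have 2: "lift X \<subseteq> L'" unfolding lift_def
    using X(2) submodule_act[OF L'_submodule] by (intro ideal_times_least[OF L'_subgroup]) auto
  note t = quo_tower(2)[OF X(4) submodule_subgroup[OF S] L'_subgroup 1 2]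
  show "lift X \<in> sublattices L'" "finite (quo (lift X) X)" using t X(3) S 2 by (auto simp: sublattices_def)
qed

text \<open>On \<open>L\<close> the two half coordinates add up to 0, so they differ by a sign and
  have the same image on \<open>X\<close>. This image is already a subspace, hence it does not grow
  when \<open>S\<close> is applied to \<open>X\<close>.\<close>

lemma half_coord_lift:
  assumes X: "X \<in> sublattices_Lam" shows "half_coord w ` lift X = half_coord w ` X" "half_coord True ` X = half_coord False ` X"
proof -
  note X' = sublattices_Lam_L'[OF X]
  have semi: "Q.semilinear (p True) X (half_coord w)" for w
    unfolding Q.semilinear_def
  proof (intro conjI ballI)
    show "half_coord w (x - y) = half_coord w x - half_coord w y" if "x \<in> X" "y \<in> X" for x y
      using R.semilinear_diff[OF half_coord_semilinear] that X'(2) by auto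
    show "half_coord w (act a x) = fscale (p True a) (half_coord w x)" if "a \<in> Lam" "x \<in> X" for a x
      using R.semilinear_act[OF half_coord_semilinear, of a x w] that X'(2) Lam_S Lam_p[OF that(1), of w] by auto
    show "finite (half_coord w ` X)" by (rule finite_subset[OF image_mono[OF X'(2)] R.semilinear_finite[OF half_coord_semilinear]])
  qed
  have sp: "fs.subspace (half_coord w ` X)" for w by (rule Q.semilinear_image_subspace[OF semi X'(1) Lam_image])
  have "lift X \<subseteq> {y\<in>L'. half_coord w y \<in> half_coord w ` X}" unfolding lift_def
  proof (rule ideal_times_least)
    show "is_add_subgroup {y\<in>L'. half_coord w y \<in> half_coord w ` X}"
      unfolding is_add_subgroup_def
    proof (intro conjI ballI)
      show "0 \<in> {y\<in>L'. half_coord w y \<in> half_coord w ` X}"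
        using add_subgroup_0[OF L'_subgroup] R.semilinear_0[OF half_coord_semilinear L'_subgroup] fs.subspace_0[OF sp] by simp
      show "x - y \<in> {y\<in>L'. half_coord w y \<in> half_coord w ` X}"
        if "x \<in> {y\<in>L'. half_coord w y \<in> half_coord w ` X}" "y \<in> {y\<in>L'. half_coord w y \<in> half_coord w ` X}" for x y
        using that add_subgroup_diff[OF L'_subgroup] R.semilinear_diff[OF half_coord_semilinear] fs.subspace_diff[OF sp] by simp
    qed
    fix a x assume ax: "a \<in> S" "x \<in> X"
    have xL: "x \<in> L'" using ax X' by auto
    have "fscale (p w a) (half_coord w x) \<in> half_coord w ` X" using ax by (intro fs.subspace_scale[OF sp]) auto
    thus "act a x \<in> {y\<in>L'. half_coord w y \<in> half_coord w ` X}"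
      using R.semilinear_act[OF half_coord_semilinear ax(1) xL] submodule_act[OF L'_submodule ax(1) xL] by simp
  qed
  thus "half_coord w ` lift X = half_coord w ` X" using lift_sublattice(2)[OF X] by auto
  have neg: "half_coord True x = - half_coord False x" if "x \<in> X" for x
  proof -
    have "x \<in> L" "x \<in> L'" using that X X'(2) by (auto simp: sublattices_Lam_def)
    hence "half_coord True x + half_coord False x = 0" using quot_coord(2) quot_coord_half_coord by metis
    thus ?thesis by (simp add: eq_neg_iff_add_eq_0)
  qed
  show "half_coord True ` X = half_coord False ` X"
  proof (intro equalityI subsetI)
    fix u assume "u \<in> half_coord True ` X"
    then obtain x where "x \<in> X" "u = - half_coord False x" using neg by auto
    thus "u \<in> half_coord False ` X" using fs.subspace_neg[OF sp, of "half_coord False x" False] by auto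
  next
    fix u assume "u \<in> half_coord False ` X"
    then obtain x where x: "x \<in> X" "u = half_coord False x" by auto
    hence "u = - half_coord True x" using neg by simp
    thus "u \<in> half_coord True ` X" using x fs.subspace_neg[OF sp, of "half_coord True x" True] by auto
  qed
qed

end

lemma ssum_modular:
  assumes "is_add_subgroup X" "is_add_subgroup U" "X \<subseteq> U" "is_add_subgroup M" "U \<subseteq> ssum X M"
  shows "ssum X (U \<inter> M) = U"
proof
  show "ssum X (U \<inter> M) \<subseteq> U" by (rule ssum_least[OF assms(2,3)]) auto
  show "U \<subseteq> ssum X (U \<inter> M)"
  proof
    fix u assume u: "u \<in> U"
    then obtain x m where xm: "u = x + m" "x \<in> X" "m \<in> M" using assms(5) by (auto simp: ssum_def)
    have "u - x \<in> U" using add_subgroup_diff[OF assms(2) u] xm(2) assms(3) by auto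
    hence "m \<in> U" using xm(1) by simp
    thus "u \<in> ssum X (U \<inter> M)" using xm unfolding ssum_def by blast
  qed
qed

context lattice_pair
begin

text \<open>The value of \<open>card_common_complements\<close> in U/JY, where
  \<open>frames q l l\<close> is the order of GL_l. The ranks are crossed: the part of
  \<open>U\<close> that vanishes in the component \<open>True\<close> has dimension
  \<open>comp_rank False - j\<close>.\<close>

definition P_coeff :: "nat \<Rightarrow> nat \<Rightarrow> rat" where
  "P_coeff j l = qbinom CARD('f) (comp_rank False - j) l * qbinom CARD('f) (comp_rank True - j) l *
     of_nat (frames CARD('f) l l) * of_nat (CARD('f) ^ (j * l))"

definition P_series :: "nat \<Rightarrow> rat fps" where "P_series j = Abs_fps (P_coeff j)"

section \<open>The fibre of \<open>lift\<close> over a fixed lattice\<close>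

context
  fixes Y assumes Yin: "Y \<in> sublattices L'" and diag: "half_coord True ` Y = half_coord False ` Y"
begin

definition D where "D = half_coord True ` Y"
definition U where "U = Y \<inter> L"
definition JY where "JY = ideal_times act J Y"
text \<open>The elements of \<open>U\<close> whose component \<open>w\<close> in Y/JY
  vanishes.\<close>

definition K where "K w = U \<inter> ideal_times act (P w) Y"

lemma latY: "lattice Y" by (rule sublattice_lattice[OF lattice_L' Yin])

lemmas subY = lattice_submodule[OF latY] and gY = lattice_subgroup[OF latY]

lemma YL': "Y \<subseteq> L'" using latY by (simp add: lattice_def)

lemma D_image: "half_coord w ` Y = D" using diag by (cases w) (auto simp: D_def)

lemma D: "fs.subspace D" "finite D" "D \<subseteq> quot_space"
  using half_coord_subspace[OF subY YL', of True] half_coord_image[of True] YL' by (auto simp: D_def)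

lemma subU: "is_submodule Lam act U"
  unfolding U_def by (intro submodule_Int submodule_mono[OF subY Lam_S] L_submodule)

lemmas gU = submodule_subgroup[OF subU]

lemma subJY: "is_submodule Lam act JY"
  unfolding JY_def by (rule submodule_mono[OF J_submodule Lam_S])

lemmas gJY = submodule_subgroup[OF subJY]

lemma JY_Y: "JY \<subseteq> Y" and JY_U: "JY \<subseteq> U" and U_Y: "U \<subseteq> Y" and U_L: "U \<subseteq> L"
proof -
  show 1: "JY \<subseteq> Y" unfolding JY_def by (rule ideal_times_subset[OF subY J_S])
  have "JY \<subseteq> ideal_times act J L'" unfolding JY_def by (rule ideal_times_mono[OF order_refl YL'])
  thus "JY \<subseteq> U" using 1 J_L'_L by (auto simp: U_def)
qed (auto simp: U_def)

lemma subK: "is_submodule Lam act (K w)"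
  unfolding K_def by (intro submodule_Int subU submodule_mono[OF P_submodule Lam_S])

lemmas gK = submodule_subgroup[OF subK]

lemma K_U: "K w \<subseteq> U" and JY_K: "JY \<subseteq> K w"
  using JY_U ideal_times_mono[OF J_P order_refl, of act Y w] by (auto simp: K_def JY_def)

lemma K_Int: "K True \<inter> K False = JY"
  using P_Int[of Y] JY_U by (auto simp: K_def JY_def)

lemma fin_Y_JY: "finite (quo Y JY)"
  unfolding JY_def by (rule finite_quo_J[OF latY])

lemma fin_U_JY: "finite (quo U JY)" and fin_Y_U: "finite (quo Y U)"
  using quo_tower(2)[OF gJY gU gY JY_U U_Y] fin_Y_JY by auto

text \<open>Y/U embeds into L'/L with image \<open>D\<close>: half coordinates are the classes of
  the parts of x, which lie in \<open>Y\<close>, and conversely the class of x is the sum of its two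
  half coordinates.\<close>

lemma idx_Y_U: "idx Y U = CARD('f) ^ fs.dim D"
proof -
  have "quot_coord ` Y = D"
  proof (intro equalityI subsetI)
    fix d assume "d \<in> D"
    then obtain x where x: "x \<in> Y" "d = half_coord True x" by (auto simp: D_def)
    thus "d \<in> quot_coord ` Y" using submodule_act[OF subY idem(1)] by (auto simp: half_coord_def)
  next
    fix d assume "d \<in> quot_coord ` Y"
    then obtain x where x: "x \<in> Y" "d = quot_coord x" by auto
    have "half_coord True x \<in> D" "half_coord False x \<in> D" using x(1) D_image by auto
    moreover have "d = half_coord True x + half_coord False x" using x YL' quot_coord_half_coord by auto
    ultimately show "d \<in> D" using fs.subspace_add[OF D(1)] by simp
  qed
  moreover have "idx Y U = card (quot_coord ` Y)"
    using YL' quot_coord(2) by (intro Q.semilinear_idx(1)[OF Q.semilinear_mono[OF quot_coord(1) YL'] gY gU]) (auto simp: U_def)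
  ultimately show ?thesis using fs.card_dim[OF D(1,2)] by simp
qed

text \<open>Both halves of \<open>Y\<close> have the same image \<open>D\<close>, so the part of x
  in the component \<open>w\<close> can be completed by a y whose other half coordinate is opposite;
  the result lies in \<open>L\<close>. It differs from x only in the other component, that is, by an
  element of P w Y.\<close>

lemma Y_decomp: "Y \<subseteq> ssum U (ideal_times act (P w) Y)"
proof
  fix x assume x: "x \<in> Y"
  have "half_coord w x \<in> D" using x D_image by auto
  hence "- half_coord w x \<in> half_coord (\<not> w) ` Y" using fs.subspace_neg[OF D(1)] D_image by auto
  then obtain y where y: "y \<in> Y" "half_coord (\<not> w) y = - half_coord w x" by (metis imageE)
  let ?u = "act (idem w) x + act (idem (\<not> w)) y"
  have in1: "act (idem w) x \<in> Y" "act (idem (\<not> w)) y \<in> Y" using x y submodule_act[OF subY idem(1)] by auto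
  have uY: "?u \<in> Y" by (rule add_subgroup_add[OF gY in1])
  have "quot_coord ?u = half_coord w x + half_coord (\<not> w) y"
    unfolding half_coord_def using in1 YL' by (intro Q.semilinear_add[OF quot_coord(1) L'_subgroup]) auto
  hence "?u \<in> L" using y(2) quot_coord(2)[of ?u] uY YL' by auto
  hence "?u \<in> U" using uY by (simp add: U_def)
  moreover have "x - ?u = act (idem (\<not> w)) (x - y)"
  proof -
    have "x = act (idem w) x + act (idem (\<not> w)) x" using split_one[of x] by (cases w) (auto simp: add.commute)
    thus ?thesis by (simp add: act_diff_right algebra_simps)
  qed
  hence "x - ?u \<in> ideal_times act (P w) Y"
    using ideal_times_mem[of "idem (\<not> w)" "P w" "x - y" Y act] idem_P[of "\<not> w"] add_subgroup_diff[OF gY x y(1)] by simp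
  moreover have "x = ?u + (x - ?u)" by simp
  ultimately show "x \<in> ssum U (ideal_times act (P w) Y)" unfolding ssum_def by blast
qed

lemma idx_U_K: "idx U (K w) = CARD('f) ^ comp_rank w"
proof -
  have "ideal_times act (P w) Y \<subseteq> Y" by (rule ideal_times_subset[OF subY P_S])
  hence "ssum U (ideal_times act (P w) Y) = Y"
    using Y_decomp ssum_least[OF gY U_Y] by (intro subset_antisym)
  thus ?thesis using idx_ssum(1)[OF gU ideal_times_subgroup, of act "P w" Y] P_quo(2)[OF latY, of w]
    by (simp add: K_def)
qed

lemma idx_Y_JY: "idx Y JY = CARD('f) ^ (comp_rank True + comp_rank False)"
proof -
  let ?P = "\<lambda>w. ideal_times act (P w) Y"
  have PY: "?P w \<subseteq> Y" for w by (rule ideal_times_subset[OF subY P_S])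
  have "Y \<subseteq> ssum (?P True) (?P False)"
  proof
    fix x assume x: "x \<in> Y"
    have "act (idem False) x \<in> ?P True" "act (idem True) x \<in> ?P False"
      using idem_P[of False] idem_P[of True] x by (auto intro!: ideal_times_mem)
    moreover have "x = act (idem False) x + act (idem True) x" using split_one[of x] by (simp add: add.commute)
    ultimately show "x \<in> ssum (?P True) (?P False)" unfolding ssum_def by blast
  qed
  hence "ssum (?P True) (?P False) = Y" using ssum_least[OF gY PY PY] by (intro subset_antisym)
  hence "idx (?P True) JY = CARD('f) ^ comp_rank False"
    using idx_ssum(1)[OF ideal_times_subgroup ideal_times_subgroup, of act "P True" Y act "P False" Y]
      P_Int[of Y] P_quo(2)[OF latY, of False] by (simp add: JY_def)
  moreover have "JY \<subseteq> ?P True" using P_Int[of Y] by (auto simp: JY_def)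
  ultimately show ?thesis
    using quo_tower(1)[OF gJY ideal_times_subgroup gY _ PY, of True] P_quo(2)[OF latY, of True]
    by (simp add: power_add)
qed

lemma dim_D_le: "fs.dim D \<le> comp_rank w"
  using fs.dim_mono_finite[OF D(1) quot_space(2,1) D(3)] quot_space(3) quot_rank_le[of w] by simp

text \<open>The exponent m1 + m2 - j, written in the shape a + b + j with a and b the dimensions of
  \<open>K True\<close> and \<open>K False\<close> modulo \<open>JY\<close>, as
  \<open>card_common_complements\<close> expects.\<close>

lemma idx_U_JY: "idx U JY = CARD('f) ^ ((comp_rank False - fs.dim D) + (comp_rank True - fs.dim D) + fs.dim D)"
proof -
  have "CARD('f) ^ fs.dim D * idx U JY = CARD('f) ^ (comp_rank True + comp_rank False)"
    using quo_tower(1)[OF gJY gU gY JY_U U_Y] idx_Y_U idx_Y_JY by simp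
  also have "comp_rank True + comp_rank False = fs.dim D + ((comp_rank False - fs.dim D) + (comp_rank True - fs.dim D) + fs.dim D)"
    using dim_D_le[of True] dim_D_le[of False] by simp
  finally show ?thesis by (simp add: power_add)
qed

lemma idx_K_JY: "idx (K w) JY = CARD('f) ^ (comp_rank (\<not> w) - fs.dim D)"
proof -
  have "CARD('f) ^ comp_rank w * idx (K w) JY = CARD('f) ^ ((comp_rank False - fs.dim D) + (comp_rank True - fs.dim D) + fs.dim D)"
    using quo_tower(1)[OF gJY gK gU JY_K K_U, of w] idx_U_K[of w] idx_U_JY by simp
  also have "(comp_rank False - fs.dim D) + (comp_rank True - fs.dim D) + fs.dim D = comp_rank w + (comp_rank (\<not> w) - fs.dim D)"
    using dim_D_le[of True] dim_D_le[of False] by (cases w) auto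
  finally show ?thesis by (simp add: power_add)
qed

text \<open>\<open>lift X = Y\<close> means that \<open>X\<close> surjects onto both components of \<open>Y / JY\<close>.\<close>

lemma fibre_iff:
  "X \<in> sublattices_Lam \<and> lift X = Y \<longleftrightarrow>
     is_submodule Lam act X \<and> JY \<subseteq> X \<and> X \<subseteq> U \<and> (\<forall>w. ssum X (K w) = U)"
proof
  assume *: "X \<in> sublattices_Lam \<and> lift X = Y"
  note X = sublattices_Lam_L'[of X] and lX = lift_sublattice[of X]
  have subX: "is_submodule Lam act X" and gX: "is_add_subgroup X" using * X by auto
  have XU: "X \<subseteq> U" using * lX(2) by (auto simp: U_def sublattices_Lam_def)
  have "JY = ideal_times act J X" unfolding JY_def using * J_S_act[of X] by (simp add: lift_def)
  hence "JY \<subseteq> X" using ideal_times_subset[OF subX J_subset_Lam] by simp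
  moreover have "ssum X (K w) = U" for w
    unfolding K_def
  proof (rule ssum_modular[OF gX gU XU ideal_times_subgroup])
    let ?R = "ssum X (ideal_times act (P w) Y)"
    have "lift X \<subseteq> ?R" unfolding lift_def
    proof (rule ideal_times_least[OF add_subgroup_ssum[OF gX ideal_times_subgroup]])
      fix a x assume a: "a \<in> S" and x: "x \<in> X"
      \<comment> \<open>An element of \<open>Lam\<close> with the residue of \<open>a\<close> at
        \<open>w\<close>: it keeps x inside \<open>X\<close>, and its difference from
        \<open>a\<close> lies in \<open>P w\<close>.\<close>
      obtain b where b: "b \<in> Lam" "p True b = p w a" using Lam_surj[of "p w a"] by (elim bexE)
      have "b \<in> S" using b Lam_S by auto
      hence "a - b \<in> P w" using a b Lam_p[OF b(1), of w] by (simp add: P_def S_diff p_diff)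
      moreover have "x \<in> Y" using x XU U_Y by auto
      ultimately have "act (a - b) x \<in> ideal_times act (P w) Y" by (rule ideal_times_mem)
      moreover have "act b x \<in> X" by (rule submodule_act[OF subX b(1) x])
      moreover have "act a x = act b x + act (a - b) x" by (simp add: act_diff_left)
      ultimately show "act a x \<in> ?R" unfolding ssum_def by blast
    qed
    thus "U \<subseteq> ?R" using * U_Y by auto
  qed
  ultimately show "is_submodule Lam act X \<and> JY \<subseteq> X \<and> X \<subseteq> U \<and> (\<forall>w. ssum X (K w) = U)"
    using subX XU by simp
next
  assume *: "is_submodule Lam act X \<and> JY \<subseteq> X \<and> X \<subseteq> U \<and> (\<forall>w. ssum X (K w) = U)"
  hence X: "is_submodule Lam act X" "JY \<subseteq> X" "X \<subseteq> U" "\<And>w. ssum X (K w) = U" by auto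
  note gX = submodule_subgroup[OF X(1)]
  have XL: "X \<subseteq> L" using X(3) U_L by auto
  have "finite (quo L' Y)" using latY by (simp add: lattice_def)
  hence "finite (quo L' JY)" using quo_tower(2)[OF gJY gY L'_subgroup JY_Y YL'] fin_Y_JY by simp
  hence "finite (quo L JY)"
    using quo_tower(2)[OF gJY L_subgroup L'_subgroup _ L_L'] JY_U U_L by auto
  hence "finite (quo L X)" using quo_tower(2)[OF gJY gX L_subgroup X(2) XL] by simp
  hence "X \<in> sublattices_Lam" using X(1) XL by (simp add: sublattices_Lam_def)
  moreover have "lift X = Y"
  proof
    show "lift X \<subseteq> Y" unfolding lift_def
      using X(3) U_Y submodule_act[OF subY] by (intro ideal_times_least[OF gY]) auto
    have S: "is_submodule S act (lift X)" unfolding lift_def by (rule S_act_submodule)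
    have XlX: "X \<subseteq> lift X" unfolding lift_def by (rule S_act_superset)
    have "act (idem w) y \<in> lift X" if y: "y \<in> Y" for w y
    proof -
      obtain u z where uz: "y = u + z" "u \<in> U" "z \<in> ideal_times act (P w) Y"
        using Y_decomp[of w] y by (auto simp: ssum_def)
      have "u \<in> ssum X (K w)" using X(4)[of w] uz(2) by simp
      then obtain x k where xk: "u = x + k" "x \<in> X" "k \<in> K w" by (auto simp: ssum_def)
      \<comment> \<open>Both corrections lie in P w Y, which \<open>idem w\<close> carries into
        \<open>JY\<close>; only the contribution of x remains, and that lies in
        \<open>lift X\<close>.\<close>
      have "act (idem w) k \<in> JY" "act (idem w) z \<in> JY"
        using idem_ideal_times[of k w Y] idem_ideal_times[of z w Y] uz xk by (auto simp: K_def JY_def)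
      hence "act (idem w) k \<in> lift X" "act (idem w) z \<in> lift X" using X(2) XlX by auto
      moreover have "act (idem w) x \<in> lift X" using submodule_act[OF S idem(1)] xk XlX by auto
      moreover note add = add_subgroup_add[OF submodule_subgroup[OF S]]
      ultimately show ?thesis unfolding uz(1) xk(1) act_add_right by (intro add)
    qed
    hence "act (idem True) y + act (idem False) y \<in> lift X" if "y \<in> Y" for y
      using that by (intro add_subgroup_add[OF submodule_subgroup[OF S]])
    thus "Y \<subseteq> lift X" using split_one by auto
  qed
  ultimately show "X \<in> sublattices_Lam \<and> lift X = Y" by simp
qed

text \<open>Coordinates on U/JY turn the members of the fibre into subspaces that span U/JY together
  with the images of \<open>K True\<close> and of \<open>K False\<close>. The length of Y/U is
  \<open>fs.dim D\<close>, so \<open>l\<close> is the codimension inside U/JY.\<close>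

lemma card_fibre:
  "of_nat (card {X. X \<in> sublattices_Lam \<and> lift X = Y \<and> idx Y X = CARD('f) ^ (fs.dim D + l)}) = P_coeff (fs.dim D) l"
proof -
  have kill: "act a x \<in> JY" if "a \<in> Lam" "p True a = 0" "x \<in> U" for a x
    unfolding JY_def using Lam_kernel[OF that(1,2)] that(3) U_Y by (intro ideal_times_mem) auto
  have "\<exists>f. Q.semilinear (p True) U f \<and> (\<forall>x\<in>U. f x = 0 \<longleftrightarrow> x \<in> JY)"
    by (rule Q.coordinates[OF Lam_hom p_one Lam_image subU subJY JY_U fin_U_JY kill]; assumption)
  then obtain \<theta> where th: "Q.semilinear (p True) U \<theta>" and ker: "\<forall>x\<in>U. \<theta> x = 0 \<longleftrightarrow> x \<in> JY"
    by (elim exE conjE)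
  have th_eq: "\<theta> x = \<theta> y \<longleftrightarrow> x - y \<in> JY" if "x \<in> U" "y \<in> U" for x y
    using bspec[OF ker add_subgroup_diff[OF gU that]] unfolding Q.semilinear_diff[OF th that] right_minus_eq .
  have th_sub: "fs.subspace (\<theta> ` X)" "card (\<theta> ` X) = idx X JY"
    if "is_submodule Lam act X" "X \<subseteq> U" for X
  proof -
    note s = Q.semilinear_mono[OF th that(2)]
    show "fs.subspace (\<theta> ` X)" by (rule Q.semilinear_image_subspace[OF s that(1) Lam_image])
    have "\<theta> x = 0 \<longleftrightarrow> x \<in> JY" if "x \<in> X" for x by (rule bspec[OF ker subsetD[OF \<open>X \<subseteq> U\<close> that]])
    from Q.semilinear_idx(1)[OF s submodule_subgroup[OF that(1)] gJY this]
    show "card (\<theta> ` X) = idx X JY" by simp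
  qed
  have mem: "x \<in> X" if "is_submodule Lam act X" "JY \<subseteq> X" "X \<subseteq> U" "x \<in> U" "\<theta> x \<in> \<theta> ` X" for x X
  proof -
    from that(5) obtain y where y: "y \<in> X" "\<theta> x = \<theta> y" by (elim imageE)
    have "x - y \<in> JY" using iffD1[OF th_eq y(2)] that(3,4) y(1) by auto
    hence "x - y \<in> X" using that(2) by auto
    hence "(x - y) + y \<in> X" using y(1) by (rule add_subgroup_add[OF submodule_subgroup[OF that(1)]])
    thus ?thesis by simp
  qed
  have span: "fs.span (\<theta> ` X \<union> \<theta> ` M) = \<theta> ` ssum X M"
    if "is_submodule Lam act X" "X \<subseteq> U" "is_submodule Lam act M" "M \<subseteq> U" for X M
  proof -
    have sX: "fs.span (\<theta> ` X) = \<theta> ` X" and sM: "fs.span (\<theta> ` M) = \<theta> ` M"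
      using th_sub(1)[OF that(1,2)] th_sub(1)[OF that(3,4)] by simp_all
    have add: "\<theta> (x + m) = \<theta> x + \<theta> m" if "x \<in> X" "m \<in> M" for x m
      using that \<open>X \<subseteq> U\<close> \<open>M \<subseteq> U\<close> by (intro Q.semilinear_add[OF th gU]) auto
    show ?thesis unfolding fs.span_Un sX sM
    proof (intro equalityI subsetI)
      fix u assume "u \<in> {x + y |x y. x \<in> \<theta> ` X \<and> y \<in> \<theta> ` M}"
      then obtain x m where "x \<in> X" "m \<in> M" "u = \<theta> x + \<theta> m" by auto
      hence "u = \<theta> (x + m)" "x + m \<in> ssum X M" using add by (auto simp: ssum_def)
      thus "u \<in> \<theta> ` ssum X M" by (rule image_eqI)
    next
      fix u assume "u \<in> \<theta> ` ssum X M"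
      then obtain x m where "x \<in> X" "m \<in> M" "u = \<theta> (x + m)" by (auto simp: ssum_def)
      thus "u \<in> {x + y |x y. x \<in> \<theta> ` X \<and> y \<in> \<theta> ` M}" using add by auto
    qed
  qed
  define Xs where "Xs = {X. is_submodule Lam act X \<and> JY \<subseteq> X \<and> X \<subseteq> U \<and> (\<forall>w. ssum X (K w) = U) \<and>
     idx Y X = CARD('f) ^ (fs.dim D + l)}"
  define Ws where "Ws = {W. fs.subspace W \<and> W \<subseteq> \<theta> ` U \<and> card W * CARD('f) ^ l = card (\<theta> ` U) \<and>
     fs.span (W \<union> \<theta> ` K True) = \<theta> ` U \<and> fs.span (W \<union> \<theta> ` K False) = \<theta> ` U}"
  have cond: "X \<in> Xs \<longleftrightarrow> \<theta> ` X \<in> Ws" if X: "is_submodule Lam act X" "JY \<subseteq> X" "X \<subseteq> U" for X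
  proof -
    note gX = submodule_subgroup[OF X(1)]
    have *: "ssum X (K w) = U \<longleftrightarrow> fs.span (\<theta> ` X \<union> \<theta> ` K w) = \<theta> ` U" for w
    proof
      assume "fs.span (\<theta> ` X \<union> \<theta> ` K w) = \<theta> ` U"
      hence eq: "\<theta> ` ssum X (K w) = \<theta> ` U" using span[OF X(1,3) subK K_U] by simp
      have s: "is_submodule Lam act (ssum X (K w))" by (rule submodule_ssum[OF X(1) subK])
      have sU: "ssum X (K w) \<subseteq> U" by (rule ssum_least[OF gU X(3) K_U])
      have "JY \<subseteq> ssum X (K w)" using X(2) ssum_upper(1)[OF gK, of X w] by auto
      hence "U \<subseteq> ssum X (K w)" using mem[OF s _ sU] eq by auto
      thus "ssum X (K w) = U" using sU by auto
    qed (use span[OF X(1,3) subK K_U] in simp)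
    have t1: "idx Y X = CARD('f) ^ fs.dim D * idx U X"
      using quo_tower(1)[OF gX gU gY X(3) U_Y] idx_Y_U by simp
    have t2: "card (\<theta> ` U) = idx U X * card (\<theta> ` X)"
      using quo_tower(1)[OF gJY gX gU X(2,3)] th_sub(2)[OF X(1,3)] th_sub(2)[OF subU order_refl] by simp
    have "card (\<theta> ` X) > 0"
      unfolding th_sub(2)[OF X(1,3)] using quo_tower(2)[OF gJY gX gU X(2,3)] fin_U_JY by (intro idx_pos[OF gX]) simp
    hence "idx Y X = CARD('f) ^ (fs.dim D + l) \<longleftrightarrow> card (\<theta> ` X) * CARD('f) ^ l = card (\<theta> ` U)"
      unfolding t1 t2 by (auto simp: power_add mult.commute)
    moreover have "\<theta> ` X \<subseteq> \<theta> ` U" using X(3) by (rule image_mono)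
    moreover have "(\<forall>w. ssum X (K w) = U) \<longleftrightarrow>
        fs.span (\<theta> ` X \<union> \<theta> ` K True) = \<theta> ` U \<and> fs.span (\<theta> ` X \<union> \<theta> ` K False) = \<theta> ` U"
      unfolding all_bool_eq * by (rule refl)
    ultimately show ?thesis unfolding Xs_def Ws_def mem_Collect_eq
      using X th_sub(1)[OF X(1,3)] by (simp only: simp_thms) argo
  qed
  have inv: "is_submodule Lam act {x\<in>U. \<theta> x \<in> W}" "JY \<subseteq> {x\<in>U. \<theta> x \<in> W}"
    "\<theta> ` {x\<in>U. \<theta> x \<in> W} = W" if W: "fs.subspace W" "W \<subseteq> \<theta> ` U" for W
  proof -
    show "is_submodule Lam act {x\<in>U. \<theta> x \<in> W}"
      unfolding is_submodule_def is_add_subgroup_def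
    proof (intro conjI ballI)
      show "0 \<in> {x\<in>U. \<theta> x \<in> W}"
        using add_subgroup_0[OF gU] Q.semilinear_0[OF th gU] fs.subspace_0[OF W(1)] by simp
      show "x - y \<in> {x\<in>U. \<theta> x \<in> W}" if "x \<in> {x\<in>U. \<theta> x \<in> W}" "y \<in> {x\<in>U. \<theta> x \<in> W}" for x y
        using that add_subgroup_diff[OF gU] Q.semilinear_diff[OF th] fs.subspace_diff[OF W(1)] by simp
      show "act a x \<in> {x\<in>U. \<theta> x \<in> W}" if "a \<in> Lam" "x \<in> {x\<in>U. \<theta> x \<in> W}" for a x
        using that submodule_act[OF subU] Q.semilinear_act[OF th] fs.subspace_scale[OF W(1)] by simp
    qed
    show "JY \<subseteq> {x\<in>U. \<theta> x \<in> W}"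
    proof
      fix x assume x: "x \<in> JY"
      hence xU: "x \<in> U" using JY_U by auto
      hence "\<theta> x = 0" using bspec[OF ker xU] x by simp
      thus "x \<in> {x\<in>U. \<theta> x \<in> W}" using xU fs.subspace_0[OF W(1)] by simp
    qed
    show "\<theta> ` {x\<in>U. \<theta> x \<in> W} = W" using W(2) by auto
  qed
  have "bij_betw (\<lambda>X. \<theta> ` X) Xs Ws"
  proof (rule bij_betwI[where g = "\<lambda>W. {x\<in>U. \<theta> x \<in> W}"], goal_cases)
    case 1 thus ?case using cond by (auto simp: Xs_def)
  next
    case 2
    show ?case
    proof
      fix W assume W: "W \<in> Ws"
      hence W': "fs.subspace W" "W \<subseteq> \<theta> ` U" by (auto simp: Ws_def)
      show "{x\<in>U. \<theta> x \<in> W} \<in> Xs" using cond[OF inv(1,2)[OF W']] inv(3)[OF W'] W by auto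
    qed
  next
    case (3 X)
    hence X: "is_submodule Lam act X" "JY \<subseteq> X" "X \<subseteq> U" by (auto simp: Xs_def)
    show ?case using mem[OF X] X(3) by auto
  next
    case (4 W)
    hence W': "fs.subspace W" "W \<subseteq> \<theta> ` U" by (auto simp: Ws_def)
    show ?case by (rule inv(3)[OF W'])
  qed
  hence "card Xs = card Ws" by (rule bij_betw_same_card)
  moreover have "of_nat (card Ws) = P_coeff (fs.dim D) l"
    unfolding Ws_def P_coeff_def
  proof (rule fs.card_common_complements)
    show "fs.subspace (\<theta> ` U)" by (rule th_sub(1)[OF subU order_refl])
    show "finite (\<theta> ` U)" by (rule Q.semilinear_finite[OF th])
    show "card (\<theta> ` U) = CARD('f) ^ ((comp_rank False - fs.dim D) + (comp_rank True - fs.dim D) + fs.dim D)"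
      unfolding th_sub(2)[OF subU order_refl] by (rule idx_U_JY)
    show "fs.subspace (\<theta> ` K True)" "fs.subspace (\<theta> ` K False)" by (rule th_sub(1)[OF subK K_U])+
    show "\<theta> ` K True \<subseteq> \<theta> ` U" "\<theta> ` K False \<subseteq> \<theta> ` U" by (rule image_mono[OF K_U])+
    show "card (\<theta> ` K True) = CARD('f) ^ (comp_rank False - fs.dim D)"
      "card (\<theta> ` K False) = CARD('f) ^ (comp_rank True - fs.dim D)"
      unfolding th_sub(2)[OF subK K_U] using idx_K_JY by simp_all
    show "\<theta> ` K True \<inter> \<theta> ` K False = {0}"
    proof (intro equalityI subsetI)
      fix u assume u: "u \<in> \<theta> ` K True \<inter> \<theta> ` K False"
      then obtain k where k: "k \<in> K True" "u = \<theta> k" by auto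
      have kU: "k \<in> U" using k K_U by auto
      have "\<theta> k \<in> \<theta> ` K False" using u k(2) by auto
      from mem[OF subK JY_K K_U kU this] have "k \<in> JY" using k(1) K_Int by auto
      thus "u \<in> {0}" using bspec[OF ker kU] k(2) by simp
    next
      fix u :: "nat \<Rightarrow> 'f" assume "u \<in> {0}"
      hence "u = \<theta> 0" using Q.semilinear_0[OF th gU] by simp
      thus "u \<in> \<theta> ` K True \<inter> \<theta> ` K False" using add_subgroup_0[OF gK] by auto
    qed
  qed
  moreover have "{X. X \<in> sublattices_Lam \<and> lift X = Y \<and> idx Y X = CARD('f) ^ (fs.dim D + l)} = Xs"
    unfolding Xs_def
  proof (rule Collect_cong)
    fix X
    let ?c = "idx Y X = CARD('f) ^ (fs.dim D + l)"
    have "(X \<in> sublattices_Lam \<and> lift X = Y) \<and> ?c \<longleftrightarrow>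
      (is_submodule Lam act X \<and> JY \<subseteq> X \<and> X \<subseteq> U \<and> (\<forall>w. ssum X (K w) = U)) \<and> ?c"
      by (simp only: fibre_iff)
    thus "X \<in> sublattices_Lam \<and> lift X = Y \<and> ?c \<longleftrightarrow>
      is_submodule Lam act X \<and> JY \<subseteq> X \<and> X \<subseteq> U \<and> (\<forall>w. ssum X (K w) = U) \<and> ?c"
      by (simp only: conj_assoc)
  qed
  ultimately show ?thesis by simp
qed

text \<open>Members of the fibre lie in \<open>U\<close>, so their colength in \<open>Y\<close> is
  at least the length \<open>fs.dim D\<close> of Y/U; the excess is counted by
  \<open>P_series\<close>.\<close>

lemma genfun_fibre: "genfun {X\<in>sublattices_Lam. lift X = Y} (Q.len Y) = fps_X ^ fs.dim D * P_series (fs.dim D)"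
proof (rule fps_ext)
  fix n
  let ?j = "fs.dim D"
  have len: "Q.len Y X = n \<longleftrightarrow> idx Y X = CARD('f) ^ n" and idx: "\<exists>k. idx Y X = CARD('f) ^ ?j * CARD('f) ^ k"
    if X: "X \<in> sublattices_Lam" "lift X = Y" for X
  proof -
    have X': "is_submodule Lam act X" "JY \<subseteq> X" "X \<subseteq> U" using iffD1[OF fibre_iff conjI[OF X]] by simp_all
    have fin: "finite (quo Y X)" using lift_sublattice(3)[OF X(1)] X(2) by simp
    have XY: "X \<subseteq> Y" using X'(3) U_Y by auto
    have "idx Y X = CARD('f) ^ Q.len Y X"
      by (rule Q.idx_len[OF submodule_mono[OF subY Lam_S] X'(1) XY fin])
    thus "Q.len Y X = n \<longleftrightarrow> idx Y X = CARD('f) ^ n" by (simp add: fs.card_power_inject)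
    note t = quo_tower[OF submodule_subgroup[OF X'(1)] gU gY X'(3) U_Y]
    obtain k where "idx U X = CARD('f) ^ k" using Q.idx_power[OF subU X'(1,3)] t(2) fin by auto
    thus "\<exists>k. idx Y X = CARD('f) ^ ?j * CARD('f) ^ k" using t(1) idx_Y_U by auto
  qed
  have eq: "{X\<in>{X\<in>sublattices_Lam. lift X = Y}. Q.len Y X = n} = {X. X \<in> sublattices_Lam \<and> lift X = Y \<and> idx Y X = CARD('f) ^ n}"
    using len by auto
  have "of_nat (card {X. X \<in> sublattices_Lam \<and> lift X = Y \<and> idx Y X = CARD('f) ^ n}) =
    (if n < ?j then 0 else P_coeff ?j (n - ?j))"
  proof (cases "n < ?j")
    case True
    have False if X: "X \<in> sublattices_Lam" "lift X = Y" "idx Y X = CARD('f) ^ n" for X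
    proof -
      obtain k where "CARD('f) ^ n = CARD('f) ^ (?j + k)" using idx[OF X(1,2)] X(3) by (auto simp: power_add)
      thus False using True by (simp only: fs.card_power_inject)
    qed
    hence "{X. X \<in> sublattices_Lam \<and> lift X = Y \<and> idx Y X = CARD('f) ^ n} = {}" by blast
    thus ?thesis using True by (simp only: card.empty) simp
  next
    case False
    thus ?thesis using card_fibre[of "n - ?j"] by simp
  qed
  thus "fps_nth (genfun {X\<in>sublattices_Lam. lift X = Y} (Q.len Y)) n = fps_nth (fps_X ^ ?j * P_series ?j) n"
    unfolding genfun_def fps_nth_Abs_fps eq by (simp add: fps_X_power_mult_nth P_series_def)
qed

end

section \<open>The generating function of the sublattices of \<open>L\<close>\<close>

lemma finite_sublattices_Lam_level: "finite {X\<in>sublattices_Lam. Q.len L X = n}"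
proof -
  have sub: "act (r ^ n) ` L \<subseteq> L"
  proof -
    have "r ^ n \<in> Lam" using r_J J_subset_Lam by (induction n) (auto intro: Lam_ring)
    thus ?thesis using submodule_act[OF L_submodule] by auto
  qed
  have fin: "finite (quo L (act (r ^ n) ` L))"
    by (rule finite_quo_r[OF L_subgroup L_L' r_L' sub])
  show ?thesis
  proof (rule finite_subset[OF _ finite_between[OF act_image_subgroup[OF L_subgroup] fin]])
    show "{X \<in> sublattices_Lam. Q.len L X = n} \<subseteq> {X. is_add_subgroup X \<and> act (r ^ n) ` L \<subseteq> X \<and> X \<subseteq> L}"
    proof
      fix X assume "X \<in> {X \<in> sublattices_Lam. Q.len L X = n}"
      hence X: "is_submodule Lam act X" "X \<subseteq> L" "finite (quo L X)" "Q.len L X = n" by (auto simp: sublattices_Lam_def)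
      obtain n' where n': "idx L X = CARD('f) ^ n'" "\<forall>x\<in>L. act (r ^ n') x \<in> X"
        using Q.J_power_kills[OF L_submodule X(1-3) r_J] by (elim exE conjE)
      have "n' = n" using Q.len_eqI[OF n'(1)] X(4) by simp
      thus "X \<in> {X. is_add_subgroup X \<and> act (r ^ n) ` L \<subseteq> X \<and> X \<subseteq> L}"
        using n'(2) X submodule_subgroup by auto
    qed
  qed
qed

lemma sublattices_Lam_len: "X \<in> sublattices_Lam \<Longrightarrow> Q.len L' X = quot_rank + Q.len L X"
proof -
  assume X: "X \<in> sublattices_Lam"
  hence X': "is_submodule Lam act X" "X \<subseteq> L" "finite (quo L X)" by (auto simp: sublattices_Lam_def)
  have "idx L' X = CARD('f) ^ (quot_rank + Q.len L X)"
    using quo_tower(1)[OF submodule_subgroup[OF X'(1)] L_subgroup L'_subgroup X'(2) L_L']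
      idx_L'_L Q.idx_len[OF L_submodule X'] by (simp add: power_add)
  thus ?thesis by (rule Q.len_eqI)
qed

lemma sublattices_Lam_lift_len: "X \<in> sublattices_Lam \<Longrightarrow> Q.len L' X = R.len L' (lift X) + Q.len (lift X) X"
proof -
  assume X: "X \<in> sublattices_Lam"
  note l = lift_sublattice[OF X] and X' = sublattices_Lam_L'[OF X]
  have Y: "is_submodule S act (lift X)" "lift X \<subseteq> L'" "finite (quo L' (lift X))" using l(1) by (auto simp: sublattices_def)
  have "idx L' X = CARD('f) ^ (R.len L' (lift X) + Q.len (lift X) X)"
    using quo_tower(1)[OF X'(4) submodule_subgroup[OF Y(1)] L'_subgroup l(2) Y(2)]
      R.idx_len[OF L'_submodule Y] Q.idx_len[OF submodule_mono[OF Y(1) Lam_S] X'(1) l(2,3)]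
    by (simp add: power_add)
  thus ?thesis by (rule Q.len_eqI)
qed

text \<open>Colengths are measured in L', where they add along X, \<open>lift X\<close>, L'. For
  fixed \<open>D\<close> of dimension j, the lattices with both images \<open>D\<close> give
  X^(2(c-j)) and the square of \<open>qpoch\<close>, and the fibre gives X^j times
  \<open>P_series\<close>. The factor X^c, the length of L'/L, is cancelled at the end.\<close>

lemma genfun_sublattices_Lam:
  "genfun sublattices_Lam (Q.len L) =
     (\<Sum>j\<le>quot_rank. fps_const (qbinom CARD('f) quot_rank j) * (fps_X ^ (quot_rank - j) * (qpoch CARD('f) j)\<^sup>2 * P_series j)) * zeta_maximal"
proof -
  let ?l = "Q.len L'"
  \<comment> \<open>Truncated subtraction is harmless: for \<open>n < quot_rank\<close> the set is
    empty.\<close>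
  have lev: "finite {X\<in>sublattices_Lam. ?l X = n}" for n
    by (rule finite_subset[OF _ finite_sublattices_Lam_level[of "n - quot_rank"]]) (auto simp: sublattices_Lam_len)
  have map: "half_coord True ` X \<in> subspaces quot_space" if X: "X \<in> sublattices_Lam" for X
  proof -
    have Y: "is_submodule S act (lift X)" "lift X \<subseteq> L'" using lift_sublattice(1)[OF X] by (auto simp: sublattices_def)
    have "half_coord True ` X = half_coord True ` lift X" using half_coord_lift(1)[OF X, of True] by simp
    thus ?thesis using half_coord_subspace(1)[OF Y, of True] image_mono[OF Y(2), of "half_coord True"] half_coord_image[of True]
      by (simp add: subspaces_def)
  qed
  have C: "half_coord True ` L' = quot_space" "half_coord False ` L' = quot_space" by (rule half_coord_image)+
  have "fps_X ^ quot_rank * genfun sublattices_Lam (Q.len L) = genfun sublattices_Lam ?l"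
    by (rule genfun_shift[symmetric]) (rule sublattices_Lam_len)
  also have "\<dots> = (\<Sum>D\<in>subspaces quot_space. genfun {X\<in>sublattices_Lam. half_coord True ` X = D} ?l)"
    by (rule genfun_partition[OF lev finite_subspaces_of[OF quot_space(2)] map])
  also have "\<dots> = (\<Sum>D\<in>subspaces quot_space. image_series L' half_coord D D * (fps_X ^ fs.dim D * P_series (fs.dim D)))"
  proof (rule sum.cong[OF refl])
    fix D assume D: "D \<in> subspaces quot_space"
    let ?B = "{Y\<in>sublattices L'. half_coord True ` Y = D \<and> half_coord False ` Y = D}"
    have "genfun {X\<in>sublattices_Lam. half_coord True ` X = D} ?l = genfun ?B (R.len L') * (fps_X ^ fs.dim D * P_series (fs.dim D))"
    proof (rule genfun_fibration[where \<pi> = lift and r = "\<lambda>X. Q.len (lift X) X"])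
      show "finite {x \<in> {X \<in> sublattices_Lam. half_coord True ` X = D}. ?l x = n}" for n
        by (rule finite_subset[OF _ lev[of n]]) auto
      show "finite {Y\<in>?B. R.len L' Y = n}" for n
        by (rule finite_subset[OF _ finite_level[OF lattice_L', of n]]) auto
      show "lift X \<in> ?B" if "X \<in> {X\<in>sublattices_Lam. half_coord True ` X = D}" for X
        using that lift_sublattice(1)[of X] half_coord_lift[of X] by auto
      show "?l X = R.len L' (lift X) + Q.len (lift X) X" if "X \<in> {X\<in>sublattices_Lam. half_coord True ` X = D}" for X
        using that sublattices_Lam_lift_len by simp
      fix Y assume Y: "Y \<in> ?B"
      hence Y': "Y \<in> sublattices L'" "half_coord True ` Y = half_coord False ` Y" "half_coord True ` Y = D" by auto
      have "{X\<in>{X\<in>sublattices_Lam. half_coord True ` X = D}. lift X = Y} = {X\<in>sublattices_Lam. lift X = Y}"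
        using half_coord_lift(1)[of _ True] Y'(3) by auto
      hence "genfun {X\<in>{X\<in>sublattices_Lam. half_coord True ` X = D}. lift X = Y} (\<lambda>X. Q.len (lift X) X) =
        genfun {X\<in>sublattices_Lam. lift X = Y} (Q.len Y)" by (intro genfun_cong) auto
      also have "\<dots> = fps_X ^ fs.dim D * P_series (fs.dim D)"
        using genfun_fibre[OF Y'(1,2)] by (simp add: D_def[OF Y'(1,2)] Y'(3))
      finally show "genfun {X\<in>{X\<in>sublattices_Lam. half_coord True ` X = D}. lift X = Y} (\<lambda>X. Q.len (lift X) X) =
        fps_X ^ fs.dim D * P_series (fs.dim D)" .
    qed
    thus "genfun {X\<in>sublattices_Lam. half_coord True ` X = D} ?l = image_series L' half_coord D D * (fps_X ^ fs.dim D * P_series (fs.dim D))"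
      by (simp add: image_series_def)
  qed
  also have "\<dots> = (\<Sum>D\<in>{E. fs.subspace E \<and> E \<subseteq> quot_space}.
     fps_X ^ quot_rank * (fps_X ^ (quot_rank - fs.dim D) * (qpoch CARD('f) (fs.dim D))\<^sup>2 * P_series (fs.dim D) * zeta_maximal))"
    unfolding subspaces_def[symmetric]
  proof (rule sum.cong[OF refl])
    fix D assume D: "D \<in> subspaces quot_space"
    hence le: "fs.dim D \<le> quot_rank" using fs.dim_mono_finite[OF _ quot_space(2,1), of D] quot_space(3) by (simp add: subspaces_def)
    have "image_series L' half_coord D D = image_series_value L' half_coord D D"
      by (rule image_series_eq[OF lattice_L' half_coord_components]) (use D C in simp_all)
    also have "\<dots> = (fps_X ^ (quot_rank - fs.dim D) * qpoch CARD('f) (fs.dim D)) * (fps_X ^ (quot_rank - fs.dim D) * qpoch CARD('f) (fs.dim D)) * zeta_maximal"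
      unfolding image_series_value_def C quot_space(3) ..
    finally have "image_series L' half_coord D D * (fps_X ^ fs.dim D * P_series (fs.dim D)) =
      (fps_X ^ (quot_rank - fs.dim D) * fps_X ^ fs.dim D) * (fps_X ^ (quot_rank - fs.dim D) * (qpoch CARD('f) (fs.dim D))\<^sup>2 * P_series (fs.dim D) * zeta_maximal)"
      by (simp only: power2_eq_square ac_simps)
    also have "fps_X ^ (quot_rank - fs.dim D) * fps_X ^ fs.dim D = (fps_X ^ quot_rank :: rat fps)"
      using le by (simp flip: power_add)
    finally show "image_series L' half_coord D D * (fps_X ^ fs.dim D * P_series (fs.dim D)) =
      fps_X ^ quot_rank * (fps_X ^ (quot_rank - fs.dim D) * (qpoch CARD('f) (fs.dim D))\<^sup>2 * P_series (fs.dim D) * zeta_maximal)" .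
  qed
  also have "\<dots> = (\<Sum>j\<le>fs.dim quot_space. fps_const (qbinom CARD('f) (fs.dim quot_space) j) *
      (fps_X ^ quot_rank * (fps_X ^ (quot_rank - j) * (qpoch CARD('f) j)\<^sup>2 * P_series j * zeta_maximal)))"
    by (rule fs.sum_subspaces_by_dim[OF quot_space(1,2)])
  also have "\<dots> = fps_X ^ quot_rank * ((\<Sum>j\<le>quot_rank. fps_const (qbinom CARD('f) quot_rank j) *
      (fps_X ^ (quot_rank - j) * (qpoch CARD('f) j)\<^sup>2 * P_series j)) * zeta_maximal)"
    unfolding quot_space(3) sum_distrib_left sum_distrib_right by (intro sum.cong refl) (simp only: ac_simps)
  finally show ?thesis by simp
qed

end

section \<open>Dimensions of finite vector spaces\<close>

text \<open>Coordinates with respect to a basis. From here on dimensions are determined by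
  counting.\<close>

lemma card_vectorspace:
  fixes V :: "('f::{field,finite}, 'm) module"
  assumes "vectorspace class_ring V" "finite (carrier V)"
  shows "card (carrier V) = CARD('f) ^ vectorspace.dim class_ring V"
proof -
  interpret vectorspace class_ring V by (rule assms(1))
  have "span (carrier V) = carrier V"
    using in_own_span[of "carrier V"] span_is_subset2[of "carrier V"] by (intro subset_antisym) simp_all
  hence "fin_dim" unfolding fin_dim_def using assms(2) by (intro exI[of _ "carrier V"] conjI order_refl)
  from finite_basis_exists[OF this] obtain B where B: "finite B" "basis B" by (elim exE conjE)
  have BV: "B \<subseteq> carrier V" using B(2) by (simp add: basis_def)
  have uniq: "\<exists>!a. a \<in> B \<rightarrow>\<^sub>E UNIV \<and> lincomb a B = v" if "v \<in> carrier V" for v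
    using basis_criterion[OF B(1) BV] B(2) that by simp
  have "bij_betw (\<lambda>a. lincomb a B) (B \<rightarrow>\<^sub>E UNIV) (carrier V)"
  proof (rule bij_betw_imageI)
    have closed: "lincomb a B \<in> carrier V" for a
      using BV by (intro lincomb_closed) auto
    show "inj_on (\<lambda>a. lincomb a B) (B \<rightarrow>\<^sub>E UNIV)"
    proof (rule inj_onI)
      fix a b assume ab: "a \<in> B \<rightarrow>\<^sub>E (UNIV :: 'f set)" "b \<in> B \<rightarrow>\<^sub>E (UNIV :: 'f set)" "lincomb a B = lincomb b B"
      obtain c where c: "\<forall>y. y \<in> B \<rightarrow>\<^sub>E UNIV \<and> lincomb y B = lincomb a B \<longrightarrow> y = c"
        using uniq[OF closed[of a]] by (elim ex1E)
      have "a = c" by (rule mp[OF spec[OF c] conjI[OF ab(1) refl]])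
      moreover have "b = c" by (rule mp[OF spec[OF c] conjI[OF ab(2) ab(3)[symmetric]]])
      ultimately show "a = b" by simp
    qed
    show "(\<lambda>a. lincomb a B) ` (B \<rightarrow>\<^sub>E UNIV) = carrier V"
    proof (intro equalityI subsetI)
      fix v assume "v \<in> carrier V"
      from ex1_implies_ex[OF uniq[OF this]] show "v \<in> (\<lambda>a. lincomb a B) ` (B \<rightarrow>\<^sub>E UNIV)" by auto
    qed (use closed in auto)
  qed
  hence "card (carrier V) = card (B \<rightarrow>\<^sub>E (UNIV :: 'f set))" by (rule bij_betw_same_card[symmetric])
  also have "\<dots> = CARD('f) ^ card B" using B(1) by (simp add: card_PiE)
  also have "card B = dim" using dim_basis[OF B] by simp
  finally show ?thesis .
qed

text \<open>\<open>V\<close> is only a record whose operations match those of a subspace under the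
  bijection \<open>h\<close>; each vector space law is pulled back along \<open>h\<close>.\<close>

lemma vectorspace_transport:
  fixes V :: "('f::{field,finite}, 'm) module" and h :: "'m \<Rightarrow> nat \<Rightarrow> 'f"
  assumes D: "fs.subspace D" "finite D" and h: "inj_on h (carrier V)" "h ` carrier V = D"
    and add: "\<And>x y. x \<in> carrier V \<Longrightarrow> y \<in> carrier V \<Longrightarrow> x \<oplus>\<^bsub>V\<^esub> y \<in> carrier V \<and> h (x \<oplus>\<^bsub>V\<^esub> y) = h x + h y"
    and smult: "\<And>c x. x \<in> carrier V \<Longrightarrow> c \<odot>\<^bsub>V\<^esub> x \<in> carrier V \<and> h (c \<odot>\<^bsub>V\<^esub> x) = fscale c (h x)"
    and zero: "\<zero>\<^bsub>V\<^esub> \<in> carrier V" "h \<zero>\<^bsub>V\<^esub> = 0"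
  shows "vectorspace class_ring V" "vectorspace.dim class_ring V = fs.dim D"
proof -
  note eqI = inj_onD[OF h(1)]
  note [simp] = conjunct1[OF add] conjunct2[OF add] conjunct1[OF smult] conjunct2[OF smult] zero
  show vs: "vectorspace class_ring V"
  proof (rule vs_criteria)
    show "field (class_ring :: 'f ring)" using class_field by (simp add: class_field_def)
    show "\<zero>\<^bsub>V\<^esub> \<in> carrier V" by (rule zero(1))
    show "\<forall>v\<in>carrier V. \<exists>w\<in>carrier V. v \<oplus>\<^bsub>V\<^esub> w = \<zero>\<^bsub>V\<^esub>"
    proof
      fix v assume v: "v \<in> carrier V"
      have "v \<oplus>\<^bsub>V\<^esub> (- 1) \<odot>\<^bsub>V\<^esub> v = \<zero>\<^bsub>V\<^esub>"
        using v by (intro eqI) (simp_all add: fscale_def fun_eq_iff)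
      thus "\<exists>w\<in>carrier V. v \<oplus>\<^bsub>V\<^esub> w = \<zero>\<^bsub>V\<^esub>" using v by (intro bexI[of _ "(- 1) \<odot>\<^bsub>V\<^esub> v"]) simp_all
    qed
    show "\<forall>v w. v \<in> carrier V \<and> w \<in> carrier V \<longrightarrow> v \<oplus>\<^bsub>V\<^esub> w = w \<oplus>\<^bsub>V\<^esub> v"
      by (intro allI impI eqI) (auto simp: add.commute)
    show "\<forall>v w x. v \<in> carrier V \<and> w \<in> carrier V \<and> x \<in> carrier V \<longrightarrow> v \<oplus>\<^bsub>V\<^esub> w \<oplus>\<^bsub>V\<^esub> x = v \<oplus>\<^bsub>V\<^esub> (w \<oplus>\<^bsub>V\<^esub> x)"
      by (intro allI impI eqI) (auto simp: add.assoc)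
    show "\<forall>v\<in>carrier V. v \<oplus>\<^bsub>V\<^esub> \<zero>\<^bsub>V\<^esub> = v"
      by (intro ballI eqI) auto
    show "\<forall>a b v. a \<in> carrier class_ring \<and> b \<in> carrier class_ring \<and> v \<in> carrier V \<longrightarrow>
        (a \<otimes>\<^bsub>class_ring\<^esub> b) \<odot>\<^bsub>V\<^esub> v = a \<odot>\<^bsub>V\<^esub> (b \<odot>\<^bsub>V\<^esub> v)"
      by (intro allI impI eqI) (auto simp: fscale_def fun_eq_iff)
    show "\<forall>v\<in>carrier V. \<one>\<^bsub>class_ring\<^esub> \<odot>\<^bsub>V\<^esub> v = v"
      by (intro ballI eqI) (auto simp: fscale_def fun_eq_iff)
    show "\<forall>a b v. a \<in> carrier class_ring \<and> b \<in> carrier class_ring \<and> v \<in> carrier V \<longrightarrow>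
        (a \<oplus>\<^bsub>class_ring\<^esub> b) \<odot>\<^bsub>V\<^esub> v = a \<odot>\<^bsub>V\<^esub> v \<oplus>\<^bsub>V\<^esub> b \<odot>\<^bsub>V\<^esub> v"
      by (intro allI impI eqI) (auto simp: fscale_def fun_eq_iff distrib_right)
    show "\<forall>a v w. a \<in> carrier class_ring \<and> v \<in> carrier V \<and> w \<in> carrier V \<longrightarrow>
        a \<odot>\<^bsub>V\<^esub> (v \<oplus>\<^bsub>V\<^esub> w) = a \<odot>\<^bsub>V\<^esub> v \<oplus>\<^bsub>V\<^esub> a \<odot>\<^bsub>V\<^esub> w"
      by (intro allI impI eqI) (auto simp: fscale_def fun_eq_iff distrib_left)
  qed auto
  have "finite (carrier V)" using h D(2) finite_imageD by blast
  from card_vectorspace[OF vs this]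
  have "CARD('f) ^ vectorspace.dim class_ring V = card D" using card_image[OF h(1)] h(2) by simp
  thus "vectorspace.dim class_ring V = fs.dim D"
    using fs.card_dim[OF D] by (simp add: fs.card_power_inject)
qed

definition vec_fun :: "nat \<Rightarrow> 'f::{field,finite} vec \<Rightarrow> nat \<Rightarrow> 'f" where
  "vec_fun n v = (\<lambda>i. if i < n then vec_index v i else 0)"

definition bounded_fun :: "nat \<Rightarrow> (nat \<Rightarrow> 'f::{field,finite}) set" where
  "bounded_fun n = {g. \<forall>i\<ge>n. g i = 0}"

lemma bounded_fun: "fs.subspace (bounded_fun n)" "finite (bounded_fun n :: (nat \<Rightarrow> 'f::{field,finite}) set)"
  by (auto intro!: fs.subspaceI finite_bounded_functions[of _ n] simp: bounded_fun_def fscale_def)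

lemma vec_fun_bij: "bij_betw (vec_fun n) (carrier_vec n) (bounded_fun n)"
  by (rule bij_betwI[where g = "\<lambda>g. vec n g"]) (auto simp: vec_fun_def bounded_fun_def fun_eq_iff)

lemma vec_fun_hom:
  "v \<in> carrier_vec n \<Longrightarrow> w \<in> carrier_vec n \<Longrightarrow> vec_fun n (v + w) = vec_fun n v + vec_fun n w"
  "v \<in> carrier_vec n \<Longrightarrow> vec_fun n (c \<cdot>\<^sub>v v) = fscale c (vec_fun n v)"
  "vec_fun n (0\<^sub>v n) = 0"
  by (auto simp: vec_fun_def fun_eq_iff fscale_def)

lemma card_bounded_fun: "card (bounded_fun n :: (nat \<Rightarrow> 'f::{field,finite}) set) = CARD('f) ^ n"
proof -
  have fin: "finite (carrier_vec n :: 'f vec set)"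
    using bij_betw_finite[OF vec_fun_bij] bounded_fun(2) by blast
  have dim: "vectorspace.dim class_ring (module_vec TYPE('f) n) = n"
    using vec_space.dim_is_n .
  have "finite (carrier (module_vec TYPE('f) n))" using fin by (simp add: module_vec_simps)
  from card_vectorspace[OF vec_vs this]
  have "card (carrier (module_vec TYPE('f) n)) = CARD('f) ^ n" unfolding dim .
  moreover have "bij_betw (vec_fun n) (carrier_vec n :: 'f vec set) (bounded_fun n)" by (rule vec_fun_bij)
  from bij_betw_same_card[OF this]
  have "card (carrier_vec n :: 'f vec set) = card (bounded_fun n :: (nat \<Rightarrow> 'f) set)" .
  ultimately show ?thesis by (simp add: module_vec_simps)
qed

text \<open>Vectors become sequences that vanish from \<open>n\<close> on. Subspaces correspond
  under this map, and a dimension is recognized from the cardinality.\<close>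

lemma gauss_binomial_qbinom:
  "of_nat (gauss_binomial TYPE('f::{field,finite}) n k) = qbinom CARD('f) n k"
proof -
  let ?V = "module_vec TYPE('f) n"
  let ?Ws = "{W. VectorSpace.subspace class_ring W ?V \<and> vectorspace.dim class_ring (?V\<lparr>carrier := W\<rparr>) = k}"
  let ?Es = "{E. fs.subspace E \<and> E \<subseteq> (bounded_fun n :: (nat \<Rightarrow> 'f) set) \<and> card E = CARD('f) ^ k}"
  have inj: "inj_on (vec_fun n) (carrier_vec n :: 'f vec set)" using vec_fun_bij by (rule bij_betw_imp_inj_on)
  have surj: "vec_fun n ` carrier_vec n = (bounded_fun n :: (nat \<Rightarrow> 'f) set)"
    using vec_fun_bij by (rule bij_betw_imp_surj_on)
  have finV: "finite (carrier_vec n :: 'f vec set)"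
    using bij_betw_finite[OF vec_fun_bij] bounded_fun(2) by blast
  have iff: "VectorSpace.subspace class_ring W ?V \<longleftrightarrow> fs.subspace (vec_fun n ` W)"
    if W: "W \<subseteq> carrier_vec n" for W :: "'f vec set"
  proof
    assume "VectorSpace.subspace class_ring W ?V"
    hence sm: "submodule class_ring W ?V" by (simp add: VectorSpace.subspace_def)
    show "fs.subspace (vec_fun n ` W)"
    proof (rule fs.subspaceI)
      have "0\<^sub>v n \<in> W" using submodule.zero_closed[OF sm] by (simp add: module_vec_simps)
      thus "0 \<in> vec_fun n ` W" by (rule image_eqI[rotated]) (simp add: vec_fun_hom)
      show "x + y \<in> vec_fun n ` W" if xy: "x \<in> vec_fun n ` W" "y \<in> vec_fun n ` W" for x y
      proof -
        obtain v w where vw: "x = vec_fun n v" "y = vec_fun n w" "v \<in> W" "w \<in> W" using xy by auto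
        have "v + w \<in> W" using submodule.m_closed[OF sm vw(3,4)] by (simp add: module_vec_simps)
        moreover have "x + y = vec_fun n (v + w)" using vw W by (subst vec_fun_hom) auto
        ultimately show ?thesis by simp
      qed
      show "fscale c x \<in> vec_fun n ` W" if x: "x \<in> vec_fun n ` W" for c x
      proof -
        obtain v where v: "x = vec_fun n v" "v \<in> W" using x by auto
        have "c \<cdot>\<^sub>v v \<in> W" using submodule.smult_closed[OF sm _ v(2), of c] by (simp add: module_vec_simps)
        moreover have "fscale c x = vec_fun n (c \<cdot>\<^sub>v v)" using v W by (subst vec_fun_hom) auto
        ultimately show ?thesis by simp
      qed
    qed
  next
    assume E: "fs.subspace (vec_fun n ` W)"
    have mem: "v \<in> W" if "v \<in> carrier_vec n" "vec_fun n v \<in> vec_fun n ` W" for v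
      using inj_on_image_mem_iff[OF inj that(1) W] that(2) by simp
    show "VectorSpace.subspace class_ring W ?V"
      unfolding VectorSpace.subspace_def
    proof (intro conjI vec_vs submodule.intro)
      show "Module.module class_ring ?V" using vec_vs[where 'a = 'f] by (simp add: vectorspace_def)
      show "W \<subseteq> carrier ?V" using W by (simp add: module_vec_simps)
      show "v \<oplus>\<^bsub>?V\<^esub> w \<in> W" if "v \<in> W" "w \<in> W" for v w
      proof -
        have c: "v \<in> carrier_vec n" "w \<in> carrier_vec n" using that W by auto
        have "vec_fun n (v + w) \<in> vec_fun n ` W"
          unfolding vec_fun_hom(1)[OF c] using that by (intro fs.subspace_add[OF E]) auto
        thus ?thesis using mem[of "v + w"] c by (simp add: module_vec_simps)
      qed
      show "\<zero>\<^bsub>?V\<^esub> \<in> W"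
        using mem[of "0\<^sub>v n"] fs.subspace_0[OF E] by (simp add: module_vec_simps vec_fun_hom)
      show "c \<odot>\<^bsub>?V\<^esub> v \<in> W" if "c \<in> carrier class_ring" "v \<in> W" for c v
      proof -
        have c: "v \<in> carrier_vec n" using that W by auto
        have "vec_fun n (c \<cdot>\<^sub>v v) \<in> vec_fun n ` W"
          unfolding vec_fun_hom(2)[OF c] using that by (intro fs.subspace_scale[OF E]) auto
        thus ?thesis using mem[of "c \<cdot>\<^sub>v v"] c by (simp add: module_vec_simps)
      qed
    qed
  qed
  have dim: "vectorspace.dim class_ring (?V\<lparr>carrier := W\<rparr>) = k \<longleftrightarrow> card (vec_fun n ` W) = CARD('f) ^ k"
    if W: "W \<subseteq> carrier_vec n" "VectorSpace.subspace class_ring W ?V" for W :: "'f vec set"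
  proof -
    have vs: "vectorspace class_ring (?V\<lparr>carrier := W\<rparr>)"
      by (rule vectorspace.subspace_is_vs[OF vec_vs W(2)])
    have "finite (carrier (?V\<lparr>carrier := W\<rparr>))" using finite_subset[OF W(1) finV] by simp
    from card_vectorspace[OF vs this] card_image[OF inj_on_subset[OF inj W(1)]]
    have "card (vec_fun n ` W) = CARD('f) ^ vectorspace.dim class_ring (?V\<lparr>carrier := W\<rparr>)" by simp
    thus ?thesis by (simp add: fs.card_power_inject)
  qed
  have car: "W \<subseteq> carrier_vec n" if "VectorSpace.subspace class_ring W ?V" for W
    using submodule.subset[of class_ring W ?V] that by (simp add: VectorSpace.subspace_def module_vec_simps)
  have "bij_betw (\<lambda>W. vec_fun n ` W) ?Ws ?Es"
  proof (rule bij_betw_imageI)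
    show "inj_on (\<lambda>W. vec_fun n ` W) ?Ws"
      by (rule inj_onI) (use inj_on_image_eq_iff[OF inj] car in auto)
    show "(\<lambda>W. vec_fun n ` W) ` ?Ws = ?Es"
    proof (intro equalityI subsetI)
      fix E assume "E \<in> (\<lambda>W. vec_fun n ` W) ` ?Ws"
      then obtain W where W: "E = vec_fun n ` W" "VectorSpace.subspace class_ring W ?V"
        "vectorspace.dim class_ring (?V\<lparr>carrier := W\<rparr>) = k" by auto
      note c = car[OF W(2)]
      show "E \<in> ?Es" using W iff[OF c] dim[OF c W(2)] image_mono[OF c, of "vec_fun n"] surj by simp
    next
      fix E assume E: "E \<in> ?Es"
      hence "E \<subseteq> vec_fun n ` carrier_vec n" using surj by simp
      then obtain W where W: "W \<subseteq> carrier_vec n" "E = vec_fun n ` W" by (auto simp: subset_image_iff)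
      have s: "VectorSpace.subspace class_ring W ?V" using iff[OF W(1)] E W(2) by simp
      have "W \<in> ?Ws" using s dim[OF W(1) s] E W(2) by simp
      thus "E \<in> (\<lambda>W. vec_fun n ` W) ` ?Ws" using W(2) by (rule rev_image_eqI)
    qed
  qed
  hence "gauss_binomial TYPE('f) n k = card ?Es"
    unfolding gauss_binomial_def by (rule bij_betw_same_card)
  moreover have "of_nat (card ?Es) = qbinom CARD('f) n k"
    by (rule fs.card_subspaces_qbinom[OF bounded_fun card_bounded_fun])
  ultimately show ?thesis by simp
qed

text \<open>Indexing the relation by positions makes a repeated entry count as a dependence, which
  is how the columns of a matrix behave.\<close>

lemma (in finite_field_space) list_independent_iff:
  "distinct ys \<and> independent (set ys) \<longleftrightarrow>
     (\<forall>c. (\<Sum>k<length ys. c k *s ys ! k) = 0 \<longrightarrow> (\<forall>k<length ys. c k = 0))"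
proof
  assume *: "distinct ys \<and> independent (set ys)"
  hence bij: "bij_betw (\<lambda>k. ys ! k) {..<length ys} (set ys)"
    by (simp add: bij_betw_nth)
  show "\<forall>c. (\<Sum>k<length ys. c k *s ys ! k) = 0 \<longrightarrow> (\<forall>k<length ys. c k = 0)"
  proof (intro allI impI)
    fix c k assume c: "(\<Sum>k<length ys. c k *s ys ! k) = 0" and k: "k < length ys"
    let ?i = "the_inv_into {..<length ys} (\<lambda>k. ys ! k)"
    have inv: "?i (ys ! k) = k" if "k < length ys" for k
      using the_inv_into_f_f[OF bij_betw_imp_inj_on[OF bij]] that by simp
    have "(\<Sum>v\<in>set ys. c (?i v) *s v) = (\<Sum>k<length ys. c (?i (ys ! k)) *s ys ! k)"
      by (rule sum.reindex_bij_betw[OF bij, symmetric])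
    also have "\<dots> = 0" using c inv by simp
    finally have "c (?i (ys ! k)) = 0"
      using independentD[of "set ys" "set ys" "\<lambda>v. c (?i v)" "ys ! k"] * k by simp
    thus "c k = 0" using inv[OF k] by simp
  qed
next
  assume *: "\<forall>c. (\<Sum>k<length ys. c k *s ys ! k) = 0 \<longrightarrow> (\<forall>k<length ys. c k = 0)"
  have dis: "distinct ys"
    unfolding distinct_conv_nth
  proof (intro allI impI notI)
    fix i j assume ij: "i < length ys" "j < length ys" "i \<noteq> j" "ys ! i = ys ! j"
    \<comment> \<open>A repeated entry yields the nontrivial relation with coefficients 1 and
      -1.\<close>
    let ?c = "\<lambda>k. if k = i then 1 else if k = j then - 1 else 0 :: 'f"
    have "(\<Sum>k<length ys. ?c k *s ys ! k) = (\<Sum>k\<in>{i, j}. ?c k *s ys ! k)"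
      using ij by (intro sum.mono_neutral_right) auto
    also have "\<dots> = 0" using ij by simp
    finally have "(\<Sum>k<length ys. ?c k *s ys ! k) = 0" .
    with * have "\<forall>k<length ys. ?c k = 0" by (elim allE[of _ ?c] impE)
    with ij(1) have "?c i = 0" by (elim allE[of _ i] impE)
    thus False by simp
  qed
  hence bij: "bij_betw (\<lambda>k. ys ! k) {..<length ys} (set ys)" by (simp add: bij_betw_nth)
  have "independent (set ys)"
  proof (rule independent_if_scalars_zero)
    fix u v assume u: "(\<Sum>x\<in>set ys. u x *s x) = 0" and v: "v \<in> set ys"
    have "(\<Sum>k<length ys. u (ys ! k) *s ys ! k) = 0"
      using sum.reindex_bij_betw[OF bij, of "\<lambda>x. u x *s x"] u by simp
    hence "\<forall>k<length ys. u (ys ! k) = 0" by (rule mp[OF spec[OF *, of "\<lambda>k. u (ys ! k)"]])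
    thus "u v = 0" using v by (auto simp: in_set_conv_nth)
  qed simp
  thus "distinct ys \<and> independent (set ys)" using dis by simp
qed

text \<open>A square matrix is invertible iff its columns form an independent list, so invertible
  matrices correspond to the ordered bases of the space.\<close>

lemma card_GL_frames: "card_GL TYPE('f::{field,finite}) l = frames CARD('f) l l"
proof -
  let ?G = "{g :: 'f mat. g \<in> carrier_mat l l \<and> invertible_mat g}"
  let ?cols = "\<lambda>g :: 'f mat. map (\<lambda>k. vec_fun l (col g k)) [0..<l]"
  let ?inv = "\<lambda>ys :: (nat \<Rightarrow> 'f) list. mat l l (\<lambda>(i, k). (ys ! k) i)"
  have det: "invertible_mat g \<longleftrightarrow> det g \<noteq> 0" if g: "g \<in> carrier_mat l l" for g :: "'f mat"
  proof
    assume "invertible_mat g"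
    then obtain h where h: "inverts_mat g h" "inverts_mat h g" by (auto simp: invertible_mat_def)
    \<comment> \<open>\<open>invertible_mat\<close> does not prescribe the size of the inverse; it
      is read off from the two products.\<close>
    have gh: "g * h = 1\<^sub>m l" "h * g = 1\<^sub>m (dim_row h)" using h g by (auto simp: inverts_mat_def)
    have "dim_col h = l" using arg_cong[OF gh(1), of dim_col] by simp
    moreover have "dim_row h = l" using arg_cong[OF gh(2), of dim_col] g by simp
    ultimately have hc: "h \<in> carrier_mat l l" by (rule carrier_matI[rotated])
    have "det g * det h = 1" using det_mult[OF g hc] gh(1) by simp
    thus "det g \<noteq> 0" by auto
  next
    assume "det g \<noteq> 0"
    from det_non_zero_imp_unit[OF g this, of "()"]
    obtain h where "h \<in> carrier_mat l l" "h * g = 1\<^sub>m l" "g * h = 1\<^sub>m l"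
      by (auto simp: Units_def ring_mat_def)
    thus "invertible_mat g" using g by (auto simp: invertible_mat_def inverts_mat_def)
  qed
  have ind: "invertible_mat g \<longleftrightarrow> distinct (?cols g) \<and> fs.independent (set (?cols g))"
    if g: "g \<in> carrier_mat l l" for g :: "'f mat"
  proof -
    have val: "(\<Sum>k<l. fscale (c k) (?cols g ! k)) i = (if i < l then (\<Sum>k<l. c k * g $$ (i, k)) else 0)" for c i
    proof -
      have "(\<Sum>k\<in>A. fscale (c k) (?cols g ! k)) i = (\<Sum>k\<in>A. c k * (?cols g ! k) i)" for A
        by (induction A rule: infinite_finite_induct) (auto simp: fscale_def)
      hence "(\<Sum>k<l. fscale (c k) (?cols g ! k)) i = (\<Sum>k<l. c k * (?cols g ! k) i)" .
      also have "\<dots> = (\<Sum>k<l. c k * (if i < l then g $$ (i, k) else 0))"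
        using g by (intro sum.cong) (auto simp: vec_fun_def)
      finally show ?thesis by simp
    qed
    have vec: "g *\<^sub>v vec l c = 0\<^sub>v l \<longleftrightarrow> (\<Sum>k<l. fscale (c k) (?cols g ! k)) = 0" for c
    proof -
      have "g *\<^sub>v vec l c = 0\<^sub>v l \<longleftrightarrow> (\<forall>i<l. (\<Sum>k<l. c k * g $$ (i, k)) = 0)"
        using g by (auto simp: vec_eq_iff scalar_prod_def lessThan_atLeast0 mult.commute intro!: sum.cong)
      also have "\<dots> \<longleftrightarrow> (\<forall>i. (\<Sum>k<l. fscale (c k) (?cols g ! k)) i = 0)" unfolding val by auto
      also have "\<dots> \<longleftrightarrow> (\<Sum>k<l. fscale (c k) (?cols g ! k)) = 0" unfolding fun_eq_iff zero_fun_apply ..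
      finally show ?thesis .
    qed
    have "invertible_mat g \<longleftrightarrow> (\<forall>v\<in>carrier_vec l. g *\<^sub>v v = 0\<^sub>v l \<longrightarrow> v = 0\<^sub>v l)"
      unfolding det[OF g] using det_0_iff_vec_prod_zero_field[OF g] by blast
    also have "\<dots> \<longleftrightarrow> (\<forall>c. g *\<^sub>v vec l c = 0\<^sub>v l \<longrightarrow> (\<forall>k<l. c k = 0))"
    proof (intro iffI allI ballI impI)
      fix c k assume "\<forall>v\<in>carrier_vec l. g *\<^sub>v v = 0\<^sub>v l \<longrightarrow> v = 0\<^sub>v l" "g *\<^sub>v vec l c = 0\<^sub>v l" "k < l"
      hence "vec l c = 0\<^sub>v l" by auto
      from arg_cong[OF this, of "\<lambda>v. vec_index v k"] show "c k = 0" using \<open>k < l\<close> by simp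
    next
      fix v assume *: "\<forall>c. g *\<^sub>v vec l c = 0\<^sub>v l \<longrightarrow> (\<forall>k<l. c k = 0)" "v \<in> carrier_vec l" "g *\<^sub>v v = 0\<^sub>v l"
      have "vec l (\<lambda>k. vec_index v k) = v" using *(2) by auto
      hence "\<forall>k<l. vec_index v k = 0" using *(1)[rule_format, of "\<lambda>k. vec_index v k"] *(3) by simp
      thus "v = 0\<^sub>v l" using *(2) by auto
    qed
    also have "\<dots> \<longleftrightarrow> distinct (?cols g) \<and> fs.independent (set (?cols g))"
      unfolding vec fs.list_independent_iff by simp
    finally show ?thesis .
  qed
  have cols_inv: "?cols (?inv ys) = ys" if "ys \<in> fs.ind_lists (bounded_fun l) l" for ys
  proof (rule nth_equalityI)
    show "length (?cols (?inv ys)) = length ys" using that by (simp add: fs.ind_lists_def)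
    fix k assume "k < length (?cols (?inv ys))"
    hence k: "k < l" by simp
    hence "ys ! k \<in> bounded_fun l" using that by (auto simp: fs.ind_lists_def)
    thus "?cols (?inv ys) ! k = ys ! k" using k by (auto simp: vec_fun_def bounded_fun_def fun_eq_iff)
  qed
  have "bij_betw ?cols ?G (fs.ind_lists (bounded_fun l) l)"
  proof (rule bij_betwI[where g = ?inv], goal_cases)
    case 1
    show ?case using ind by (auto simp: fs.ind_lists_def bounded_fun_def vec_fun_def)
  next
    case 2
    show ?case
    proof
      fix ys :: "(nat \<Rightarrow> 'f) list" assume ys: "ys \<in> fs.ind_lists (bounded_fun l) l"
      have "?inv ys \<in> carrier_mat l l" by simp
      moreover have "distinct ys \<and> fs.independent (set ys)" using ys by (simp add: fs.ind_lists_def)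
      hence "distinct (?cols (?inv ys)) \<and> fs.independent (set (?cols (?inv ys)))" unfolding cols_inv[OF ys] .
      ultimately show "?inv ys \<in> ?G" using ind[of "?inv ys"] by blast
    qed
  next
    case (3 g)
    thus ?case by (auto simp: vec_fun_def intro!: eq_matI)
  next
    case (4 ys)
    thus ?case by (rule cols_inv)
  qed
  hence "card_GL TYPE('f) l = card (fs.ind_lists (bounded_fun l :: (nat \<Rightarrow> 'f) set) l)"
    unfolding card_GL_def by (rule bij_betw_same_card)
  also have "\<dots> = frames CARD('f) l l"
    by (rule fs.card_ind_lists[OF bounded_fun card_bounded_fun])
  finally show ?thesis .
qed

section \<open>Quotients as in HOL-Algebra\<close>

lemma rcoset_module_on: "X +>\<^bsub>module_on act N\<^esub> x = coset X x"
  by (auto simp: a_r_coset_def' module_on_def coset_def)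

lemma rcoset_ring_on: "X +>\<^bsub>ring_on S\<^esub> x = coset X x"
  by (auto simp: a_r_coset_def' ring_on_def coset_def)

lemma carrier_quot_module_on: "carrier (quot_module (module_on act N) X) = quo N X"
proof -
  have "carrier (quot_module (module_on act N) X) = (\<Union>a\<in>N. {X +>\<^bsub>module_on act N\<^esub> a})"
    by (simp add: quot_module_def A_RCOSETS_def' module_on_def)
  thus ?thesis by (auto simp: rcoset_module_on quo_def)
qed

lemma coset_0: "coset A 0 = A"
  by (auto simp: coset_def)

lemma coset_plus_coset:
  assumes "is_add_subgroup A"
  shows "(\<Union>h\<in>coset A x. \<Union>k\<in>coset A y. {h + k}) = coset A (x + y)"
proof (intro equalityI subsetI)
  fix z assume "z \<in> (\<Union>h\<in>coset A x. \<Union>k\<in>coset A y. {h + k})"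
  then obtain h k where hk: "h - x \<in> A" "k - y \<in> A" "z = h + k" by (auto simp: mem_coset[OF assms])
  have "z - (x + y) = (h - x) + (k - y)" using hk(3) by simp
  also have "\<dots> \<in> A" by (rule add_subgroup_add[OF assms hk(1,2)])
  finally show "z \<in> coset A (x + y)" by (simp only: mem_coset[OF assms])
next
  fix z assume "z \<in> coset A (x + y)"
  hence "(z - y) - x \<in> A" by (simp add: mem_coset[OF assms] algebra_simps)
  hence "z - y \<in> coset A x" "y \<in> coset A y" using add_subgroup_0[OF assms] by (simp_all add: mem_coset[OF assms])
  moreover have "z = (z - y) + y" by simp
  ultimately show "z \<in> (\<Union>h\<in>coset A x. \<Union>k\<in>coset A y. {h + k})" by blast
qed

lemma set_add_module_on:
  assumes "is_add_subgroup A"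
  shows "set_add (module_on act N) (coset A x) (coset A y) = coset A (x + y)"
  unfolding coset_plus_coset[OF assms, symmetric] by (simp add: set_add_def' module_on_def)

lemma (in left_module) smult_coset:
  assumes "is_submodule S act A" "a \<in> S"
  shows "(\<Union>y\<in>coset A x. coset A (act a y)) = coset A (act a x)"
proof -
  note gA = submodule_subgroup[OF assms(1)]
  have eq: "coset A (act a y) = coset A (act a x)" if "y \<in> coset A x" for y
  proof -
    have "act a (y - x) \<in> A" using that by (intro submodule_act[OF assms]) (simp add: mem_coset[OF gA])
    thus ?thesis by (simp add: coset_eq_iff[OF gA] act_diff_right)
  qed
  have x: "x \<in> coset A x" using add_subgroup_0[OF gA] by (simp add: mem_coset[OF gA])
  have "(\<Union>y\<in>coset A x. coset A (act a y)) = (\<Union>y\<in>coset A x. coset A (act a x))"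
    by (rule SUP_cong[OF refl eq])
  also have "\<dots> = coset A (act a x)" using x unfolding UN_constant by (metis empty_iff)
  finally show ?thesis .
qed

text \<open>The isomorphism is pulled back to elements, so that from here on only the composite of
  \<psi> with the coset map matters.\<close>

lemma residue_hom:
  fixes S I :: "'a::ring_1 set"
  assumes S: "is_add_subgroup S"
    and I: "is_add_subgroup I" "\<forall>s\<in>S. \<forall>i\<in>I. s * i \<in> I \<and> i * s \<in> I" "I \<subseteq> S"
    and iso: "\<psi> \<in> ring_iso (ring_on S Quot I) T"
  shows "\<And>x y. x \<in> S \<Longrightarrow> y \<in> S \<Longrightarrow> \<psi> (coset I (x + y)) = \<psi> (coset I x) \<oplus>\<^bsub>T\<^esub> \<psi> (coset I y)"
    "\<And>x y. x \<in> S \<Longrightarrow> y \<in> S \<Longrightarrow> \<psi> (coset I (x * y)) = \<psi> (coset I x) \<otimes>\<^bsub>T\<^esub> \<psi> (coset I y)"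
    "\<psi> (coset I 1) = \<one>\<^bsub>T\<^esub>"
    "\<And>x y. x \<in> S \<Longrightarrow> y \<in> S \<Longrightarrow> \<psi> (coset I x) = \<psi> (coset I y) \<longleftrightarrow> x - y \<in> I"
    "(\<lambda>x. \<psi> (coset I x)) ` S = carrier T"
proof -
  let ?Q = "ring_on S Quot I"
  have car: "carrier ?Q = coset I ` S"
  proof -
    have "carrier ?Q = (\<Union>a\<in>S. {I +>\<^bsub>ring_on S\<^esub> a})"
      by (simp add: FactRing_def A_RCOSETS_def' ring_on_def)
    thus ?thesis by (auto simp: rcoset_ring_on)
  qed
  have hom: "\<psi> \<in> Ring.ring_hom ?Q T" and bij: "bij_betw \<psi> (carrier ?Q) (carrier T)"
    using iso by (auto simp: ring_iso_def)
  show "\<psi> (coset I (x + y)) = \<psi> (coset I x) \<oplus>\<^bsub>T\<^esub> \<psi> (coset I y)" if "x \<in> S" "y \<in> S" for x y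
  proof -
    have "coset I x \<oplus>\<^bsub>?Q\<^esub> coset I y = coset I (x + y)"
      unfolding coset_plus_coset[OF I(1), symmetric] by (simp add: FactRing_def set_add_def' ring_on_def)
    thus ?thesis using ring_hom_add[OF hom, of "coset I x" "coset I y"] that car by simp
  qed
  show "\<psi> (coset I (x * y)) = \<psi> (coset I x) \<otimes>\<^bsub>T\<^esub> \<psi> (coset I y)" if xy: "x \<in> S" "y \<in> S" for x y
  proof -
    have "coset I (a * b) = coset I (x * y)" if ab: "a \<in> coset I x" "b \<in> coset I y" for a b
    proof -
      have d: "a - x \<in> I" "b - y \<in> I" using ab by (simp_all add: mem_coset[OF I(1)])
      have "a \<in> S"
      proof -
        have "x - (- (a - x)) \<in> S" by (rule add_subgroup_diff[OF S xy(1) subsetD[OF I(3) add_subgroup_minus[OF I(1) d(1)]]])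
        thus ?thesis by simp
      qed
      hence "a * (b - y) \<in> I" "(a - x) * y \<in> I" using I(2) d xy by auto
      from add_subgroup_add[OF I(1) this] have "a * b - x * y \<in> I" by (simp add: algebra_simps)
      thus ?thesis by (simp add: coset_eq_iff[OF I(1)])
    qed
    moreover have "x \<in> coset I x" "y \<in> coset I y" using add_subgroup_0[OF I(1)] by (simp_all add: mem_coset[OF I(1)])
    ultimately have "(\<Union>a\<in>coset I x. \<Union>b\<in>coset I y. coset I (a * b)) = coset I (x * y)" by blast
    hence "coset I x \<otimes>\<^bsub>?Q\<^esub> coset I y = coset I (x * y)"
      by (simp add: FactRing_def rcoset_mult_def rcoset_ring_on) (simp add: ring_on_def)
    thus ?thesis using ring_hom_mult[OF hom, of "coset I x" "coset I y"] xy car by simp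
  qed
  have "\<one>\<^bsub>?Q\<^esub> = coset I 1"
    by (simp add: FactRing_def rcoset_ring_on) (simp add: ring_on_def)
  thus "\<psi> (coset I 1) = \<one>\<^bsub>T\<^esub>" using ring_hom_one[OF hom] by simp
  show "\<psi> (coset I x) = \<psi> (coset I y) \<longleftrightarrow> x - y \<in> I" if "x \<in> S" "y \<in> S" for x y
    unfolding coset_eq_iff[OF I(1), symmetric]
    by (rule inj_on_eq_iff[OF bij_betw_imp_inj_on[OF bij, unfolded car]]) (rule imageI that)+
  show "(\<lambda>x. \<psi> (coset I x)) ` S = carrier T"
    using bij_betw_imp_surj_on[OF bij] by (simp add: car image_image)
qed

text \<open>The carrier consists of classes \<open>cc x\<close>, and \<open>f\<close> takes equal
  values exactly on equal classes. The induced map on classes is the bijection that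
  \<open>vectorspace_transport\<close> asks for.\<close>

lemma dim_via_map:
  fixes V :: "('f::{field,finite}, 'm) module" and f :: "'v::ab_group_add \<Rightarrow> nat \<Rightarrow> 'f"
  assumes D: "fs.subspace D" "finite D" "f ` E = D" and car: "carrier V = cc ` E"
    and eq: "\<And>x y. x \<in> E \<Longrightarrow> y \<in> E \<Longrightarrow> cc x = cc y \<longleftrightarrow> f x = f y"
    and add: "\<And>x y. x \<in> E \<Longrightarrow> y \<in> E \<Longrightarrow> x + y \<in> E \<and> cc x \<oplus>\<^bsub>V\<^esub> cc y = cc (x + y) \<and> f (x + y) = f x + f y"
    and smult: "\<And>c x. x \<in> E \<Longrightarrow> \<exists>z\<in>E. c \<odot>\<^bsub>V\<^esub> cc x = cc z \<and> f z = fscale c (f x)"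
    and zero: "0 \<in> E" "\<zero>\<^bsub>V\<^esub> = cc 0" "f 0 = 0"
  shows "vectorspace.dim class_ring V = fs.dim D"
proof -
  define h where "h X = f (SOME x. x \<in> E \<and> cc x = X)" for X
  have h: "h (cc x) = f x" if x: "x \<in> E" for x
  proof -
    have "\<exists>y. y \<in> E \<and> cc y = cc x" using x by auto
    from someI_ex[OF this] have s: "(SOME y. y \<in> E \<and> cc y = cc x) \<in> E" "cc (SOME y. y \<in> E \<and> cc y = cc x) = cc x"
      by simp_all
    show ?thesis unfolding h_def using eq[OF s(1) x] s(2) by (rule iffD1)
  qed
  show ?thesis
  proof (rule vectorspace_transport(2)[where h = h, OF D(1,2)])
    show "inj_on h (carrier V)" unfolding car by (rule inj_onI) (auto simp: h eq)
    show "h ` carrier V = D" unfolding car D(3)[symmetric] image_image by (rule image_cong) (auto simp: h)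
    show "x \<oplus>\<^bsub>V\<^esub> y \<in> carrier V \<and> h (x \<oplus>\<^bsub>V\<^esub> y) = h x + h y" if "x \<in> carrier V" "y \<in> carrier V" for x y
      using that add by (auto simp: car h)
    show "c \<odot>\<^bsub>V\<^esub> x \<in> carrier V \<and> h (c \<odot>\<^bsub>V\<^esub> x) = fscale c (h x)" if x: "x \<in> carrier V" for c x
    proof -
      obtain y where y: "y \<in> E" "x = cc y" using x by (auto simp: car)
      obtain z where "z \<in> E" "c \<odot>\<^bsub>V\<^esub> cc y = cc z" "f z = fscale c (f y)" using smult[OF y(1), of c] by (elim bexE conjE)
      thus ?thesis using y by (simp add: car h)
    qed
    show "\<zero>\<^bsub>V\<^esub> \<in> carrier V" "h \<zero>\<^bsub>V\<^esub> = 0" using zero by (auto simp: car h)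
  qed
qed

section \<open>The dimensions and series of the statement\<close>

context lattice_pair
begin

abbreviation "JL \<equiv> ideal_times act J L'"

lemma gJL: "is_add_subgroup JL" by (rule ideal_times_subgroup)

text \<open>The multipliers \<open>lam c\<close> have residue c at \<open>w\<close> and 0 at the
  other factor, so their images in L'/JL' are the classes on which the other coordinate vanishes. On
  these the coordinate at \<open>w\<close> is a faithful linear coordinate.\<close>

lemma dim_component:
  fixes V :: "('f, 'v set) module"
  assumes car: "carrier V = {coset JL (act (lam c) x) |c x. x \<in> L'}"
    and lam: "\<And>c. lam c \<in> S" "\<And>c. p w (lam c) = c" "\<And>c. p (\<not> w) (lam c) = 0"
    and add: "\<And>x y. x \<in> L' \<Longrightarrow> y \<in> L' \<Longrightarrow> coset JL x \<oplus>\<^bsub>V\<^esub> coset JL y = coset JL (x + y)"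
    and smult: "\<And>c x. x \<in> L' \<Longrightarrow> c \<odot>\<^bsub>V\<^esub> coset JL x = coset JL (act (lam c) x)"
    and zero: "\<zero>\<^bsub>V\<^esub> = JL"
  shows "vectorspace.dim class_ring V = comp_rank w"
proof -
  obtain g where g: "components L' g" and ker: "\<forall>w. \<forall>x\<in>L'. g w x = 0 \<longleftrightarrow> x \<in> ideal_times act (P w) L'"
    using components_P[OF lattice_L'] by (elim exE conjE)
  note semi = comp_semilinear[OF L'_submodule g]
  note C = comp_subspace[OF L'_submodule g L'_submodule order_refl]
  define E where "E = {y\<in>L'. g (\<not> w) y = 0}"
  have EL: "E \<subseteq> L'" by (auto simp: E_def)
  have g0: "g w' 0 = 0" for w' by (rule R.semilinear_0[OF semi L'_subgroup])
  have gadd: "g w' (x + y) = g w' x + g w' y" if "x \<in> L'" "y \<in> L'" for x y w'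
    by (rule R.semilinear_add[OF semi L'_subgroup that])
  have lamL: "act (lam c) x \<in> L'" if "x \<in> L'" for c x by (rule submodule_act[OF L'_submodule lam(1) that])
  have lamE: "act (lam c) x \<in> E" if "x \<in> L'" for c x
    using R.semilinear_act[OF semi lam(1) that, of "\<not> w" c] lamL[OF that] lam(3) by (simp add: E_def fscale_def fun_eq_iff)
  have lamg: "g w (act (lam c) x) = fscale c (g w x)" if "x \<in> L'" for c x
    using R.semilinear_act[OF semi lam(1) that, of w c] lam(2) by simp
  have lam1: "g w (act (lam 1) x) = g w x" if "x \<in> L'" for x
    using lamg[OF that, of 1] by (simp add: fscale_def)
  have eq: "coset JL x = coset JL y \<longleftrightarrow> g w x = g w y" if xy: "x \<in> E" "y \<in> E" for x y
  proof -
    have L: "x \<in> L'" "y \<in> L'" "x - y \<in> L'" using xy EL add_subgroup_diff[OF L'_subgroup] by auto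
    have "x - y \<in> JL \<longleftrightarrow> g True (x - y) = 0 \<and> g False (x - y) = 0"
      using ker L(3) P_Int[of L'] by blast
    also have "\<dots> \<longleftrightarrow> g w (x - y) = 0 \<and> g (\<not> w) (x - y) = 0" by (cases w) auto
    also have "g (\<not> w) (x - y) = 0" using R.semilinear_diff[OF semi L(1,2)] xy by (simp add: E_def)
    finally show ?thesis
      unfolding coset_eq_iff[OF gJL] R.semilinear_diff[OF semi L(1,2), of w] by (simp only: right_minus_eq simp_thms)
  qed
  have img: "g w ` E = g w ` L'"
  proof
    show "g w ` L' \<subseteq> g w ` E"
    proof
      fix u assume "u \<in> g w ` L'"
      then obtain x where "x \<in> L'" "u = g w x" by auto
      thus "u \<in> g w ` E" using lam1[of x] lamE[of x 1] by (metis imageI)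
    qed
  qed (use EL in auto)
  have "vectorspace.dim class_ring V = fs.dim (g w ` L')"
  proof (rule dim_via_map[OF C img _ eq])
    show "carrier V = coset JL ` E"
    proof (intro equalityI subsetI)
      fix X assume "X \<in> carrier V"
      thus "X \<in> coset JL ` E" unfolding car using lamE by auto
    next
      fix X assume "X \<in> coset JL ` E"
      then obtain y where y: "y \<in> E" "X = coset JL y" by auto
      have yL: "y \<in> L'" using y EL by auto
      \<comment> \<open>\<open>lam 1\<close> preserves the coordinate at \<open>w\<close>, and the
        other one is 0 before and after, so the class does not change.\<close>
      have "X = coset JL (act (lam 1) y)" unfolding y(2) using eq[OF y(1) lamE[OF yL, of 1]] lam1[OF yL] by simp
      thus "X \<in> carrier V" unfolding car using yL by blast
    qed
    show "x + y \<in> E \<and> coset JL x \<oplus>\<^bsub>V\<^esub> coset JL y = coset JL (x + y) \<and> g w (x + y) = g w x + g w y"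
      if xy: "x \<in> E" "y \<in> E" for x y
    proof -
      have L: "x \<in> L'" "y \<in> L'" using xy EL by auto
      have "g (\<not> w) (x + y) = 0" using gadd[OF L, of "\<not> w"] xy by (simp add: E_def)
      thus ?thesis using L add[OF L] gadd[OF L] add_subgroup_add[OF L'_subgroup L] by (simp add: E_def)
    qed
    show "\<exists>z\<in>E. c \<odot>\<^bsub>V\<^esub> coset JL x = coset JL z \<and> g w z = fscale c (g w x)" if x: "x \<in> E" for c x
    proof -
      have L: "x \<in> L'" using x EL by auto
      show ?thesis by (intro bexI[OF _ lamE[OF L, of c]] conjI smult lamg L)
    qed
    show "0 \<in> E" using g0 add_subgroup_0[OF L'_subgroup] by (simp add: E_def)
    show "\<zero>\<^bsub>V\<^esub> = coset JL 0" by (simp add: zero coset_0)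
    show "g w 0 = 0" by (rule g0)
  qed
  also have "fs.dim (g w ` L') = comp_rank w"
  proof -
    have "g w x = 0 \<longleftrightarrow> x \<in> ideal_times act (P w) L'" if "x \<in> L'" for x using ker that by simp
    from R.semilinear_idx(1)[OF semi L'_subgroup ideal_times_subgroup this]
    have "CARD('f) ^ comp_rank w = CARD('f) ^ fs.dim (g w ` L')"
      using P_quo(2)[OF lattice_L', of w] fs.card_dim[OF C] by simp
    thus ?thesis by (simp add: fs.card_power_inject)
  qed
  finally show ?thesis .
qed

lemma dim_quotient:
  fixes V :: "('f, 'm) module" and cc :: "'v \<Rightarrow> 'm"
  assumes car: "carrier V = cc ` L'"
    and eq: "\<And>x y. x \<in> L' \<Longrightarrow> y \<in> L' \<Longrightarrow> cc x = cc y \<longleftrightarrow> x - y \<in> L"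
    and lam: "\<And>c. lam c \<in> Lam" "\<And>c. p True (lam c) = c"
    and add: "\<And>x y. x \<in> L' \<Longrightarrow> y \<in> L' \<Longrightarrow> cc x \<oplus>\<^bsub>V\<^esub> cc y = cc (x + y)"
    and smult: "\<And>c x. x \<in> L' \<Longrightarrow> c \<odot>\<^bsub>V\<^esub> cc x = cc (act (lam c) x)"
    and zero: "\<zero>\<^bsub>V\<^esub> = cc 0"
  shows "vectorspace.dim class_ring V = quot_rank"
proof -
  have "vectorspace.dim class_ring V = fs.dim quot_space"
  proof (rule dim_via_map[OF quot_space(1,2) quot_space_def[symmetric] car])
    show "cc x = cc y \<longleftrightarrow> quot_coord x = quot_coord y" if xy: "x \<in> L'" "y \<in> L'" for x y
      unfolding eq[OF xy] quot_coord(2)[OF add_subgroup_diff[OF L'_subgroup xy], symmetric]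
        Q.semilinear_diff[OF quot_coord(1) xy] by simp
    show "x + y \<in> L' \<and> cc x \<oplus>\<^bsub>V\<^esub> cc y = cc (x + y) \<and> quot_coord (x + y) = quot_coord x + quot_coord y" if "x \<in> L'" "y \<in> L'" for x y
      by (intro conjI add_subgroup_add[OF L'_subgroup] add Q.semilinear_add[OF quot_coord(1) L'_subgroup] that)
    show "\<exists>z\<in>L'. c \<odot>\<^bsub>V\<^esub> cc x = cc z \<and> quot_coord z = fscale c (quot_coord x)" if x: "x \<in> L'" for c x
      using Q.semilinear_act[OF quot_coord(1) lam(1) x, of c] lam(2)
      by (intro bexI[OF _ submodule_act[OF L'_Lam lam(1) x, of c]] conjI smult x) simp
    show "0 \<in> L'" by (rule add_subgroup_0[OF L'_subgroup])
    show "\<zero>\<^bsub>V\<^esub> = cc 0" by (rule zero)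
    show "quot_coord 0 = 0" by (rule Q.semilinear_0[OF quot_coord(1) L'_subgroup])
  qed
  thus ?thesis by (simp add: quot_space(3))
qed

text \<open>Beyond the upper limit of the finite sum one of the two Gaussian binomials is 0, so the
  power series stops there by itself.\<close>

lemma P_poly_P_series: "P_poly TYPE('f) (comp_rank True) (comp_rank False) j = P_series j"
proof (rule fps_ext)
  fix n
  let ?m = "min (comp_rank True - j) (comp_rank False - j)"
  have summand: "of_nat (gauss_binomial TYPE('f) (comp_rank True - j) l) * of_nat (gauss_binomial TYPE('f) (comp_rank False - j) l) *
      of_nat (card_GL TYPE('f) l) * q_pow_minus_s CARD('f) j ^ l = fps_const (P_coeff j l) * fps_X ^ l" for l
  proof -
    have "q_pow_minus_s CARD('f) j ^ l = fps_const (of_nat (CARD('f) ^ (j * l))) * fps_X ^ l"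
      by (simp add: q_pow_minus_s_def power_mult_distrib fps_const_power power_mult)
    thus ?thesis
      by (simp only: fps_of_nat[symmetric] gauss_binomial_qbinom card_GL_frames P_coeff_def
          fps_const_mult mult.assoc[symmetric]) (simp only: mult.commute mult.left_commute)
  qed
  have "fps_nth (P_poly TYPE('f) (comp_rank True) (comp_rank False) j) n = (\<Sum>l = 0..?m. if n = l then P_coeff j l else 0)"
    unfolding P_poly_def summand fps_sum_nth by (intro sum.cong refl) simp
  also have "\<dots> = (if n \<le> ?m then P_coeff j n else 0)" by (subst sum.delta') auto
  also have "\<dots> = P_coeff j n"
    using qbinom_gt[of "comp_rank True - j" n] qbinom_gt[of "comp_rank False - j" n] by (auto simp: P_coeff_def)
  finally show "fps_nth (P_poly TYPE('f) (comp_rank True) (comp_rank False) j) n = fps_nth (P_series j) n" by (simp add: P_series_def)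
qed

lemma index_maximal: "finite_index_submodules S act L' = sublattices L'"
  by (auto simp: finite_index_submodules_def sublattices_def carrier_quot_module_on)

lemma index_Lam: "finite_index_submodules Lam act L = sublattices_Lam"
  by (auto simp: finite_index_submodules_def sublattices_Lam_def carrier_quot_module_on)

lemma submodule_index_idx: "submodule_index act N X = idx N X"
  by (simp add: submodule_index_def carrier_quot_module_on idx_def)

lemma sublattices_len: "X \<in> sublattices L' \<Longrightarrow> idx L' X = CARD('f) ^ R.len L' X"
  using R.idx_len[OF L'_submodule] by (simp add: sublattices_def)

lemma sublattices_Lam_idx: "X \<in> sublattices_Lam \<Longrightarrow> idx L X = CARD('f) ^ Q.len L X"
  using Q.idx_len[OF L_submodule] by (simp add: sublattices_Lam_def)

lemma level_maximal: "{X \<in> sublattices L'. idx L' X = CARD('f) ^ n} = {X \<in> sublattices L'. R.len L' X = n}"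
  using sublattices_len by (auto simp: fs.card_power_inject)

lemma level_Lam: "{X \<in> sublattices_Lam. idx L X = CARD('f) ^ n} = {X \<in> sublattices_Lam. Q.len L X = n}"
  using sublattices_Lam_idx by (auto simp: fs.card_power_inject)

lemma zeta_well_defined_maximal: "zeta_well_defined CARD('f) S act L'"
  unfolding zeta_well_defined_def index_maximal submodule_index_idx level_maximal
  using sublattices_len finite_level[OF lattice_L'] by blast

lemma zeta_well_defined_Lam: "zeta_well_defined CARD('f) Lam act L"
  unfolding zeta_well_defined_def index_Lam submodule_index_idx level_Lam
  using sublattices_Lam_idx finite_sublattices_Lam_level by blast

lemma solomon_zeta_maximal: "solomon_zeta CARD('f) S act L' = zeta_maximal"
  using zeta_eq[OF lattice_L']
  unfolding solomon_zeta_def index_maximal submodule_index_idx level_maximal zeta_def genfun_def .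

lemma solomon_zeta_Lam: "solomon_zeta CARD('f) Lam act L = genfun sublattices_Lam (Q.len L)"
  unfolding solomon_zeta_def index_Lam submodule_index_idx level_Lam genfun_def ..

lemma zeta_maximal_product:
  "zeta_maximal = (\<Prod>h<comp_rank True. inverse (1 - q_pow_minus_s CARD('f) h)) * (\<Prod>i<comp_rank False. inverse (1 - q_pow_minus_s CARD('f) i))"
    (is "_ = ?A (comp_rank True) * ?A (comp_rank False)")
proof -
  have 1: "?A m * qpoch CARD('f) m = 1" for m
  proof -
    have "inverse (1 - q_pow_minus_s CARD('f) h) * (1 - q_pow_minus_s CARD('f) h) = 1" for h
      by (rule inverse_mult_eq_1) (simp add: q_pow_minus_s_def)
    thus ?thesis unfolding qpoch_def prod.distrib[symmetric] by simp
  qed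
  have "zeta_maximal = zeta_maximal * ((?A (comp_rank True) * qpoch CARD('f) (comp_rank True)) * (?A (comp_rank False) * qpoch CARD('f) (comp_rank False)))"
    by (simp add: 1)
  also have "\<dots> = (qpoch CARD('f) (comp_rank True) * qpoch CARD('f) (comp_rank False) * zeta_maximal) * (?A (comp_rank True) * ?A (comp_rank False))"
    by (simp only: ac_simps)
  finally show ?thesis by (simp add: zeta_maximal_mult)
qed

lemma zeta_quotient:
  "solomon_zeta CARD('f) Lam act L / solomon_zeta CARD('f) S act L' =
     (\<Sum>j = 0..quot_rank. of_nat (gauss_binomial TYPE('f) quot_rank j) * fps_X ^ (quot_rank - j) *
        P_poly TYPE('f) (comp_rank True) (comp_rank False) j * (\<Prod>k<j. (1 - q_pow_minus_s CARD('f) k)\<^sup>2))"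
proof -
  have Zf0: "zeta_maximal \<noteq> 0" using zeta_maximal_mult by auto
  have "(\<Sum>j\<le>quot_rank. fps_const (qbinom CARD('f) quot_rank j) * (fps_X ^ (quot_rank - j) * (qpoch CARD('f) j)\<^sup>2 * P_series j)) =
     (\<Sum>j = 0..quot_rank. of_nat (gauss_binomial TYPE('f) quot_rank j) * fps_X ^ (quot_rank - j) *
        P_poly TYPE('f) (comp_rank True) (comp_rank False) j * (\<Prod>k<j. (1 - q_pow_minus_s CARD('f) k)\<^sup>2))"
    unfolding atLeast0AtMost
  proof (rule sum.cong[OF refl])
    fix j
    have "(\<Prod>k<j. (1 - q_pow_minus_s CARD('f) k)\<^sup>2) = (qpoch CARD('f) j)\<^sup>2"
      by (simp add: qpoch_def prod_power_distrib)
    moreover have "(of_nat (gauss_binomial TYPE('f) quot_rank j) :: rat fps) = fps_const (qbinom CARD('f) quot_rank j)"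
      by (simp only: fps_of_nat[symmetric] gauss_binomial_qbinom)
    ultimately show "fps_const (qbinom CARD('f) quot_rank j) * (fps_X ^ (quot_rank - j) * (qpoch CARD('f) j)\<^sup>2 * P_series j) =
      of_nat (gauss_binomial TYPE('f) quot_rank j) * fps_X ^ (quot_rank - j) *
        P_poly TYPE('f) (comp_rank True) (comp_rank False) j * (\<Prod>k<j. (1 - q_pow_minus_s CARD('f) k)\<^sup>2)"
      by (simp only: P_poly_P_series) (simp only: ac_simps)
  qed
  thus ?thesis
    unfolding solomon_zeta_maximal solomon_zeta_Lam genfun_sublattices_Lam nonzero_mult_div_cancel_right[OF Zf0] .
qed

end

context lattice_pair
begin

text \<open>The lift of scalars is kept abstract: any choice of elements of \<open>S\<close> with
  the right residues will do.\<close>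

lemma residue_module_dims:
  fixes lift_of :: "'f \<times> 'f \<Rightarrow> 'a"
  assumes lift_of: "\<And>t. lift_of t \<in> S" "\<And>t. p True (lift_of t) = fst t" "\<And>t. p False (lift_of t) = snd t"
    and M: "M = restrict_scalars lift_of (quot_module (module_on act L') JL)"
    and N: "N = carrier (quot_module (module_on act L) JL)"
  shows "vectorspace.dim class_ring (component1 M) = comp_rank True"
    and "vectorspace.dim class_ring (component2 M) = comp_rank False"
    and "vectorspace.dim class_ring (quot_module (restrict_scalars (\<lambda>a. (a, a)) M) N) = quot_rank"
proof -
  have JL_sub: "is_submodule S act JL" by (rule ideal_times_submodule) (rule J_left)
  have car: "carrier M = quo L' JL"
    by (simp add: M restrict_scalars_def carrier_quot_module_on)
  have add: "coset JL x \<oplus>\<^bsub>M\<^esub> coset JL y = coset JL (x + y)" for x y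
    using set_add_module_on[OF gJL, of act L' x y] by (simp add: M restrict_scalars_def quot_module_def)
  have smult: "t \<odot>\<^bsub>M\<^esub> coset JL x = coset JL (act (lift_of t) x)" for t x
  proof -
    have "t \<odot>\<^bsub>M\<^esub> coset JL x = (\<Union>y\<in>coset JL x. coset JL (act (lift_of t) y))"
      by (simp add: M restrict_scalars_def quot_module_def rcoset_module_on) (simp add: module_on_def)
    thus ?thesis by (simp only: smult_coset[OF JL_sub lift_of(1)])
  qed
  have zero: "\<zero>\<^bsub>M\<^esub> = JL"
    by (simp add: M restrict_scalars_def quot_module_def)
  show "vectorspace.dim class_ring (component1 M) = comp_rank True"
  proof (rule dim_component[where lam = "\<lambda>c. lift_of (c, 0)"])
    show "carrier (component1 M) = {coset JL (act (lift_of (c, 0)) x) |c x. x \<in> L'}"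
    proof -
      have "carrier (component1 M) = {(c, 0) \<odot>\<^bsub>M\<^esub> X |c X. X \<in> coset JL ` L'}"
        by (simp add: component1_def restrict_scalars_def car quo_def)
      also have "\<dots> = {(c, 0) \<odot>\<^bsub>M\<^esub> coset JL x |c x. x \<in> L'}" by blast
      finally show ?thesis by (simp only: smult)
    qed
  qed (use lift_of add smult zero in \<open>simp_all add: component1_def restrict_scalars_def\<close>)
  show "vectorspace.dim class_ring (component2 M) = comp_rank False"
  proof (rule dim_component[where lam = "\<lambda>c. lift_of (0, c)"])
    show "carrier (component2 M) = {coset JL (act (lift_of (0, c)) x) |c x. x \<in> L'}"
    proof -
      have "carrier (component2 M) = {(0, c) \<odot>\<^bsub>M\<^esub> X |c X. X \<in> coset JL ` L'}"
        by (simp add: component2_def restrict_scalars_def car quo_def)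
      also have "\<dots> = {(0, c) \<odot>\<^bsub>M\<^esub> coset JL x |c x. x \<in> L'}" by blast
      finally show ?thesis by (simp only: smult)
    qed
  qed (use lift_of add smult zero in \<open>simp_all add: component2_def restrict_scalars_def\<close>)
  define D where "D = restrict_scalars (\<lambda>a. (a, a)) M"
  \<comment> \<open>\<open>N\<close> is itself a set of cosets of \<open>JL\<close>, so an element
    of M/N is a set of such cosets; \<open>cc x\<close> is the one represented by x.\<close>
  define cc where "cc x = (\<lambda>l. coset JL (l + x)) ` L" for x
  have N_eq: "N = coset JL ` L" unfolding N carrier_quot_module_on quo_def ..
  have addD: "coset JL x \<oplus>\<^bsub>D\<^esub> coset JL y = coset JL (x + y)" for x y
    unfolding add[symmetric] by (simp add: D_def restrict_scalars_def)
  have smultD: "c \<odot>\<^bsub>D\<^esub> coset JL x = coset JL (act (lift_of (c, c)) x)" for c x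
    unfolding smult[symmetric] by (simp add: D_def restrict_scalars_def)
  have lift_Lam: "lift_of (c, c) \<in> Lam" for c by (simp add: Lam_def lift_of)
  have rcoset: "N +>\<^bsub>D\<^esub> coset JL x = cc x" for x
  proof -
    have "N +>\<^bsub>D\<^esub> coset JL x = (\<lambda>X. X \<oplus>\<^bsub>D\<^esub> coset JL x) ` N" by (auto simp: a_r_coset_def')
    thus ?thesis by (simp add: N_eq image_image addD cc_def)
  qed
  have cc_mono: "cc x \<subseteq> cc y" if "x - y \<in> L" for x y
  proof
    fix X assume "X \<in> cc x"
    then obtain l where l: "l \<in> L" "X = coset JL (l + x)" by (auto simp: cc_def)
    have "X = coset JL ((l + (x - y)) + y)" using l(2) by simp
    thus "X \<in> cc y" unfolding cc_def using add_subgroup_add[OF L_subgroup l(1) that] by (rule image_eqI)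
  qed
  have cc_eq: "cc x = cc y \<longleftrightarrow> x - y \<in> L" for x y
  proof
    assume eq: "cc x = cc y"
    have "coset JL (0 + x) \<in> cc x" unfolding cc_def by (rule imageI[OF add_subgroup_0[OF L_subgroup]])
    then obtain l where l: "l \<in> L" "coset JL x = coset JL (l + y)" unfolding eq by (auto simp: cc_def)
    hence "x - (l + y) \<in> L" using coset_eq_iff[OF gJL] J_L'_L by blast
    from add_subgroup_add[OF L_subgroup this l(1)] show "x - y \<in> L" by simp
  next
    assume xy: "x - y \<in> L"
    moreover have "y - x \<in> L" using add_subgroup_minus[OF L_subgroup xy] by simp
    ultimately show "cc x = cc y" by (intro equalityI cc_mono)
  qed
  have cc_add: "set_add D (cc x) (cc y) = cc (x + y)" for x y
  proof (intro equalityI subsetI)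
    fix X assume "X \<in> set_add D (cc x) (cc y)"
    then obtain a b where ab: "a \<in> L" "b \<in> L" "X = coset JL (a + x) \<oplus>\<^bsub>D\<^esub> coset JL (b + y)"
      by (auto simp: set_add_def' cc_def)
    have "X = coset JL ((a + b) + (x + y))" unfolding ab(3) addD by (simp only: ac_simps)
    thus "X \<in> cc (x + y)" unfolding cc_def using add_subgroup_add[OF L_subgroup ab(1,2)] by (rule image_eqI)
  next
    fix X assume "X \<in> cc (x + y)"
    then obtain l where l: "l \<in> L" "X = coset JL (l + (x + y))" by (auto simp: cc_def)
    have "X = coset JL (l + x) \<oplus>\<^bsub>D\<^esub> coset JL (0 + y)" unfolding l(2) addD by (simp add: ac_simps)
    moreover have "coset JL (l + x) \<in> cc x" "coset JL (0 + y) \<in> cc y"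
      unfolding cc_def by (rule imageI, rule l(1), rule imageI, rule add_subgroup_0[OF L_subgroup])
    ultimately show "X \<in> set_add D (cc x) (cc y)" unfolding set_add_def' by blast
  qed
  have "vectorspace.dim class_ring (quot_module D N) = quot_rank"
  proof (rule dim_quotient[where cc = cc and lam = "\<lambda>c. lift_of (c, c)"])
    have "carrier D = coset JL ` L'" by (simp add: D_def restrict_scalars_def car quo_def)
    hence "carrier (quot_module D N) = (\<Union>X\<in>coset JL ` L'. {N +>\<^bsub>D\<^esub> X})"
      by (simp add: quot_module_def A_RCOSETS_def')
    thus "carrier (quot_module D N) = cc ` L'" by (auto simp: rcoset)
    show "cc x \<oplus>\<^bsub>quot_module D N\<^esub> cc y = cc (x + y)" for x y
      unfolding cc_add[symmetric] by (simp add: quot_module_def)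
    show "c \<odot>\<^bsub>quot_module D N\<^esub> cc x = cc (act (lift_of (c, c)) x)" for c x
    proof -
      have eq: "cc (act (lift_of (c, c)) (l + x)) = cc (act (lift_of (c, c)) x)" if "l \<in> L" for l
        unfolding cc_eq using submodule_act[OF L_submodule lift_Lam that] by (simp add: act_add_right)
      have "c \<odot>\<^bsub>quot_module D N\<^esub> cc x = (\<Union>X\<in>cc x. N +>\<^bsub>D\<^esub> (c \<odot>\<^bsub>D\<^esub> X))" by (simp add: quot_module_def)
      also have "\<dots> = (\<Union>l\<in>L. cc (act (lift_of (c, c)) (l + x)))"
        unfolding cc_def[of x] image_image smultD rcoset ..
      also have "\<dots> = (\<Union>l\<in>L. cc (act (lift_of (c, c)) x))" by (rule SUP_cong[OF refl eq])
      also have "\<dots> = cc (act (lift_of (c, c)) x)"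
        using add_subgroup_0[OF L_subgroup] unfolding UN_constant by (metis empty_iff)
      finally show ?thesis .
    qed
    have "\<zero>\<^bsub>quot_module D N\<^esub> = N" by (simp add: quot_module_def)
    also have "N = cc 0" by (simp add: N_eq cc_def)
    finally show "\<zero>\<^bsub>quot_module D N\<^esub> = cc 0" .
  qed (use cc_eq lift_Lam lift_of in simp_all)
  thus "vectorspace.dim class_ring (quot_module (restrict_scalars (\<lambda>a. (a, a)) M) N) = quot_rank" unfolding D_def .
qed

end

section \<open>From the hypotheses to the counting situation\<close>

lemma conductor_ideal:
  fixes S T :: "'a::ring_1 set"
  assumes S: "1 \<in> S" "\<forall>x\<in>S. \<forall>y\<in>S. x * y \<in> S" and T: "is_add_subgroup T"
  shows "is_add_subgroup (two_sided_conductor S T)"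
    and "\<forall>s\<in>S. \<forall>x\<in>two_sided_conductor S T. s * x \<in> two_sided_conductor S T \<and> x * s \<in> two_sided_conductor S T"
    and "two_sided_conductor S T \<subseteq> T"
proof -
  show "is_add_subgroup (two_sided_conductor S T)"
    using T by (auto simp: is_add_subgroup_def two_sided_conductor_def right_diff_distrib left_diff_distrib)
  have left: "s * x \<in> two_sided_conductor S T" if "s \<in> S" "x \<in> two_sided_conductor S T" for s x
    unfolding two_sided_conductor_def
  proof (clarsimp simp: mult.assoc[symmetric])
    fix a b assume "a \<in> S" "b \<in> S"
    thus "a * s * x * b \<in> T" using that S(2) by (auto simp: two_sided_conductor_def)
  qed
  have right: "x * s \<in> two_sided_conductor S T" if "s \<in> S" "x \<in> two_sided_conductor S T" for s x
    unfolding two_sided_conductor_def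
  proof (intro CollectI ballI)
    fix a b assume "a \<in> S" "b \<in> S"
    hence "a * x * (s * b) \<in> T" using that S(2) by (auto simp: two_sided_conductor_def)
    thus "a * (x * s) * b \<in> T" by (simp add: mult.assoc)
  qed
  show "\<forall>s\<in>S. \<forall>x\<in>two_sided_conductor S T. s * x \<in> two_sided_conductor S T \<and> x * s \<in> two_sided_conductor S T"
    using left right by blast
  show "two_sided_conductor S T \<subseteq> T"
  proof
    fix x assume "x \<in> two_sided_conductor S T"
    hence "1 * x * 1 \<in> T" using S(1) unfolding two_sided_conductor_def by blast
    thus "x \<in> T" by simp
  qed
qed

lemma RDirProd_class_ring:
  fixes x y :: "'f::field \<times> 'g::field"
  shows "x \<oplus>\<^bsub>RDirProd class_ring class_ring\<^esub> y = (fst x + fst y, snd x + snd y)"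
    "x \<otimes>\<^bsub>RDirProd class_ring class_ring\<^esub> y = (fst x * fst y, snd x * snd y)"
    "\<one>\<^bsub>RDirProd class_ring class_ring\<^esub> = (1 :: 'f, 1 :: 'g)"
    "carrier (RDirProd class_ring class_ring) = (UNIV :: ('f \<times> 'g) set)"
  by (cases x, cases y, simp add: RDirProd_def DirProd_def monoid.defs)+

lemma split_ring_of_residue_iso:
  fixes S I :: "'a::ring_1 set" and \<psi> :: "'a set \<Rightarrow> 'f::{field,finite} \<times> 'f"
  assumes S: "1 \<in> S" "is_add_subgroup S" "\<forall>x\<in>S. \<forall>y\<in>S. x * y \<in> S"
    and I: "is_add_subgroup I" "\<forall>s\<in>S. \<forall>i\<in>I. s * i \<in> I \<and> i * s \<in> I" "I = jacobson_radical S"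
    and iso: "\<psi> \<in> ring_iso (ring_on S Quot I) (RDirProd class_ring class_ring)"
    and p_def: "\<And>w a. p w a = (if w then fst (\<psi> (coset I a)) else snd (\<psi> (coset I a)))"
  shows "split_ring S p" and "split_ring.J S p = I"
proof -
  have I_S: "I \<subseteq> S" unfolding I(3) jacobson_radical_def by blast
  note hom = residue_hom[OF S(2) I(1,2) I_S iso, unfolded RDirProd_class_ring]
  have add: "p w (x + y) = p w x + p w y" if "x \<in> S" "y \<in> S" for w x y
    using hom(1)[OF that] by (simp add: p_def)
  have diff: "p w (x - y) = p w x - p w y" if "x \<in> S" "y \<in> S" for w x y
    using add[OF add_subgroup_diff[OF S(2) that] that(2), of w] by simp
  have S0: "0 \<in> S" by (rule add_subgroup_0[OF S(2)])
  have p0: "p w 0 = 0" for w using diff[OF S0 S0, of w] by simp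
  have ker: "p True x = 0 \<and> p False x = 0 \<longleftrightarrow> x \<in> I" if x: "x \<in> S" for x
  proof -
    have "p True x = 0 \<and> p False x = 0 \<longleftrightarrow> \<psi> (coset I x) = \<psi> (coset I 0)"
      using p0[of True] p0[of False] by (simp add: p_def prod_eq_iff)
    also have "\<dots> \<longleftrightarrow> x \<in> I" using hom(4)[OF x S0] by simp
    finally show ?thesis .
  qed
  show split: "split_ring S p"
  proof
    show "\<exists>x\<in>S. p True x = c \<and> p False x = d" for c d
    proof -
      have "(c, d) \<in> (\<lambda>x. \<psi> (coset I x)) ` S" unfolding hom(5) by simp
      then obtain x where "x \<in> S" "\<psi> (coset I x) = (c, d)" by (elim imageE) simp
      thus ?thesis by (intro bexI[of _ x]) (simp_all add: p_def)
    qed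
    show "x \<in> jacobson_radical S" if "x \<in> S" "p True x = 0" "p False x = 0" for x
      using ker[OF that(1)] that(2,3) I(3) by simp
    show "p w (x * y) = p w x * p w y" if "x \<in> S" "y \<in> S" for w x y
      using hom(2)[OF that] by (simp add: p_def)
    show "p w 1 = 1" for w using hom(3) by (simp add: p_def)
  qed (use S diff add_subgroup_diff[OF S(2)] in auto)
  have "split_ring.J S p = {x\<in>S. p True x = 0 \<and> p False x = 0}"
    unfolding split_ring.J_def[OF split] by (metis (full_types))
  also have "\<dots> = I" using ker I_S by auto
  finally show "split_ring.J S p = I" .
qed

theorem theorem5p3:
  fixes v :: "'k::field \<Rightarrow> real"
    and R :: "'k set"
    and scale :: "'k \<Rightarrow> 'a::ring_1 \<Rightarrow> 'a"
    and act :: "'a \<Rightarrow> 'v::ab_group_add \<Rightarrow> 'v"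
    and \<Lambda> \<Lambda>' I :: "'a set"
    and L L' :: "'v set"
    and \<phi> :: "'a set \<Rightarrow> 'f::{field,finite}"
    and \<psi> :: "'a set \<Rightarrow> 'f \<times> 'f"
    and M :: "('f \<times> 'f, 'v set) module"
    and N :: "'v set set"
    and q m\<^sub>1 m\<^sub>2 c :: nat
  assumes K: "nonarch_local_field v"
    and R: "R = integers v"
    and A: "fin_dim_algebra scale" "semisimple_ring TYPE('a)"
    and V: "left_module act"
    and \<Lambda>: "is_order R scale \<Lambda>"
    and L: "is_full_lattice R scale \<Lambda> act L"
    and \<Lambda>': "is_maximal_order R scale \<Lambda>'" "\<Lambda> \<subseteq> \<Lambda>'"
    and L': "L' = is_submodule \<Lambda>' act hull L"
    and I: "I = two_sided_conductor \<Lambda>' \<Lambda>"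
    and q: "q = CARD('f)"
    and rad: "I = jacobson_radical \<Lambda>'" "jacobson_radical \<Lambda>' = jacobson_radical \<Lambda>"
    and \<phi>: "\<phi> \<in> ring_iso (ring_on \<Lambda> Quot I) class_ring"
    and \<psi>: "\<psi> \<in> ring_iso (ring_on \<Lambda>' Quot I) (RDirProd class_ring class_ring)"
    and diagonal: "\<forall>x\<in>\<Lambda>. \<psi> (I +>\<^bsub>ring_on \<Lambda>'\<^esub> x) =
                     (\<phi> (I +>\<^bsub>ring_on \<Lambda>\<^esub> x), \<phi> (I +>\<^bsub>ring_on \<Lambda>\<^esub> x))"
    and M: "M = residue_module \<Lambda>' I \<psi> (quot_module (module_on act L') (ideal_times act I L'))"
    and N: "N = carrier (quot_module (module_on act L) (ideal_times act I L))"
    and m\<^sub>1: "m\<^sub>1 = vectorspace.dim class_ring (component1 M)"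
    and m\<^sub>2: "m\<^sub>2 = vectorspace.dim class_ring (component2 M)"
    and c: "c = vectorspace.dim class_ring (quot_module (restrict_scalars (\<lambda>a. (a, a)) M) N)"
  shows "ideal_times act I L' = ideal_times act I L \<and>
         zeta_well_defined q \<Lambda> act L \<and> zeta_well_defined q \<Lambda>' act L' \<and>
         solomon_zeta q \<Lambda>' act L' =
           (\<Prod>h<m\<^sub>1. inverse (1 - q_pow_minus_s q h)) * (\<Prod>i<m\<^sub>2. inverse (1 - q_pow_minus_s q i)) \<and>
         solomon_zeta q \<Lambda> act L / solomon_zeta q \<Lambda>' act L' =
           (\<Sum>j = 0..c. of_nat (gauss_binomial TYPE('f) c j) * fps_X ^ (c - j) *
              P_poly TYPE('f) m\<^sub>1 m\<^sub>2 j * (\<Prod>k<j. (1 - q_pow_minus_s q k)\<^sup>2)) \<and>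
         c \<le> min m\<^sub>1 m\<^sub>2"
proof -
  interpret nonarch_local_field v by (rule K)
  interpret fin_dim_algebra scale by (rule A(1))
  interpret left_module act by (rule V)
  have order: "is_order (integers v) scale \<Lambda>'" using \<Lambda>'(1) R by (simp add: is_maximal_order_def)
  have S: "1 \<in> \<Lambda>'" "is_add_subgroup \<Lambda>'" "\<forall>x\<in>\<Lambda>'. \<forall>y\<in>\<Lambda>'. x * y \<in> \<Lambda>'"
    using order by (simp_all add: is_order_def is_submodule_def)
  have gLam: "is_add_subgroup \<Lambda>" using \<Lambda> by (simp add: is_order_def is_submodule_def)
  note I_ideal = conductor_ideal[OF S(1,3) gLam, folded I]
  \<comment> \<open>Indexing the two projections by a truth value allows arguments that are
    symmetric in the factors to be given once.\<close>
  define p where "p w a = (if w then fst (\<psi> (coset I a)) else snd (\<psi> (coset I a)))" for w a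
  note split = split_ring_of_residue_iso[OF S I_ideal(1,2) rad(1) \<psi> p_def]
  interpret split_ring \<Lambda>' p by (rule split(1))
  interpret split_maximal_order v scale \<Lambda>' p
    by unfold_locales (use \<Lambda>'(1) R in simp)
  have I_Lam': "I \<subseteq> \<Lambda>'" using I_ideal(3) \<Lambda>'(2) by (rule subset_trans)
  note hom = residue_hom[OF S(2) I_ideal(1,2) I_Lam' \<psi>]
  have "\<forall>s\<in>\<Lambda>. \<forall>i\<in>I. s * i \<in> I \<and> i * s \<in> I" using I_ideal(2) \<Lambda>'(2) by blast
  note hom_Lam = residue_hom[OF gLam I_ideal(1) this I_ideal(3) \<phi>]
  have diag: "\<psi> (coset I x) = (\<phi> (coset I x), \<phi> (coset I x))" if "x \<in> \<Lambda>" for x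
    using diagonal that by (simp add: rcoset_ring_on)
  have Lam_eq: "\<Lambda> = {x\<in>\<Lambda>'. p True x = p False x}"
  proof (intro equalityI subsetI)
    fix x assume "x \<in> \<Lambda>"
    thus "x \<in> {x\<in>\<Lambda>'. p True x = p False x}" using diag \<Lambda>'(2) by (auto simp: p_def)
  next
    fix x assume x: "x \<in> {x\<in>\<Lambda>'. p True x = p False x}"
    \<comment> \<open>\<phi> is onto, so some y in \<Lambda> has the same diagonal residue as x;
      their difference lies in I, which is contained in \<Lambda>.\<close>
    have "p True x \<in> (\<lambda>y. \<phi> (coset I y)) ` \<Lambda>" unfolding hom_Lam(5) by simp
    then obtain y where y: "y \<in> \<Lambda>" "p True x = \<phi> (coset I y)" by (elim imageE)
    have "\<psi> (coset I x) = \<psi> (coset I y)"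
      unfolding diag[OF y(1)] y(2)[symmetric] using x by (simp add: p_def prod_eq_iff)
    hence "x - y \<in> I" using hom(4)[of x y] x y(1) \<Lambda>'(2) by auto
    from add_subgroup_add[OF gLam subsetD[OF I_ideal(3) this] y(1)] show "x \<in> \<Lambda>" by simp
  qed
  have sub_L: "is_submodule \<Lambda> act L" and "is_free_fg (integers v) (\<lambda>r. act (scale r 1)) L"
    using L R by (simp_all add: is_full_lattice_def)
  then obtain B where B: "finite B" "is_submodule (integers v) (\<lambda>r. act (scale r 1)) hull B = L"
    unfolding is_free_fg_def by (elim conjE exE)
  \<comment> \<open>The uniformizer, viewed as the element \<open>rho 1\<close> of the radical,
    takes the role of \<open>r\<close>.\<close>
  interpret lattice_pair \<Lambda>' p act \<Lambda> L "rho 1"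
  proof
    show "\<Lambda> = {x\<in>\<Lambda>'. p True x = p False x}" by (rule Lam_eq)
    show "split_ring.J \<Lambda>' p \<subseteq> jacobson_radical \<Lambda>" unfolding split(2) rad(1) rad(2) ..
    show "is_submodule \<Lambda> act L" by (rule sub_L)
    show "rho 1 \<in> split_ring.J \<Lambda>' p" by (rule rho_J)
    show "finite (quo (is_submodule \<Lambda>' act hull L) (act (rho 1 ^ n) ` (is_submodule \<Lambda>' act hull L)))" for n
      unfolding rho_power by (rule finite_quo_lattice(2)[OF V B])
    show "\<exists>T. (\<forall>s\<in>\<Lambda>'. \<forall>a\<in>T. s * a \<in> T) \<and> ideal_times (*) (split_ring.P \<Lambda>' p w) T = \<Lambda>' \<and>
        ideal_times (*) T (split_ring.P \<Lambda>' p w) = \<Lambda>'" for w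
      by (rule P_invertible)
  qed
  have L'_eq: "L' = lattice_pair.L' \<Lambda>' act L" unfolding L' L'_def ..
  \<comment> \<open>The same choice of lifts as in \<open>residue_module\<close>, so that
    \<open>M\<close> takes the required form by mere unfolding.\<close>
  define lift_of where "lift_of t = (SOME a. a \<in> \<Lambda>' \<and> \<psi> (coset I a) = t)" for t
  have lift_of: "lift_of t \<in> \<Lambda>' \<and> \<psi> (coset I (lift_of t)) = t" for t
  proof -
    have "t \<in> (\<lambda>a. \<psi> (coset I a)) ` \<Lambda>'" unfolding hom(5) RDirProd_class_ring by simp
    hence "\<exists>a. a \<in> \<Lambda>' \<and> \<psi> (coset I a) = t" by blast
    thus ?thesis unfolding lift_of_def by (rule someI_ex)
  qed
  have M': "M = restrict_scalars lift_of (quot_module (module_on act (lattice_pair.L' \<Lambda>' act L)) JL)"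
    unfolding M residue_module_def rcoset_ring_on L'_eq split(2) lift_of_def ..
  have N': "N = carrier (quot_module (module_on act L) JL)"
    unfolding N split(2) J_L'[unfolded split(2)] ..
  have "p True (lift_of t) = fst t" "p False (lift_of t) = snd t" for t
    using lift_of[of t] by (simp_all add: p_def)
  note dims = residue_module_dims[OF conjunct1[OF lift_of] this M' N', folded m\<^sub>1 m\<^sub>2 c]
  have "ideal_times act I L' = ideal_times act I L"
    using J_L' unfolding split(2) L'_eq .
  moreover have "c \<le> min m\<^sub>1 m\<^sub>2"
    unfolding dims using quot_rank_le by simp
  ultimately show ?thesis
    unfolding q L'_eq dims
    using zeta_well_defined_Lam zeta_well_defined_maximal zeta_quotient solomon_zeta_maximal zeta_maximal_product
    by simp
qed

end
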